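(* There is a natural surjective $\mathbb{Q}$-algebra homomorphism from $\mathcal{C}_0(K)$ to the monoid ring $\mathbb{Q}\,\mathcal{CM}(K)$ of the composition monoid (sending the generators $i,j$ of $\mathcal{C}_0(K)$ to the generators $i,j$ of $\mathcal{CM}(K)$). It sends $(\alpha):=i^{\alpha_i}j^{\alpha_j}\in\mathcal{C}_0(K)$ to $\mathrm{Rep}(\alpha)$ for each positive root $\alpha$ of $K$. Its kernel is generated, as a two-sided ideal, by the relations $(ij)^m=i^mj^m$ for all $m\ge 1$, i.e. by the elements $(ij)^m-i^mj^m$.
   Context: $K$ is the Kronecker quiver $i\rightrightarrows j$. Its positive roots are the dimension vectors $(\alpha_i,\alpha_j)$ of the form $(m,m+1)$, $(m+1,m)$ with $m\ge0$ and $(s,s)$ with $s\ge1$. The algebra $\mathcal{C}_0(K)$: let $q$ be an indeterminate and $\mathcal{C}'_q(K)$ the associative unital $\mathbb{Q}(q)$-algebra generated by $i,j$ subject to $$i^3j-(q^2+q+1)i^2ji+q(q^2+q+1)iji^2-q^3ji^3=0,$$ $$ij^3-(q^2+q+1)jij^2+q(q^2+q+1)j^2ij-q^3j^3i=0.$$ $\mathcal{C}_q(K)$ is the $\mathbb{Q}[q]$-subalgebra generated by $i$ and $j$, and $\mathcal{C}_0(K)=\mathcal{C}_q(K)/q\,\mathcal{C}_q(K)$. The monoid $\mathcal{CM}(K)$: let $k$ be an algebraically closed field of characteristic zero. For a dimension vector $\alpha=(\alpha_i,\alpha_j)$, let $\mathrm{Rep}(\alpha)$ be the affine space of pairs of $\alpha_j\times\alpha_i$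 matrices over $k$, with the action of $\mathrm{GL}(\alpha)=\mathrm{GL}(\alpha_i)\times\mathrm{GL}(\alpha_j)$ by base change. The extension monoid has as elements the irreducible closed $\mathrm{GL}(\alpha)$-stable subvarieties of $\mathrm{Rep}(\alpha)$, for all $\alpha$, with the product of $\mathcal{A}\subset\mathrm{Rep}(\alpha)$ and $\mathcal{B}\subset\mathrm{Rep}(\beta)$ given by $$\mathcal{A}\ast\mathcal{B}=\{X\in\mathrm{Rep}(\alpha+\beta): \exists\text{ an exact sequence }0\to B\to X\to A\to 0\text{ with }A\in\mathcal{A},B\in\mathcal{B}\},$$ and unit $\mathrm{Rep}(0)$ (this is a known well-defined monoid). $\mathcal{CM}(K)$ is the submonoid generated by $i:=\mathrm{Rep}((1,0))$ and $j:=\mathrm{Rep}((0,1))$. *)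

theory Defs
  imports
    Jordan_Normal_Form.Matrix_Kernel
    "HOL-Algebra.QuotRing"
    "HOL-Algebra.Generated_Rings"
    "HOL-Library.Poly_Mapping"
    "HOL-Library.Product_Plus"
    "HOL-Computational_Algebra.Fraction_Field"
begin

section \<open>Monoid rings\<close>

text \<open>
  The product is the bilinear extension of the product of \<open>M\<close>; coefficients are taken from
  a type-class ring, and elements are finitely supported functions with support in the carrier.
\<close>

definition monoid_ring :: "('m, 'z) monoid_scheme \<Rightarrow> ('m \<Rightarrow>\<^sub>0 'r::comm_ring_1) ring" where
  "monoid_ring M =
    \<lparr>carrier = {f. Poly_Mapping.keys f \<subseteq> carrier M},
     monoid.mult = (\<lambda>f g. \<Sum>x\<in>Poly_Mapping.keys f. \<Sum>y\<in>Poly_Mapping.keys g.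
               Poly_Mapping.single (x \<otimes>\<^bsub>M\<^esub> y)
                 (Poly_Mapping.lookup f x * Poly_Mapping.lookup g y)),
     one = Poly_Mapping.single \<one>\<^bsub>M\<^esub> 1,
     zero = 0,
     add = (+)\<rparr>"

lemma monoid_ring_mult_superset:
  fixes f g :: "'m \<Rightarrow>\<^sub>0 'r::comm_ring_1"
  assumes "finite A" "finite B" "Poly_Mapping.keys f \<subseteq> A" "Poly_Mapping.keys g \<subseteq> B"
  shows "f \<otimes>\<^bsub>monoid_ring M\<^esub> g =
    (\<Sum>x\<in>A. \<Sum>y\<in>B. Poly_Mapping.single (x \<otimes>\<^bsub>M\<^esub> y)
                 (Poly_Mapping.lookup f x * Poly_Mapping.lookup g y))"
proof -
  have "(\<Sum>x\<in>A. \<Sum>y\<in>B. Poly_Mapping.single (x \<otimes>\<^bsub>M\<^esub> y)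
                 (Poly_Mapping.lookup f x * Poly_Mapping.lookup g y))
      = (\<Sum>x\<in>Poly_Mapping.keys f. \<Sum>y\<in>B. Poly_Mapping.single (x \<otimes>\<^bsub>M\<^esub> y)
                 (Poly_Mapping.lookup f x * Poly_Mapping.lookup g y))"
    by (rule sum.mono_neutral_right) (use assms in \<open>auto simp: in_keys_iff\<close>)
  also have "\<dots> = (\<Sum>x\<in>Poly_Mapping.keys f. \<Sum>y\<in>Poly_Mapping.keys g.
               Poly_Mapping.single (x \<otimes>\<^bsub>M\<^esub> y)
                 (Poly_Mapping.lookup f x * Poly_Mapping.lookup g y))"
    by (intro sum.cong refl sum.mono_neutral_right)
       (use assms in \<open>auto simp: in_keys_iff\<close>)
  finally show ?thesis by (simp add: monoid_ring_def)
qed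

lemma monoid_ring_simps [simp]:
  "carrier (monoid_ring M) = {f. Poly_Mapping.keys f \<subseteq> carrier M}"
  "\<one>\<^bsub>monoid_ring M\<^esub> = Poly_Mapping.single \<one>\<^bsub>M\<^esub> 1"
  "\<zero>\<^bsub>monoid_ring M\<^esub> = 0"
  "f \<oplus>\<^bsub>monoid_ring M\<^esub> g = f + g"
  by (simp_all add: monoid_ring_def)

lemma monoid_ring_add_left:
  fixes f g h :: "'m \<Rightarrow>\<^sub>0 'r::comm_ring_1"
  shows "(f + g) \<otimes>\<^bsub>monoid_ring M\<^esub> h =
    f \<otimes>\<^bsub>monoid_ring M\<^esub> h + g \<otimes>\<^bsub>monoid_ring M\<^esub> h"
proof -
  let ?A = "Poly_Mapping.keys f \<union> Poly_Mapping.keys g"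
  have k: "Poly_Mapping.keys (f + g) \<subseteq> ?A" by (rule Poly_Mapping.keys_add)
  show ?thesis
    by (subst (1 2 3) monoid_ring_mult_superset[of ?A "Poly_Mapping.keys h"])
       (use k in \<open>auto simp: lookup_add distrib_right single_add sum.distrib\<close>)
qed

lemma monoid_ring_add_right:
  fixes f g h :: "'m \<Rightarrow>\<^sub>0 'r::comm_ring_1"
  shows "h \<otimes>\<^bsub>monoid_ring M\<^esub> (f + g) =
    h \<otimes>\<^bsub>monoid_ring M\<^esub> f + h \<otimes>\<^bsub>monoid_ring M\<^esub> g"
proof -
  let ?A = "Poly_Mapping.keys f \<union> Poly_Mapping.keys g"
  have k: "Poly_Mapping.keys (f + g) \<subseteq> ?A" by (rule Poly_Mapping.keys_add)
  show ?thesis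
    by (subst (1 2 3) monoid_ring_mult_superset[of "Poly_Mapping.keys h" ?A])
       (use k in \<open>auto simp: lookup_add distrib_left single_add sum.distrib\<close>)
qed

lemma monoid_ring_mult_zero [simp]:
  "0 \<otimes>\<^bsub>monoid_ring M\<^esub> f = 0" "f \<otimes>\<^bsub>monoid_ring M\<^esub> 0 = 0"
  by (simp_all add: monoid_ring_def)

lemma monoid_ring_mult_single [simp]:
  "Poly_Mapping.single x a \<otimes>\<^bsub>monoid_ring M\<^esub> Poly_Mapping.single y b =
    Poly_Mapping.single (x \<otimes>\<^bsub>M\<^esub> y) (a * b)"
  by (subst monoid_ring_mult_superset[of "{x}" "{y}"]) auto

lemma monoid_ring_induct [consumes 1, case_names zero add]:
  fixes f :: "'m \<Rightarrow>\<^sub>0 'r::comm_ring_1"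
  assumes "Poly_Mapping.keys f \<subseteq> S" "P 0"
    and "\<And>x a f. x \<in> S \<Longrightarrow> P f \<Longrightarrow> P (Poly_Mapping.single x a + f)"
  shows "P f"
proof -
  have "P (\<Sum>x\<in>A. Poly_Mapping.single x (Poly_Mapping.lookup f x))"
    if "finite A" "A \<subseteq> S" for A
    using that by (induction A rule: finite_induct) (auto simp: assms)
  moreover have "(\<Sum>x\<in>Poly_Mapping.keys f. Poly_Mapping.single x (Poly_Mapping.lookup f x)) = f"
    by (rule poly_mapping_eqI) (auto simp: lookup_sum lookup_single when_def in_keys_iff)
  ultimately show ?thesis
    using assms(1) by (metis finite_keys)
qed

lemma (in monoid) ring_monoid_ring:
  "ring (monoid_ring G :: ('a \<Rightarrow>\<^sub>0 'r::comm_ring_1) ring)"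
proof -
  let ?R = "monoid_ring G :: ('a \<Rightarrow>\<^sub>0 'r) ring"
  note distr = monoid_ring_add_left monoid_ring_add_right
  have s1: "(Poly_Mapping.single x a \<otimes>\<^bsub>?R\<^esub> Poly_Mapping.single y b) \<otimes>\<^bsub>?R\<^esub> h =
      Poly_Mapping.single x a \<otimes>\<^bsub>?R\<^esub> (Poly_Mapping.single y b \<otimes>\<^bsub>?R\<^esub> h)"
    if "x \<in> carrier G" "y \<in> carrier G" "Poly_Mapping.keys h \<subseteq> carrier G" for x y a b and h
    using that(3,1,2) by (induction h rule: monoid_ring_induct) (auto simp: distr m_assoc mult.assoc)
  have s2: "(Poly_Mapping.single x a \<otimes>\<^bsub>?R\<^esub> g) \<otimes>\<^bsub>?R\<^esub> h =
      Poly_Mapping.single x a \<otimes>\<^bsub>?R\<^esub> (g \<otimes>\<^bsub>?R\<^esub> h)"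
    if "Poly_Mapping.keys g \<subseteq> carrier G" "x \<in> carrier G" "Poly_Mapping.keys h \<subseteq> carrier G"
    for x a g h
    using that
    by (induction g rule: monoid_ring_induct)
       (auto simp: distr s1 simp del: monoid_ring_mult_single)
  have assoc: "(f \<otimes>\<^bsub>?R\<^esub> g) \<otimes>\<^bsub>?R\<^esub> h = f \<otimes>\<^bsub>?R\<^esub> (g \<otimes>\<^bsub>?R\<^esub> h)"
    if "Poly_Mapping.keys f \<subseteq> carrier G" "Poly_Mapping.keys g \<subseteq> carrier G"
      "Poly_Mapping.keys h \<subseteq> carrier G" for f g h
    using that by (induction f rule: monoid_ring_induct) (auto simp: distr s2)
  have one: "Poly_Mapping.single \<one> 1 \<otimes>\<^bsub>?R\<^esub> f = f" "f \<otimes>\<^bsub>?R\<^esub> Poly_Mapping.single \<one> 1 = f"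
    if "Poly_Mapping.keys f \<subseteq> carrier G" for f
    using that by (induction f rule: monoid_ring_induct) (auto simp: distr)
  have closed: "Poly_Mapping.keys (f \<otimes>\<^bsub>?R\<^esub> g) \<subseteq> carrier G"
    if "Poly_Mapping.keys f \<subseteq> carrier G" "Poly_Mapping.keys g \<subseteq> carrier G" for f g
  proof
    fix z assume "z \<in> Poly_Mapping.keys (f \<otimes>\<^bsub>?R\<^esub> g)"
    hence "Poly_Mapping.lookup (f \<otimes>\<^bsub>?R\<^esub> g) z \<noteq> 0" by (simp add: in_keys_iff)
    moreover have "Poly_Mapping.lookup (f \<otimes>\<^bsub>?R\<^esub> g) z = 0"
      if "\<forall>x\<in>Poly_Mapping.keys f. \<forall>y\<in>Poly_Mapping.keys g. z \<noteq> x \<otimes> y"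
      using that by (auto simp: monoid_ring_def lookup_sum lookup_single when_def intro!: sum.neutral) blast
    ultimately obtain x y where "x \<in> Poly_Mapping.keys f" "y \<in> Poly_Mapping.keys g" "z = x \<otimes> y"
      by blast
    thus "z \<in> carrier G" using that by auto
  qed
  show ?thesis
  proof (rule ringI)
    show "abelian_group ?R"
    proof (rule abelian_groupI)
      fix f assume "f \<in> carrier ?R"
      thus "\<exists>g\<in>carrier ?R. g \<oplus>\<^bsub>?R\<^esub> f = \<zero>\<^bsub>?R\<^esub>"
        by (intro bexI[of _ "- f"]) auto
    qed (auto simp: algebra_simps dest!: subsetD[OF Poly_Mapping.keys_add])
    show "monoid ?R"
      by (rule monoidI) (simp_all add: closed one assoc)
  qed (simp_all add: distr)
qed


section \<open>The algebra \<open>C\<^sub>0(K)\<close>\<close>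

datatype vertex = vi | vj

definition free_monoid :: "'a list monoid" where
  "free_monoid = \<lparr>carrier = UNIV, monoid.mult = (@), one = []\<rparr>"

abbreviation qvar :: "rat poly fract" where
  "qvar \<equiv> Fraction_Field.Fract [:0, 1:] 1"

abbreviation free_alg :: "(vertex list \<Rightarrow>\<^sub>0 rat poly fract) ring" where
  "free_alg \<equiv> monoid_ring free_monoid"

definition rel_i :: "vertex list \<Rightarrow>\<^sub>0 rat poly fract" where
  "rel_i = Poly_Mapping.single [vi, vi, vi, vj] 1
         - Poly_Mapping.single [vi, vi, vj, vi] (qvar^2 + qvar + 1)
         + Poly_Mapping.single [vi, vj, vi, vi] (qvar * (qvar^2 + qvar + 1))
         - Poly_Mapping.single [vj, vi, vi, vi] (qvar^3)"

definition rel_j :: "vertex list \<Rightarrow>\<^sub>0 rat poly fract" where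
  "rel_j = Poly_Mapping.single [vi, vj, vj, vj] 1
         - Poly_Mapping.single [vj, vi, vj, vj] (qvar^2 + qvar + 1)
         + Poly_Mapping.single [vj, vj, vi, vj] (qvar * (qvar^2 + qvar + 1))
         - Poly_Mapping.single [vj, vj, vj, vi] (qvar^3)"

definition rel_ideal :: "(vertex list \<Rightarrow>\<^sub>0 rat poly fract) set" where
  "rel_ideal = Idl\<^bsub>free_alg\<^esub> {rel_i, rel_j}"

definition C'q :: "(vertex list \<Rightarrow>\<^sub>0 rat poly fract) set ring" where
  "C'q = free_alg Quot rel_ideal"

definition C'q_gen :: "vertex \<Rightarrow> (vertex list \<Rightarrow>\<^sub>0 rat poly fract) set" where
  "C'q_gen v = rel_ideal +>\<^bsub>free_alg\<^esub> Poly_Mapping.single [v] 1"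

definition C'q_scalar :: "rat poly fract \<Rightarrow> (vertex list \<Rightarrow>\<^sub>0 rat poly fract) set" where
  "C'q_scalar c = rel_ideal +>\<^bsub>free_alg\<^esub> Poly_Mapping.single [] c"

text \<open>
  A subring containing the (central) image of \<open>\<rat>[q]\<close> is the same as a \<open>\<rat>[q]\<close>-subalgebra.
\<close>

definition Cq :: "(vertex list \<Rightarrow>\<^sub>0 rat poly fract) set ring" where
  "Cq = C'q\<lparr>carrier := generate_ring C'q
           (range (\<lambda>p. C'q_scalar (Fraction_Field.Fract p 1)) \<union> range C'q_gen)\<rparr>"

definition qCq :: "(vertex list \<Rightarrow>\<^sub>0 rat poly fract) set set" where
  "qCq = {C'q_scalar qvar \<otimes>\<^bsub>Cq\<^esub> x | x. x \<in> carrier Cq}"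

definition C0 :: "(vertex list \<Rightarrow>\<^sub>0 rat poly fract) set set ring" where
  "C0 = Cq Quot qCq"

definition C0_gen :: "vertex \<Rightarrow> (vertex list \<Rightarrow>\<^sub>0 rat poly fract) set set" where
  "C0_gen v = qCq +>\<^bsub>Cq\<^esub> C'q_gen v"

definition C0_scalar :: "rat \<Rightarrow> (vertex list \<Rightarrow>\<^sub>0 rat poly fract) set set" where
  "C0_scalar c = qCq +>\<^bsub>Cq\<^esub> C'q_scalar (Fraction_Field.Fract [:c:] 1)"

text \<open>
  The \<open>\<rat>\<close>-algebra structures of \<open>C0\<close> and of a monoid ring are given by the central maps
  \<open>C0_scalar\<close> and \<open>Poly_Mapping.single \<one>\<close>; a ring homomorphism is \<open>\<rat>\<close>-linear iff it is
  compatible with them.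
\<close>

definition C0_root :: "nat \<times> nat \<Rightarrow> (vertex list \<Rightarrow>\<^sub>0 rat poly fract) set set" where
  "C0_root \<alpha> = C0_gen vi [^]\<^bsub>C0\<^esub> fst \<alpha> \<otimes>\<^bsub>C0\<^esub> C0_gen vj [^]\<^bsub>C0\<^esub> snd \<alpha>"

definition positive_roots :: "(nat \<times> nat) set" where
  "positive_roots = {(m, m + 1) | m. True} \<union> {(m + 1, m) | m. True} \<union> {(s, s) | s. s \<ge> 1}"


section \<open>The composition monoid \<open>CM(K)\<close>\<close>

text \<open>
  A representation is a pair of matrices acting on column vectors, one for each arrow
  from \<open>i\<close> to \<open>j\<close>.
\<close>

type_synonym 'k krep = "'k mat \<times> 'k mat"

definition Rep :: "nat \<times> nat \<Rightarrow> 'k krep set" where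
  "Rep \<alpha> = carrier_mat (snd \<alpha>) (fst \<alpha>) \<times> carrier_mat (snd \<alpha>) (fst \<alpha>)"

definition dimension_vector :: "'k krep \<Rightarrow> nat \<times> nat" where
  "dimension_vector X = (dim_col (fst X), dim_row (fst X))"

definition rep_hom :: "'k::field krep \<Rightarrow> 'k krep \<Rightarrow> ('k mat \<times> 'k mat) set" where
  "rep_hom X Y = {(Fi, Fj).
     Fi \<in> carrier_mat (fst (dimension_vector Y)) (fst (dimension_vector X)) \<and>
     Fj \<in> carrier_mat (snd (dimension_vector Y)) (snd (dimension_vector X)) \<and>
     fst Y * Fi = Fj * fst X \<and> snd Y * Fi = Fj * snd X}"

definition short_exact_mat :: "'k::field mat \<Rightarrow> 'k mat \<Rightarrow> bool" where
  "short_exact_mat F G \<longleftrightarrow>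
     inj_on ((*\<^sub>v) F) (carrier_vec (dim_col F)) \<and>
     (*\<^sub>v) F ` carrier_vec (dim_col F) = mat_kernel G \<and>
     (*\<^sub>v) G ` carrier_vec (dim_col G) = carrier_vec (dim_row G)"

text \<open>Exactness of \<open>0 \<rightarrow> B \<rightarrow> X \<rightarrow> A \<rightarrow> 0\<close>, in this order of the arguments.\<close>

definition short_exact :: "'k::field krep \<Rightarrow> 'k krep \<Rightarrow> 'k krep \<Rightarrow> bool" where
  "short_exact B X A \<longleftrightarrow>
     (\<exists>(Fi, Fj) \<in> rep_hom B X. \<exists>(Gi, Gj) \<in> rep_hom X A.
        short_exact_mat Fi Gi \<and> short_exact_mat Fj Gj)"

inductive_set poly_functions :: "nat \<times> nat \<Rightarrow> ('k::field krep \<Rightarrow> 'k) set" for \<alpha> where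
  const: "(\<lambda>X. c) \<in> poly_functions \<alpha>"
| coord1: "r < snd \<alpha> \<Longrightarrow> s < fst \<alpha> \<Longrightarrow> (\<lambda>X. fst X $$ (r, s)) \<in> poly_functions \<alpha>"
| coord2: "r < snd \<alpha> \<Longrightarrow> s < fst \<alpha> \<Longrightarrow> (\<lambda>X. snd X $$ (r, s)) \<in> poly_functions \<alpha>"
| add: "f \<in> poly_functions \<alpha> \<Longrightarrow> g \<in> poly_functions \<alpha> \<Longrightarrow> (\<lambda>X. f X + g X) \<in> poly_functions \<alpha>"
| mult: "f \<in> poly_functions \<alpha> \<Longrightarrow> g \<in> poly_functions \<alpha> \<Longrightarrow> (\<lambda>X. f X * g X) \<in> poly_functions \<alpha>"

definition zariski_closed :: "nat \<times> nat \<Rightarrow> 'k::field krep set \<Rightarrow> bool" where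
  "zariski_closed \<alpha> Z \<longleftrightarrow>
     (\<exists>S \<subseteq> poly_functions \<alpha>. Z = {X \<in> Rep \<alpha>. \<forall>f\<in>S. f X = 0})"

definition irreducible_closed :: "nat \<times> nat \<Rightarrow> 'k::field krep set \<Rightarrow> bool" where
  "irreducible_closed \<alpha> Z \<longleftrightarrow> zariski_closed \<alpha> Z \<and> Z \<noteq> {} \<and>
     (\<forall>Z1 Z2. zariski_closed \<alpha> Z1 \<and> zariski_closed \<alpha> Z2 \<and> Z = Z1 \<union> Z2 \<longrightarrow> Z = Z1 \<or> Z = Z2)"

definition GL_stable :: "nat \<times> nat \<Rightarrow> 'k::field krep set \<Rightarrow> bool" where
  "GL_stable \<alpha> Z \<longleftrightarrow>
     (\<forall>P \<in> carrier_mat (fst \<alpha>) (fst \<alpha>). \<forall>P' \<in> carrier_mat (fst \<alpha>) (fst \<alpha>).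
      \<forall>Q \<in> carrier_mat (snd \<alpha>) (snd \<alpha>). \<forall>X \<in> Z.
        inverts_mat P P' \<and> inverts_mat P' P \<and> invertible_mat Q \<longrightarrow>
        (Q * fst X * P', Q * snd X * P') \<in> Z)"

text \<open>
  The sets \<open>Rep \<alpha>\<close> are pairwise disjoint and irreducible sets are nonempty, so a subvariety
  determines its dimension vector and need not be tagged with it.
\<close>

definition ext_monoid :: "'k::field krep set monoid" where
  "ext_monoid =
    \<lparr>carrier = {Z. \<exists>\<alpha>. irreducible_closed \<alpha> Z \<and> GL_stable \<alpha> Z},
     monoid.mult = (\<lambda>\<A> \<B>. {X. \<exists>A\<in>\<A>. \<exists>B\<in>\<B>.
               X \<in> Rep (dimension_vector A + dimension_vector B) \<and> short_exact B X A}),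
     one = Rep 0\<rparr>"

inductive_set generate_submonoid :: "('a, 'b) monoid_scheme \<Rightarrow> 'a set \<Rightarrow> 'a set"
  for G and H where
  one: "\<one>\<^bsub>G\<^esub> \<in> generate_submonoid G H"
| incl: "h \<in> H \<Longrightarrow> h \<in> generate_submonoid G H"
| eng: "h1 \<in> generate_submonoid G H \<Longrightarrow> h2 \<in> generate_submonoid G H \<Longrightarrow>
    h1 \<otimes>\<^bsub>G\<^esub> h2 \<in> generate_submonoid G H"

definition comp_monoid :: "'k::field krep set monoid" where
  "comp_monoid = ext_monoid\<lparr>carrier := generate_submonoid ext_monoid {Rep (1, 0), Rep (0, 1)}\<rparr>"

definition QCM :: "('k::field krep set \<Rightarrow>\<^sub>0 rat) ring" where
  "QCM = monoid_ring comp_monoid"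

end

theory Submission
  imports Defs "Jordan_Normal_Form.Char_Poly" "HOL-Library.Function_Algebras"
begin

text \<open>
  Write \<open>P\<^sub>a = (ij)\<^sup>a j\<close> and \<open>I\<^sub>b = i (ij)\<^sup>b\<close>, and call a word normal if it is a product of \<open>P\<^sub>a\<close>'s with
  increasing \<open>a\<close>, a power of \<open>ij\<close>, and \<open>I\<^sub>b\<close>'s with decreasing \<open>b\<close>. The normal
  words are a basis of the monoid ring and of the quotient of \<open>C\<^sub>0(K)\<close> by the ideal.

  In the algebra with generic \<open>q\<close> the root vectors \<open>u\<^sub>0 = j\<close>, \<open>u\<^sub>m\<^sub>+\<^sub>1 = h u\<^sub>m - q u\<^sub>m h\<close>, \<open>h = ij - ji\<close>, satisfy
  \<open>u\<^sub>m\<^sub>+\<^sub>1 u\<^sub>m = q\<^sup>2 u\<^sub>m u\<^sub>m\<^sub>+\<^sub>1\<close>. At \<open>q = 0\<close>, modulo \<open>(ij)\<^sup>m = i\<^sup>m j\<^sup>m\<close>, this says that \<open>P\<^sub>a\<close> and \<open>P\<^sub>a\<^sub>+\<^sub>1\<close> commute;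
  dually for the \<open>I\<^sub>b\<close>. These relations bring every word to a normal form.

  For the independence of the normal words, let the generic algebra act on lists of blocks, one
  for each factor of a normal word \<open>n\<close>, where a letter lowers the dimension of one block. Rescaled by
  powers of \<open>q\<close> the action is integral, and for \<open>q = 0\<close> the coefficient attached to \<open>n\<close> is 1 on a word
  \<open>w\<close> if \<open>n \<le> w\<close> and 0 otherwise, in the order that compares the numbers of letters \<open>j\<close> to the right
  of each \<open>i\<close>. These coefficients vanish on \<open>(ij)\<^sup>m - i\<^sup>m j\<^sup>m\<close> in every context.

  On the geometric side a word corresponds to the variety of representations that have a
  composition series of this type. The same relations hold: for \<open>P\<^sub>a\<close> and \<open>P\<^sub>a\<^sub>+\<^sub>1\<close> because all
  representations of dimension \<open>(a, a + 2)\<close> have small subrepresentations, found by following chains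
  \<open>y u\<^sub>k = x u\<^sub>k\<^sub>+\<^sub>1\<close>. A direct sum of string modules for \<open>n\<close> has a composition series of type \<open>w\<close> only
  if \<open>n \<le> w\<close>, so distinct normal words have distinct varieties.
\<close>


section \<open>Block lists and the quantum Serre relations\<close>

text \<open>\<open>C0\<close> is a quotient of a subalgebra of an algebra over Q(q). An integral
  combination of words vanishes in it as soon as it lies, up to a multiple of \<open>q\<close>, in
  the ideal that the Serre relations generate over Q(q), and denominators may occur on the way.
  Relations in \<open>C0\<close> are therefore found by computing over Q(q) and dividing, while
  independence needs functionals that are integral and still vanish on the whole ideal. The two
  quotients are compared through a single rewriting procedure, carried out simultaneously modulo the
  ideal of the relations \<open>(ij)^m = i^m j^m\<close> and for equality of varieties, so that each
  word gets one normal word valid on both sides. As normal words are independent on both sides, an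
  integral combination of words dies in the monoid ring exactly if it dies modulo that ideal. Hence
  no Serre relation is checked for varieties: that the map factors through \<open>C0\<close> follows
  from the comparison of kernels.\<close>

text \<open>
  A block \<open>(t, a, b)\<close> is a vector of weight \<open>(a, b)\<close>, and a letter lowers one of the coordinates. The
  factors \<open>P\<^sub>a\<close>, \<open>(ij)\<^sup>s\<close> and \<open>I\<^sub>b\<close> of a normal word start with the blocks \<open>(True, a, a + 1)\<close>, \<open>(False, s, s)\<close>
  and \<open>(False, b + 1, b)\<close>. A list of blocks is a tensor product of such vectors; the power of \<open>q\<close> in
  the action comes from the coproduct.
\<close>

type_synonym block = "bool \<times> nat \<times> nat"

section \<open>q-numbers and the action of letters\<close>

definition qnum :: "'a::comm_ring_1 \<Rightarrow> nat \<Rightarrow> 'a" where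
  "qnum q n = (\<Sum>k<n. q ^ k)"

lemma qnum_Suc: "qnum q (Suc n) = 1 + q * qnum q n"
  by (simp add: qnum_def sum.lessThan_Suc_shift sum_distrib_left del: sum.lessThan_Suc)

lemma qnum_simps [simp]: "qnum q 0 = 0" "qnum q (Suc 0) = 1" "qnum q (Suc (Suc n)) = 1 + q * qnum q (Suc n)"
  by (simp_all add: qnum_Suc) (simp_all add: qnum_def)

text \<open>For generic \<open>q\<close> the product of two consecutive q-numbers is a combination
  of \<open>1\<close>, \<open>q^n\<close> and \<open>q^(2n)\<close>, and the four coefficients are
  those of \<open>(x - 1)(x - q)(x - q^2)\<close>. The Serre relations have the same coefficients.
  For \<open>n = 0\<close> the truncated \<open>n - 1\<close> is harmless because of the factor
  \<open>qnum q 0\<close>.\<close>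

lemma qnum_quadratic:
  "qnum q (n + 2) * qnum q (n + 3) - (q\<^sup>2 + q + 1) * (qnum q (n + 1) * qnum q (n + 2))
    + q * (q\<^sup>2 + q + 1) * (qnum q n * qnum q (n + 1)) - q ^ 3 * (qnum q (n - 1) * qnum q n) = 0"
proof (cases n)
  case 0
  then show ?thesis by (simp add: numeral_eq_Suc algebra_simps)
next
  case (Suc m)
  define y z w where "y = qnum q (n + 1)" and "z = qnum q n" and "w = qnum q (n - 1)"
  have *: "q * z = y - 1" "q * w = z - 1" "qnum q (n + 2) = 1 + q * y" "qnum q (n + 3) = 1 + q * (1 + q * y)"
    using qnum_Suc[of q "Suc m"] by (simp_all add: Suc y_def z_def w_def qnum_Suc numeral_eq_Suc)
  have 1: "q ^ 3 * (w * z) = (y - 1) ^ 2 - q * (y - 1)"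
  proof -
    have "q ^ 3 * (w * z) = q * (q * w) * (q * z)" by (simp add: power3_eq_cube mult_ac)
    also have "\<dots> = (q * z) * (q * z) - q * (q * z)" unfolding *(2) by (simp add: algebra_simps)
    finally show ?thesis unfolding *(1) by (simp add: power2_eq_square)
  qed
  have 2: "q * (q\<^sup>2 + q + 1) * (z * y) = (q\<^sup>2 + q + 1) * ((y - 1) * y)"
    unfolding *(1)[symmetric] by (simp only: mult_ac)
  show ?thesis
    unfolding y_def[symmetric] z_def[symmetric] w_def[symmetric] 1 2 *(3,4)
    by (simp add: power2_eq_square algebra_simps)
qed

fun block_step :: "vertex \<Rightarrow> block \<Rightarrow> block" where
  "block_step vi (t, a, b) = (t, a - 1, b)"
| "block_step vj (t, a, b) = (t, a, b - 1)"

text \<open>With \<open>n = b - a - of_bool t\<close> the letter j acts by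
  \<open>[n][n + 1]\<close>, a solution of the recurrence \<open>qnum_quadratic\<close>. This
  product vanishes on \<open>(True, 0, 1)\<close>, the block of \<open>P_0 = j\<close>, so the last
  summand supplies the coefficient 1 there.\<close>

fun block_coeff :: "'a::comm_ring_1 \<Rightarrow> vertex \<Rightarrow> block \<Rightarrow> 'a" where
  "block_coeff q vi (t, a, b) = (if 1 \<le> a \<and> a + of_bool t \<le> b + 1 then 1 else 0)"
| "block_coeff q vj (t, a, b) = (if b = 0 then 0 else
     qnum q (b - (a + of_bool t)) * qnum q (b + 1 - (a + of_bool t)) + of_bool (t \<and> a = 0 \<and> b = 1))"

text \<open>The Euler form of the Kronecker quiver, evaluated on \<open>(a, b)\<close> and the
  simple root of the letter. Correspondingly \<open>weight_shift\<close> is minus the Euler form of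
  two letters.\<close>

fun block_weight :: "vertex \<Rightarrow> block \<Rightarrow> int" where
  "block_weight vi (t, a, b) = int a"
| "block_weight vj (t, a, b) = int b - 2 * int a"

definition weight :: "vertex \<Rightarrow> block list \<Rightarrow> int" where
  "weight c m = sum_list (map (block_weight c) m)"

text \<open>Letters act on functions of block lists, so that the leftmost letter of a word is the
  first to lower the list. The power of \<open>q\<close> arises when the letter passes the blocks of
  the tail.\<close>

fun act :: "'a::field \<Rightarrow> vertex \<Rightarrow> (block list \<Rightarrow> 'a) \<Rightarrow> block list \<Rightarrow> 'a" where
  "act q c G [] = 0"
| "act q c G (g # v) = act q c (\<lambda>v'. G (g # v')) v
     + q powi (weight c v) * block_coeff q c g * G (block_step c g # v)"

lemma weight_Cons [simp]: "weight c (g # v) = block_weight c g + weight c v"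
  by (simp add: weight_def)

lemma act_add: "act q c (\<lambda>v. F v + G v) m = act q c F m + act q c G m"
  by (induction m arbitrary: F G) (auto simp: algebra_simps)

lemma act_scale: "act q c (\<lambda>v. x * G v) m = x * act q c G m"
  by (induction m arbitrary: G) (auto simp: algebra_simps)

definition weight_shift :: "vertex \<Rightarrow> vertex \<Rightarrow> int" where
  "weight_shift c d = (case c of vi \<Rightarrow> (case d of vi \<Rightarrow> -1 | vj \<Rightarrow> 2)
                        | vj \<Rightarrow> (case d of vi \<Rightarrow> 0 | vj \<Rightarrow> -1))"

lemma block_weight_step:
  "block_coeff q c g \<noteq> 0 \<Longrightarrow> block_weight d (block_step c g) = block_weight d g + weight_shift c d"
  by (cases c; cases d; cases g) (auto simp: weight_shift_def split: if_splits)

text \<open>All lists reached by the letter \<open>c\<close> with nonzero coefficient differ from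
  \<open>m\<close> in weight by the same amount, so the power of \<open>q\<close> can be taken out
  of the sum.\<close>

lemma act_weight:
  assumes "q \<noteq> 0"
  shows "act q c (\<lambda>v. q powi (weight d v) * G v) m
       = q powi (weight_shift c d) * q powi (weight d m) * act q c G m"
proof (induction m arbitrary: G)
  case (Cons g v)
  have "act q c (\<lambda>v'. q powi (weight d (g # v')) * G (g # v')) v
      = q powi (block_weight d g) * act q c (\<lambda>v'. q powi (weight d v') * G (g # v')) v"
    by (simp add: power_int_add assms mult.assoc act_scale)
  also have "\<dots> = q powi (block_weight d g) *
      (q powi (weight_shift c d) * q powi (weight d v) * act q c (\<lambda>v'. G (g # v')) v)"
    by (simp add: Cons)
  finally have 1: "act q c (\<lambda>v'. q powi (weight d (g # v')) * G (g # v')) v = \<dots>" .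
  show ?case
  proof (cases "block_coeff q c g = 0")
    case True
    then show ?thesis
      unfolding act.simps 1 by (simp add: power_int_add assms)
  next
    case False
    then show ?thesis
      unfolding act.simps 1
      by (simp add: power_int_add assms block_weight_step distrib_left mult_ac)
  qed
qed auto

section \<open>The Serre relations for blocks and their tensor products\<close>

definition serre_i :: "'a::field \<Rightarrow> (vertex \<Rightarrow> ('x \<Rightarrow> 'a) \<Rightarrow> 'x \<Rightarrow> 'a) \<Rightarrow> ('x \<Rightarrow> 'a) \<Rightarrow> 'x \<Rightarrow> 'a" where
  "serre_i q T G x = T vi (T vi (T vi (T vj G))) x
     - (q^2 + q + 1) * T vi (T vi (T vj (T vi G))) x
     + q * (q^2 + q + 1) * T vi (T vj (T vi (T vi G))) x
     - q^3 * T vj (T vi (T vi (T vi G))) x"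

definition serre_j :: "'a::field \<Rightarrow> (vertex \<Rightarrow> ('x \<Rightarrow> 'a) \<Rightarrow> 'x \<Rightarrow> 'a) \<Rightarrow> ('x \<Rightarrow> 'a) \<Rightarrow> 'x \<Rightarrow> 'a" where
  "serre_j q T G x = T vi (T vj (T vj (T vj G))) x
     - (q^2 + q + 1) * T vj (T vi (T vj (T vj G))) x
     + q * (q^2 + q + 1) * T vj (T vj (T vi (T vj G))) x
     - q^3 * T vj (T vj (T vj (T vi G))) x"

definition block_act :: "'a::field \<Rightarrow> vertex \<Rightarrow> (block \<Rightarrow> 'a) \<Rightarrow> block \<Rightarrow> 'a" where
  "block_act q c G g = block_coeff q c g * G (block_step c g)"

lemma block_coeff_j:
  "\<not> (t \<and> a = 0 \<and> b = 1) \<Longrightarrow> block_coeff q vj (t, a, b) = qnum q (b - (a + of_bool t)) * qnum q (b + 1 - (a + of_bool t))"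
  by auto

text \<open>In the nontrivial case all four terms end at \<open>(t, a - 3, b - 1)\<close>. The
  letter j contributes \<open>[d + 2][d + 3]\<close> down to \<open>[d - 1][d]\<close>, according to
  the number of letters i that act before it, and \<open>qnum_quadratic\<close> cancels the
  sum.\<close>

lemma serre_i_block: "serre_i q (block_act q) G (t, a, b) = 0"
proof -
  consider "a < 3 \<or> b = 0" | "a + of_bool t > b + 1"
    | a' d where "a = Suc (Suc (Suc a'))" "b = Suc (Suc (a' + of_bool t + d))"
  proof -
    assume r: "a < 3 \<or> b = 0 \<Longrightarrow> thesis" "a + of_bool t > b + 1 \<Longrightarrow> thesis"
       "\<And>a' d. a = Suc (Suc (Suc a')) \<Longrightarrow> b = Suc (Suc (a' + of_bool t + d)) \<Longrightarrow> thesis"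
    show thesis
    proof (cases "(a < 3 \<or> b = 0) \<or> a + of_bool t > b + 1")
      case False
      then show thesis by (intro r(3)[of "a - 3" "b - (a - 3) - of_bool t - 2"]) auto
    qed (use r in auto)
  qed
  then show ?thesis
  proof cases
    case (3 a' d)
    let ?j = "block_coeff q vj"
    have i: "block_coeff q vi (t, Suc a, b) = 1" if "a + of_bool t \<le> b" for a b
      using that by simp
    have j: "?j (t, a', b) = qnum q (d + 2) * qnum q (d + 3)"
        "?j (t, Suc a', b) = qnum q (d + 1) * qnum q (d + 2)"
        "?j (t, Suc (Suc a'), b) = qnum q d * qnum q (d + 1)"
        "?j (t, Suc (Suc (Suc a')), b) = qnum q (d - 1) * qnum q d"
      using 3 by (simp_all add: block_coeff_j numeral_eq_Suc del: block_coeff.simps)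
    have b: "b = Suc (Suc (a' + of_bool t + d))" and a: "a = Suc (Suc (Suc a'))" using 3 by auto
    have "serre_i q (block_act q) G (t, a, b) = G (t, a', b - 1) *
       (qnum q (d + 2) * qnum q (d + 3) - (q\<^sup>2 + q + 1) * (qnum q (d + 1) * qnum q (d + 2))
        + q * (q\<^sup>2 + q + 1) * (qnum q d * qnum q (d + 1)) - q ^ 3 * (qnum q (d - 1) * qnum q d))"
      unfolding serre_i_def block_act_def a
      using i[of "Suc (Suc a')" "Suc (a' + of_bool t + d)"] j[unfolded b]
      \<comment> \<open>For \<open>d = 0\<close> an i that acts after j can be inactive, but then j
        has already contributed the factor \<open>qnum q 0\<close>.\<close>
      by (cases "d = 0")
        (simp_all add: i b algebra_simps del: block_coeff.simps qnum_simps(3))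
    also have "\<dots> = 0"
      using qnum_quadratic[of q d] by simp
    finally show ?thesis .
  next
    case 1
    have "block_coeff q vi (t, 0, b) = 0" "block_coeff q vj (t, a, 0) = 0" for a b by auto
    moreover have "b = 0 \<or> a = 0 \<or> a = Suc 0 \<or> a = Suc (Suc 0)" using 1 by auto
    ultimately show ?thesis
      by (auto simp: serre_i_def block_act_def simp del: block_coeff.simps)
  next
    case 2
    then have "block_coeff q vi (t, a, b) = 0" "block_coeff q vj (t, a, b) = 0" by auto
    then show ?thesis by (simp add: serre_i_def block_act_def del: block_coeff.simps)
  qed
qed

lemma serre_j_block: "serre_j q (block_act q) G (t, a, b) = 0"
proof -
  consider "a = 0 \<or> b < 3" | "a + of_bool t > b + 1" | "a + of_bool t = b + 1" "3 \<le> b" "a \<noteq> 0"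
    | a' n where "a = Suc a'" "b = a' + of_bool t + Suc n" "3 \<le> b"
  proof -
    assume r: "a = 0 \<or> b < 3 \<Longrightarrow> thesis" "a + of_bool t > b + 1 \<Longrightarrow> thesis"
       "a + of_bool t = b + 1 \<Longrightarrow> 3 \<le> b \<Longrightarrow> a \<noteq> 0 \<Longrightarrow> thesis"
       "\<And>a' n. a = Suc a' \<Longrightarrow> b = a' + of_bool t + Suc n \<Longrightarrow> 3 \<le> b \<Longrightarrow> thesis"
    show thesis
    proof (cases "(a = 0 \<or> b < 3) \<or> a + of_bool t \<ge> b + 1")
      case False
      then show thesis by (intro r(4)[of "a - 1" "b - a - of_bool t"]) auto
    next
      case True
      then show thesis using r(1-3) by (cases "a = 0 \<or> b < 3"; cases "a + of_bool t = b + 1") auto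
    qed
  qed
  then show ?thesis
  proof cases
    case 1
    have "block_coeff q vi (t, 0, b) = 0" "block_coeff q vj (t, a, 0) = 0" for a b by auto
    moreover have "a = 0 \<or> b = 0 \<or> b = Suc 0 \<or> b = Suc (Suc 0)" using 1 by auto
    ultimately show ?thesis
      by (auto simp: serre_j_def block_act_def simp del: block_coeff.simps)
  next
    case 2
    then have "block_coeff q vi (t, a, b) = 0" "block_coeff q vj (t, a, b) = 0" by auto
    then show ?thesis by (simp add: serre_j_def block_act_def del: block_coeff.simps)
  next
    case 3
    then have "block_coeff q vj (t, a, b) = 0" "block_coeff q vj (t, a - 1, b) = 0"
      by (auto simp: block_coeff_j)
    then show ?thesis by (simp add: serre_j_def block_act_def del: block_coeff.simps)
  next
    case (4 a' n)
    then obtain b' where b': "b = Suc (Suc (Suc b'))"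
      using that[of "b - 3"] by simp
    have B: "Suc (Suc (Suc b')) = a' + of_bool t + Suc n" using 4 b' by simp
    let ?c = "qnum q"
    let ?j = "block_coeff q vj"
    have j: "?j (t, Suc a', b) = ?c n * ?c (n + 1)"
        "?j (t, Suc a', Suc (Suc b')) = ?c (n - 1) * ?c n"
        "?j (t, Suc a', Suc b') = ?c (n - 2) * ?c (n - 1)"
        "?j (t, a', b) = ?c (n + 1) * ?c (n + 2)"
        "?j (t, a', Suc (Suc b')) = ?c n * ?c (n + 1)"
      using B by (simp_all add: b' block_coeff_j del: block_coeff.simps)
        (auto simp: Suc_diff_le numeral_eq_Suc intro!: arg_cong2[of _ _ _ _ "(*)"] arg_cong[of _ _ "qnum q"])
    \<comment> \<open>The coefficient \<open>e\<close> of the last j stays opaque: for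
      \<open>n = 1\<close> it may be the exceptional one of \<open>(True, 0, 1)\<close>, where the
      product formula fails. In that case only two terms survive, and they cancel for any
      \<open>e\<close>.\<close>
    define e where "e = ?j (t, a', Suc b')"
    have e: "e = ?c (n - 1) * ?c n" if "n \<noteq> 1"
      unfolding e_def using B that
      by (subst block_coeff_j) (auto intro!: arg_cong2[of _ _ _ _ "(*)"] arg_cong[of _ _ "qnum q"])
    have i: "block_coeff q vi (t, Suc a', b) = 1"
      "n \<ge> 1 \<Longrightarrow> block_coeff q vi (t, Suc a', Suc (Suc b')) = 1"
      "n \<ge> 1 \<Longrightarrow> block_coeff q vi (t, Suc a', Suc b') = 1"
      "n \<ge> 2 \<Longrightarrow> block_coeff q vi (t, Suc a', b') = 1"
      using B b' by auto
    have S: "serre_j q (block_act q) G (t, Suc a', b) =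
        block_coeff q vi (t, Suc a', b) * (?j (t, a', b) * (?j (t, a', Suc (Suc b')) * (e * G (t, a', b'))))
        - (q\<^sup>2 + q + 1) * (?j (t, Suc a', b) * (block_coeff q vi (t, Suc a', Suc (Suc b')) * (?j (t, a', Suc (Suc b')) * (e * G (t, a', b')))))
        + q * (q\<^sup>2 + q + 1) * (?j (t, Suc a', b) * (?j (t, Suc a', Suc (Suc b')) * (block_coeff q vi (t, Suc a', Suc b') * (e * G (t, a', b')))))
        - q ^ 3 * (?j (t, Suc a', b) * (?j (t, Suc a', Suc (Suc b')) * (?j (t, Suc a', Suc b') * (block_coeff q vi (t, Suc a', b') * G (t, a', b')))))"
      unfolding serre_j_def block_act_def b' e_def by (simp del: block_coeff.simps)
    consider "n = 0" | "n = 1" | m where "n = Suc (Suc m)"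
      by (metis One_nat_def not0_implies_Suc)
    then show ?thesis
    proof cases
      case 1
      then have "?c n = 0" "e = 0" using e by simp_all
      then show ?thesis unfolding 4(1) S j by simp
    next
      case 2
      have n: "?c n = 1" "?c (n + 1) = 1 + q" "?c (n + 2) = q\<^sup>2 + q + 1" "?c (n - 1) = 0"
        by (simp_all add: 2 numeral_eq_Suc qnum_Suc algebra_simps)
      show ?thesis
        unfolding 4(1) S j n using i(1-3) 2 by (simp add: algebra_simps del: block_coeff.simps)
    next
      case (3 m)
      have *: "n1 * n2 * (n * n1 * (m * n * g)) - t * (n * n1 * (n * n1 * (m * n * g)))
         + u * (n * n1 * (m * n * (m * n * g))) - r * (n * n1 * (m * n * (l * m * g))) = 0"
        if "n1 * n2 - t * (n * n1) + u * (m * n) - r * (l * m) = 0" for n n1 n2 m l t u r g :: 'a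
      proof -
        have "n1 * n2 * (n * n1 * (m * n * g)) - t * (n * n1 * (n * n1 * (m * n * g)))
         + u * (n * n1 * (m * n * (m * n * g))) - r * (n * n1 * (m * n * (l * m * g)))
         = g * n * n * n1 * m * (n1 * n2 - t * (n * n1) + u * (m * n) - r * (l * m))"
          by (simp add: algebra_simps)
        with that show ?thesis by simp
      qed
      have Q: "?c (n + 1) * ?c (n + 2) - (q\<^sup>2 + q + 1) * (?c n * ?c (n + 1))
        + q * (q\<^sup>2 + q + 1) * (?c (n - 1) * ?c n) - q ^ 3 * (?c (n - 2) * ?c (n - 1)) = 0"
        using qnum_quadratic[of q "Suc m"] by (simp add: 3 numeral_eq_Suc del: qnum_simps)
      have "n \<noteq> 1" "n \<ge> 1" "n \<ge> 2" using 3 by auto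
      then show ?thesis
        unfolding 4(1) S j e[OF \<open>n \<noteq> 1\<close>] i(1) i(2)[OF \<open>n \<ge> 1\<close>] i(3)[OF \<open>n \<ge> 1\<close>] i(4)[OF \<open>n \<ge> 2\<close>] mult_1_left
        by (intro * Q)
    qed
  qed
qed

lemma act_simp: "act q c (\<lambda>v. x * F v) m = x * act q c F m"
  "act q c (\<lambda>v. F v * x) m = x * act q c F m"
  "act q c (\<lambda>v. F v - G v) m = act q c F m - act q c G m"
  using act_scale[of q c x F m] act_add[of q c F "\<lambda>v. (-1) * G v" m] act_scale[of q c "-1" G m]
  by (simp_all add: mult.commute)

text \<open>A model of the tensor product of two modules. The twist of the coproduct enters only
  through the commutation rule \<open>AB\<close>.\<close>

locale commuting_actions =
  fixes q :: "'a::field" and A B :: "vertex \<Rightarrow> ('x \<Rightarrow> 'a) \<Rightarrow> 'x \<Rightarrow> 'a"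
  assumes q: "q \<noteq> 0"
    and A_add: "A c (\<lambda>p. F p + G p) = (\<lambda>p. A c F p + A c G p)"
    and B_add: "B c (\<lambda>p. F p + G p) = (\<lambda>p. B c F p + B c G p)"
    and A_scale: "A c (\<lambda>p. x * F p) = (\<lambda>p. x * A c F p)"
    and B_scale: "B c (\<lambda>p. x * F p) = (\<lambda>p. x * B c F p)"
    and AB: "A c (B d F) = (\<lambda>p. q powi weight_shift c d * B d (A c F) p)"
begin

definition T :: "vertex \<Rightarrow> ('x \<Rightarrow> 'a) \<Rightarrow> 'x \<Rightarrow> 'a" where
  "T c F = (\<lambda>p. A c F p + B c F p)"

text \<open>The Serre elements are primitive for this coproduct: once every \<open>B\<close> is
  moved outside every \<open>A\<close>, the coefficient of each mixed word vanishes
  identically.\<close>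

lemma serre_T:
  shows "serre_i q T G p = serre_i q A G p + serre_i q B G p"
    and "serre_j q T G p = serre_j q A G p + serre_j q B G p"
proof -
  obtain r where r: "r * q = 1" using q by (metis left_inverse)
  have AB': "A vi (B vi F) = (\<lambda>p. r * B vi (A vi F) p)" "A vj (B vj F) = (\<lambda>p. r * B vj (A vj F) p)"
    "A vi (B vj F) = (\<lambda>p. q^2 * B vj (A vi F) p)" "A vj (B vi F) = B vi (A vj F)" for F
    using r q by (simp_all add: AB weight_shift_def power_int_minus field_simps)
      (simp_all add: fun_eq_iff field_simps)
  have rr: "r * q = 1" "q * r = 1" "r * (q * x) = x" "q * (r * x) = x" for x
    using r by (simp_all add: mult.commute mult.left_commute)
  note rw = A_add B_add A_scale B_scale AB' T_def
  show "serre_i q T G p = serre_i q A G p + serre_i q B G p"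
    unfolding serre_i_def rw distrib_left by (simp add: algebra_simps power2_eq_square power3_eq_cube rr)
  show "serre_j q T G p = serre_j q A G p + serre_j q B G p"
    unfolding serre_j_def rw distrib_left by (simp add: algebra_simps power2_eq_square power3_eq_cube rr)
qed

end

lemma serre_act:
  assumes "q \<noteq> 0"
  shows "serre_i q (act q) G m = 0" "serre_j q (act q) G m = 0"
proof (induction m arbitrary: G)
  case Nil
  { case 1 show ?case by (simp add: serre_i_def) next case 2 show ?case by (simp add: serre_j_def) }
next
  case (Cons g v)
  \<comment> \<open>Pairs keep head and tail apart: \<open>A\<close> acts on the tail,
    \<open>B\<close> on the head with the weight of the current tail as twist.\<close>
  define A :: "vertex \<Rightarrow> (block \<times> block list \<Rightarrow> 'a) \<Rightarrow> block \<times> block list \<Rightarrow> 'a" where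
    "A = (\<lambda>c F (g, v). act q c (\<lambda>v'. F (g, v')) v)"
  define B :: "vertex \<Rightarrow> (block \<times> block list \<Rightarrow> 'a) \<Rightarrow> block \<times> block list \<Rightarrow> 'a" where
    "B = (\<lambda>c F (g, v). q powi (weight c v) * block_act q c (\<lambda>g'. F (g', v)) g)"
  interpret commuting_actions q A B
    using assms by unfold_locales
      (auto simp: A_def B_def fun_eq_iff block_act_def algebra_simps act_add act_simp act_weight)
  have T: "act q c G (fst p # snd p) = T c (\<lambda>p. G (fst p # snd p)) p" for c G p
    unfolding T_def by (cases p) (simp add: A_def B_def block_act_def mult.assoc)
  define x y where "x = q powi (weight vi v)" and "y = q powi (weight vj v)"
  have B1: "B vi F (g, v) = x * block_act q vi (\<lambda>g'. F (g', v)) g"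
    "B vj F (g, v) = y * block_act q vj (\<lambda>g'. F (g', v)) g" for F g
    by (simp_all add: B_def x_def y_def)
  have Bs: "block_act q c (\<lambda>g'. x * F g') g = x * block_act q c F g" for c x F g
    by (simp add: block_act_def)
  {
    case 1
    have "serre_i q (act q) G (fst (g, v) # snd (g, v)) = serre_i q T (\<lambda>p. G (fst p # snd p)) (g, v)"
      unfolding serre_i_def T ..
    also have "\<dots> = serre_i q A (\<lambda>p. G (fst p # snd p)) (g, v) + serre_i q B (\<lambda>p. G (fst p # snd p)) (g, v)"
      by (rule serre_T)
    also have "serre_i q A (\<lambda>p. G (fst p # snd p)) (g, v) = serre_i q (act q) (\<lambda>v'. G (g # v')) v"
      by (simp add: serre_i_def A_def)
    also have "\<dots> = 0" by (rule Cons)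
    also have "serre_i q B (\<lambda>p. G (fst p # snd p)) (g, v) =
       x ^ 3 * y * serre_i q (block_act q) (\<lambda>g'. G (g' # v)) g"
      by (simp add: serre_i_def B1 Bs algebra_simps power3_eq_cube)
    also have "\<dots> = 0" by (cases g) (simp add: serre_i_block)
    finally show ?case by simp
  next
    case 2
    have "serre_j q (act q) G (fst (g, v) # snd (g, v)) = serre_j q T (\<lambda>p. G (fst p # snd p)) (g, v)"
      unfolding serre_j_def T ..
    also have "\<dots> = serre_j q A (\<lambda>p. G (fst p # snd p)) (g, v) + serre_j q B (\<lambda>p. G (fst p # snd p)) (g, v)"
      by (rule serre_T)
    also have "serre_j q A (\<lambda>p. G (fst p # snd p)) (g, v) = serre_j q (act q) (\<lambda>v'. G (g # v')) v"
      by (simp add: serre_j_def A_def)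
    also have "\<dots> = 0" by (rule Cons)
    also have "serre_j q B (\<lambda>p. G (fst p # snd p)) (g, v) =
       x * y ^ 3 * serre_j q (block_act q) (\<lambda>g'. G (g' # v)) g"
      by (simp add: serre_j_def B1 Bs algebra_simps power3_eq_cube)
    also have "\<dots> = 0" by (cases g) (simp add: serre_j_block)
    finally show ?case by simp
  }
qed

section \<open>Integral form of the action\<close>

text \<open>
  The defect of two blocks is the dimension of the space of extensions between the string modules
  truncated to these dimensions. Its power of \<open>q\<close> clears the denominators of the action.
\<close>

fun block_defect :: "block \<Rightarrow> block \<Rightarrow> nat" where
  "block_defect (True, a, b) (True, c, d) =
     (if a = 0 then b * (c - 1) else (c - (a + 1)) + (b - (a + 1)) * (c - 1))"
| "block_defect (False, a, b) (True, c, d) = (b - a) * (c - 1)"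
| "block_defect (False, a, b) (False, c, d) =
     (if a \<le> b then if c \<le> d then (b - a) * c else a + (b - a) * (c + 1)
      else if c \<le> d then 0 else a - (c + 1))"
| "block_defect (True, a, b) (False, c, d) = 0"

fun defect :: "block list \<Rightarrow> nat" where
  "defect [] = 0"
| "defect (g # v) = sum_list (map (block_defect g) v) + defect v"

fun valid_block :: "block \<Rightarrow> bool" where
  "valid_block (t, a, b) = (if t then a = 0 \<and> b = 0 \<or> a < b else a \<le> b + 1)"

text \<open>These are the blocks whose coefficient is a nonzero polynomial in \<open>q\<close>; it
  then has the value 1 at \<open>q = 0\<close>.\<close>

fun active :: "vertex \<Rightarrow> block \<Rightarrow> bool" where
  "active vi (t, a, b) = (1 \<le> a \<and> a + of_bool t \<le> b + 1)"
| "active vj (t, a, b) = (1 \<le> b \<and> (a + of_bool t < b \<or> t \<and> a = 0 \<and> b = 1))"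

lemma block_coeff_inactive: "\<not> active c g \<Longrightarrow> block_coeff q c g = 0"
  by (cases c; cases g) auto

lemma valid_step: "valid_block g \<Longrightarrow> active c g \<Longrightarrow> valid_block (block_step c g)"
  by (cases c; cases g) (auto split: if_splits)

lemma fst_step [simp]: "fst (block_step c g) = fst g"
  by (cases c; cases g) auto

text \<open>The exponent that the pair \<open>g\<close>, \<open>h\<close> contributes when its left
  block is lowered: the loss of defect plus the twist. In \<open>left_exp\<close> the right block is
  lowered. That the truncations to natural numbers do not interfere on valid pairs, as proved below,
  is the integrality of the action.\<close>

definition right_exp :: "vertex \<Rightarrow> block \<Rightarrow> block \<Rightarrow> nat" where
  "right_exp c g h = nat (int (block_defect g h) + block_weight c h - int (block_defect (block_step c g) h))"

definition left_exp :: "vertex \<Rightarrow> block \<Rightarrow> block \<Rightarrow> nat" where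
  "left_exp c g h = block_defect g h - block_defect g (block_step c h)"

text \<open>Substituting these shapes turns the truncated subtractions in
  \<open>block_defect\<close> into polynomial expressions in the parameters.\<close>

lemma valid_blockE:
  assumes "valid_block g"
  obtains (zero) "g = (True, 0, 0)" | (proj) a k where "g = (True, a, a + 1 + k)"
    | (inj) b where "g = (False, b + 1, b)" | (reg) a k where "g = (False, a, a + k)"
proof -
  obtain t a b where g: "g = (t, a, b)" by (cases g)
  show thesis
    using assms unfolding g
    by (cases t; cases "a < b"; cases "a \<le> b")
      (auto simp: g dest: less_imp_Suc_add intro: proj[of a "b - a - 1"] reg[of a "b - a"] inj[of b] zero)
qed

lemma right_exp:
  assumes "valid_block g" "valid_block h" "active c g" "fst g \<longrightarrow> fst h"
  shows "int (right_exp c g h) = int (block_defect g h) + block_weight c h - int (block_defect (block_step c g) h)"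
proof -
  have "int (block_defect (block_step c g) h) \<le> int (block_defect g h) + block_weight c h"
    using assms(1)
  proof (cases rule: valid_blockE)
    case (proj a k)
    from assms(2) show ?thesis
    proof (cases rule: valid_blockE)
      case h: (proj x l)
      show ?thesis using assms unfolding proj h
        by (cases c; cases a; cases k; cases x) (auto simp: algebra_simps)
    qed (use assms proj in \<open>cases c; cases a; cases k; auto\<close>)+
  next
    case (inj b)
    from assms(2) show ?thesis
      by (cases rule: valid_blockE; cases c; cases b) (use assms inj in \<open>auto simp: algebra_simps\<close>)
  next
    case (reg a k)
    from assms(2) show ?thesis
    proof (cases rule: valid_blockE)
      case h: (proj x l)
      show ?thesis using assms unfolding reg h
        by (cases c; cases a; cases k; cases x) (auto simp: algebra_simps)
    next
      case h: (inj x)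
      show ?thesis using assms unfolding reg h
        by (cases c; cases a; cases k; cases x) (auto simp: algebra_simps)
    next
      case h: (reg x l)
      show ?thesis using assms unfolding reg h
        by (cases c; cases a; cases k; cases x) (auto simp: algebra_simps)
    qed (use assms reg in \<open>cases c; cases a; cases k; auto\<close>)
  qed (use assms in \<open>cases c; auto\<close>)
  then show ?thesis by (simp add: right_exp_def)
qed

lemma left_exp:
  assumes "valid_block g" "valid_block h" "active c h" "fst g \<longrightarrow> fst h"
  shows "int (left_exp c g h) = int (block_defect g h) - int (block_defect g (block_step c h))"
proof -
  have "block_defect g (block_step c h) \<le> block_defect g h"
    using assms(2)
  proof (cases rule: valid_blockE)
    case (proj x l)
    from assms(1) show ?thesis
      by (cases rule: valid_blockE; cases c; cases x) (use assms proj in \<open>auto simp: algebra_simps\<close>)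
  next
    case (inj x)
    from assms(1) show ?thesis
      by (cases rule: valid_blockE; cases c; cases x) (use assms inj in \<open>auto simp: algebra_simps\<close>)
  next
    case (reg x l)
    from assms(1) show ?thesis
      by (cases rule: valid_blockE; cases c; cases x; cases l) (use assms reg in \<open>auto simp: algebra_simps\<close>)
  qed (use assms in \<open>cases c; auto\<close>)
  then show ?thesis by (simp add: left_exp_def)
qed

definition step_at :: "vertex \<Rightarrow> nat \<Rightarrow> block list \<Rightarrow> block list" where
  "step_at c k m = m[k := block_step c (m ! k)]"

lemma act_sum:
  "act q c G m = (\<Sum>k<length m. q powi (weight c (drop (Suc k) m)) * block_coeff q c (m ! k) * G (step_at c k m))"
proof (induction m arbitrary: G)
  case (Cons g v)
  show ?case
    unfolding act.simps Cons
    by (simp add: sum.lessThan_Suc_shift step_at_def del: sum.lessThan_Suc)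
qed simp

text \<open>Blocks of type P stand at the end, so the pairs on which \<open>block_defect\<close> has
  its default value 0 do not occur.\<close>

definition valid_list :: "block list \<Rightarrow> bool" where
  "valid_list m \<longleftrightarrow> (\<forall>g\<in>set m. valid_block g) \<and> sorted_wrt (\<lambda>g h. fst g \<longrightarrow> fst h) m"

definition step_exp :: "vertex \<Rightarrow> nat \<Rightarrow> block list \<Rightarrow> nat" where
  "step_exp c k m = sum_list (map (\<lambda>g. left_exp c g (m ! k)) (take k m))
     + sum_list (map (right_exp c (m ! k)) (drop (Suc k) m))"

lemma defect_append:
  "defect (xs @ ys) = defect xs + defect ys + sum_list (map (\<lambda>g. sum_list (map (block_defect g) ys)) xs)"
  by (induction xs) auto

lemma split_at: "k < length m \<Longrightarrow> m = take k m @ m ! k # drop (Suc k) m"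
  by (simp add: id_take_nth_drop)

lemma step_at_split: "k < length m \<Longrightarrow> step_at c k m = take k m @ block_step c (m ! k) # drop (Suc k) m"
  by (simp add: step_at_def upd_conv_take_nth_drop)

lemma valid_list_append:
  "valid_list (xs @ g # ys) \<longleftrightarrow> valid_list xs \<and> valid_list ys \<and> valid_block g \<and>
     (\<forall>x\<in>set xs. fst x \<longrightarrow> fst g) \<and> (\<forall>y\<in>set ys. fst g \<longrightarrow> fst y) \<and> (\<forall>x\<in>set xs. \<forall>y\<in>set ys. fst x \<longrightarrow> fst y)"
  unfolding valid_list_def by (simp add: sorted_wrt_append ball_Un) blast

lemma valid_list_split:
  assumes "valid_list m" "k < length m"
  shows "valid_list (take k m @ m ! k # drop (Suc k) m)"
  by (rule subst[where P = valid_list, OF split_at[OF assms(2)] assms(1)])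

lemma valid_step_at:
  assumes "valid_list m" "k < length m" "active c (m ! k)"
  shows "valid_list (step_at c k m)"
  unfolding step_at_split[OF assms(2)] valid_list_append fst_step
  using valid_list_split[OF assms(1,2), unfolded valid_list_append] valid_step[OF _ assms(3)] by blast

text \<open>Lowering one block changes the defect only in the pairs that contain it, and the weight
  of the blocks to its right splits over the same pairs.\<close>

lemma step_exp:
  assumes m: "valid_list m" "k < length m" "active c (m ! k)"
  shows "int (step_exp c k m) = int (defect m) - int (defect (step_at c k m)) + weight c (drop (Suc k) m)"
proof -
  define xs g ys where "xs = take k m" and "g = m ! k" and "ys = drop (Suc k) m"
  have "valid_list (xs @ g # ys)"
    unfolding xs_def g_def ys_def by (rule valid_list_split[OF m(1,2)])
  then have v: "valid_block g" "valid_list xs" "valid_list ys"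
    and xs: "\<forall>x\<in>set xs. valid_block x \<and> (fst x \<longrightarrow> fst g)"
    and ys: "\<forall>x\<in>set ys. valid_block x \<and> (fst g \<longrightarrow> fst x)"
    unfolding valid_list_append unfolding valid_list_def by blast+
  have g: "active c g" using m(3) by (simp only: g_def)
  have L: "int (sum_list (map (\<lambda>x. left_exp c x g) xs)) =
      int (sum_list (map (\<lambda>x. block_defect x g) xs)) - int (sum_list (map (\<lambda>x. block_defect x (block_step c g)) xs))"
    if "\<forall>x\<in>set xs. valid_block x \<and> (fst x \<longrightarrow> fst g)" for xs
    using that v(1) g by (induction xs) (auto simp: left_exp)
  have R: "int (sum_list (map (right_exp c g) ys)) =
      int (sum_list (map (block_defect g) ys)) + weight c ys - int (sum_list (map (block_defect (block_step c g)) ys))"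
    if "\<forall>x\<in>set ys. valid_block x \<and> (fst g \<longrightarrow> fst x)" for ys
    using that v(1) g by (induction ys) (auto simp: right_exp weight_def)
  have 1: "m = xs @ g # ys" "step_at c k m = xs @ block_step c g # ys"
    unfolding xs_def g_def ys_def by (rule split_at[OF m(2)], rule step_at_split[OF m(2)])
  have S: "sum_list (map (\<lambda>x. f x + h x) xs) = sum_list (map f xs) + sum_list (map h xs)" for f h :: "block \<Rightarrow> nat"
    by (rule sum_list_addf)
  have D: "defect (xs @ h # ys) = defect xs + defect ys + sum_list (map (block_defect h) ys)
      + sum_list (map (\<lambda>x. block_defect x h) xs) + sum_list (map (\<lambda>x. sum_list (map (block_defect x) ys)) xs)" for h
    by (simp add: defect_append S)
  have "int (step_exp c k m) = int (sum_list (map (\<lambda>x. left_exp c x g) xs)) + int (sum_list (map (right_exp c g) ys))"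
    by (simp add: step_exp_def xs_def g_def ys_def)
  also have "\<dots> = int (defect (xs @ g # ys)) - int (defect (xs @ block_step c g # ys)) + weight c ys"
    unfolding D L[OF xs] R[OF ys] by simp
  finally show ?thesis by (simp only: 1[symmetric] ys_def[symmetric])
qed

section \<open>Values of words on block lists\<close>

text \<open>No negative powers occur, so \<open>q\<close> may be taken from any commutative ring,
  and in particular be 0.\<close>

primrec word_value :: "'a::comm_ring_1 \<Rightarrow> vertex list \<Rightarrow> block list \<Rightarrow> 'a" where
  "word_value q [] m = of_bool (\<forall>g\<in>set m. snd g = (0, 0))"
| "word_value q (c # w) m = (\<Sum>k<length m. q ^ step_exp c k m * block_coeff q c (m ! k) * word_value q w (step_at c k m))"

primrec word_act :: "'a::field \<Rightarrow> vertex list \<Rightarrow> block list \<Rightarrow> 'a" where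
  "word_act q [] = (\<lambda>m. of_bool (\<forall>g\<in>set m. snd g = (0, 0)))"
| "word_act q (c # w) = act q c (word_act q w)"

lemma block_defect_zero: "snd g = (0, 0) \<Longrightarrow> snd h = (0, 0) \<Longrightarrow> block_defect g h = 0"
  by (induction g h rule: block_defect.induct) simp_all

lemma defect_zero: "(\<And>g. g \<in> set m \<Longrightarrow> snd g = (0, 0)) \<Longrightarrow> defect m = 0"
  by (induction m) (simp_all add: block_defect_zero)

text \<open>Along a path of active steps the exponents telescope, and exhausted blocks have defect
  0. Paths with an inactive step have coefficient 0 on both sides.\<close>

lemma word_value_act:
  assumes "q \<noteq> 0" "valid_list m"
  shows "word_value q w m = q ^ defect m * word_act q w m"
  using assms(2)
proof (induction w arbitrary: m)
  case Nil
  then show ?case by (cases "\<forall>g\<in>set m. snd g = (0, 0)") (simp_all add: defect_zero)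
next
  case (Cons c w)
  have "q ^ step_exp c k m * block_coeff q c (m ! k) * word_value q w (step_at c k m) =
     q ^ defect m * (q powi (weight c (drop (Suc k) m)) * block_coeff q c (m ! k) * word_act q w (step_at c k m))"
    if k: "k < length m" for k
  proof (cases "active c (m ! k)")
    case True
    have "q ^ step_exp c k m * q ^ defect (step_at c k m) = q powi (int (step_exp c k m) + int (defect (step_at c k m)))"
      using assms(1) by (simp add: power_int_add)
    also have "\<dots> = q powi (int (defect m) + weight c (drop (Suc k) m))"
      unfolding step_exp[OF Cons.prems k True] by (rule arg_cong[where f = "\<lambda>n. q powi n"]) simp
    also have "\<dots> = q ^ defect m * q powi (weight c (drop (Suc k) m))"
      using assms(1) by (simp add: power_int_add)
    finally have *: "q ^ step_exp c k m * q ^ defect (step_at c k m) = \<dots>" .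
    have "q ^ step_exp c k m * block_coeff q c (m ! k) * word_value q w (step_at c k m) =
      (q ^ step_exp c k m * q ^ defect (step_at c k m)) * (block_coeff q c (m ! k) * word_act q w (step_at c k m))"
      unfolding Cons.IH[OF valid_step_at[OF Cons.prems k True]] by (simp only: mult_ac)
    also have "\<dots> = q ^ defect m * (q powi (weight c (drop (Suc k) m)) * block_coeff q c (m ! k) * word_act q w (step_at c k m))"
      unfolding * by (simp only: mult_ac)
    finally show ?thesis .
  qed (simp add: block_coeff_inactive)
  then show ?case
    unfolding word_value.simps word_act.simps act_sum sum_distrib_left by (intro sum.cong) auto
qed

lemma word_act_append: "word_act q (u @ v) = foldr (act q) u (word_act q v)"
  by (induction u) simp_all

lemma foldr_act_linear:
  "foldr (act q) u (\<lambda>m. F m + G m) = (\<lambda>m. foldr (act q) u F m + foldr (act q) u G m)"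
  "foldr (act q) u (\<lambda>m. x * F m) = (\<lambda>m. x * foldr (act q) u F m)"
proof -
  have add: "act q c (\<lambda>m. F m + G m) = (\<lambda>m. act q c F m + act q c G m)"
    and scale: "act q c (\<lambda>m. x * F m) = (\<lambda>m. x * act q c F m)" for c F G
    by (simp_all only: fun_eq_iff act_add act_scale simp_thms)
  show "foldr (act q) u (\<lambda>m. F m + G m) = (\<lambda>m. foldr (act q) u F m + foldr (act q) u G m)"
    by (induction u) (simp_all only: foldr_Nil foldr_Cons id_apply o_apply add)
  show "foldr (act q) u (\<lambda>m. x * F m) = (\<lambda>m. x * foldr (act q) u F m)"
    by (induction u) (simp_all only: foldr_Nil foldr_Cons id_apply o_apply scale)
qed

lemma word_act_serre:
  assumes "q \<noteq> 0"
  shows "word_act q (u @ [vi,vi,vi,vj] @ v) m - (q^2 + q + 1) * word_act q (u @ [vi,vi,vj,vi] @ v) m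
     + q * (q^2 + q + 1) * word_act q (u @ [vi,vj,vi,vi] @ v) m - q^3 * word_act q (u @ [vj,vi,vi,vi] @ v) m = 0"
    and "word_act q (u @ [vi,vj,vj,vj] @ v) m - (q^2 + q + 1) * word_act q (u @ [vj,vi,vj,vj] @ v) m
     + q * (q^2 + q + 1) * word_act q (u @ [vj,vj,vi,vj] @ v) m - q^3 * word_act q (u @ [vj,vj,vj,vi] @ v) m = 0"
proof -
  have comb: "foldr (act q) u F1 m - x2 * foldr (act q) u F2 m + x3 * foldr (act q) u F3 m - x4 * foldr (act q) u F4 m = 0"
    if "\<And>m. F1 m - x2 * F2 m + x3 * F3 m - x4 * F4 m = 0" for F1 F2 F3 F4 and x2 x3 x4 :: 'a
  proof -
    have "foldr (act q) u (\<lambda>m. F1 m + ((- x2) * F2 m + (x3 * F3 m + (- x4) * F4 m))) m =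
       foldr (act q) u F1 m - x2 * foldr (act q) u F2 m + x3 * foldr (act q) u F3 m - x4 * foldr (act q) u F4 m"
      unfolding foldr_act_linear by simp
    moreover have "(\<lambda>m. F1 m + ((- x2) * F2 m + (x3 * F3 m + (- x4) * F4 m))) = (\<lambda>m. 0 * F1 m)"
      using that by (simp add: fun_eq_iff algebra_simps)
    ultimately show ?thesis using foldr_act_linear(2)[of q u 0 F1] by simp
  qed
  show "word_act q (u @ [vi,vi,vi,vj] @ v) m - (q^2 + q + 1) * word_act q (u @ [vi,vi,vj,vi] @ v) m
     + q * (q^2 + q + 1) * word_act q (u @ [vi,vj,vi,vi] @ v) m - q^3 * word_act q (u @ [vj,vi,vi,vi] @ v) m = 0"
    unfolding word_act_append[of q u]
    by (rule comb) (use serre_act(1)[OF assms, of "word_act q v"] in \<open>simp add: serre_i_def fun_eq_iff\<close>)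
  show "word_act q (u @ [vi,vj,vj,vj] @ v) m - (q^2 + q + 1) * word_act q (u @ [vj,vi,vj,vj] @ v) m
     + q * (q^2 + q + 1) * word_act q (u @ [vj,vj,vi,vj] @ v) m - q^3 * word_act q (u @ [vj,vj,vj,vi] @ v) m = 0"
    unfolding word_act_append[of q u]
    by (rule comb) (use serre_act(2)[OF assms, of "word_act q v"] in \<open>simp add: serre_j_def fun_eq_iff\<close>)
qed

section \<open>Specialization at \<open>q = 0\<close>\<close>

text \<open>Designed to hold between the blocks of a sorted normal word and to survive the lowering
  of the last active block, while lowering an earlier active block costs a positive power of
  \<open>q\<close>.\<close>

fun ordered :: "block \<Rightarrow> block \<Rightarrow> bool" where
  "ordered (True, a, b) (True, c, d) = (c = 0 \<or> b = a + 1 \<and> c \<le> a)"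
| "ordered (False, a, b) (True, c, d) = (c = 0 \<or> b \<le> a)"
| "ordered (False, a, b) (False, c, d) = (c = 0 \<or> b + 1 = a \<and> (d + 1 = c \<longrightarrow> a \<le> c))"
| "ordered (True, a, b) (False, c, d) = False"

definition ordered_list :: "block list \<Rightarrow> bool" where
  "ordered_list m \<longleftrightarrow> (\<forall>g\<in>set m. valid_block g) \<and> sorted_wrt ordered m"

lemma ordered_append:
  "ordered_list (xs @ g # ys) \<longleftrightarrow> ordered_list xs \<and> ordered_list ys \<and> valid_block g \<and>
     (\<forall>x\<in>set xs. ordered x g) \<and> (\<forall>y\<in>set ys. ordered g y) \<and> (\<forall>x\<in>set xs. \<forall>y\<in>set ys. ordered x y)"
  unfolding ordered_list_def by (simp add: sorted_wrt_append ball_Un) blast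

lemma ordered_left:
  assumes "valid_block x" "valid_block g" "ordered x g" "active c g"
  shows "left_exp c x g = 0" "ordered x (block_step c g)"
proof -
  have "left_exp c x g = 0 \<and> ordered x (block_step c g)"
    using assms(2)
  proof (cases rule: valid_blockE)
    case g: (proj y l)
    from assms(1) show ?thesis
      by (cases rule: valid_blockE; cases c; cases y) (use assms g in \<open>auto simp: left_exp_def\<close>)
  next
    case g: (inj y)
    from assms(1) show ?thesis
      by (cases rule: valid_blockE; cases c; cases y) (use assms g in \<open>auto simp: left_exp_def\<close>)
  next
    case g: (reg y l)
    from assms(1) show ?thesis
      by (cases rule: valid_blockE; cases c; cases y; cases l) (use assms g in \<open>auto simp: left_exp_def\<close>)
  qed (use assms in \<open>cases c; auto\<close>)
  then show "left_exp c x g = 0" "ordered x (block_step c g)" by blast+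
qed

lemma ordered_right_inactive:
  assumes "valid_block g" "valid_block y" "ordered g y" "active c g" "\<not> active c y"
  shows "right_exp c g y = 0" "ordered (block_step c g) y"
proof -
  have "right_exp c g y = 0 \<and> ordered (block_step c g) y"
    using assms(1)
  proof (cases rule: valid_blockE)
    case g: (proj a k)
    from assms(2) show ?thesis
      by (cases rule: valid_blockE; cases c; cases a; cases k) (use assms g in \<open>auto simp: right_exp_def\<close>)
  next
    case g: (inj b)
    from assms(2) show ?thesis
      by (cases rule: valid_blockE; cases c; cases b) (use assms g in \<open>auto simp: right_exp_def\<close>)
  next
    case g: (reg a k)
    from assms(2) show ?thesis
      by (cases rule: valid_blockE; cases c; cases a; cases k) (use assms g in \<open>auto simp: right_exp_def\<close>)
  qed (use assms in \<open>cases c; auto\<close>)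
  then show "right_exp c g y = 0" "ordered (block_step c g) y" by blast+
qed

lemma ordered_right_active:
  assumes "valid_block x" "valid_block g" "ordered x g" "active c x" "active c g"
  shows "0 < right_exp c x g"
  using assms(1)
proof (cases rule: valid_blockE)
  case x: (proj a k)
  from assms(2) show ?thesis
    by (cases rule: valid_blockE; cases c; cases a; cases k) (use assms x in \<open>auto simp: right_exp_def\<close>)
next
  case x: (inj b)
  from assms(2) show ?thesis
    by (cases rule: valid_blockE; cases c; cases b) (use assms x in \<open>auto simp: right_exp_def\<close>)
next
  case x: (reg a k)
  from assms(2) show ?thesis
    by (cases rule: valid_blockE; cases c; cases a; cases k) (use assms x in \<open>auto simp: right_exp_def\<close>)
qed (use assms in \<open>cases c; auto\<close>)

lemma qnum_0: "qnum 0 n = of_bool (0 < n)"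
  by (cases n) (simp_all add: qnum_Suc)

lemma block_coeff_0: "active c g \<Longrightarrow> block_coeff 0 c g = 1"
  by (cases c; cases g) (auto simp: qnum_0)

lemma word_value_inactive:
  "(\<And>g. g \<in> set m \<Longrightarrow> \<not> active c g) \<Longrightarrow> word_value q (c # w) m = 0"
  by (simp add: block_coeff_inactive)

text \<open>At \<open>q = 0\<close> only the last active block contributes to the action on an ordered list.\<close>

lemma word_value_0_step:
  assumes m: "ordered_list (xs @ g # ys)" and g: "active c g" and ys: "\<And>y. y \<in> set ys \<Longrightarrow> \<not> active c y"
  shows "word_value 0 (c # w) (xs @ g # ys) = word_value 0 w (xs @ block_step c g # ys)"
    and "ordered_list (xs @ block_step c g # ys)"
proof -
  let ?m = "xs @ g # ys"
  note o = m[unfolded ordered_append]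
  have vx: "valid_block x" if "x \<in> set xs" for x using o that by (simp add: ordered_list_def)
  have vy: "valid_block y" if "y \<in> set ys" for y using o that by (simp add: ordered_list_def)
  have vg: "valid_block g" and ox: "\<And>x. x \<in> set xs \<Longrightarrow> ordered x g" and oy: "\<And>y. y \<in> set ys \<Longrightarrow> ordered g y"
    using o by blast+
  have zero: "0 ^ step_exp c k ?m * block_coeff 0 c (?m ! k) * word_value 0 w (step_at c k ?m) = 0"
    if k: "k < length ?m" "k \<noteq> length xs" for k
  proof (cases "active c (?m ! k)")
    case act: True
    have "k < length xs"
    proof (rule ccontr)
      assume "\<not> k < length xs"
      then have "?m ! k \<in> set ys" using k by (simp add: nth_append nth_Cons')
      with ys act show False by blast
    qed
    then have x: "?m ! k = xs ! k" "xs ! k \<in> set xs" by (simp_all add: nth_append)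
    have "0 < right_exp c (xs ! k) g"
      using vx[OF x(2)] vg ox[OF x(2)] act g unfolding x(1) by (rule ordered_right_active)
    moreover have "right_exp c (xs ! k) g \<le> sum_list (map (right_exp c (xs ! k)) (drop (Suc k) ?m))"
      using \<open>k < length xs\<close> by (intro member_le_sum_list) simp_all
    ultimately have "0 < step_exp c k ?m" unfolding step_exp_def x(1) by linarith
    then show ?thesis by (simp only: zero_power mult_zero_left)
  qed (simp add: block_coeff_inactive)
  have "word_value 0 (c # w) ?m = (\<Sum>k<length ?m. 0 ^ step_exp c k ?m * block_coeff 0 c (?m ! k) * word_value 0 w (step_at c k ?m))"
    by simp
  also have "\<dots> = (\<Sum>k\<in>{length xs}. 0 ^ step_exp c k ?m * block_coeff 0 c (?m ! k) * word_value 0 w (step_at c k ?m))"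
    by (rule sum.mono_neutral_right) (use zero in auto)
  also have "\<dots> = 0 ^ step_exp c (length xs) ?m * word_value 0 w (xs @ block_step c g # ys)"
    by (simp add: block_coeff_0[OF g] step_at_def)
  also have "step_exp c (length xs) ?m = 0"
  proof -
    have "map (\<lambda>x. left_exp c x g) xs = map (\<lambda>x. 0) xs"
      by (rule map_cong[OF refl]) (rule ordered_left(1)[OF vx vg ox g])
    moreover have "map (right_exp c g) ys = map (\<lambda>x. 0) ys"
      by (rule map_cong[OF refl]) (rule ordered_right_inactive(1)[OF vg vy oy g ys])
    ultimately show ?thesis by (simp add: step_exp_def)
  qed
  finally show "word_value 0 (c # w) (xs @ g # ys) = word_value 0 w (xs @ block_step c g # ys)" by simp
  show "ordered_list (xs @ block_step c g # ys)"
    unfolding ordered_append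
    using o ordered_left(2)[OF vx vg ox g] ordered_right_inactive(2)[OF vg vy oy g ys] valid_step[OF vg g]
    by blast
qed

section \<open>The value at q = 0 as a greedy acceptance test\<close>

text \<open>The number of letters j that a block cannot give up as long as it contains an i.\<close>

fun lock :: "block \<Rightarrow> nat" where
  "lock (t, a, b) = (if a = 0 then 0 else if t then a + 1 else min a b)"

fun block_thresholds :: "bool \<Rightarrow> nat \<Rightarrow> nat \<Rightarrow> nat list" where
  "block_thresholds t 0 b = []"
| "block_thresholds t (Suc a) b = lock (t, Suc a, b) # block_thresholds t a b"

text \<open>For the successive letters i, the least number of letters j that must be left when it is
  read. Blocks are emptied from the last to the first, hence the shift by the locks of the earlier
  blocks.\<close>

fun thresholds :: "block list \<Rightarrow> nat list" where
  "thresholds [] = []"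
| "thresholds ((t, a, b) # v) = map ((+) (lock (t, a, b))) (thresholds v) @ block_thresholds t a b"

definition total_j :: "block list \<Rightarrow> nat" where
  "total_j m = sum_list (map (\<lambda>g. snd (snd g)) m)"

text \<open>The state consists of the thresholds of the remaining letters i and the number of
  remaining letters j. A j may be read only if the next i will still meet its threshold.\<close>

fun accepts :: "nat list \<Rightarrow> nat \<Rightarrow> vertex list \<Rightarrow> bool" where
  "accepts gs n [] \<longleftrightarrow> gs = [] \<and> n = 0"
| "accepts [] n (vi # w) \<longleftrightarrow> False"
| "accepts (x # gs) n (vi # w) \<longleftrightarrow> x \<le> n \<and> accepts gs n w"
| "accepts gs n (vj # w) \<longleftrightarrow> (case gs of [] \<Rightarrow> 0 | x # _ \<Rightarrow> x) < n \<and> accepts gs (n - 1) w"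

fun profile :: "vertex list \<Rightarrow> nat list" where
  "profile [] = []"
| "profile (vi # w) = count_list w vj # profile w"
| "profile (vj # w) = profile w"

lemma profile_le: "x \<in> set (profile w) \<Longrightarrow> x \<le> count_list w vj"
  by (induction w rule: profile.induct) auto

text \<open>The test at a letter j is implied by the test at the next i, which sees only letters
  further to the right. What remains is the comparison with the profile.\<close>

lemma accepts_iff: "accepts gs n w \<longleftrightarrow> list_all2 (\<le>) gs (profile w) \<and> count_list w vj = n"
proof (induction gs n w rule: accepts.induct)
  case (4 gs n w)
  have "(case gs of [] \<Rightarrow> 0 | x # _ \<Rightarrow> x) \<le> count_list w vj" if "list_all2 (\<le>) gs (profile w)"
    using that profile_le[of _ w] by (cases gs) (auto simp: list_all2_Cons1 intro: order.trans)
  then show ?case using 4 by auto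
qed auto

lemma thresholds_append:
  "thresholds (xs @ ys) = map ((+) (sum_list (map lock xs))) (thresholds ys) @ thresholds xs"
  by (induction xs rule: thresholds.induct) (auto simp: o_def add.assoc simp del: lock.simps)

lemma lock_le: "valid_block g \<Longrightarrow> lock g \<le> snd (snd g)"
  by (cases g) (auto split: if_splits)

lemma active_i_iff: "valid_block g \<Longrightarrow> active vi g \<longleftrightarrow> fst (snd g) \<noteq> 0"
  by (cases g) (auto split: if_splits)

lemma active_j_iff: "valid_block g \<Longrightarrow> active vj g \<longleftrightarrow> lock g < snd (snd g)"
  by (cases g) (auto split: if_splits)

lemma thresholds_idle: "(\<And>g. g \<in> set m \<Longrightarrow> fst (snd g) = 0) \<Longrightarrow> thresholds m = [] \<and> sum_list (map lock m) = 0"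
proof (induction m rule: thresholds.induct)
  case (2 t a b v)
  have "a = 0" using "2.prems"[of "(t, a, b)"] by simp
  with 2 show ?case by simp
qed simp

lemma thresholds_step_i:
  assumes "fst (snd g) \<noteq> 0" "\<And>y. y \<in> set ys \<Longrightarrow> fst (snd y) = 0"
  shows "thresholds (xs @ g # ys) = sum_list (map lock (xs @ g # ys)) # thresholds (xs @ block_step vi g # ys)"
proof -
  obtain t a b where g: "g = (t, Suc a, b)" using assms(1) by (cases g) (auto simp: gr0_conv_Suc)
  show ?thesis using thresholds_idle[OF assms(2)] unfolding g by (simp add: thresholds_append)
qed

lemma lock_step_j: "active vj g \<Longrightarrow> lock (block_step vj g) = lock g"
  by (cases g) auto

lemma thresholds_step_j:
  assumes "active vj g"
  shows "thresholds (xs @ block_step vj g # ys) = thresholds (xs @ g # ys)"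
proof -
  obtain t a b where g: "g = (t, a, b)" by (cases g)
  have 1: "block_thresholds t a' (b - Suc 0) = block_thresholds t a' b" if "a' \<le> a" for a'
    using that assms unfolding g by (induction a') auto
  show ?thesis using lock_step_j[OF assms] 1[of a] unfolding g
    by (simp add: thresholds_append del: lock.simps)
qed

lemma case_thresholds:
  assumes "\<And>g. g \<in> set m \<Longrightarrow> valid_block g"
  shows "(case thresholds m of [] \<Rightarrow> 0 | x # _ \<Rightarrow> x) = sum_list (map lock m)"
proof (cases "\<exists>g\<in>set m. fst (snd g) \<noteq> 0")
  case True
  then obtain xs g ys where "m = xs @ g # ys" "fst (snd g) \<noteq> 0" "\<forall>y\<in>set ys. \<not> fst (snd y) \<noteq> 0"
    by (rule split_list_last_propE)
  then show ?thesis using thresholds_step_i[of g ys xs] by simp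
next
  case False
  then show ?thesis using thresholds_idle[of m] by simp
qed

text \<open>Each letter acts only on the last active block, so a single path contributes; it either
  exhausts all blocks or gets stuck.\<close>

lemma word_value_0:
  assumes "ordered_list m"
  shows "word_value 0 w m = of_bool (accepts (thresholds m) (total_j m) w)"
  using assms
proof (induction w arbitrary: m)
  case Nil
  have "(\<forall>g\<in>set m. snd g = (0, 0)) \<longleftrightarrow> thresholds m = [] \<and> total_j m = 0"
    by (induction m rule: thresholds.induct) (auto simp: total_j_def gr0_conv_Suc neq0_conv[symmetric] simp del: neq0_conv elim: block_thresholds.elims)
  then show ?case by simp
next
  case (Cons c w)
  have v: "valid_block g" if "g \<in> set m" for g
    using Cons.prems that by (simp add: ordered_list_def)
  show ?case
  proof (cases "\<exists>g\<in>set m. active c g")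
    case True
    then obtain xs g ys where m: "m = xs @ g # ys" and g: "active c g" and ys: "\<forall>y\<in>set ys. \<not> active c y"
      by (rule split_list_last_propE)
    let ?m = "xs @ block_step c g # ys"
    have step: "word_value 0 (c # w) m = word_value 0 w ?m" "ordered_list ?m"
      using word_value_0_step[OF Cons.prems[unfolded m] g] ys unfolding m by blast+
    have le: "sum_list (map lock m) \<le> total_j m"
      unfolding total_j_def by (rule sum_list_mono) (rule lock_le[OF v])
    show ?thesis
    proof (cases c)
      case vi
      have "thresholds m = sum_list (map lock m) # thresholds ?m"
        unfolding m vi using active_i_iff v g ys
        by (intro thresholds_step_i) (auto simp: m vi simp del: active.simps valid_block.simps)
      moreover have "total_j ?m = total_j m"
        unfolding m vi total_j_def by (cases g) simp
      ultimately show ?thesis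
        unfolding step(1) Cons.IH[OF step(2)] using le by (simp add: vi)
    next
      case vj
      have t: "thresholds ?m = thresholds m"
        unfolding m vj by (rule thresholds_step_j) (use g vj in simp)
      have "lock g < snd (snd g)" using active_j_iff v g vj m by simp
      then have "total_j ?m = total_j m - 1"
        unfolding m vj total_j_def by (cases g) simp
      moreover have "sum_list (map lock m) < total_j m"
      proof -
        have "sum_list (map lock xs) \<le> total_j xs" "sum_list (map lock ys) \<le> total_j ys"
          unfolding total_j_def by (auto intro!: sum_list_mono lock_le v simp: m simp del: lock.simps)
        with \<open>lock g < snd (snd g)\<close> show ?thesis by (simp add: m total_j_def)
      qed
      ultimately show ?thesis
        unfolding step(1) Cons.IH[OF step(2)] t using case_thresholds[OF v] by (simp add: vj)
    qed
  next
    case False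
    have "\<not> accepts (thresholds m) (total_j m) (c # w)"
    proof (cases c)
      case vi
      have "thresholds m = []"
        using thresholds_idle[of m] active_i_iff v False vi by blast
      then show ?thesis by (simp add: vi)
    next
      case vj
      have "snd (snd g) \<le> lock g" if "g \<in> set m" for g
        using active_j_iff[OF v[OF that]] False that vj by auto
      then have "total_j m \<le> sum_list (map lock m)"
        unfolding total_j_def by (rule sum_list_mono)
      then show ?thesis using case_thresholds[OF v] by (simp add: vj)
    qed
    then show ?thesis
      using False by (subst word_value_inactive) auto
  qed
qed

section \<open>Normal words\<close>

definition reg_word :: "nat \<Rightarrow> vertex list" where
  "reg_word m = concat (replicate m [vi, vj])"

definition proj_word :: "nat \<Rightarrow> vertex list" where
  "proj_word a = reg_word a @ [vj]"

definition inj_word :: "nat \<Rightarrow> vertex list" where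
  "inj_word b = vi # reg_word b"

definition normal_form :: "nat list \<Rightarrow> nat \<Rightarrow> nat list \<Rightarrow> vertex list" where
  "normal_form as s bs = concat (map proj_word as) @ reg_word s @ concat (map inj_word bs)"

definition normal_words :: "vertex list set" where
  "normal_words = {normal_form as s bs | as s bs. sorted as \<and> sorted (rev bs)}"

definition word_le :: "vertex list \<Rightarrow> vertex list \<Rightarrow> bool" where
  "word_le v w \<longleftrightarrow> list_all2 (\<le>) (profile v) (profile w) \<and> count_list v vj = count_list w vj"

lemma reg_word_simps [simp]: "reg_word 0 = []" "reg_word (Suc m) = [vi, vj] @ reg_word m"
  by (simp_all add: reg_word_def)

lemma count_words [simp]:
  "count_list (reg_word m) vj = m" "count_list (proj_word m) vj = Suc m" "count_list (inj_word m) vj = m"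
  "count_list (reg_word m) vi = m" "count_list (proj_word m) vi = m" "count_list (inj_word m) vi = Suc m"
proof -
  show 1: "count_list (reg_word m) vj = m" "count_list (reg_word m) vi = m" by (induction m) auto
  show "count_list (proj_word m) vj = Suc m" "count_list (inj_word m) vj = m"
    "count_list (proj_word m) vi = m" "count_list (inj_word m) vi = Suc m"
    by (simp_all add: proj_word_def inj_word_def 1)
qed

lemma profile_append: "profile (u @ v) = map ((+) (count_list v vj)) (profile u) @ profile v"
  by (induction u rule: profile.induct) auto

lemma length_profile: "length (profile w) = count_list w vi"
  by (induction w rule: profile.induct) auto

lemma profile_inj: "profile v = profile w \<Longrightarrow> count_list v vj = count_list w vj \<Longrightarrow> v = w"
proof (induction v arbitrary: w rule: profile.induct)
  case 1
  then show ?case by (cases w rule: profile.cases) auto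
next
  case (2 v)
  then show ?case
  proof (cases w rule: profile.cases)
    case (3 w')
    then have "count_list v vj \<in> set (profile w')" using 2(2) by (metis list.set_intros(1) profile.simps(2,3))
    then show ?thesis using profile_le[of _ w'] 2(3) 3 by fastforce
  qed auto
next
  case (3 v)
  then show ?case
  proof (cases w rule: profile.cases)
    case (2 w')
    then have "count_list w' vj \<in> set (profile v)" using 3(2) by (metis list.set_intros(1) profile.simps(2,3))
    then show ?thesis using profile_le[of _ v] 3(3) 2 by fastforce
  qed auto
qed

lemma word_le_refl: "word_le w w"
  by (simp add: word_le_def list_all2_refl)

lemma word_le_trans: "word_le u v \<Longrightarrow> word_le v w \<Longrightarrow> word_le u w"
  unfolding word_le_def by (auto intro: list_all2_trans[of "(\<le>)" "(\<le>)" "(\<le>)"])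

lemma word_le_antisym:
  assumes "word_le v w" "word_le w v"
  shows "v = w"
proof (rule profile_inj)
  show "profile v = profile w"
    using assms unfolding word_le_def list_all2_conv_all_nth
    by (intro nth_equalityI) (auto intro: antisym)
  show "count_list v vj = count_list w vj" using assms by (simp add: word_le_def)
qed

text \<open>The list of blocks is read from the socle to the top, words from the top to the socle.\<close>

definition normal_blocks :: "nat list \<Rightarrow> nat \<Rightarrow> nat list \<Rightarrow> block list" where
  "normal_blocks as s bs = rev (map (\<lambda>a. (True, a, a + 1)) as @ (False, s, s) # map (\<lambda>b. (False, b + 1, b)) bs)"

lemma ordered_normal_blocks:
  assumes "sorted as" "sorted (rev bs)"
  shows "ordered_list (normal_blocks as s bs)"
proof -
  have "sorted_wrt (\<ge>) bs" using assms(2) by (simp add: sorted_wrt_rev)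
  then show ?thesis using assms(1)
    unfolding ordered_list_def normal_blocks_def sorted_wrt_rev
    by (auto simp: sorted_wrt_append sorted_wrt_map intro: sorted_wrt_mono_rel[where P = "(\<le>)"] sorted_wrt_mono_rel[where P = "(\<ge>)"])
qed

lemma block_thresholds_eq:
  "block_thresholds True a b = rev [Suc (Suc 0)..<Suc (Suc a)]"
  "a \<le> b \<Longrightarrow> block_thresholds False a b = rev [1..<Suc a]"
  by (induction a) (auto simp: min_def)

lemma profile_reg_word: "profile (reg_word m) = rev [1..<Suc m]"
  by (induction m) auto

lemma profile_proj_word: "profile (proj_word a) = rev [Suc (Suc 0)..<Suc (Suc a)]"
proof -
  have "(+) (Suc 0) = Suc" by auto
  then have "map ((+) (Suc 0)) [1..<Suc a] = [Suc (Suc 0)..<Suc (Suc a)]"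
    by (simp only: map_Suc_upt One_nat_def)
  then show ?thesis
    by (simp add: proj_word_def profile_append profile_reg_word flip: rev_map del: upt_Suc)
qed

lemma profile_inj_word: "profile (inj_word b) = b # rev [1..<Suc b]"
  by (simp add: inj_word_def profile_reg_word)

lemma total_j_append: "total_j (xs @ ys) = total_j xs + total_j ys"
  by (simp add: total_j_def)

lemma thresholds_Cons_last: "thresholds (m @ [(t, a, b)]) =
    map ((+) (sum_list (map lock m))) (block_thresholds t a b) @ thresholds m"
  by (simp add: thresholds_append)

lemma thresholds_normal_blocks:
  assumes "sorted as"
  shows "thresholds (normal_blocks as s bs) = profile (normal_form as s bs)"
    and "total_j (normal_blocks as s bs) = count_list (normal_form as s bs) vj"
proof -
  let ?I = "rev (map (\<lambda>b. (False, b + 1, b)) bs)"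
  have I: "thresholds ?I = profile (concat (map inj_word bs)) \<and> total_j ?I = count_list (concat (map inj_word bs)) vj
     \<and> sum_list (map lock ?I) = count_list (concat (map inj_word bs)) vj"
    by (induction bs) (simp_all add: thresholds_Cons_last profile_append profile_inj_word total_j_append
        block_thresholds_eq total_j_def)
  let ?J = "?I @ [(False, s, s)]"
  have J: "thresholds ?J = profile (reg_word s @ concat (map inj_word bs))"
     "total_j ?J = count_list (reg_word s @ concat (map inj_word bs)) vj"
     "sum_list (map lock ?J) = count_list (reg_word s @ concat (map inj_word bs)) vj"
    using I by (simp_all add: thresholds_Cons_last profile_append profile_reg_word total_j_append
        block_thresholds_eq total_j_def)
  \<comment> \<open>The third conjunct is conditional because the block of \<open>P_0\<close>
    contains a j but locks none. Since \<open>as\<close> is sorted, such factors come first, and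
    having no thresholds themselves they do not use the sum of the locks behind them.\<close>
  have "thresholds (normal_blocks as s bs) = profile (normal_form as s bs)
    \<and> total_j (normal_blocks as s bs) = count_list (normal_form as s bs) vj
    \<and> ((\<forall>a\<in>set as. a \<noteq> 0) \<longrightarrow> sum_list (map lock (normal_blocks as s bs)) = count_list (normal_form as s bs) vj)"
    using assms
  proof (induction as)
    case Nil
    then show ?case using J by (simp add: normal_blocks_def normal_form_def)
  next
    case (Cons a as)
    have *: "normal_blocks (a # as) s bs = normal_blocks as s bs @ [(True, a, a + 1)]"
      "normal_form (a # as) s bs = proj_word a @ normal_form as s bs"
      by (simp_all add: normal_blocks_def normal_form_def)
    have "a \<noteq> 0 \<Longrightarrow> \<forall>a\<in>set as. a \<noteq> 0" using Cons.prems by auto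
    with Cons show ?case unfolding *
      by (cases "a = 0") (simp_all add: thresholds_Cons_last profile_append profile_proj_word total_j_append
        block_thresholds_eq total_j_def)
  qed
  then show "thresholds (normal_blocks as s bs) = profile (normal_form as s bs)"
    "total_j (normal_blocks as s bs) = count_list (normal_form as s bs) vj" by blast+
qed

lemma word_value_normal_blocks:
  assumes "sorted as" "sorted (rev bs)"
  shows "word_value 0 w (normal_blocks as s bs) = of_bool (word_le (normal_form as s bs) w)"
  unfolding word_value_0[OF ordered_normal_blocks[OF assms]] accepts_iff thresholds_normal_blocks[OF assms(1)] word_le_def
  by (simp add: eq_commute)

section \<open>Valley-shaped profiles\<close>

definition hd0 :: "nat list \<Rightarrow> nat" where
  "hd0 l = (case l of [] \<Rightarrow> 0 | x # _ \<Rightarrow> x)"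

lemma hd0_simps [simp]: "hd0 [] = 0" "hd0 (x # l) = x"
  by (simp_all add: hd0_def)

fun flat :: "nat list \<Rightarrow> bool" where
  "flat [] \<longleftrightarrow> True"
| "flat (x # l) \<longleftrightarrow> x \<le> hd0 l + 1 \<and> flat l"

text \<open>If every entry is increased by its position, such a list first weakly falls and then
  weakly rises. The value past the end counts as 0, by \<open>hd0\<close>.\<close>

fun valley :: "nat list \<Rightarrow> bool" where
  "valley [] \<longleftrightarrow> True"
| "valley (x # l) \<longleftrightarrow> flat (x # l) \<or> hd0 l < x \<and> valley l"

lemma flat_valley: "flat l \<Longrightarrow> valley l"
  by (cases l) auto

lemma valley_append: "valley (g @ h) \<Longrightarrow> valley h"
  by (induction g) (auto intro: flat_valley simp: )

lemma flat_bound: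
  "flat (g @ h) \<Longrightarrow> hd0 h \<le> x \<Longrightarrow> list_all2 (\<le>) g (map ((+) x) (rev [1..<Suc (length g)])) \<and> hd0 (g @ h) \<le> length g + x"
  by (induction g) auto

text \<open>A sequence that falls and then rises is bounded on an interval by its values at the two
  ends. In terms of the original entries a constant bound becomes a staircase of slope one.\<close>

lemma valley_bound:
  "valley (g @ h) \<Longrightarrow> hd0 h \<le> x \<Longrightarrow> hd0 (g @ h) \<le> length g + x \<Longrightarrow>
     list_all2 (\<le>) g (map ((+) x) (rev [1..<Suc (length g)]))"
proof (induction g)
  case (Cons y g)
  show ?case
  proof (cases "flat (y # g @ h)")
    case True
    then show ?thesis using flat_bound[of "y # g" h x] Cons.prems by simp
  next
    case False
    then have "hd0 (g @ h) < y" "valley (g @ h)" using Cons.prems(1) by auto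
    then show ?thesis using Cons by simp
  qed
qed simp

text \<open>The factors \<open>(ij)^s\<close> and \<open>I_b\<close> only produce drops of at most
  one and form the flat tail. Inside \<open>P_a\<close> the profile drops by one, and from its last
  entry to the next factor by at least two.\<close>

lemma valley_normal_form:
  "valley (profile (normal_form as s bs))"
proof -
  have R: "flat (map ((+) x) (rev [1..<Suc m]) @ l) \<and> hd0 (map ((+) x) (rev [1..<Suc m]) @ l) = x + m"
    if "flat l" "hd0 l = x" for x m l
    using that by (induction m) auto
  let ?I = "profile (concat (map inj_word bs))"
  have I: "flat ?I \<and> hd0 ?I = count_list (concat (map inj_word bs)) vj"
  proof (induction bs)
    case (Cons b bs)
    show ?case
      using R[of "profile (concat (map inj_word bs))" _ b] Cons
      by (simp add: profile_append profile_inj_word del: upt_Suc)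
  qed simp
  let ?J = "reg_word s @ concat (map inj_word bs)"
  have J: "flat (profile ?J) \<and> hd0 (profile ?J) = count_list ?J vj"
    using R[of ?I _ s] I by (simp add: profile_append profile_reg_word del: upt_Suc)
  have P: "valley (map ((+) x) (rev [Suc (Suc 0)..<Suc (Suc a)]) @ l) \<and>
      hd0 (map ((+) x) (rev [Suc (Suc 0)..<Suc (Suc a)]) @ l) \<le> x + Suc a"
    if "valley l" "hd0 l \<le> x" for x a l
    using that by (induction a) auto
  have "valley (profile (normal_form as s bs)) \<and> hd0 (profile (normal_form as s bs)) \<le> count_list (normal_form as s bs) vj"
  proof (induction as)
    case Nil
    then show ?case using J flat_valley by (simp add: normal_form_def)
  next
    case (Cons a as)
    have *: "normal_form (a # as) s bs = proj_word a @ normal_form as s bs"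
      by (simp add: normal_form_def)
    show ?case unfolding *
      using P[of "profile (normal_form as s bs)" "count_list (normal_form as s bs) vj" a] Cons
      by (simp add: profile_append profile_proj_word del: upt_Suc)
  qed
  then show ?thesis ..
qed

text \<open>The valley shape of its profile makes a normal word blind to the difference between
  \<open>(ij)\<^sup>m\<close> and \<open>i\<^sup>m j\<^sup>m\<close>.\<close>

lemma word_le_reg_word:
  assumes "w \<in> normal_words"
  shows "word_le w (u @ reg_word m @ v) \<longleftrightarrow> word_le w (u @ replicate m vi @ replicate m vj @ v)"
proof -
  let ?g = "profile w" and ?x = "count_list v vj"
  have ij: "profile (replicate m vi @ replicate m vj @ v) = replicate m (m + ?x) @ profile v"
  proof -
    have "profile (replicate n vj @ v) = profile v" "count_list (replicate n vj @ v) vj = n + ?x" for n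
      by (induction n) simp_all
    moreover have "profile (replicate n vi @ r) = replicate n (count_list r vj) @ profile r \<and>
        count_list (replicate n vi @ r) vj = count_list r vj" for n r
      by (induction n) simp_all
    ultimately show ?thesis by simp
  qed
  have c: "count_list (replicate m vi) vj = 0" "count_list (replicate m vj) vj = m"
    by (induction m) simp_all
  let ?u = "map ((+) (m + ?x)) (profile u)"
  have e: "profile (u @ reg_word m @ v) = ?u @ map ((+) ?x) (rev [1..<Suc m]) @ profile v"
     "profile (u @ replicate m vi @ replicate m vj @ v) = ?u @ replicate m (m + ?x) @ profile v"
    by (simp_all add: profile_append[of u] profile_append[of "reg_word m"] profile_reg_word ij c del: upt_Suc)
  have "list_all2 (\<le>) ?g (?u @ map ((+) ?x) (rev [1..<Suc m]) @ profile v) \<longleftrightarrow>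
        list_all2 (\<le>) ?g (?u @ replicate m (m + ?x) @ profile v)"
  proof
    assume "list_all2 (\<le>) ?g (?u @ map ((+) ?x) (rev [1..<Suc m]) @ profile v)"
    moreover have "list_all2 (\<le>) (map ((+) ?x) (rev [1..<Suc m])) (replicate m (m + ?x))"
      unfolding list_all2_conv_all_nth by (auto simp: rev_nth simp del: upt_Suc)
    then have "list_all2 (\<le>) (?u @ map ((+) ?x) (rev [1..<Suc m]) @ profile v) (?u @ replicate m (m + ?x) @ profile v)"
      by (intro list_all2_appendI) (auto intro: list_all2_refl)
    ultimately show "list_all2 (\<le>) ?g (?u @ replicate m (m + ?x) @ profile v)"
      by (rule list_all2_trans[rotated]) auto
  next
    assume "list_all2 (\<le>) ?g (?u @ replicate m (m + ?x) @ profile v)"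
    then obtain g1 g2 g3 where g: "?g = g1 @ g2 @ g3" "list_all2 (\<le>) g1 ?u"
      "list_all2 (\<le>) g2 (replicate m (m + ?x))" "list_all2 (\<le>) g3 (profile v)"
      by (auto simp: list_all2_append2)
    have m: "length g2 = m" using g(3) by (simp add: list_all2_lengthD)
    obtain as s bs where "w = normal_form as s bs" using assms by (auto simp: normal_words_def)
    then have val: "valley (g2 @ g3)" using valley_normal_form g(1) valley_append by metis
    \<comment> \<open>Only the ends of the segment \<open>g2\<close> have to be checked. What
      follows it is bounded by the number of letters j in \<open>v\<close>, its first entry by the
      constant profile of \<open>i^m j^m\<close>.\<close>
    have h: "hd0 g3 \<le> ?x"
      using g(4) profile_le[of _ v] by (cases g3) (auto simp: list_all2_Cons1 intro: order.trans)
    have "hd0 (g2 @ g3) \<le> m + ?x"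
    proof (cases g2)
      case (Cons y g2')
      then show ?thesis using g(3) by (cases m) auto
    qed (use h in simp)
    then have "list_all2 (\<le>) g2 (map ((+) ?x) (rev [1..<Suc m]))"
      using valley_bound[OF val h] m by simp
    then show "list_all2 (\<le>) ?g (?u @ map ((+) ?x) (rev [1..<Suc m]) @ profile v)"
      unfolding g(1) using g by (intro list_all2_appendI)
  qed
  moreover have "count_list (u @ reg_word m @ v) vj = count_list (u @ replicate m vi @ replicate m vj @ v) vj"
    by (simp add: c)
  ultimately show ?thesis unfolding word_le_def e by simp
qed

text \<open>The matrix of \<open>word_le\<close> is unitriangular: at a maximal word of the support
  the sum reduces to one coefficient.\<close>

lemma normal_words_independent:
  fixes c :: "vertex list \<Rightarrow> 'a::comm_ring_1"
  assumes "finite A" "A \<subseteq> normal_words"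
    and "\<And>v. v \<in> normal_words \<Longrightarrow> (\<Sum>w\<in>A. c w * of_bool (word_le v w)) = 0"
    and "w \<in> A"
  shows "c w = 0"
proof (rule ccontr)
  assume "c w \<noteq> 0"
  let ?S = "{w \<in> A. c w \<noteq> 0}"
  interpret order word_le "\<lambda>v w. word_le v w \<and> v \<noteq> w"
    by standard (auto intro: word_le_refl word_le_antisym dest: word_le_trans)
  have "finite ?S" "?S \<noteq> {}" using assms \<open>c w \<noteq> 0\<close> by auto
  then obtain v where v: "v \<in> ?S" "\<And>w. w \<in> ?S \<Longrightarrow> word_le v w \<Longrightarrow> v = w"
    using finite_has_maximal[of ?S] by auto
  have "(\<Sum>w\<in>A. c w * of_bool (word_le v w)) = (\<Sum>w\<in>{v}. c w * of_bool (word_le v w))"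
    by (rule sum.mono_neutral_right) (use v assms in \<open>auto simp: word_le_refl\<close>)
  also have "\<dots> = c v" by (simp add: word_le_refl)
  finally show False using assms(2,3) v by auto
qed

text \<open>Replacing an adjacent pair \<open>d + k + 1, d\<close> by \<open>d + k, d + 1\<close> balances a list until it is sorted.\<close>

fun head_weight :: "nat list \<Rightarrow> nat" where
  "head_weight [] = 0"
| "head_weight (x # l) = x * Suc (length l) + head_weight l"

text \<open>The weight of a position exceeds that of the next one by one, so moving a unit to the
  right lowers the total by one.\<close>

lemma head_weight_balance:
  "head_weight (xs @ [d + k, d + 1] @ ys) < head_weight (xs @ [d + k + 1, d] @ ys)"
  by (induction xs) auto

lemma balance_to_sorted:
  fixes R :: "nat list \<Rightarrow> nat list \<Rightarrow> bool"
  assumes refl: "\<And>l. R l l" and trans: "\<And>l m n. R l m \<Longrightarrow> R m n \<Longrightarrow> R l n"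
    and step: "\<And>xs d k ys. R (xs @ [d + k + 1, d] @ ys) (xs @ [d + k, d + 1] @ ys)"
  shows "\<exists>l'. sorted l' \<and> R l l'"
proof (induction l rule: measure_induct_rule[where f = head_weight])
  case (less l)
  show ?case
  proof (cases "sorted l")
    case False
    then obtain i where i: "Suc i < length l" "l ! Suc i < l ! i"
      by (auto simp: sorted_iff_nth_Suc not_le)
    define xs d k ys where "xs = take i l" and "d = l ! Suc i" and "k = l ! i - Suc (l ! Suc i)"
      and "ys = drop (Suc (Suc i)) l"
    have "l = take i l @ l ! i # l ! Suc i # drop (Suc (Suc i)) l"
      using i by (metis Cons_nth_drop_Suc Suc_lessD append_take_drop_id)
    also have "l ! i = d + k + 1" using i by (simp add: d_def k_def)
    finally have l: "l = xs @ [d + k + 1, d] @ ys" by (simp add: xs_def d_def ys_def)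
    obtain l' where "sorted l'" "R (xs @ [d + k, d + 1] @ ys) l'"
      using less.IH[of "xs @ [d + k, d + 1] @ ys"] head_weight_balance l by blast
    with step show ?thesis unfolding l by (blast intro: trans)
  qed (use refl in blast)
qed

lemma reg_word_add: "reg_word (a + b) = reg_word a @ reg_word b"
  by (simp add: reg_word_def replicate_add)

section \<open>Rewriting words to normal form\<close>

text \<open>The relation is abstract so that it can stand for the conjunction of congruence modulo
  the ideal and equality of varieties.\<close>

locale word_congruence =
  fixes R :: "vertex list \<Rightarrow> vertex list \<Rightarrow> bool"
  assumes refl: "R w w" and sym: "R v w \<Longrightarrow> R w v" and trans: "R u v \<Longrightarrow> R v w \<Longrightarrow> R u w"
    and context_closed: "R v w \<Longrightarrow> R (x @ v @ y) (x @ w @ y)"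
    and reg: "R (reg_word m) (replicate m vi @ replicate m vj)"
    and proj_commute: "R (proj_word (Suc d) @ proj_word d) (proj_word d @ proj_word (Suc d))"
    and inj_commute: "R (inj_word d @ inj_word (Suc d)) (inj_word (Suc d) @ inj_word d)"
begin

text \<open>Both sides are equivalent to \<open>i^(b + 1) j^(b + 1) y\<close>.\<close>

lemma reg_Suc: "R (vi # reg_word b @ vj # y) (reg_word (Suc b) @ y)"
proof -
  have "R ([vi] @ reg_word b @ vj # y) ([vi] @ (replicate b vi @ replicate b vj) @ vj # y)"
    by (rule context_closed[OF reg])
  also have "[vi] @ (replicate b vi @ replicate b vj) @ vj # y = [] @ (replicate (Suc b) vi @ replicate (Suc b) vj) @ y"
    by (simp add: replicate_app_Cons_same)
  finally show ?thesis
    using context_closed[OF sym[OF reg], of "[]" "Suc b" y] by (auto intro: trans)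
qed

text \<open>Because of \<open>P_(d + k) = (ij)^k P_d\<close>, commutation of neighbouring indices
  suffices for all distances. The dual statement uses \<open>I_(d + k) = I_d (ij)^k\<close>.\<close>

lemma proj_balance: "R (x @ proj_word (d + k + 1) @ proj_word d @ y) (x @ proj_word (d + k) @ proj_word (d + 1) @ y)"
proof -
  have "proj_word (d + k + 1) = reg_word k @ proj_word (Suc d)" "proj_word (d + k) = reg_word k @ proj_word d"
    unfolding proj_word_def append_assoc[symmetric] reg_word_add[symmetric] by (simp_all only: add_ac Suc_eq_plus1)
  then show ?thesis
    using context_closed[OF proj_commute, of "x @ reg_word k" d y] by (simp only: append_assoc Suc_eq_plus1)
qed

lemma inj_balance: "R (x @ inj_word d @ inj_word (d + k + 1) @ y) (x @ inj_word (d + 1) @ inj_word (d + k) @ y)"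
proof -
  have "inj_word (d + k + 1) = inj_word (Suc d) @ reg_word k" "inj_word (d + k) = inj_word d @ reg_word k"
    unfolding inj_word_def append_Cons reg_word_add[symmetric] by (simp_all only: add_ac Suc_eq_plus1)
  then show ?thesis
    using context_closed[OF inj_commute, of x d "reg_word k @ y"] by (simp only: append_assoc Suc_eq_plus1)
qed

lemma proj_sort:
  "\<exists>as'. sorted as' \<and> R (concat (map proj_word as) @ y) (concat (map proj_word as') @ y)"
proof (rule balance_to_sorted[where R = "\<lambda>l m. R (concat (map proj_word l) @ y) (concat (map proj_word m) @ y)"])
  show "R (concat (map proj_word (xs @ [d + k + 1, d] @ ys)) @ y) (concat (map proj_word (xs @ [d + k, d + 1] @ ys)) @ y)" for xs d k ys
    using proj_balance[of "concat (map proj_word xs)" d k "concat (map proj_word ys) @ y"]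
    by (simp only: map_append concat_append list.map concat.simps append_assoc append_Nil)
qed (rule refl, rule trans)

lemma inj_sort:
  "\<exists>bs'. sorted (rev bs') \<and> R (x @ concat (map inj_word bs)) (x @ concat (map inj_word bs'))"
proof -
  have "\<exists>l'. sorted l' \<and> R (x @ concat (map inj_word (rev (rev bs)))) (x @ concat (map inj_word (rev l')))"
  proof (rule balance_to_sorted[where R = "\<lambda>l m. R (x @ concat (map inj_word (rev l))) (x @ concat (map inj_word (rev m)))"])
    show "R (x @ concat (map inj_word (rev (xs @ [d + k + 1, d] @ ys)))) (x @ concat (map inj_word (rev (xs @ [d + k, d + 1] @ ys))))" for xs d k ys
      using inj_balance[of "x @ concat (map inj_word (rev ys))" d k "concat (map inj_word (rev xs))"]
      by (simp only: rev_append rev.simps map_append concat_append list.map concat.simps append_assoc append_Nil append_Nil2)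
  qed (rule refl, rule trans)
  then show ?thesis by (metis rev_rev_ident)
qed

lemma normal_form_sort:
  "\<exists>v\<in>normal_words. R (normal_form as s bs) v"
proof -
  obtain bs' where b: "sorted (rev bs')" "R (normal_form as s bs) (normal_form as s bs')"
    using inj_sort[of "concat (map proj_word as) @ reg_word s" bs] by (auto simp: normal_form_def)
  obtain as' where a: "sorted as'" "R (normal_form as s bs') (normal_form as' s bs')"
    using proj_sort[of as "reg_word s @ concat (map inj_word bs')"] by (auto simp: normal_form_def)
  show ?thesis using trans[OF b(2) a(2)] a(1) b(1) unfolding normal_words_def by blast
qed

theorem normal_form_exists: "\<exists>v\<in>normal_words. R w v"
proof (induction w)
  case Nil
  have "[] = normal_form [] 0 []" by (simp add: normal_form_def)
  then have "[] \<in> normal_words" unfolding normal_words_def by fastforce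
  then show ?case using refl by blast
next
  case (Cons c w)
  then obtain as s bs where n: "R w (normal_form as s bs)"
    by (auto simp: normal_words_def)
  have cw: "R (c # w) (c # normal_form as s bs)"
    using context_closed[OF n, of "[c]" "[]"] by simp
  \<comment> \<open>A letter j in front is a new factor \<open>P_0\<close>. A letter i is absorbed
    by \<open>i (ij)^s = I_s\<close>, by \<open>i P_a (ij)^s ~ (ij)^(a + s + 1)\<close> or by
    \<open>i P_a P_b ~ P_(a + b + 1)\<close>.\<close>
  have "\<exists>as' s' bs'. R (c # normal_form as s bs) (normal_form as' s' bs')"
  proof (cases c)
    case vj
    then have "c # normal_form as s bs = normal_form (0 # as) s bs"
      by (simp add: normal_form_def proj_word_def)
    then show ?thesis using refl by metis
  next
    case vi
    show ?thesis
    proof (cases as)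
      case Nil
      then have "c # normal_form as s bs = normal_form [] 0 (s # bs)"
        by (simp add: normal_form_def inj_word_def vi)
      then show ?thesis using refl by metis
    next
      case as: (Cons a as')
      show ?thesis
      proof (cases as')
        case Nil
        then have "R (c # normal_form as s bs) (normal_form [] (Suc a + s) bs)"
          using reg_Suc[of a "reg_word s @ concat (map inj_word bs)"]
          by (simp add: normal_form_def as vi proj_word_def reg_word_add)
        then show ?thesis by blast
      next
        case (Cons b as'')
        then have "R (c # normal_form as s bs) (normal_form ((Suc a + b) # as'') s bs)"
          using reg_Suc[of a "proj_word b @ concat (map proj_word as'') @ reg_word s @ concat (map inj_word bs)"]
          by (simp add: normal_form_def as vi proj_word_def reg_word_add)
        then show ?thesis by blast
      qed
    qed
  qed
  then show ?case using cw trans normal_form_sort by metis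
qed

end

section \<open>Commuting real root vectors\<close>

text \<open>Reversing words and exchanging i and j carries \<open>P_a\<close> to \<open>I_a\<close>
  and preserves the relations. The opposite ring makes this symmetry available for statements about
  arbitrary rings.\<close>

typedef 'a opposite = "UNIV :: 'a set" morphisms from_opposite to_opposite by simp

setup_lifting type_definition_opposite

instantiation opposite :: (ring_1) ring_1
begin
lift_definition zero_opposite :: "'a opposite" is 0 .
lift_definition one_opposite :: "'a opposite" is 1 .
lift_definition plus_opposite :: "'a opposite \<Rightarrow> 'a opposite \<Rightarrow> 'a opposite" is "(+)" .
lift_definition minus_opposite :: "'a opposite \<Rightarrow> 'a opposite \<Rightarrow> 'a opposite" is "(-)" .
lift_definition uminus_opposite :: "'a opposite \<Rightarrow> 'a opposite" is uminus .
lift_definition times_opposite :: "'a opposite \<Rightarrow> 'a opposite \<Rightarrow> 'a opposite" is "\<lambda>x y. y * x" .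
instance
  by standard (transfer; simp add: algebra_simps)+
end

lemma to_opposite:
  fixes x y :: "'a::ring_1"
  shows "to_opposite x * to_opposite y = to_opposite (y * x)"
    and "to_opposite x + to_opposite y = to_opposite (x + y)"
    and "to_opposite x - to_opposite y = to_opposite (x - y)"
    and "to_opposite x = 0 \<longleftrightarrow> x = 0"
    and "to_opposite x = to_opposite y \<longleftrightarrow> x = y"
    and "to_opposite 1 = (1 :: 'a opposite)"
  by (simp_all add: times_opposite_def plus_opposite_def minus_opposite_def zero_opposite_def one_opposite_def
      to_opposite_inverse to_opposite_inject)

lemma to_opposite_power: "to_opposite x ^ n = to_opposite (x ^ n :: 'a::ring_1)"
  by (induction n) (simp_all add: to_opposite power_commutes flip: to_opposite(6))

text \<open>With \<open>u_a = h^a j\<close>, the relations \<open>(ij)^m = i^m j^m\<close> force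
  \<open>i u_a = 0\<close> for \<open>a >= 1\<close>, and then \<open>P_n\<close> is the sum of the
  \<open>u_a (ij)^(n - a)\<close> with \<open>a <= n\<close>. In
  \<open>P_(d + 1) P_d = P_d P_(d + 1) + u_(d + 1) P_d\<close> the last product vanishes, since
  \<open>u_(d + 1) u_a = 0\<close> for \<open>a <= d\<close>.\<close>

lemma reg_power_proj_commute:
  fixes i j :: "'a::ring_1"
  defines "e \<equiv> i * j" and "h \<equiv> i * j - j * i"
  assumes reg: "\<And>m. e ^ m = i ^ m * j ^ m"
    and u: "\<And>m. h ^ Suc m * j * (h ^ m * j) = 0"
  shows "e ^ Suc d * j * (e ^ d * j) = e ^ d * j * (e ^ Suc d * j)"
proof -
  define u where "u m = h ^ m * j" for m
  have u_Suc: "u (Suc m) = h * u m" for m by (simp add: u_def mult.assoc)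
  have u0: "u 0 = j" by (simp add: u_def)
  have e_u: "e * u m = u (Suc m) + j * (i * u m)" for m
    by (simp add: u_Suc e_def h_def algebra_simps)
  have vanish: "u a * u b = 0" if "b < a" for a b
  proof -
    have "a = (a - Suc b) + Suc b" using that by simp
    moreover define k where "k = a - Suc b"
    moreover have "u (k + Suc b) * u b = h ^ k * (u (Suc b) * u b)"
      unfolding u_def power_add by (simp only: mult.assoc)
    ultimately show ?thesis using u[of b] by (simp add: u_def)
  qed
  \<comment> \<open>The hypothesis stops below \<open>n\<close> because the expansion of
    \<open>P_m\<close> is needed in the proof of \<open>i u_m = 0\<close>.\<close>
  have expand: "e ^ n * j = (\<Sum>a\<le>n. u a * e ^ (n - a))" if "\<And>a. 1 \<le> a \<Longrightarrow> a < n \<Longrightarrow> i * u a = 0" for n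
    using that
  proof (induction n)
    case (Suc n)
    have "e ^ Suc n * j = e * (\<Sum>a\<le>n. u a * e ^ (n - a))"
      using Suc by (simp add: mult.assoc)
    also have "\<dots> = (\<Sum>a\<le>n. u (Suc a) * e ^ (n - a) + (if a = 0 then u 0 * e ^ Suc n else 0))"
      unfolding sum_distrib_left
    proof (rule sum.cong[OF refl])
      fix a assume "a \<in> {..n}"
      then have "i * u a = 0" if "a \<noteq> 0" using Suc.prems[of a] that by auto
      then show "e * (u a * e ^ (n - a)) = u (Suc a) * e ^ (n - a) + (if a = 0 then u 0 * e ^ Suc n else 0)"
        by (cases "a = 0") (simp_all add: mult.assoc[symmetric] e_u distrib_right, simp add: u0 e_def mult.assoc)
    qed
    also have "\<dots> = (\<Sum>a\<le>n. u (Suc a) * e ^ (n - a)) + u 0 * e ^ Suc n"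
      by (simp add: sum.distrib)
    also have "\<dots> = (\<Sum>a\<le>Suc n. u a * e ^ (Suc n - a))"
      by (simp only: sum.atMost_Suc_shift diff_Suc_Suc diff_zero add.commute)
    finally show ?case .
  qed (simp add: u0)
  have iu: "i * u m = 0" if "1 \<le> m" for m
    using that
  proof (induction m rule: less_induct)
    case (less m)
    \<comment> \<open>In \<open>i P_m = (ij)^(m + 1)\<close> the term of \<open>u_0\<close> already
      accounts for the whole right-hand side, which leaves \<open>i u_m = 0\<close>.\<close>
    have "i * (e ^ m * j) = i ^ Suc m * j ^ Suc m"
      by (simp only: reg power_Suc mult.assoc power_commutes)
    also have "\<dots> = e ^ Suc m" by (rule reg[symmetric])
    finally have "e ^ Suc m = i * (\<Sum>a\<le>m. u a * e ^ (m - a))"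
      using expand[of m] less by simp
    also have "\<dots> = (\<Sum>a\<le>m. (i * u a) * e ^ (m - a))"
      by (simp add: sum_distrib_left mult.assoc)
    also have "\<dots> = (\<Sum>a\<in>{0, m}. (i * u a) * e ^ (m - a))"
      by (rule sum.mono_neutral_right) (use less in auto)
    also have "\<dots> = e ^ Suc m + i * u m"
      using less(2) by (simp add: u0 e_def)
    finally show ?case by simp
  qed
  have eu: "e ^ n * u a = u (a + n)" if "1 \<le> a" for n a
    using that by (induction n) (simp_all add: e_u iu mult.assoc)
  have comm: "e ^ Suc d * j = e ^ d * j * e + e ^ d * u 1"
  proof -
    have "e * j = j * e + u 1" by (simp add: u_def e_def h_def algebra_simps)
    then show ?thesis by (simp add: power_commutes[symmetric] mult.assoc distrib_left add.commute)
  qed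
  have "e ^ d * u 1 * (e ^ d * j) = 0"
  proof -
    have "e ^ d * j = (\<Sum>a\<le>d. u a * e ^ (d - a))" by (rule expand) (rule iu)
    moreover have "u (1 + d) * (\<Sum>a\<le>d. u a * e ^ (d - a)) = 0"
      unfolding sum_distrib_left by (rule sum.neutral) (simp add: mult.assoc[symmetric] vanish)
    ultimately show ?thesis by (simp add: eu)
  qed
  then have "e ^ Suc d * j * (e ^ d * j) = e ^ d * j * e * (e ^ d * j)"
    unfolding comm distrib_right by simp
  then show ?thesis by (simp only: mult.assoc power_Suc)
qed

text \<open>A vector of weight \<open>(m, m + 1)\<close>, which becomes \<open>h^m j\<close> at
  \<open>q = 0\<close>.\<close>

primrec root_vector :: "'a::ring_1 \<Rightarrow> 'a \<Rightarrow> 'a \<Rightarrow> nat \<Rightarrow> 'a" where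
  "root_vector q h j 0 = j"
| "root_vector q h j (Suc m) = h * root_vector q h j m - q * (root_vector q h j m * h)"

text \<open>Twisted commutation with \<open>h\<close> raises the index of a root vector by 1, that
  with \<open>k\<close> by 2. Applying \<open>h\<close> twice or \<open>k\<close> once to the
  relation for \<open>m\<close> gives two relations of equal weight, whose difference is a multiple
  of the relation for \<open>m + 1\<close>. The hypotheses \<open>cancel\<close> permit the
  divisions that occur; they hold over Q(q).\<close>

lemma root_vector_commute:
  fixes i j q :: "'a::ring_1"
  defines "h \<equiv> i * j - j * i" and "t \<equiv> q^2 + q + 1"
  assumes central: "\<And>x. x * q = q * x"
    and si: "i * i * i * j - t * (i * i * j * i) + q * t * (i * j * i * i) - q ^ 3 * (j * i * i * i) = 0"
    and sj: "i * j * j * j - t * (j * i * j * j) + q * t * (j * j * i * j) - q ^ 3 * (j * j * j * i) = 0"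
    and cancel: "\<And>x. q * t * x = 0 \<Longrightarrow> x = 0" "\<And>x. 2 * q * (1 + q^2) * x = 0 \<Longrightarrow> x = 0"
  shows "root_vector q h j (Suc m) * root_vector q h j m = q^2 * (root_vector q h j m * root_vector q h j (Suc m))"
proof -
  let ?u = "root_vector q h j"
  have c: "i * q = q * i" "j * q = q * j" "i * (q * y) = q * (i * y)" "j * (q * y) = q * (j * y)" for y
    using central[of i] central[of j] by (simp_all add: mult.assoc[symmetric])
  \<comment> \<open>\<open>h2\<close> has weight \<open>(2, 2)\<close>. The coefficients of
    \<open>k\<close> are chosen so that in \<open>k j - q^2 j k\<close> the terms
    \<open>u_1 h\<close> and \<open>j h h\<close> cancel and \<open>(1 + q^2) u_2\<close>
    remains.\<close>
  define h2 where "h2 = i * ?u 1 - q * (?u 1 * i)"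
  define k where "k = 2 * h2 + (1 - q^2) * (h * h)"
  note nc = left_diff_distrib right_diff_distrib distrib_left distrib_right mult.assoc mult_1_left mult_1_right
    power2_eq_square power3_eq_cube
  note neg = diff_conv_add_uminus minus_add_distrib minus_minus minus_mult_left[symmetric] minus_mult_right[symmetric]
  define SI SJ where "SI = i * i * i * j - t * (i * i * j * i) + q * t * (i * j * i * i) - q ^ 3 * (j * i * i * i)"
    and "SJ = i * j * j * j - t * (j * i * j * j) + q * t * (j * j * i * j) - q ^ 3 * (j * j * j * i)"
  have S: "SI = 0" "SJ = 0" using si sj by (simp_all add: SI_def SJ_def)
  have u0: "?u 0 = j" and u1: "?u 1 = h * j - q * (j * h)" by simp_all
  \<comment> \<open>The commutator has weight \<open>(3, 3)\<close>; up to the factor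
    \<open>q t\<close> it is a combination of the Serre elements multiplied by words of length
    two.\<close>
  have "q * t * (h * h2 - h2 * h) = SI * j * j - q * (q + 1) * (j * SI * j) + q ^ 3 * (j * j * SI)
      - q ^ 3 * (SJ * i * i) + q * (q + 1) * (i * SJ * i) - i * i * SJ"
    unfolding SI_def SJ_def h2_def u1 unfolding t_def h_def
    by (simp only: nc c, (simp only: neg)?, (simp only: add_ac)?, simp?)
  then have hh2: "h * h2 = h2 * h"
    using cancel(1)[of "h * h2 - h2 * h"] S by simp
  have q0: "?u 1 * j = q^2 * (j * ?u 1)"
  proof -
    have "?u 1 * j - q^2 * (j * ?u 1) = SJ"
      unfolding SJ_def u1 unfolding t_def h_def
      by (simp only: nc c, (simp only: neg)?, (simp only: add_ac)?, simp?)
    then show ?thesis using S by simp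
  qed
  have r1: "h2 * j - q^2 * (j * h2) = q^2 * (h * ?u 1) - q * (?u 1 * h)"
  proof -
    define a where "a = ?u 1"
    have ca: "a * q = q * a" "a * (q * y) = q * (a * y)" for y
      using central[of a] by (simp_all add: mult.assoc[symmetric])
    have "(h2 * j - q^2 * (j * h2)) - (q^2 * (h * a) - q * (a * h))
       = i * (a * j - q^2 * (j * a)) - q * ((a * j - q^2 * (j * a)) * i)"
      unfolding h2_def a_def[symmetric] unfolding h_def
      by (simp only: nc c ca, (simp only: neg)?, (simp only: add_ac)?, simp?)
    also have "\<dots> = 0" using q0 by (simp add: a_def)
    finally show ?thesis by (simp add: a_def)
  qed
  have com: "x * q = q * x" "x * (q * y) = q * (x * y)" if "x \<in> {h, k, h2} \<union> range ?u" for x y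
    using central[of x] by (simp_all add: mult.assoc[symmetric])
  have hu: "h * ?u n = ?u (Suc n) + q * (?u n * h)" "h * (?u n * y) = ?u (Suc n) * y + q * (?u n * (h * y))" for n y
    by (simp_all add: mult.assoc[symmetric] distrib_right[symmetric])
  have kh: "k * h = h * k"
  proof -
    have "h * (2 * h2) = 2 * (h * h2)" by (simp add: mult_2 mult_2_right distrib_left)
    then show ?thesis
      unfolding k_def nc using hh2 com[of h] by (simp add: mult.assoc)
  qed
  have ku: "k * ?u n = (1 + q^2) * ?u (Suc (Suc n)) + q^2 * (?u n * k)" for n
  proof (induction n)
    case 0
    define a b where "a = ?u 1" and "b = ?u 2"
    have ca: "x * q = q * x" "x * (q * y) = q * (x * y)" if "x \<in> {h, a, b, j, h2}" for x y
      using central[of x] by (simp_all add: mult.assoc[symmetric])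
    have ha: "h * j = a + q * (j * h)" "h * a = b + q * (a * h)" "h * (j * y) = a * y + q * (j * (h * y))" for y
      using hu[of 0] hu[of 1] by (simp_all add: a_def b_def numeral_2_eq_2)
    have "k * j - q^2 * (j * k) = 2 * (h2 * j - q^2 * (j * h2)) + ((1 - q^2) * (h * h * j) - q^2 * (j * ((1 - q^2) * (h * h))))"
      unfolding k_def mult_2 by (simp only: nc ca c insertI1 insertI2, (simp only: neg)?, (simp only: add_ac)?, simp?)
    also have "h2 * j - q^2 * (j * h2) = q^2 * (h * a) - q * (a * h)" using r1 by (simp add: a_def)
    also have "2 * (q^2 * (h * a) - q * (a * h)) + ((1 - q^2) * (h * h * j) - q^2 * (j * ((1 - q^2) * (h * h))))
        = (1 + q^2) * b"
      unfolding mult_2 by (simp only: nc c ca[of h] ca[of a] ha insertI1 insertI2, (simp only: neg)?, (simp only: add_ac)?, simp?)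
    finally show ?case by (simp add: a_def b_def numeral_2_eq_2 algebra_simps)
  next
    case (Suc n)
    define a b d where "a = ?u n" and "b = ?u (Suc n)" and "d = ?u (Suc (Suc n))"
    have ca: "x * q = q * x" "x * (q * y) = q * (x * y)" if "x \<in> {h, a, b, d, k}" for x y
      using central[of x] by (simp_all add: mult.assoc[symmetric])
    have ka: "k * a = (1 + q^2) * d + q^2 * (a * k)" using Suc by (simp add: a_def d_def)
    have kh': "k * (h * y) = h * (k * y)" for y using kh by (simp add: mult.assoc[symmetric])
    have "k * b = h * (k * a) - q * ((k * a) * h)"
      using kh' kh ca[of k] by (simp add: b_def a_def[symmetric] right_diff_distrib mult.assoc)
    also have "\<dots> = (1 + q^2) * (h * d - q * (d * h)) + q^2 * ((h * a - q * (a * h)) * k)"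
      unfolding ka by (simp only: nc ca insertI1 insertI2 kh kh', (simp only: neg)?, (simp only: add_ac)?, simp?)
    finally show ?case by (simp add: a_def b_def d_def)
  qed
  show ?thesis
  proof (induction m)
    case 0
    show ?case using q0 by simp
  next
    case (Suc m)
    define a b x y where "a = ?u m" and "b = ?u (Suc m)" and "x = ?u (Suc (Suc m))" and "y = ?u (Suc (Suc (Suc m)))"
    have ca: "z * q = q * z" "z * (q * w) = q * (z * w)" if "z \<in> {h, a, b, x, y, k}" for z w
      using central[of z] by (simp_all add: mult.assoc[symmetric])
    have Q: "b * a = q^2 * (a * b)" using Suc by (simp add: a_def b_def)
    have H: "h * a = b + q * (a * h)" "h * b = x + q * (b * h)" "h * x = y + q * (x * h)"
      "h * (a * w) = b * w + q * (a * (h * w))" "h * (b * w) = x * w + q * (b * (h * w))"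
      "h * (x * w) = y * w + q * (x * (h * w))" for w
      using hu[of m] hu[of "Suc m"] hu[of "Suc (Suc m)"] by (simp_all add: a_def b_def x_def y_def)
    have K: "k * a = (1 + q^2) * x + q^2 * (a * k)" "k * b = (1 + q^2) * y + q^2 * (b * k)"
      using ku[of m] ku[of "Suc m"] by (simp_all add: a_def b_def x_def y_def)
    have K': "k * (a * w) = (1 + q^2) * (x * w) + q^2 * (a * (k * w))" "k * (b * w) = (1 + q^2) * (y * w) + q^2 * (b * (k * w))" for w
      using K by (simp_all only: mult.assoc[symmetric] distrib_right)
    \<comment> \<open>\<open>S\<close> and \<open>S'\<close> are the first and second twisted
      commutator of \<open>Z\<close> with \<open>h\<close>, and \<open>W\<close> comes from the one
      with \<open>k\<close>. The difference \<open>S' - W\<close> is \<open>2 q\<close> times the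
      relation for \<open>m + 1\<close>.\<close>
    define Z where "Z = b * a - q^2 * (a * b)"
    have Z: "Z = 0" using Q by (simp add: Z_def)
    define S where "S = x * a + q * (b * b) - q^2 * (b * b) - q^3 * (a * x)"
    have "S = h * Z - q^2 * (Z * h)"
      unfolding S_def Z_def by (simp only: nc ca H insertI1 insertI2, (simp only: neg)?, (simp only: add_ac)?, simp?)
    then have S: "S = 0" using Z by simp
    define S' where "S' = y * a + 2 * q * (x * b) - q^2 * (x * b) - 2 * q^3 * (b * x) + q^2 * (b * x) - q^4 * (a * y)"
    have "S' = h * S - q^2 * (S * h)"
      unfolding S_def S'_def power4_eq_xxxx mult_2 by (simp only: nc ca H insertI1 insertI2, (simp only: neg)?, (simp only: add_ac)?, simp?)
    then have S': "S' = 0" using S by simp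
    define W where "W = y * a + q^2 * (b * x) - q^2 * (x * b) - q^4 * (a * y)"
    have "(1 + q^2) * W = k * Z - q^4 * (Z * k)"
      unfolding W_def Z_def power4_eq_xxxx by (simp only: nc ca K K' insertI1 insertI2, (simp only: neg)?, (simp only: add_ac)?, simp?)
    then have W: "(1 + q^2) * W = 0" using Z by simp
    have "2 * q * (1 + q^2) * (x * b - q^2 * (b * x)) = (1 + q^2) * S' - (1 + q^2) * W"
      unfolding W_def S'_def power4_eq_xxxx mult_2 by (simp only: nc ca insertI1 insertI2, (simp only: neg)?, (simp only: add_ac)?, simp?)
    then have "2 * q * (1 + q^2) * (x * b - q^2 * (b * x)) = 0"
      unfolding S' W by simp
    then have "x * b - q^2 * (b * x) = 0" by (rule cancel(2))
    then show ?case by (simp add: b_def x_def)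
  qed
qed

section \<open>Spaces of functions\<close>

text \<open>Vectors of all lengths are functions on the natural numbers, and
  \<open>funs_below n\<close> plays the role of \<open>k^n\<close>, so that dimensions may vary
  inside one type.\<close>

definition fscale :: "'k::field \<Rightarrow> (nat \<Rightarrow> 'k) \<Rightarrow> nat \<Rightarrow> 'k" where
  "fscale c f = (\<lambda>n. c * f n)"

global_interpretation fv: vector_space "fscale :: 'k::field \<Rightarrow> _"
  by unfold_locales (auto simp: fscale_def algebra_simps plus_fun_def fun_eq_iff)

global_interpretation fvp: vector_space_pair "fscale :: 'k::field \<Rightarrow> _" "fscale :: 'k::field \<Rightarrow> _" ..

definition funs_below :: "nat \<Rightarrow> (nat \<Rightarrow> 'k::field) set" where
  "funs_below n = {f. \<forall>k\<ge>n. f k = 0}"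

definition unit_fun :: "nat \<Rightarrow> nat \<Rightarrow> 'k::field" where
  "unit_fun s = (\<lambda>k. if k = s then 1 else 0)"

lemma sum_fun_apply: "(\<Sum>s\<in>A. F s) n = (\<Sum>s\<in>A. F s n)" for F :: "'b \<Rightarrow> nat \<Rightarrow> 'k::field"
  by (induction A rule: infinite_finite_induct) (auto simp: zero_fun_def plus_fun_def)

lemma subspace_funs_below: "fv.subspace (funs_below n)"
  by (auto simp: fv.subspace_def funs_below_def fscale_def)

lemma funs_below_expand: "f \<in> funs_below n \<Longrightarrow> f = (\<Sum>s<n. fscale (f s) (unit_fun s))"
  by (rule ext, subst sum_fun_apply) (auto simp: funs_below_def fscale_def unit_fun_def if_distrib cong: if_cong)

lemma unit_fun_below: "s < n \<Longrightarrow> unit_fun s \<in> funs_below n"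
  by (auto simp: funs_below_def unit_fun_def)

lemma inj_unit_fun: "inj (unit_fun :: nat \<Rightarrow> nat \<Rightarrow> 'k::field)"
  by (rule injI) (metis unit_fun_def zero_neq_one)

lemma span_unit_fun: "fv.span (unit_fun ` {..<n}) = (funs_below n :: (nat \<Rightarrow> 'a::field) set)"
proof
  show "fv.span (unit_fun ` {..<n}) \<subseteq> funs_below n"
    by (rule fv.span_minimal) (auto simp: unit_fun_below subspace_funs_below)
  show "(funs_below n :: (nat \<Rightarrow> 'a) set) \<subseteq> fv.span (unit_fun ` {..<n})"
  proof
    fix f :: "nat \<Rightarrow> 'a" assume "f \<in> funs_below n"
    then have "f = (\<Sum>s<n. fscale (f s) (unit_fun s))" by (rule funs_below_expand)
    also have "\<dots> \<in> fv.span (unit_fun ` {..<n})"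
      by (intro fv.span_sum fv.span_scale fv.span_base) auto
    finally show "f \<in> fv.span (unit_fun ` {..<n})" .
  qed
qed

lemma independent_unit_fun: "fv.independent (unit_fun ` {..<n} :: (nat \<Rightarrow> 'k::field) set)"
proof (rule fv.independent_if_scalars_zero)
  fix f :: "(nat \<Rightarrow> 'k) \<Rightarrow> 'k" and x :: "nat \<Rightarrow> 'k"
  assume "(\<Sum>x\<in>unit_fun ` {..<n}. fscale (f x) x) = 0" and "x \<in> unit_fun ` {..<n}"
  then obtain s where s: "s < n" "x = unit_fun s" "(\<Sum>t<n. fscale (f (unit_fun t)) (unit_fun t)) = 0"
    by (auto simp: sum.reindex inj_on_subset[OF inj_unit_fun])
  then have "(\<Sum>t<n. fscale (f (unit_fun t)) (unit_fun t)) s = 0" by simp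
  then show "f x = 0"
    using s by (auto simp: sum_fun_apply fscale_def unit_fun_def if_distrib cong: if_cong)
qed auto

lemma card_unit_fun: "card (unit_fun ` {..<n} :: (nat \<Rightarrow> 'k::field) set) = n"
  by (simp add: card_image inj_on_subset[OF inj_unit_fun])

lemma independent_below_card:
  assumes "fv.independent B" "B \<subseteq> funs_below n"
  shows "finite B" "card B \<le> n"
  using fv.independent_span_bound[of "unit_fun ` {..<n}" B] assms
  by (auto simp: span_unit_fun card_unit_fun)

lemma linear_kernel_below:
  assumes T: "Vector_Spaces.linear fscale fscale T" and "T ` funs_below N \<subseteq> funs_below M" "M < N"
  shows "\<exists>f\<in>funs_below N. f \<noteq> 0 \<and> T f = 0"
proof (rule ccontr)
  assume "\<not> ?thesis"
  then have "inj_on T (fv.span (unit_fun ` {..<N}))"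
    by (subst fvp.linear_inj_on_iff_eq_0[OF T fv.subspace_span]) (auto simp: span_unit_fun)
  then have "fv.independent (T ` unit_fun ` {..<N})" and "inj_on T (unit_fun ` {..<N})"
    by (rule fvp.linear_independent_injective_image[OF T independent_unit_fun], rule inj_on_subset[OF _ fv.span_superset])
  then have "N \<le> M"
    using independent_below_card(2)[of "T ` unit_fun ` {..<N}" M] assms(2) unit_fun_below
    by (auto simp: card_image card_unit_fun image_subset_iff)
  with assms(3) show False by simp
qed

section \<open>Leading positions of the vectors of a subspace\<close>

definition lead :: "(nat \<Rightarrow> 'k::field) \<Rightarrow> nat" where
  "lead f = (GREATEST n. f n \<noteq> 0)"

lemma lead:
  assumes "f \<in> funs_below n" "f \<noteq> 0"
  shows "f (lead f) \<noteq> 0" "k > lead f \<Longrightarrow> f k = 0" "lead f < n"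
proof -
  obtain m where m: "f m \<noteq> 0" using assms(2) by (auto simp: fun_eq_iff)
  have b: "y \<le> n" if "f y \<noteq> 0" for y using assms(1) that by (cases "y \<le> n") (auto simp: funs_below_def)
  show 1: "f (lead f) \<noteq> 0" unfolding lead_def by (rule GreatestI_nat[where P = "\<lambda>n. f n \<noteq> 0", OF m]) (rule b)
  show "k > lead f \<Longrightarrow> f k = 0" unfolding lead_def
    using Greatest_le_nat[of "\<lambda>n. f n \<noteq> 0" k n] b by force
  show "lead f < n" using 1 assms(1) not_le by (auto simp: funs_below_def)
qed

lemma leadI: "f n \<noteq> 0 \<Longrightarrow> (\<And>k. k > n \<Longrightarrow> f k = 0) \<Longrightarrow> lead f = n"
  unfolding lead_def by (rule Greatest_equality) (auto simp: not_le[symmetric])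

text \<open>Vectors with distinct leading positions are independent: at the largest position that
  occurs in a linear combination only one of them is nonzero.\<close>

lemma card_leads_le:
  assumes "finite G" "G \<subseteq> funs_below n"
  shows "card (lead ` (fv.span G - {0})) \<le> card G"
proof -
  have E: "fv.span G \<subseteq> funs_below n" by (rule fv.span_minimal) (use assms subspace_funs_below in auto)
  let ?L = "lead ` (fv.span G - {0})"
  define c where "c l = (SOME f. f \<in> fv.span G - {0} \<and> lead f = l)" for l
  have c: "c l \<in> fv.span G - {0}" "lead (c l) = l" if "l \<in> ?L" for l
    using someI_ex[of "\<lambda>f. f \<in> fv.span G - {0} \<and> lead f = l"] that unfolding c_def by blast+
  have ci: "inj_on c ?L" by (rule inj_on_inverseI[of _ lead]) (rule c(2))
  have fin: "finite ?L" using E lead(3) by (intro finite_subset[of ?L "{..<n}"]) auto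
  have "fv.independent (c ` ?L)"
  proof (rule fv.independent_if_scalars_zero)
    fix g x assume 0: "(\<Sum>x\<in>c ` ?L. fscale (g x) x) = 0" and x: "x \<in> c ` ?L"
    show "g x = 0"
    proof (rule ccontr)
      assume "g x \<noteq> 0"
      let ?S = "{l \<in> ?L. g (c l) \<noteq> 0}"
      have S: "finite ?S" "?S \<noteq> {}" using finite_subset[OF _ fin, of ?S] x \<open>g x \<noteq> 0\<close> by blast+
      define m where "m = Max ?S"
      have m: "m \<in> ?S" unfolding m_def by (rule Max_in[OF S])
      have z: "fscale (g (c l)) (c l) m = 0" if "l \<in> ?L - {m}" for l
      proof (cases "g (c l) = 0")
        case False
        then have "l \<le> m" unfolding m_def using that S(1) by (intro Max_ge) auto
        then have "l < m" using that by auto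
        moreover have "c l \<in> funs_below n" "c l \<noteq> 0" "lead (c l) = l" using c[of l] that E by blast+
          ultimately show ?thesis using lead(2)[of "c l" n m] by (simp add: fscale_def)
      qed (simp add: fscale_def)
      have "0 = (\<Sum>l\<in>?L. fscale (g (c l)) (c l)) m" using 0 ci by (simp add: sum.reindex)
      also have "\<dots> = (\<Sum>l\<in>?L. fscale (g (c l)) (c l) m)" by (rule sum_fun_apply)
      also have "\<dots> = fscale (g (c m)) (c m) m" using z m fin by (subst sum.remove[of _ m]) auto
      finally have "g (c m) * c m m = 0" by (simp add: fscale_def)
      moreover have "c m \<in> funs_below n" "c m \<noteq> 0" "lead (c m) = m" "g (c m) \<noteq> 0" using c[of m] m E by blast+
      ultimately show False using lead(1)[of "c m" n] by simp
    qed
  qed (use fin in auto)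
  then have "card (c ` ?L) \<le> card G"
    using fv.independent_span_bound[of G "c ` ?L"] assms(1) c by blast
  then show ?thesis using ci by (simp add: card_image)
qed

text \<open>Restriction to the set of leading positions is injective on the span, since a nonzero
  vector survives at its own leading position.\<close>

lemma card_leads_ge:
  assumes "fv.independent B" "B \<subseteq> funs_below n"
  shows "card B \<le> card (lead ` (fv.span B - {0}))"
proof (rule ccontr)
  assume less: "\<not> ?thesis"
  let ?L = "lead ` (fv.span B - {0})"
  have E: "fv.span B \<subseteq> funs_below n" by (rule fv.span_minimal) (use assms subspace_funs_below in auto)
  have fin: "finite ?L" using E lead(3) by (intro finite_subset[of ?L "{..<n}"]) auto
  define T where "T f = (\<lambda>k. if k \<in> ?L then f k else 0)" for f :: "nat \<Rightarrow> 'a"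
  have T: "Vector_Spaces.linear fscale fscale T"
    by unfold_locales (auto simp: T_def fscale_def fun_eq_iff)
  have "T f \<noteq> 0" if "f \<in> fv.span B" "f \<noteq> 0" for f
  proof
    assume "T f = 0"
    then have "T f (lead f) = 0" by simp
    then show False using that lead(1)[of f n] E by (auto simp: T_def)
  qed
  then have "inj_on T (fv.span B)"
    by (subst fvp.linear_inj_on_iff_eq_0[OF T fv.subspace_span]) auto
  then have i: "fv.independent (T ` B)" "inj_on T B"
    by (auto intro!: fvp.linear_independent_injective_image[OF T assms(1)] inj_on_subset[OF _ fv.span_superset])
  have "T f \<in> fv.span (unit_fun ` ?L)" for f
  proof -
    have "T f = (\<Sum>s\<in>?L. fscale (f s) (unit_fun s))"
      by (rule ext, subst sum_fun_apply)
        (auto simp: T_def fscale_def unit_fun_def if_distrib fin sum.delta' cong: if_cong)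
    also have "\<dots> \<in> fv.span (unit_fun ` ?L)"
      by (intro fv.span_sum fv.span_scale fv.span_base) auto
    finally show ?thesis .
  qed
  then have "card (T ` B) \<le> card (unit_fun ` ?L :: (nat \<Rightarrow> 'a) set)"
    using fv.independent_span_bound[of "unit_fun ` ?L" "T ` B"] fin i by auto
  then show False using i less card_image_le[OF fin, of "unit_fun :: nat \<Rightarrow> nat \<Rightarrow> 'a"] by (simp add: card_image)
qed


lemma basis_extension_below:
  fixes B :: "(nat \<Rightarrow> 'k::field) set"
  assumes B: "fv.independent B" "B \<subseteq> funs_below n"
  obtains ps where "length ps = n" "distinct ps" "set ps \<subseteq> funs_below n" "funs_below n \<subseteq> fv.span (set ps)"
    "set (drop (n - card B) ps) = B"
proof -
  obtain C where C: "B \<subseteq> C" "C \<subseteq> funs_below n" "fv.independent C" "funs_below n \<subseteq> fv.span C"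
    using fv.maximal_independent_subset_extend[OF B(2,1)] .
  have fin: "finite C" "card C \<le> n" using independent_below_card[OF C(3,2)] .
  moreover have "n \<le> card C"
    using fv.independent_span_bound[OF fin(1) independent_unit_fun[of n]] C(4) unit_fun_below
    by (auto simp: card_unit_fun image_subset_iff subset_iff)
  ultimately have card: "card C = n" by simp
  obtain xs ys where xs: "set xs = C - B" "distinct xs" and ys: "set ys = B" "distinct ys"
    by (metis finite_distinct_list fin(1) finite_Diff finite_subset C(1))
  have l: "length ys = card B" "length xs = n - card B"
    using xs ys card fin C(1) by (auto simp: distinct_card[symmetric] card_Diff_subset finite_subset)
  moreover have "card B \<le> n" using card_mono[OF fin(1) C(1)] card by simp
  moreover have "set (xs @ ys) = C" using xs ys C(1) by auto
  moreover have "distinct (xs @ ys)" using xs ys by auto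
  moreover have "set (drop (n - card B) (xs @ ys)) = B" using l ys by simp
  ultimately show thesis using that[of "xs @ ys"] C(2,4) by (simp del: set_append)
qed

section \<open>Chains in a pair of linear maps\<close>

text \<open>By the chain, both images of \<open>B\<close> lie in the span of its image under
  \<open>x\<close> and the single vector \<open>y (u n)\<close>. If \<open>B\<close> has at most
  \<open>n\<close> elements one dimension is saved: either \<open>x\<close> has a kernel on the span
  of \<open>B\<close>, or a dependence among the \<open>u k\<close> propagates to \<open>u n\<close>
  and puts \<open>y (u n)\<close> into the span of the image under \<open>x\<close>.\<close>

lemma chain_span:
  fixes x y :: "(nat \<Rightarrow> 'k::field) \<Rightarrow> nat \<Rightarrow> 'k"
  assumes x: "Vector_Spaces.linear fscale fscale x" and y: "Vector_Spaces.linear fscale fscale y"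
    and chain: "\<And>k. k < n \<Longrightarrow> y (u k) = x (u (Suc k))"
  obtains B G where "B \<subseteq> u ` {..n}" "u ` {..n} \<subseteq> fv.span B" "fv.independent B"
    "finite G" "G \<subseteq> fv.span (x ` B \<union> y ` u ` {..n})" "x ` B \<union> y ` B \<subseteq> fv.span G" "card G \<le> Suc (card B)"
    "card B \<le> n \<Longrightarrow> card G \<le> card B"
proof -
  obtain B where B: "B \<subseteq> u ` {..n}" "fv.independent B" "u ` {..n} \<subseteq> fv.span B"
    using fv.maximal_independent_subset .
  have finB: "finite B" by (rule finite_subset[OF B(1)]) simp
  have uB: "u k \<in> fv.span B" if "k \<le> n" for k using B(3) that by auto
  have sp: "x v \<in> fv.span (x ` S)" "y v \<in> fv.span (y ` S)" if "v \<in> fv.span S" for v S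
    using fvp.linear_span_image[OF x, of S] fvp.linear_span_image[OF y, of S] that by auto
  have main: "x ` B \<union> y ` B \<subseteq> fv.span G" if G: "x ` B \<subseteq> fv.span G" "y (u n) \<in> fv.span G" for G
  proof -
    have xG: "x v \<in> fv.span G" if "v \<in> fv.span B" for v
      using sp(1)[OF that] fv.span_minimal[OF G(1) fv.subspace_span] by auto
    have "y (u k) \<in> fv.span G" if "k \<le> n" for k
      using that G(2) chain[of k] xG[OF uB[of "Suc k"]] by (cases "k = n") auto
    then have "y ` u ` {..n} \<subseteq> fv.span G" by auto
    then show ?thesis using G(1) image_mono[OF B(1), of y] by (meson Un_least order_trans)
  qed
  consider "inj_on x (fv.span B)" "card B \<le> n" | "\<not> inj_on x (fv.span B)" | "n < card B" by linarith
  then show thesis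
  proof cases
    case 1
    have "\<exists>k\<le>n. u k \<in> fv.span (u ` {..<k})"
    proof (rule ccontr)
      assume neg: "\<not> ?thesis"
      have "fv.independent (u ` {..<k}) \<and> card (u ` {..<k}) = k" if "k \<le> Suc n" for k
        using that
      proof (induction k)
        case (Suc k)
        then have "u k \<notin> fv.span (u ` {..<k})" using neg by auto
        moreover from this have "u k \<notin> u ` {..<k}" using fv.span_base[of "u k" "u ` {..<k}"] by argo
        ultimately show ?case using Suc by (auto simp: lessThan_Suc fv.independent_insertI)
      qed (simp add: fv.independent_empty)
      from this[of "Suc n"] have "Suc n \<le> card B"
        using fv.independent_span_bound[OF finB, of "u ` {..n}"] B(3) by (auto simp: lessThan_Suc_atMost)
      with 1 show False by simp
    qed
    then obtain k where k: "k \<le> n" "u k \<in> fv.span (u ` {..<k})" by blast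
    \<comment> \<open>The dependence moves one step along the chain: apply \<open>y\<close>, rewrite
      its values as values of \<open>x\<close>, and cancel the injective \<open>x\<close>.\<close>
    have "u (k + m) \<in> fv.span (u ` {..<k + m})" if "k + m \<le> n" for m
      using that
    proof (induction m)
      case (Suc m)
      let ?K = "k + m"
      have "y (u ?K) \<in> fv.span (y ` u ` {..<?K})" using Suc sp(2) by simp
      moreover have "y ` u ` {..<?K} \<subseteq> x ` u ` Suc ` {..<?K}" using chain Suc.prems by auto
      ultimately have "y (u ?K) \<in> fv.span (x ` u ` Suc ` {..<?K})" by (rule fv.span_mono[THEN subsetD, rotated])
      then obtain v where v: "v \<in> fv.span (u ` Suc ` {..<?K})" "y (u ?K) = x v"
        using fvp.linear_span_image[OF x, of "u ` Suc ` {..<?K}"] by auto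
      have sub: "u ` Suc ` {..<?K} \<subseteq> u ` {..<Suc ?K}" by auto
      have "fv.span (u ` Suc ` {..<?K}) \<subseteq> fv.span B"
        by (rule fv.span_minimal[OF _ fv.subspace_span]) (use uB Suc.prems in auto)
      then have "u (Suc ?K) = v"
        using inj_onD[OF 1(1), of "u (Suc ?K)" v] v uB[of "Suc ?K"] chain[of ?K] Suc.prems by auto
      then show ?case using v(1) fv.span_mono[OF sub] by auto
    qed (use k in simp)
    from this[of "n - k"] k have "u n \<in> fv.span (u ` {..<n})" by simp
    then have "y (u n) \<in> fv.span (y ` u ` {..<n})" by (rule sp(2))
    moreover have "fv.span (y ` u ` {..<n}) \<subseteq> fv.span (x ` B)"
      by (rule fv.span_minimal[OF _ fv.subspace_span]) (use chain sp(1) uB in auto)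
    ultimately have "x ` B \<union> y ` B \<subseteq> fv.span (x ` B)"
      by (intro main) (auto intro: fv.span_base)
    moreover have "x ` B \<subseteq> fv.span (x ` B \<union> y ` u ` {..n})" by (meson fv.span_superset le_supE)
    ultimately show thesis
      using that[OF B(1,3,2), of "x ` B"] finB card_image_le[OF finB, of x] by (simp add: le_SucI)
  next
    case 2
    obtain G where G: "G \<subseteq> x ` B" "fv.independent G" "x ` B \<subseteq> fv.span G"
      using fv.maximal_independent_subset .
    have "card G \<noteq> card B"
    proof
      assume eq: "card G = card B"
      have "card (x ` B) \<le> card B" "card G \<le> card (x ` B)" using G(1) finB by (auto intro: card_image_le card_mono)
      then have "G = x ` B" "inj_on x B" using eq finB G(1) by (auto simp: card_subset_eq eq_card_imp_inj_on)
      then have "inj_on x (fv.span B)"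
        using G(2) fvp.linear_inj_on_span_iff_independent_image[OF x, of B] by simp
      with 2 show False by simp
    qed
    moreover have "card G \<le> card B" using card_mono[OF _ G(1)] card_image_le[OF finB, of x] finB by simp
    ultimately have lt: "card G < card B" by simp
    have fin: "finite G" by (rule finite_subset[OF G(1)]) (simp add: finB)
    have "x ` B \<union> y ` B \<subseteq> fv.span (insert (y (u n)) G)"
      by (rule main) (use G(3) fv.span_mono[of G "insert (y (u n)) G"] in \<open>auto intro: fv.span_base\<close>)
    moreover have "insert (y (u n)) G \<subseteq> fv.span (x ` B \<union> y ` u ` {..n})"
      using G(1) by (auto intro: fv.span_base)
    moreover have "card (insert (y (u n)) G) \<le> card B" using lt fin by (simp add: card_insert_if)
    ultimately show thesis using that[OF B(1,3,2), of "insert (y (u n)) G"] fin by simp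
  next
    case 3
    have "x ` B \<union> y ` B \<subseteq> fv.span (insert (y (u n)) (x ` B))"
      by (rule main) (auto intro: fv.span_base)
    moreover have "insert (y (u n)) (x ` B) \<subseteq> fv.span (x ` B \<union> y ` u ` {..n})"
      by (auto intro: fv.span_base)
    moreover have "card (insert (y (u n)) (x ` B)) \<le> Suc (card B)"
      using finB card_image_le[OF finB, of x] by (simp add: card_insert_if)
    ultimately show thesis using that[OF B(1,3,2), of "insert (y (u n)) (x ` B)"] finB 3 by simp
  qed
qed

text \<open>The vectors \<open>u 0\<close> to \<open>u n\<close> have \<open>Suc n * a\<close>
  coordinates and satisfy \<open>n * b\<close> linear equations. They are encoded as one function,
  cut into slices of length \<open>a\<close>.\<close>

lemma chain_exists:
  fixes x y :: "(nat \<Rightarrow> 'k::field) \<Rightarrow> nat \<Rightarrow> 'k"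
  assumes x: "Vector_Spaces.linear fscale fscale x" and y: "Vector_Spaces.linear fscale fscale y"
    and im: "\<And>f. x f \<in> funs_below b" "\<And>f. y f \<in> funs_below b"
    and less: "n * b < Suc n * a"
  obtains u where "\<And>k. u k \<in> funs_below a" "\<exists>k\<le>n. u k \<noteq> 0" "\<And>k. k < n \<Longrightarrow> y (u k) = x (u (Suc k))"
proof -
  define sl where "sl f k = (\<lambda>s. if s < a then f (k * a + s) else 0)" for f :: "nat \<Rightarrow> 'k" and k
  define T where "T f = (\<lambda>m. if m < n * b then y (sl f (m div b)) (m mod b) - x (sl f (Suc (m div b))) (m mod b) else 0)"
    for f :: "nat \<Rightarrow> 'k"
  interpret x: Vector_Spaces.linear fscale fscale x by fact
  interpret y: Vector_Spaces.linear fscale fscale y by fact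
  have sl: "sl (f + g) k = sl f k + sl g k" "sl (fscale c f) k = fscale c (sl f k)" for f g c k
    by (auto simp: sl_def fscale_def fun_eq_iff)
  have "Vector_Spaces.linear fscale fscale T"
    by unfold_locales (auto simp: T_def sl x.add x.scale y.add y.scale fun_eq_iff, auto simp: fscale_def algebra_simps)
  moreover have "T ` funs_below (Suc n * a) \<subseteq> funs_below (n * b)" by (auto simp: funs_below_def T_def)
  ultimately obtain f where f: "f \<in> funs_below (Suc n * a)" "f \<noteq> 0" "T f = 0"
    using linear_kernel_below less by blast
  show thesis
  proof (rule that[of "sl f"])
    show "sl f k \<in> funs_below a" for k by (simp add: sl_def funs_below_def)
    obtain m where m: "f m \<noteq> 0" using f(2) by (auto simp: fun_eq_iff)
    then have "m < Suc n * a" using f(1) not_le by (auto simp: funs_below_def)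
    then have "m div a < Suc n" "m mod a < a" using less_mult_imp_div_less by (auto intro!: mod_less_divisor gr0I)
    moreover have "sl f (m div a) (m mod a) \<noteq> 0" using m \<open>m mod a < a\<close> by (simp add: sl_def)
    ultimately show "\<exists>k\<le>n. sl f k \<noteq> 0" by (intro exI[of _ "m div a"]) auto
    show "y (sl f k) = x (sl f (Suc k))" if "k < n" for k
    proof
      fix r
      show "y (sl f k) r = x (sl f (Suc k)) r"
      proof (cases "r < b")
        case True
        have "k * b + r < n * b" using that True mult_le_mono1[of "Suc k" n b] by simp
        moreover have "T f (k * b + r) = 0" using f(3) by simp
        ultimately show ?thesis using True by (simp add: T_def)
      next
        case False
        then show ?thesis using im(1)[of "sl f (Suc k)"] im(2)[of "sl f k"] by (auto simp: funs_below_def)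
      qed
    qed
  qed
qed

section \<open>Varieties of words\<close>

definition inverse_pair :: "nat \<Rightarrow> 'k::field mat \<Rightarrow> 'k mat \<Rightarrow> bool" where
  "inverse_pair n P P' \<longleftrightarrow> P \<in> carrier_mat n n \<and> P' \<in> carrier_mat n n \<and> P * P' = 1\<^sub>m n \<and> P' * P = 1\<^sub>m n"

lemma inverse_pairD:
  assumes "inverse_pair n P P'"
  shows "P \<in> carrier_mat n n" "P' \<in> carrier_mat n n" "P * P' = 1\<^sub>m n" "P' * P = 1\<^sub>m n"
  using assms by (auto simp: inverse_pair_def)

lemma inverse_pair_one: "inverse_pair n (1\<^sub>m n) (1\<^sub>m n)"
  by (simp add: inverse_pair_def)

lemma inverse_pair_cancel:
  assumes "inverse_pair n P P'"
  shows "M \<in> carrier_mat n m \<Longrightarrow> P * (P' * M) = M" "M \<in> carrier_mat n m \<Longrightarrow> P' * (P * M) = M"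
  using inverse_pairD[OF assms] by (simp_all flip: assoc_mult_mat[of _ n n _ n])

lemma inverse_pair_mult:
  assumes "inverse_pair n P P'" "inverse_pair n R R'"
  shows "inverse_pair n (P * R) (R' * P')"
  using inverse_pairD[OF assms(1)] inverse_pairD[OF assms(2)]
    inverse_pair_cancel[OF assms(1)] inverse_pair_cancel[OF assms(2)]
  unfolding inverse_pair_def
  by (simp add: assoc_mult_mat[of _ n n _ n _ n])

lemma inverse_pair_block:
  assumes "inverse_pair n P P'" "inverse_pair m R R'"
  shows "inverse_pair (n + m) (four_block_mat P (0\<^sub>m n m) (0\<^sub>m m n) R) (four_block_mat P' (0\<^sub>m n m) (0\<^sub>m m n) R')"
  using inverse_pairD[OF assms(1)] inverse_pairD[OF assms(2)]
  unfolding inverse_pair_def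
  by (simp add: mult_four_block_mat[where ?nr1.0 = n and ?n1.0 = n and ?n2.0 = m and ?nr2.0 = m and ?nc1.0 = n and ?nc2.0 = m])

lemma mult_mat_zero_vec: "A \<in> carrier_mat n m \<Longrightarrow> A *\<^sub>v 0\<^sub>v m = (0\<^sub>v n :: 'k::field vec)"
  by (intro eq_vecI) auto

lemma mult_zero_mat_vec: "v \<in> carrier_vec m \<Longrightarrow> 0\<^sub>m n m *\<^sub>v v = (0\<^sub>v n :: 'k::field vec)"
  by (intro eq_vecI) auto

lemma minus_zero_mat: "A \<in> carrier_mat n m \<Longrightarrow> A - 0\<^sub>m n m = (A :: 'k::field mat)"
  by (intro eq_matI) auto

lemma mat_eq_mult_vecI:
  fixes A B :: "'k::field mat"
  assumes "A \<in> carrier_mat n m" "B \<in> carrier_mat n m" "\<And>v. v \<in> carrier_vec m \<Longrightarrow> A *\<^sub>v v = B *\<^sub>v v"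
  shows "A = B"
proof (rule eq_matI)
  fix i j assume ij: "i < dim_row B" "j < dim_col B"
  have "(A *\<^sub>v unit_vec m j) $ i = (B *\<^sub>v unit_vec m j) $ i" using assms(3) by simp
  then show "A $$ (i, j) = B $$ (i, j)" using ij assms(1,2) by simp
qed (use assms in auto)

lemma mat_of_image:
  fixes G :: "'k::field mat"
  assumes G: "G \<in> carrier_mat p n" and M: "M \<in> carrier_mat p m"
    and im: "\<And>j. j < m \<Longrightarrow> col M j \<in> (*\<^sub>v) G ` carrier_vec n"
  obtains S where "S \<in> carrier_mat n m" "G * S = M"
proof -
  have "\<exists>v\<in>carrier_vec n. G *\<^sub>v v = col M j" if "j < m" for j using im[OF that] by force
  then obtain v where v: "\<And>j. j < m \<Longrightarrow> v j \<in> carrier_vec n \<and> G *\<^sub>v v j = col M j" by metis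
  let ?S = "mat_of_cols n (map v [0..<m])"
  have S: "?S \<in> carrier_mat n m" by auto
  moreover have "G * ?S = M"
  proof (rule eq_matI)
    fix i j assume ij: "i < dim_row M" "j < dim_col M"
    then have "col ?S j = v j" using v M by (subst col_mat_of_cols) auto
    then have "(G * ?S) $$ (i, j) = (G *\<^sub>v v j) $ i" using ij S G M by simp
    also have "\<dots> = M $$ (i, j)" using v[of j] ij M by simp
    finally show "(G * ?S) $$ (i, j) = M $$ (i, j)" .
  qed (use G M in auto)
  ultimately show thesis by (rule that)
qed

text \<open>A section \<open>S\<close> of the surjection and a retraction \<open>T\<close> turn
  exactness into matrix identities. \<open>T\<close> arises by factoring the projector
  \<open>1 - S G\<close> through \<open>F\<close>.\<close>

lemma short_exact_mat_splits:
  fixes F G :: "'k::field mat"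
  assumes F: "F \<in> carrier_mat n q" and G: "G \<in> carrier_mat p n"
  shows "short_exact_mat F G \<longleftrightarrow> (\<exists>S\<in>carrier_mat n p. \<exists>T\<in>carrier_mat q n.
    G * S = 1\<^sub>m p \<and> T * F = 1\<^sub>m q \<and> G * F = 0\<^sub>m p q \<and> T * S = 0\<^sub>m q p \<and> S * G + F * T = 1\<^sub>m n)"
    (is "_ \<longleftrightarrow> ?R")
proof
  assume se: "short_exact_mat F G"
  then have inj: "inj_on ((*\<^sub>v) F) (carrier_vec q)"
    and ker: "\<And>v. v \<in> carrier_vec n \<and> G *\<^sub>v v = 0\<^sub>v p \<longleftrightarrow> v \<in> (*\<^sub>v) F ` carrier_vec q"
    and sur: "(*\<^sub>v) G ` carrier_vec n = carrier_vec p"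
    using F G unfolding short_exact_mat_def mat_kernel_def by auto
  obtain S where S: "S \<in> carrier_mat n p" "G * S = 1\<^sub>m p"
    using mat_of_image[OF G one_carrier_mat[of p]] sur by auto
  define D where "D = 1\<^sub>m n - S * G"
  have D: "D \<in> carrier_mat n n" unfolding D_def by (rule minus_carrier_mat) (use S G in auto)
  have GD: "G * D = 0\<^sub>m p n"
    using S G by (simp add: D_def mult_minus_distrib_mat[of _ p n _ n] minus_r_inv_mat[of _ p n] flip: assoc_mult_mat[of _ p n _ p _ n])
  have "col D j \<in> (*\<^sub>v) F ` carrier_vec q" if "j < n" for j
  proof -
    have "G *\<^sub>v col D j = col (G * D) j" by (rule col_mult2[OF G D that, symmetric])
    then show ?thesis using that D by (simp add: GD flip: ker)
  qed
  then obtain T where T: "T \<in> carrier_mat q n" "F * T = D" using mat_of_image[OF F D] by auto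
  have GFv: "G *\<^sub>v (F *\<^sub>v v) = 0\<^sub>v p" if "v \<in> carrier_vec q" for v
    using ker[of "F *\<^sub>v v"] that by auto
  have GF: "G * F = 0\<^sub>m p q"
    by (rule mat_eq_mult_vecI[of _ p q]) (use F G GFv in \<open>auto simp: assoc_mult_mat_vec\<close>)
  have inj_mat: "M = N" if "F * M = F * N" "M \<in> carrier_mat q m" "N \<in> carrier_mat q m" for M N m
  proof (rule mat_eq_mult_vecI[OF that(2,3)])
    fix v :: "'k vec" assume v: "v \<in> carrier_vec m"
    then have "F *\<^sub>v (M *\<^sub>v v) = F *\<^sub>v (N *\<^sub>v v)"
      using that F by (simp flip: assoc_mult_mat_vec)
    then show "M *\<^sub>v v = N *\<^sub>v v" using inj that v by (auto dest!: inj_onD)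
  qed
  have "F * (T * F) = F * 1\<^sub>m q"
    using F T(1) S(1) G GF
    by (simp flip: assoc_mult_mat[of _ n q _ n] add: T(2) D_def minus_zero_mat minus_mult_distrib_mat[of _ n n] assoc_mult_mat[of _ n p _ n])
  then have TF: "T * F = 1\<^sub>m q" by (rule inj_mat) (use T F in auto)
  have "F * (T * S) = F * 0\<^sub>m q p"
    using F T(1) S G
    by (simp flip: assoc_mult_mat[of _ n q _ n] add: T(2) D_def minus_zero_mat minus_mult_distrib_mat[of _ n n] assoc_mult_mat[of _ n p _ n])
  then have TS: "T * S = 0\<^sub>m q p" by (rule inj_mat) (use T S in auto)
  have "S * G + F * T = 1\<^sub>m n"
    using S G unfolding T(2) D_def by (intro eq_matI) auto
  with S T(1) TF GF TS show ?R by blast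
next
  assume ?R
  then obtain S T where S: "S \<in> carrier_mat n p" and T: "T \<in> carrier_mat q n"
    and e: "G * S = 1\<^sub>m p" "T * F = 1\<^sub>m q" "G * F = 0\<^sub>m p q" "S * G + F * T = 1\<^sub>m n" by blast
  have TF: "T *\<^sub>v (F *\<^sub>v v) = v" if "v \<in> carrier_vec q" for v
    using that T F e(2) by (simp flip: assoc_mult_mat_vec)
  have GS: "G *\<^sub>v (S *\<^sub>v v) = v" if "v \<in> carrier_vec p" for v
    using that G S e(1) by (simp flip: assoc_mult_mat_vec)
  have GF: "G *\<^sub>v (F *\<^sub>v v) = 0\<^sub>v p" if "v \<in> carrier_vec q" for v
    using that G F e(3) by (simp flip: assoc_mult_mat_vec add: mult_zero_mat_vec)
  have FT: "v = F *\<^sub>v (T *\<^sub>v v)" if "v \<in> carrier_vec n" "G *\<^sub>v v = 0\<^sub>v p" for v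
  proof -
    have "v = (S * G + F * T) *\<^sub>v v" using that e(4) by simp
    also have "\<dots> = S *\<^sub>v (G *\<^sub>v v) + F *\<^sub>v (T *\<^sub>v v)"
      using that S T F G by (simp add: add_mult_distrib_mat_vec[of _ n n] assoc_mult_mat_vec)
    finally show ?thesis using that S T F by (simp add: mult_mat_zero_vec[of S n p])
  qed
  have "inj_on ((*\<^sub>v) F) (carrier_vec q)" using TF by (rule inj_on_inverseI)
  moreover have "(*\<^sub>v) F ` carrier_vec q = {v \<in> carrier_vec n. G *\<^sub>v v = 0\<^sub>v p}"
    using GF FT F T by (auto intro!: image_eqI)
  moreover have "(*\<^sub>v) G ` carrier_vec n = carrier_vec p"
    using GS[symmetric] G S by (auto intro!: image_eqI simp del: assoc_mult_mat_vec)
  ultimately show "short_exact_mat F G" using F G by (auto simp: short_exact_mat_def mat_kernel_def)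
qed

text \<open>
  Columns and rows follow the letters of \<open>w\<close> from left to right, so that the last ones span the
  subrepresentations: the image of column \<open>s\<close> lies in the span of the last \<open>profile w ! s\<close> rows.
\<close>

definition pattern :: "vertex list \<Rightarrow> 'k::field krep set" where
  "pattern w = {Z \<in> Rep (count_list w vi, count_list w vj).
     \<forall>s < count_list w vi. \<forall>r < count_list w vj - profile w ! s. fst Z $$ (r, s) = 0 \<and> snd Z $$ (r, s) = 0}"

definition variety :: "vertex list \<Rightarrow> 'k::field krep set" where
  "variety w = {(Q * fst Z * P, Q * snd Z * P) | P P' Q Q' Z.
     inverse_pair (count_list w vi) P P' \<and> inverse_pair (count_list w vj) Q Q' \<and> Z \<in> pattern w}"

text \<open>The subrepresentation \<open>B\<close> occupies the last coordinates, hence the lower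
  triangular form; \<open>Y\<close> describes the extension.\<close>

definition block_rep :: "'k::field krep \<Rightarrow> 'k krep \<Rightarrow> 'k krep \<Rightarrow> 'k krep" where
  "block_rep A Y B = (four_block_mat (fst A) (0\<^sub>m (dim_row (fst A)) (dim_col (fst B))) (fst Y) (fst B),
     four_block_mat (snd A) (0\<^sub>m (dim_row (snd A)) (dim_col (snd B))) (snd Y) (snd B))"

lemma mem_Rep: "X \<in> Rep (a, b) \<longleftrightarrow> fst X \<in> carrier_mat b a \<and> snd X \<in> carrier_mat b a"
  by (cases X) (auto simp: Rep_def)

lemma dimension_vector_Rep: "X \<in> Rep (a, b) \<Longrightarrow> dimension_vector X = (a, b)"
  by (auto simp: mem_Rep dimension_vector_def)

lemma pattern_Rep: "Z \<in> pattern w \<Longrightarrow> Z \<in> Rep (count_list w vi, count_list w vj)"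
  by (simp add: pattern_def)

lemma variety_Rep: "X \<in> variety w \<Longrightarrow> X \<in> Rep (count_list w vi, count_list w vj)"
proof -
  assume "X \<in> variety w"
  then obtain P P' Q Q' Z where X: "X = (Q * fst Z * P, Q * snd Z * P)"
    and "inverse_pair (count_list w vi) P P'" "inverse_pair (count_list w vj) Q Q'" "Z \<in> pattern w"
    unfolding variety_def by blast
  then have "P \<in> carrier_mat (count_list w vi) (count_list w vi)" "Q \<in> carrier_mat (count_list w vj) (count_list w vj)"
    "fst Z \<in> carrier_mat (count_list w vj) (count_list w vi)" "snd Z \<in> carrier_mat (count_list w vj) (count_list w vi)"
    using pattern_Rep[OF \<open>Z \<in> pattern w\<close>] by (auto simp: mem_Rep inverse_pair_def)
  then show ?thesis unfolding X mem_Rep by (auto intro: mult_carrier_mat)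
qed

lemma profile_nth_append:
  "s < count_list u vi \<Longrightarrow> profile (u @ v) ! s = count_list v vj + profile u ! s"
  "profile (u @ v) ! (count_list u vi + s) = profile v ! s"
  by (simp_all add: profile_append nth_append length_profile)

lemma profile_nth_le: "s < count_list w vi \<Longrightarrow> profile w ! s \<le> count_list w vj"
  using profile_le[of "profile w ! s" w] by (simp add: length_profile)

lemma block_rep_pattern:
  assumes A: "A \<in> pattern u" and B: "B \<in> pattern v" and Y: "Y \<in> Rep (count_list u vi, count_list v vj)"
  shows "block_rep A Y B \<in> pattern (u @ v)"
proof -
  have "block_rep A Y B \<in> Rep (count_list u vi + count_list v vi, count_list u vj + count_list v vj)"
    using pattern_Rep[OF A] pattern_Rep[OF B] Y by (auto simp: mem_Rep block_rep_def)
  moreover have "fst (block_rep A Y B) $$ (r, s) = 0 \<and> snd (block_rep A Y B) $$ (r, s) = 0"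
    if s: "s < count_list u vi + count_list v vi" and r: "r < count_list u vj + count_list v vj - profile (u @ v) ! s" for r s
  proof (cases "s < count_list u vi")
    case True
    then have "r < count_list u vj - profile u ! s" using r profile_nth_append(1)[OF True, of v] by linarith
    moreover from this have "r < count_list u vj" by simp
    ultimately show ?thesis using A True s r pattern_Rep[OF A] pattern_Rep[OF B] Y
      by (auto simp: block_rep_def pattern_def mem_Rep)
  next
    case False
    then obtain t where t: "s = count_list u vi + t" using le_Suc_ex not_le by blast
    have t': "t < count_list v vi" using s t by simp
    show ?thesis
    proof (cases "r < count_list u vj")
      case True
      then show ?thesis using t t' pattern_Rep[OF A] pattern_Rep[OF B] Y
        by (auto simp: block_rep_def mem_Rep)
    next
      case False
      then obtain q where q: "r = count_list u vj + q" using le_Suc_ex not_le by blast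
      have "q < count_list v vj - profile v ! t" using r t q profile_nth_append(2)[of u v t] by simp
      then show ?thesis using t t' q B pattern_Rep[OF A] pattern_Rep[OF B] Y
        by (auto simp: block_rep_def pattern_def mem_Rep)
    qed
  qed
  ultimately show ?thesis by (simp add: pattern_def)
qed

lemma pattern_splits:
  assumes Z: "Z \<in> pattern (u @ v)"
  obtains A Y B where "A \<in> pattern u" "B \<in> pattern v" "Y \<in> Rep (count_list u vi, count_list v vj)" "Z = block_rep A Y B"
proof -
  let ?a = "count_list u vi" and ?b = "count_list u vj" and ?c = "count_list v vi" and ?d = "count_list v vj"
  define A where "A = (mat ?b ?a (\<lambda>(r, s). fst Z $$ (r, s)), mat ?b ?a (\<lambda>(r, s). snd Z $$ (r, s)))"
  define Y where "Y = (mat ?d ?a (\<lambda>(r, s). fst Z $$ (?b + r, s)), mat ?d ?a (\<lambda>(r, s). snd Z $$ (?b + r, s)))"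
  define B where "B = (mat ?d ?c (\<lambda>(r, s). fst Z $$ (?b + r, ?a + s)), mat ?d ?c (\<lambda>(r, s). snd Z $$ (?b + r, ?a + s)))"
  have R: "fst Z \<in> carrier_mat (?b + ?d) (?a + ?c)" "snd Z \<in> carrier_mat (?b + ?d) (?a + ?c)"
    using pattern_Rep[OF Z] by (auto simp: mem_Rep)
  have 0: "fst Z $$ (r, s) = 0 \<and> snd Z $$ (r, s) = 0"
    if "s < ?a + ?c" "r < ?b + ?d - profile (u @ v) ! s" for r s
    using Z that by (simp add: pattern_def)
  show thesis
  proof
    show "A \<in> pattern u"
      using 0 by (auto simp: A_def pattern_def mem_Rep profile_nth_append)
    have "profile (u @ v) ! (?a + s) = profile v ! s" for s by (rule profile_nth_append)
    then show "B \<in> pattern v"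
      using 0[of "?a + _" "?b + _"] by (auto simp: B_def pattern_def mem_Rep)
    show "Y \<in> Rep (?a, ?d)" by (simp add: Y_def mem_Rep)
    have z: "fst Z $$ (r, s) = 0" "snd Z $$ (r, s) = 0" if "\<not> s < ?a" "s < ?a + ?c" "r < ?b" for r s
    proof -
      have "profile v ! (s - ?a) \<le> ?d" using that by (intro profile_nth_le) auto
      then show "fst Z $$ (r, s) = 0" "snd Z $$ (r, s) = 0"
        using that 0[of s r] profile_nth_append(2)[of u v "s - ?a"] by auto
    qed
    have "fst Z = fst (block_rep A Y B)" "snd Z = snd (block_rep A Y B)"
      by (rule eq_matI; use R z in \<open>auto simp: block_rep_def A_def Y_def B_def\<close>)+
    then show "Z = block_rep A Y B" by (simp add: prod_eq_iff)
  qed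
qed

text \<open>A row or a column of two blocks is encoded as a \<open>four_block_mat\<close> whose
  other blocks are empty.\<close>

lemma block_column_mult:
  fixes S F G T X :: "'k::field mat"
  assumes "S \<in> carrier_mat n p" "F \<in> carrier_mat n q" "G \<in> carrier_mat p m" "T \<in> carrier_mat q m"
  shows "four_block_mat S F (0\<^sub>m 0 p) (0\<^sub>m 0 q) * four_block_mat G (0\<^sub>m p 0) T (0\<^sub>m q 0) = S * G + F * T"
proof -
  have "four_block_mat S F (0\<^sub>m 0 p) (0\<^sub>m 0 q) * four_block_mat G (0\<^sub>m p 0) T (0\<^sub>m q 0) =
    four_block_mat (S * G + F * T) (0\<^sub>m n 0) (0\<^sub>m 0 m) (0\<^sub>m 0 0)"
    using assms by (subst mult_four_block_mat[where ?nr1.0 = n and ?n1.0 = p and ?n2.0 = q and ?nr2.0 = 0 and ?nc1.0 = m and ?nc2.0 = 0])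
      (auto intro!: eq_matI arg_cong4[where f = four_block_mat])
  also have "\<dots> = S * G + F * T" using assms by (intro eq_matI) auto
  finally show ?thesis .
qed

lemma block_row_mult:
  fixes S F G T X :: "'k::field mat"
  assumes "S \<in> carrier_mat n p" "F \<in> carrier_mat n q" "G \<in> carrier_mat p' n" "T \<in> carrier_mat q' n"
  shows "four_block_mat G (0\<^sub>m p' 0) T (0\<^sub>m q' 0) * four_block_mat S F (0\<^sub>m 0 p) (0\<^sub>m 0 q) =
    four_block_mat (G * S) (G * F) (T * S) (T * F)"
  using assms by (subst mult_four_block_mat[where ?nr1.0 = p' and ?n1.0 = n and ?n2.0 = 0 and ?nr2.0 = q' and ?nc1.0 = p and ?nc2.0 = q])
      (auto intro!: eq_matI arg_cong4[where f = four_block_mat])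

lemma mult_assoc_dim: "dim_col A = dim_row B \<Longrightarrow> dim_col B = dim_row C \<Longrightarrow> A * B * C = A * (B * (C :: 'k::field mat))"
  by (rule assoc_mult_mat) auto

lemma inverse_pair_cancel_dim:
  assumes "inverse_pair n P P'"
  shows "dim_row M = n \<Longrightarrow> P * (P' * M) = M" "dim_row M = n \<Longrightarrow> P' * (P * M) = M"
  using inverse_pair_cancel[OF assms, of M "dim_col M"] by auto

lemma splitting_inverse_pair:
  assumes c: "F \<in> carrier_mat (p + q) q" "G \<in> carrier_mat p (p + q)" "S \<in> carrier_mat (p + q) p" "T \<in> carrier_mat q (p + q)"
    and "G * S = 1\<^sub>m p" "T * F = 1\<^sub>m q" "G * F = 0\<^sub>m p q" "T * S = 0\<^sub>m q p" "S * G + F * T = 1\<^sub>m (p + q)"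
  shows "inverse_pair (p + q) (four_block_mat G (0\<^sub>m p 0) T (0\<^sub>m q 0)) (four_block_mat S F (0\<^sub>m 0 p) (0\<^sub>m 0 q))"
  unfolding inverse_pair_def block_row_mult[OF c(3,1,2,4)] block_column_mult[OF c(3,1,2,4)]
  using assms by (simp add: four_block_one_mat) (auto intro!: carrier_matI)

text \<open>In bases adapted to the exact sequence at both vertices an arrow becomes block
  triangular. Its corner \<open>Tj * x * Si\<close> measures how far the splittings are from being
  compatible with the arrow.\<close>

lemma block_rep_key:
  fixes x :: "'k::field mat"
  assumes x: "x \<in> carrier_mat (b + d) (a + c)"
    and F: "Fi \<in> carrier_mat (a + c) c" "Fj \<in> carrier_mat (b + d) d" "x * Fi = Fj * B"
    and G: "Gi \<in> carrier_mat a (a + c)" "Gj \<in> carrier_mat b (b + d)" "A * Gi = Gj * x"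
    and S: "Si \<in> carrier_mat (a + c) a" "Gi * Si = 1\<^sub>m a" and T: "Tj \<in> carrier_mat d (b + d)" "Tj * Fj = 1\<^sub>m d" "Gj * Fj = 0\<^sub>m b d"
    and AB: "A \<in> carrier_mat b a" "B \<in> carrier_mat d c"
    and Q: "inverse_pair (b + d) Mj (four_block_mat Gj (0\<^sub>m b 0) Tj (0\<^sub>m d 0))"
    and P: "inverse_pair (a + c) Ni (four_block_mat Si Fi (0\<^sub>m 0 a) (0\<^sub>m 0 c))"
  shows "x = Mj * four_block_mat A (0\<^sub>m b c) (Tj * x * Si) B * Ni"
proof -
  let ?Nj = "four_block_mat Gj (0\<^sub>m b 0) Tj (0\<^sub>m d 0)" and ?Mi = "four_block_mat Si Fi (0\<^sub>m 0 a) (0\<^sub>m 0 c)"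
  note dims = carrier_matD[OF x] carrier_matD[OF F(1)] carrier_matD[OF F(2)] carrier_matD[OF G(1)] carrier_matD[OF G(2)]
    carrier_matD[OF S(1)] carrier_matD[OF T(1)] carrier_matD[OF AB(1)] carrier_matD[OF AB(2)]
    inverse_pairD(1)[OF Q, THEN carrier_matD(1)] inverse_pairD(1)[OF Q, THEN carrier_matD(2)]
    inverse_pairD(1)[OF P, THEN carrier_matD(1)] inverse_pairD(1)[OF P, THEN carrier_matD(2)]
  have "x = four_block_mat x (0\<^sub>m (b + d) 0) (0\<^sub>m 0 (a + c)) (0\<^sub>m 0 0)" using x by (intro eq_matI) auto
  then have "?Nj * x = ?Nj * four_block_mat x (0\<^sub>m (b + d) 0) (0\<^sub>m 0 (a + c)) (0\<^sub>m 0 0)" by simp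
  also have "\<dots> = four_block_mat (Gj * x) (0\<^sub>m b 0) (Tj * x) (0\<^sub>m d 0)"
    using G T x
    by (subst mult_four_block_mat[where ?nr1.0 = b and ?n1.0 = "b + d" and ?n2.0 = 0 and ?nr2.0 = d and ?nc1.0 = "a + c" and ?nc2.0 = 0])
      (auto intro!: eq_matI arg_cong4[where f = four_block_mat])
  finally have "?Nj * x * ?Mi = four_block_mat (Gj * x * Si) (Gj * x * Fi) (Tj * x * Si) (Tj * x * Fi)"
    using block_row_mult[OF S(1) F(1), of "Gj * x" b "Tj * x" d] mult_carrier_mat[OF G(2) x] mult_carrier_mat[OF T(1) x] by simp
  also have "Gj * x * Si = A" using S(2) dims by (simp flip: G(3) add: mult_assoc_dim right_mult_one_mat[OF AB(1)])
  also have "Gj * x * Fi = 0\<^sub>m b c"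
  proof -
    have "Gj * x * Fi = Gj * Fj * B" using dims by (simp add: mult_assoc_dim F(3))
    then show ?thesis using AB T(3) by simp
  qed
  also have "Tj * x * Fi = B"
  proof -
    have "Tj * x * Fi = Tj * Fj * B" using dims by (simp add: mult_assoc_dim F(3))
    then show ?thesis using AB T(2) by simp
  qed
  finally have e: "?Nj * x * ?Mi = four_block_mat A (0\<^sub>m b c) (Tj * x * Si) B" .
  have "Mj * (?Nj * x * ?Mi) * Ni = Mj * (?Nj * (x * (?Mi * Ni)))" using dims by (simp add: mult_assoc_dim)
  also have "\<dots> = x" using inverse_pairD(4)[OF P] x dims by (simp add: inverse_pair_cancel_dim[OF Q])
  finally show ?thesis unfolding e by simp
qed

text \<open>Base changes of the two diagonal blocks are absorbed into one base change of the whole,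
  at the price of rewriting the corner in the new bases.\<close>

lemma block_conjugate:
  fixes zA zB :: "'k::field mat"
  assumes z: "zA \<in> carrier_mat b a" "zB \<in> carrier_mat d c" "W \<in> carrier_mat d a"
    and QA: "inverse_pair b QA QA'" and QB: "inverse_pair d QB QB'" and PA: "inverse_pair a PA PA'" and PB: "inverse_pair c PB PB'"
  shows "four_block_mat (QA * zA * PA) (0\<^sub>m b c) W (QB * zB * PB) =
      four_block_mat QA (0\<^sub>m b d) (0\<^sub>m d b) QB * four_block_mat zA (0\<^sub>m b c) (QB' * W * PA') zB * four_block_mat PA (0\<^sub>m a c) (0\<^sub>m c a) PB"
proof -
  note m = inverse_pairD[OF QA] inverse_pairD[OF QB] inverse_pairD[OF PA] inverse_pairD[OF PB] z
  note c = inverse_pairD(1,2)[OF QA] inverse_pairD(1,2)[OF QB] inverse_pairD(1,2)[OF PA] inverse_pairD(1,2)[OF PB] z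
  note dims = c[THEN carrier_matD(1)] c[THEN carrier_matD(2)]
  have "QB * (QB' * W * PA') * PA = QB * (QB' * (W * (PA' * PA)))" using dims by (simp add: mult_assoc_dim)
  also have "\<dots> = W" using m dims by (simp add: inverse_pair_cancel_dim[OF QB])
  finally show ?thesis
    using m by (simp add: mult_four_block_mat[where ?nr1.0 = b and ?n1.0 = b and ?n2.0 = d and ?nr2.0 = d and ?nc1.0 = a and ?nc2.0 = c]
          mult_four_block_mat[where ?nr1.0 = b and ?n1.0 = a and ?n2.0 = c and ?nr2.0 = d and ?nc1.0 = a and ?nc2.0 = c])
qed

text \<open>The splittings of the exact sequence and the base changes of \<open>A\<close> and
  \<open>B\<close> combine to one base change that makes \<open>X\<close> block triangular with two
  patterns on the diagonal. The pattern of \<open>u @ v\<close> imposes nothing on the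
  corner.\<close>

lemma variety_append_le:
  assumes X: "X \<in> (variety u :: 'k::field krep set) \<otimes>\<^bsub>ext_monoid\<^esub> variety v"
  shows "X \<in> variety (u @ v)"
proof -
  let ?a = "count_list u vi" and ?b = "count_list u vj" and ?c = "count_list v vi" and ?d = "count_list v vj"
  obtain A B where A: "A \<in> variety u" and B: "B \<in> variety v"
    and XR: "X \<in> Rep (dimension_vector A + dimension_vector B)" and se: "short_exact B X A"
    using X by (auto simp: ext_monoid_def)
  have AR: "fst A \<in> carrier_mat ?b ?a" "snd A \<in> carrier_mat ?b ?a" and BR: "fst B \<in> carrier_mat ?d ?c" "snd B \<in> carrier_mat ?d ?c"
    using variety_Rep[OF A] variety_Rep[OF B] by (auto simp: mem_Rep)
  have XR: "fst X \<in> carrier_mat (?b + ?d) (?a + ?c)" "snd X \<in> carrier_mat (?b + ?d) (?a + ?c)"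
    using XR dimension_vector_Rep[OF variety_Rep[OF A]] dimension_vector_Rep[OF variety_Rep[OF B]] by (auto simp: mem_Rep)
  obtain Fi Fj Gi Gj where F: "Fi \<in> carrier_mat (?a + ?c) ?c" "Fj \<in> carrier_mat (?b + ?d) ?d"
      "fst X * Fi = Fj * fst B" "snd X * Fi = Fj * snd B"
    and G: "Gi \<in> carrier_mat ?a (?a + ?c)" "Gj \<in> carrier_mat ?b (?b + ?d)"
      "fst A * Gi = Gj * fst X" "snd A * Gi = Gj * snd X"
    and sei: "short_exact_mat Fi Gi" and sej: "short_exact_mat Fj Gj"
    using se XR AR BR by (auto simp: short_exact_def rep_hom_def dimension_vector_def)
  obtain Si Ti where i: "Si \<in> carrier_mat (?a + ?c) ?a" "Ti \<in> carrier_mat ?c (?a + ?c)" "Gi * Si = 1\<^sub>m ?a"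
    "Ti * Fi = 1\<^sub>m ?c" "Gi * Fi = 0\<^sub>m ?a ?c" "Ti * Si = 0\<^sub>m ?c ?a" "Si * Gi + Fi * Ti = 1\<^sub>m (?a + ?c)"
    using sei short_exact_mat_splits[OF F(1) G(1)] by blast
  obtain Sj Tj where j: "Sj \<in> carrier_mat (?b + ?d) ?b" "Tj \<in> carrier_mat ?d (?b + ?d)" "Gj * Sj = 1\<^sub>m ?b"
    "Tj * Fj = 1\<^sub>m ?d" "Gj * Fj = 0\<^sub>m ?b ?d" "Tj * Sj = 0\<^sub>m ?d ?b" "Sj * Gj + Fj * Tj = 1\<^sub>m (?b + ?d)"
    using sej short_exact_mat_splits[OF F(2) G(2)] by blast
  define Ni where "Ni = four_block_mat Gi (0\<^sub>m ?a 0) Ti (0\<^sub>m ?c 0)"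
  define Mj where "Mj = four_block_mat Sj Fj (0\<^sub>m 0 ?b) (0\<^sub>m 0 ?d)"
  let ?Mi = "four_block_mat Si Fi (0\<^sub>m 0 ?a) (0\<^sub>m 0 ?c)" and ?Nj = "four_block_mat Gj (0\<^sub>m ?b 0) Tj (0\<^sub>m ?d 0)"
  have pi: "inverse_pair (?a + ?c) Ni ?Mi"
    unfolding Ni_def by (rule splitting_inverse_pair[OF F(1) G(1) i])
  have pj: "inverse_pair (?b + ?d) Mj ?Nj"
    using splitting_inverse_pair[OF F(2) G(2) j] unfolding Mj_def inverse_pair_def by auto
  obtain PA PA' QA QA' ZA where ZA: "A = (QA * fst ZA * PA, QA * snd ZA * PA)" "inverse_pair ?a PA PA'"
      "inverse_pair ?b QA QA'" "ZA \<in> pattern u" using A unfolding variety_def by blast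
  obtain PB PB' QB QB' ZB where ZB: "B = (QB * fst ZB * PB, QB * snd ZB * PB)" "inverse_pair ?c PB PB'"
      "inverse_pair ?d QB QB'" "ZB \<in> pattern v" using B unfolding variety_def by blast
  note PA = inverse_pairD[OF ZA(2)] and QA = inverse_pairD[OF ZA(3)] and PB = inverse_pairD[OF ZB(2)] and QB = inverse_pairD[OF ZB(3)]
  have ZAR: "fst ZA \<in> carrier_mat ?b ?a" "snd ZA \<in> carrier_mat ?b ?a" and ZBR: "fst ZB \<in> carrier_mat ?d ?c" "snd ZB \<in> carrier_mat ?d ?c"
    using pattern_Rep[OF ZA(4)] pattern_Rep[OF ZB(4)] by (auto simp: mem_Rep)
  define Y where "Y = (QB' * (Tj * fst X * Si) * PA', QB' * (Tj * snd X * Si) * PA')"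
  have YR: "Y \<in> Rep (?a, ?d)" using QB PA i j XR by (auto simp: Y_def mem_Rep intro!: mult_carrier_mat)
  define P where "P = four_block_mat PA (0\<^sub>m ?a ?c) (0\<^sub>m ?c ?a) PB * Ni"
  define Q where "Q = Mj * four_block_mat QA (0\<^sub>m ?b ?d) (0\<^sub>m ?d ?b) QB"
  note mQ = inverse_pairD(1)[OF inverse_pair_block[OF ZA(3) ZB(3)]] inverse_pairD(1)[OF pj] QB(1,2)
    inverse_pairD(1)[OF inverse_pair_block[OF ZA(2) ZB(2)]] inverse_pairD(1)[OF pi] PA(1,2) j(2) i(1) XR ZAR ZBR
  note dims = mQ[THEN carrier_matD(1)] mQ[THEN carrier_matD(2)]
  have key: "x = Q * four_block_mat zA (0\<^sub>m ?b ?c) (QB' * (Tj * x * Si) * PA') zB * P"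
    if x: "x \<in> carrier_mat (?b + ?d) (?a + ?c)" "x * Fi = Fj * (QB * zB * PB)" "(QA * zA * PA) * Gi = Gj * x"
      and z: "zA \<in> carrier_mat ?b ?a" "zB \<in> carrier_mat ?d ?c" for x zA zB
  proof -
    have W: "Tj * x * Si \<in> carrier_mat ?d ?a" using j i x by auto
    have AB: "QA * zA * PA \<in> carrier_mat ?b ?a" "QB * zB * PB \<in> carrier_mat ?d ?c" using z QA PA QB PB by auto
    show ?thesis
      using block_rep_key[OF x(1) F(1,2) x(2) G(1,2) x(3) i(1,3) j(2,4,5) AB pj pi]
      unfolding P_def Q_def block_conjugate[OF z W ZA(3) ZB(3) ZA(2) ZB(2)]
      using dims z x(1) by (simp add: mult_assoc_dim)
  qed
  have "X = (Q * fst (block_rep ZA Y ZB) * P, Q * snd (block_rep ZA Y ZB) * P)"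
    using key[OF XR(1), of "fst ZB" "fst ZA"] key[OF XR(2), of "snd ZB" "snd ZA"] F G ZAR ZBR
    by (simp add: prod_eq_iff block_rep_def Y_def ZA(1) ZB(1))
  moreover have "inverse_pair (?a + ?c) P (?Mi * four_block_mat PA' (0\<^sub>m ?a ?c) (0\<^sub>m ?c ?a) PB')"
    unfolding P_def by (intro inverse_pair_mult inverse_pair_block ZA ZB pi)
  moreover have "inverse_pair (?b + ?d) Q (four_block_mat QA' (0\<^sub>m ?b ?d) (0\<^sub>m ?d ?b) QB' * ?Nj)"
    unfolding Q_def by (intro inverse_pair_mult inverse_pair_block ZA ZB pj)
  moreover have "block_rep ZA Y ZB \<in> pattern (u @ v)" by (rule block_rep_pattern[OF ZA(4) ZB(4) YR])
  ultimately show ?thesis unfolding variety_def count_list_append by blast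
qed

section \<open>The canonical exact sequence of a block triangular representation\<close>

definition inclusion_mat :: "nat \<Rightarrow> nat \<Rightarrow> 'k::field mat" where
  "inclusion_mat a c = four_block_mat (0\<^sub>m a 0) (0\<^sub>m a c) (0\<^sub>m c 0) (1\<^sub>m c)"

definition projection_mat :: "nat \<Rightarrow> nat \<Rightarrow> 'k::field mat" where
  "projection_mat a c = four_block_mat (1\<^sub>m a) (0\<^sub>m a c) (0\<^sub>m 0 a) (0\<^sub>m 0 c)"

lemma dims_inclusion_projection [simp]:
  "dim_row (inclusion_mat a c) = a + c" "dim_col (inclusion_mat a c) = c"
  "dim_row (projection_mat a c) = a" "dim_col (projection_mat a c) = a + c"
  by (simp_all add: inclusion_mat_def projection_mat_def)

lemma block_mult_inclusion:
  assumes "A \<in> carrier_mat b a" "Y \<in> carrier_mat d a" "B \<in> carrier_mat d c"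
  shows "four_block_mat A (0\<^sub>m b c) Y B * inclusion_mat a c = inclusion_mat b d * (B :: 'k::field mat)"
proof -
  have "inclusion_mat b d * B = inclusion_mat b d * four_block_mat (0\<^sub>m 0 0) (0\<^sub>m 0 c) (0\<^sub>m d 0) B"
    using assms by (intro arg_cong2[where f = "(*)"] refl eq_matI) auto
  then show ?thesis using assms unfolding inclusion_mat_def
    by (simp add: mult_four_block_mat[where ?nr1.0 = b and ?n1.0 = a and ?n2.0 = c and ?nr2.0 = d and ?nc1.0 = 0 and ?nc2.0 = c]
      mult_four_block_mat[where ?nr1.0 = b and ?n1.0 = 0 and ?n2.0 = d and ?nr2.0 = d and ?nc1.0 = 0 and ?nc2.0 = c])
qed

lemma projection_mult_block:
  assumes "A \<in> carrier_mat b a" "Y \<in> carrier_mat d a" "B \<in> carrier_mat d c"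
  shows "projection_mat b d * four_block_mat A (0\<^sub>m b c) Y B = (A :: 'k::field mat) * projection_mat a c"
proof -
  have "A * projection_mat a c = four_block_mat A (0\<^sub>m b 0) (0\<^sub>m 0 a) (0\<^sub>m 0 0) * projection_mat a c"
    using assms by (intro arg_cong2[where f = "(*)"] refl eq_matI) auto
  then show ?thesis using assms unfolding projection_mat_def
    by (simp add: mult_four_block_mat[where ?nr1.0 = b and ?n1.0 = b and ?n2.0 = d and ?nr2.0 = 0 and ?nc1.0 = a and ?nc2.0 = c]
      mult_four_block_mat[where ?nr1.0 = b and ?n1.0 = a and ?n2.0 = 0 and ?nr2.0 = 0 and ?nc1.0 = a and ?nc2.0 = c])
qed

lemma short_exact_conjugate:
  assumes P: "inverse_pair (a + c) P P'"
  shows "short_exact_mat (P' * inclusion_mat a c) (projection_mat a c * (P :: 'k::field mat))"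
proof -
  let ?S = "four_block_mat (1\<^sub>m a) (0\<^sub>m a 0) (0\<^sub>m c a) (0\<^sub>m c 0) :: 'k mat"
  let ?T = "four_block_mat (0\<^sub>m c a) (1\<^sub>m c) (0\<^sub>m 0 a) (0\<^sub>m 0 c) :: 'k mat"
  note c = inverse_pairD[OF P]
  note dims = c(1,2)[THEN carrier_matD(1)] c(1,2)[THEN carrier_matD(2)]
  note cc = inverse_pair_cancel_dim[OF P]
  have e: "projection_mat a c * ?S = 1\<^sub>m a" "?T * inclusion_mat a c = 1\<^sub>m c" "projection_mat a c * inclusion_mat a c = (0\<^sub>m a c :: 'k mat)"
    "?T * ?S = 0\<^sub>m c a" "?S * projection_mat a c + inclusion_mat a c * ?T = 1\<^sub>m (a + c)"
  proof -
    have I: "inclusion_mat a c = four_block_mat (0\<^sub>m a c) (0\<^sub>m a 0) (1\<^sub>m c) (0\<^sub>m c 0)"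
      unfolding inclusion_mat_def by (rule eq_matI) auto
    show "projection_mat a c * ?S = 1\<^sub>m a" "projection_mat a c * inclusion_mat a c = (0\<^sub>m a c :: 'k mat)"
      "?T * inclusion_mat a c = 1\<^sub>m c" "?T * ?S = 0\<^sub>m c a"
      unfolding I projection_mat_def by (subst block_column_mult, auto)+
    have "?S * projection_mat a c = four_block_mat (1\<^sub>m a) (0\<^sub>m a c) (0\<^sub>m c a) (0\<^sub>m c c)"
      "inclusion_mat a c * ?T = four_block_mat (0\<^sub>m a a) (0\<^sub>m a c) (0\<^sub>m c a) (1\<^sub>m c)"
      unfolding I projection_mat_def by (subst block_row_mult, auto)+
    then show "?S * projection_mat a c + inclusion_mat a c * ?T = 1\<^sub>m (a + c)"
      by (simp add: add_four_block_mat[of _ a a _ c _ c] four_block_one_mat)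
  qed
  show ?thesis
  proof (subst short_exact_mat_splits[of _ "a + c" c _ a])
    show "P' * inclusion_mat a c \<in> carrier_mat (a + c) c" "projection_mat a c * P \<in> carrier_mat a (a + c)"
      using dims by (auto intro!: carrier_matI)
    have "P' * (?S * projection_mat a c + inclusion_mat a c * ?T) * P = P' * (?S * projection_mat a c) * P + P' * (inclusion_mat a c * ?T) * P"
      using c by (subst mult_add_distrib_mat[of _ "a + c" "a + c" _ "a + c"], (auto intro!: carrier_matI)[3])
        (rule add_mult_distrib_mat[of _ "a + c" "a + c" _ _ "a + c"], auto intro!: carrier_matI)
    then have "P' * ?S * (projection_mat a c * P) + P' * inclusion_mat a c * (?T * P) = 1\<^sub>m (a + c)"
      using dims c unfolding e by (simp add: mult_assoc_dim)
    then show "\<exists>S\<in>carrier_mat (a + c) a. \<exists>T\<in>carrier_mat c (a + c).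
       projection_mat a c * P * S = 1\<^sub>m a \<and> T * (P' * inclusion_mat a c) = 1\<^sub>m c \<and>
       projection_mat a c * P * (P' * inclusion_mat a c) = 0\<^sub>m a c \<and> T * S = 0\<^sub>m c a \<and>
       S * (projection_mat a c * P) + P' * inclusion_mat a c * T = 1\<^sub>m (a + c)"
      using dims e by (intro bexI[of _ "P' * ?S"] bexI[of _ "?T * P"]) (auto simp: mult_assoc_dim cc intro!: carrier_matI)
  qed
qed

lemma pattern_variety: "Z \<in> pattern w \<Longrightarrow> Z \<in> variety w"
proof -
  assume Z: "Z \<in> pattern w"
  then have "Z = (1\<^sub>m (count_list w vj) * fst Z * 1\<^sub>m (count_list w vi), 1\<^sub>m (count_list w vj) * snd Z * 1\<^sub>m (count_list w vi))"
    using pattern_Rep[OF Z] by (auto simp: mem_Rep prod_eq_iff)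
  then show ?thesis unfolding variety_def using Z inverse_pair_one by blast
qed

lemma variety_append_ge:
  assumes X: "X \<in> variety (u @ v)"
  shows "X \<in> (variety u :: 'k::field krep set) \<otimes>\<^bsub>ext_monoid\<^esub> variety v"
proof -
  let ?a = "count_list u vi" and ?b = "count_list u vj" and ?c = "count_list v vi" and ?d = "count_list v vj"
  obtain P P' Q Q' Z where Z: "X = (Q * fst Z * P, Q * snd Z * P)" "inverse_pair (?a + ?c) P P'"
      "inverse_pair (?b + ?d) Q Q'" "Z \<in> pattern (u @ v)" using X unfolding variety_def count_list_append by blast
  obtain A Y B where AB: "A \<in> pattern u" "B \<in> pattern v" and Y: "Y \<in> Rep (?a, ?d)" and ZAB: "Z = block_rep A Y B"
    using pattern_splits[OF Z(4)] .
  have R: "fst A \<in> carrier_mat ?b ?a" "snd A \<in> carrier_mat ?b ?a" "fst B \<in> carrier_mat ?d ?c" "snd B \<in> carrier_mat ?d ?c"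
    "fst Y \<in> carrier_mat ?d ?a" "snd Y \<in> carrier_mat ?d ?a"
    using pattern_Rep[OF AB(1)] pattern_Rep[OF AB(2)] Y by (auto simp: mem_Rep)
  note PQ = inverse_pairD(1,2)[OF Z(2)] inverse_pairD(1,2)[OF Z(3)]
  note dims = PQ[THEN carrier_matD(1)] PQ[THEN carrier_matD(2)] R[THEN carrier_matD(1)] R[THEN carrier_matD(2)]
  have XR: "X \<in> Rep (?a + ?c, ?b + ?d)" using variety_Rep[OF X] by simp
  have Q'Q: "inverse_pair (?b + ?d) Q' Q" using Z(3) by (simp add: inverse_pair_def)
  have blocks: "fst Z = four_block_mat (fst A) (0\<^sub>m ?b ?c) (fst Y) (fst B)" "snd Z = four_block_mat (snd A) (0\<^sub>m ?b ?c) (snd Y) (snd B)"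
    using R by (simp_all add: ZAB block_rep_def)
  have key: "Q * z * P * (P' * inclusion_mat ?a ?c) = Q * inclusion_mat ?b ?d * zB \<and>
      zA * (projection_mat ?a ?c * P) = projection_mat ?b ?d * Q' * (Q * z * P)"
    if "zA \<in> carrier_mat ?b ?a" "zB \<in> carrier_mat ?d ?c" "zY \<in> carrier_mat ?d ?a" "z = four_block_mat zA (0\<^sub>m ?b ?c) zY zB" for z zA zY zB
  proof -
    have "dim_row z = ?b + ?d" "dim_col z = ?a + ?c" "dim_col zA = ?a" "dim_row zA = ?b" "dim_row zB = ?d" using that by auto
    then have "Q * z * P * (P' * inclusion_mat ?a ?c) = Q * (z * inclusion_mat ?a ?c)"
      "projection_mat ?b ?d * Q' * (Q * z * P) = projection_mat ?b ?d * z * P"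
      using dims by (simp_all add: mult_assoc_dim inverse_pair_cancel_dim[OF Z(2)] inverse_pair_cancel_dim[OF Z(3)])
    then show ?thesis
      using block_mult_inclusion[OF that(1,3,2)] projection_mult_block[OF that(1,3,2)] that dims
      by (simp add: mult_assoc_dim)
  qed
  have "(P' * inclusion_mat ?a ?c, Q * inclusion_mat ?b ?d) \<in> rep_hom B X"
    using key[OF R(1,3,5) blocks(1)] key[OF R(2,4,6) blocks(2)] dims XR Z(1)
    by (auto simp: rep_hom_def dimension_vector_def mem_Rep intro!: carrier_matI)
  moreover have "(projection_mat ?a ?c * P, projection_mat ?b ?d * Q') \<in> rep_hom X A"
    using key[OF R(1,3,5) blocks(1)] key[OF R(2,4,6) blocks(2)] dims XR Z(1)
    by (auto simp: rep_hom_def dimension_vector_def mem_Rep intro!: carrier_matI)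
  moreover have "short_exact_mat (P' * inclusion_mat ?a ?c) (projection_mat ?a ?c * P)"
    "short_exact_mat (Q * inclusion_mat ?b ?d) (projection_mat ?b ?d * Q')"
    using short_exact_conjugate[OF Z(2)] short_exact_conjugate[OF Q'Q] by auto
  ultimately have "short_exact B X A" unfolding short_exact_def by blast
  moreover have "dimension_vector A + dimension_vector B = (?a + ?c, ?b + ?d)"
    using dims by (simp add: dimension_vector_def)
  ultimately show ?thesis
    using XR pattern_variety[OF AB(1)] pattern_variety[OF AB(2)] unfolding ext_monoid_def by force
qed

text \<open>With this \<open>variety\<close> is multiplicative on words, and its range is the
  composition monoid.\<close>

theorem variety_append: "variety (u @ v) = (variety u :: 'k::field krep set) \<otimes>\<^bsub>ext_monoid\<^esub> variety v"
  using variety_append_le variety_append_ge by blast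

lemma variety_eq_Rep:
  assumes "\<And>s. s < count_list w vi \<Longrightarrow> profile w ! s = count_list w vj"
  shows "variety w = Rep (count_list w vi, count_list w vj)"
proof -
  have "Rep (count_list w vi, count_list w vj) \<subseteq> pattern w" by (auto simp: pattern_def assms)
  then show ?thesis using pattern_variety variety_Rep by blast
qed

text \<open>In \<open>i^a j^b\<close> every i has all letters j to its right, so the pattern
  prescribes no zero.\<close>

lemma variety_Rep_word: "variety (replicate a vi @ replicate b vj) = Rep (a, b)"
proof -
  have p: "profile (replicate b vj) = []" by (induction b) auto
  have c: "count_list (replicate n x) y = (if x = y then n else 0)" for n and x y :: vertex by (induction n) auto
  have "profile (replicate a vi @ replicate b vj) ! s = b" if "s < a" for s
    using that
  proof (induction a arbitrary: s)
    case (Suc a)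
    then show ?case by (cases s) (auto simp: c)
  qed simp
  then show ?thesis using variety_eq_Rep[of "replicate a vi @ replicate b vj"] by (simp add: c)
qed

lemma generate_submonoid_variety:
  "generate_submonoid ext_monoid {Rep (1, 0), Rep (0, 1)} = range (variety :: vertex list \<Rightarrow> 'k::field krep set)"
proof -
  have g: "variety [vi] = Rep (1, 0)" "variety [vj] = Rep (0, 1)" "variety [] = (\<one>\<^bsub>ext_monoid\<^esub> :: 'k krep set)"
    using variety_Rep_word[of 1 0] variety_Rep_word[of 0 1] variety_Rep_word[of 0 0] by (simp_all add: ext_monoid_def zero_prod_def)
  show ?thesis
  proof
    show "generate_submonoid ext_monoid {Rep (1, 0), Rep (0, 1)} \<subseteq> range (variety :: vertex list \<Rightarrow> 'k krep set)"
    proof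
      fix Z :: "'k krep set" assume "Z \<in> generate_submonoid ext_monoid {Rep (1, 0), Rep (0, 1)}"
      then show "Z \<in> range variety"
        by induction (auto simp flip: g variety_append simp del: One_nat_def)
    qed
    have "variety w \<in> generate_submonoid ext_monoid {Rep (1, 0), Rep (0, 1) :: 'k krep set}" for w
    proof (induction w)
      case (Cons c w)
      have "variety [c] \<in> generate_submonoid ext_monoid {Rep (1, 0), Rep (0, 1) :: 'k krep set}"
        by (cases c) (auto simp: g intro: generate_submonoid.incl)
      from generate_submonoid.eng[OF this Cons] show ?case by (simp flip: variety_append)
    qed (simp add: g generate_submonoid.one)
    then show "range (variety :: vertex list \<Rightarrow> 'k krep set) \<subseteq> generate_submonoid ext_monoid {Rep (1, 0), Rep (0, 1)}" by auto
  qed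
qed

lemma comp_monoid_simps:
  "carrier comp_monoid = range (variety :: vertex list \<Rightarrow> 'k::field krep set)"
  "variety u \<otimes>\<^bsub>comp_monoid\<^esub> variety v = (variety (u @ v) :: 'k krep set)"
  "\<one>\<^bsub>comp_monoid\<^esub> = (variety [] :: 'k krep set)"
proof -
  show "carrier comp_monoid = range (variety :: vertex list \<Rightarrow> 'k krep set)"
    by (simp add: comp_monoid_def generate_submonoid_variety del: One_nat_def)
  show "variety u \<otimes>\<^bsub>comp_monoid\<^esub> variety v = (variety (u @ v) :: 'k krep set)"
    by (simp add: comp_monoid_def variety_append)
  show "\<one>\<^bsub>comp_monoid\<^esub> = (variety [] :: 'k krep set)"
    using variety_Rep_word[of 0 0, where 'a = 'k] by (simp add: comp_monoid_def) (simp add: ext_monoid_def zero_prod_def)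
qed

lemma monoid_comp_monoid: "monoid (comp_monoid :: 'k::field krep set monoid)"
  by (rule monoidI) (auto simp: comp_monoid_simps)

section \<open>Varieties and subspaces\<close>

definition col_fun :: "'k::field mat \<Rightarrow> nat \<Rightarrow> nat \<Rightarrow> 'k" where
  "col_fun M s = (\<lambda>r. if r < dim_row M then M $$ (r, s) else 0)"

definition mat_fun :: "'k::field mat \<Rightarrow> (nat \<Rightarrow> 'k) \<Rightarrow> nat \<Rightarrow> 'k" where
  "mat_fun M f = (\<lambda>r. if r < dim_row M then \<Sum>s<dim_col M. M $$ (r, s) * f s else 0)"

lemma linear_mat_fun: "Vector_Spaces.linear fscale fscale (mat_fun M)"
  by unfold_locales
    (auto simp: mat_fun_def fscale_def fun_eq_iff algebra_simps sum.distrib sum_distrib_left)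

lemma mat_fun_below: "mat_fun M f \<in> funs_below (dim_row M)"
  by (auto simp: mat_fun_def funs_below_def)

lemma col_fun_below: "col_fun M s \<in> funs_below (dim_row M)"
  by (auto simp: col_fun_def funs_below_def)

lemma mat_fun_expand: "mat_fun M f = (\<Sum>s<dim_col M. fscale (f s) (col_fun M s))"
  by (rule ext, subst sum_fun_apply) (auto simp: mat_fun_def fscale_def col_fun_def mult.commute)

lemma index_mult_sum:
  assumes "i < dim_row A" "j < dim_col B" "dim_col A = dim_row B"
  shows "(A * B) $$ (i, j) = (\<Sum>k<dim_row B. A $$ (i, k) * B $$ (k, j) :: 'k::field)"
  using assms by (simp add: scalar_prod_def row_def col_def lessThan_atLeast0)

lemma mat_fun_col_fun:
  assumes "dim_col A = dim_row B" "s < dim_col B"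
  shows "mat_fun A (col_fun B s) = col_fun (A * B) s"
  by (rule ext) (use assms in \<open>auto simp: mat_fun_def col_fun_def index_mult_sum simp del: index_mult_mat(1)\<close>)

lemma span_nth:
  assumes "f \<in> fv.span (set (drop k qs))" "distinct qs"
  obtains c where "f = (\<Sum>t<length qs. fscale (c t) (qs ! t))" "\<And>t. t < k \<Longrightarrow> c t = 0"
proof -
  have D: "set (drop k qs) = (\<lambda>t. qs ! t) ` {k..<length qs}"
    by (auto simp: set_conv_nth image_iff) (metis add.commute le_add_diff_inverse le_add1 less_diff_conv nth_drop less_imp_le_nat atLeastLessThan_iff diff_less_mono)+
  obtain u where u: "f = (\<Sum>v\<in>set (drop k qs). fscale (u v) v)"
    using assms(1) by (auto simp: fv.span_finite)
  have "inj_on (\<lambda>t. qs ! t) {k..<length qs}" using assms(2) by (auto simp: inj_on_def nth_eq_iff_index_eq)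
  then have "f = (\<Sum>t\<in>{k..<length qs}. fscale (u (qs ! t)) (qs ! t))"
    unfolding u D by (simp add: sum.reindex)
  also have "\<dots> = (\<Sum>t<length qs. fscale (if t < k then 0 else u (qs ! t)) (qs ! t))"
    by (rule sum.mono_neutral_cong_left) (auto simp: fscale_def zero_fun_def)
  finally show thesis by (rule that) auto
qed

lemma mat_fun_eq_sum:
  assumes "length qs = n" "\<And>t. t < n \<Longrightarrow> qs ! t \<in> funs_below m"
  shows "mat_fun (mat m n (\<lambda>(r, t). (qs ! t) r)) c = (\<Sum>t<n. fscale (c t) (qs ! t))"
  unfolding mat_fun_expand
  by (simp, intro sum.cong refl arg_cong[where f = "fscale _"] ext)
    (use assms(2) in \<open>auto simp: col_fun_def funs_below_def not_less\<close>)

lemma basis_inverse_pair: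
  fixes ps :: "(nat \<Rightarrow> 'k::field) list"
  assumes "length ps = n" "distinct ps" "set ps \<subseteq> funs_below n" "funs_below n \<subseteq> fv.span (set ps)"
  obtains P' where "inverse_pair n (mat n n (\<lambda>(r, s). (ps ! s) r)) P'"
proof -
  let ?P = "mat n n (\<lambda>(r, s). (ps ! s) r)"
  have "\<exists>c. unit_fun j = mat_fun ?P c" if "j < n" for j
  proof -
    have "unit_fun j \<in> fv.span (set (drop 0 ps))" using assms(4) unit_fun_below[OF that] by auto
    from span_nth[OF this assms(2)] obtain c where "unit_fun j = (\<Sum>t<n. fscale (c t) (ps ! t))"
      unfolding assms(1) by metis
    moreover have "mat_fun ?P c = (\<Sum>t<n. fscale (c t) (ps ! t))"
      by (rule mat_fun_eq_sum) (use assms in auto)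
    ultimately have "unit_fun j = mat_fun ?P c" by (simp only:)
    then show ?thesis by blast
  qed
  then obtain c where c: "\<And>j. j < n \<Longrightarrow> unit_fun j = mat_fun ?P (c j)" by metis
  let ?C = "mat n n (\<lambda>(r, s). c s r)"
  have "?P * ?C = 1\<^sub>m n"
  proof (rule eq_matI)
    fix i j assume ij: "i < dim_row (1\<^sub>m n :: 'k mat)" "j < dim_col (1\<^sub>m n :: 'k mat)"
    have "(?P * ?C) $$ (i, j) = (\<Sum>k<n. ?P $$ (i, k) * ?C $$ (k, j))"
      using ij index_mult_sum[of i ?P j ?C] by simp
    also have "\<dots> = mat_fun ?P (c j) i" using ij by (simp add: mat_fun_def)
    also have "\<dots> = (1\<^sub>m n :: 'k mat) $$ (i, j)" using ij c[of j] by (auto simp: unit_fun_def dest!: fun_cong[of _ _ i])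
    finally show "(?P * ?C) $$ (i, j) = (1\<^sub>m n :: 'k mat) $$ (i, j)" .
  qed auto
  then have "inverse_pair n ?P ?C"
    using mat_mult_left_right_inverse[of ?P n ?C] by (simp add: inverse_pair_def)
  then show thesis by (rule that)
qed

lemma count_list_replicate: "count_list (replicate n x) y = (if x = y then n else 0)"
  by (induction n) auto

lemma profile_replicate: "profile (replicate a vi) = replicate a 0" "profile (replicate b vj) = []"
proof -
  show "profile (replicate a vi) = replicate a 0" by (induction a) (auto simp: count_list_replicate)
  show "profile (replicate b vj) = []" by (induction b) auto
qed

text \<open>Bases that end with \<open>B\<close> and with an independent part of \<open>G\<close>
  produce the zero block of the pattern. If that part has fewer than \<open>r\<close> elements, the
  zero block is larger than required.\<close>

lemma variety_of_subspace:
  fixes X :: "'k::field krep"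
  assumes X: "X \<in> Rep (a, b)"
    and B: "fv.independent B" "B \<subseteq> funs_below a"
    and G: "finite G" "G \<subseteq> funs_below b" "card G \<le> r" "r \<le> b"
    and im: "mat_fun (fst X) ` B \<union> mat_fun (snd X) ` B \<subseteq> fv.span G"
  shows "X \<in> variety ((replicate (a - card B) vi @ replicate (b - r) vj) @ (replicate (card B) vi @ replicate r vj))"
proof -
  let ?p = "card B" and ?w = "(replicate (a - card B) vi @ replicate (b - r) vj) @ (replicate (card B) vi @ replicate r vj)"
  have p: "?p \<le> a" using independent_below_card[OF B] by simp
  have cw: "count_list ?w vi = a" "count_list ?w vj = b" using p G(4) by (simp_all add: count_list_replicate)
  have pw: "profile ?w ! s = r" if "s \<ge> a - ?p" "s < a" for s
    using that p G(4) by (simp add: profile_append profile_replicate count_list_replicate nth_append)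
  have pw': "profile ?w ! s = b" if "s < a - ?p" for s
    using that p G(4) by (simp add: profile_append profile_replicate count_list_replicate nth_append)
  obtain ps where ps: "length ps = a" "distinct ps" "set ps \<subseteq> funs_below a" "funs_below a \<subseteq> fv.span (set ps)"
    "set (drop (a - ?p) ps) = B" using basis_extension_below[OF B] .
  let ?P = "mat a a (\<lambda>(r, s). (ps ! s) r)"
  obtain P' where P: "inverse_pair a ?P P'" using basis_inverse_pair[OF ps(1-4)] .
  obtain H where H: "H \<subseteq> G" "fv.independent H" "G \<subseteq> fv.span H" using fv.maximal_independent_subset .
  have cH: "card H \<le> r" using card_mono[OF G(1) H(1)] G(3) by simp
  obtain qs where qs: "length qs = b" "distinct qs" "set qs \<subseteq> funs_below b" "funs_below b \<subseteq> fv.span (set qs)"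
    "set (drop (b - card H) qs) = H" using basis_extension_below[OF H(2), of b] H(1) G(2) by blast
  let ?Q = "mat b b (\<lambda>(r, s). (qs ! s) r)"
  obtain Q' where Q: "inverse_pair b ?Q Q'" using basis_inverse_pair[OF qs(1-4)] .
  note PQ = inverse_pairD(1,2)[OF P] inverse_pairD(1,2)[OF Q]
  note dims = PQ[THEN carrier_matD(1)] PQ[THEN carrier_matD(2)]
  define Z where "Z = (Q' * fst X * ?P, Q' * snd X * ?P)"
  have psB: "ps ! s \<in> B" if "s \<ge> a - ?p" "s < a" for s
  proof -
    have "drop (a - ?p) ps ! (s - (a - ?p)) \<in> B"
      by (subst ps(5)[symmetric], rule nth_mem) (use that ps(1) in simp)
    then show ?thesis using that ps(1) by simp
  qed
  have key: "(Q' * x * ?P) $$ (i, s) = 0"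
    if x: "x \<in> carrier_mat b a" "mat_fun x ` B \<subseteq> fv.span G" and s: "s \<ge> a - ?p" "s < a" and i: "i < b - r" for x i s
  proof -
    have "mat_fun x (ps ! s) \<in> fv.span (set (drop (b - card H) qs))"
      using x(2) psB[OF s] fv.span_minimal[OF H(3) fv.subspace_span] unfolding qs(5) by blast
    from span_nth[OF this qs(2)] obtain c where c: "mat_fun x (ps ! s) = (\<Sum>t<b. fscale (c t) (qs ! t))" "\<And>t. t < b - card H \<Longrightarrow> c t = 0"
      unfolding qs(1) by metis
    let ?C = "mat b 1 (\<lambda>(t, _). c t)"
    have "ps ! s \<in> funs_below a" using ps(1,3) s nth_mem[of s ps] by blast
    then have "col_fun ?P s = ps ! s"
      by (intro ext) (use s in \<open>auto simp: col_fun_def funs_below_def\<close>)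
    then have "col_fun (x * ?P) s = mat_fun ?Q c"
      using c(1) x(1) s mat_fun_col_fun[of x ?P s] qs by (subst mat_fun_eq_sum) (auto simp: subset_iff)
    also have "\<dots> = mat_fun ?Q (col_fun ?C 0)" by (simp add: mat_fun_def col_fun_def cong: if_cong)
    also have "\<dots> = col_fun (?Q * ?C) 0" by (rule mat_fun_col_fun) auto
    finally have e: "col_fun (x * ?P) s = col_fun (?Q * ?C) 0" .
    have "col_fun (Q' * (x * ?P)) s = mat_fun Q' (col_fun (x * ?P) s)"
      by (rule mat_fun_col_fun[symmetric]) (use dims x s in auto)
    also have "\<dots> = col_fun (Q' * (?Q * ?C)) 0" unfolding e by (rule mat_fun_col_fun) (use dims in auto)
    also have "\<dots> = col_fun ?C 0" by (simp add: inverse_pair_cancel_dim[OF Q])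
    finally have "col_fun (Q' * (x * ?P)) s i = col_fun ?C 0 i" by simp
    then have "(Q' * (x * ?P)) $$ (i, s) = c i" using i less_le_trans[OF i diff_le_self] dims by (simp add: col_fun_def)
    also have "c i = 0" using c(2) i cH by simp
    finally show ?thesis using x(1) dims by (simp add: mult_assoc_dim)
  qed
  have XR: "fst X \<in> carrier_mat b a" "snd X \<in> carrier_mat b a" using X by (auto simp: mem_Rep)
  have "Z \<in> pattern ?w"
  proof -
    have "fst Z $$ (i, s) = 0 \<and> snd Z $$ (i, s) = 0" if "s < a" "i < b - profile ?w ! s" for i s
    proof (cases "s < a - ?p")
      case True
      then show ?thesis using that(2) pw'[OF True] by simp
    next
      case False
      then show ?thesis using that key[OF XR(1), of s i] key[OF XR(2), of s i] im pw[of s] by (simp add: Z_def)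
    qed
    moreover have "Z \<in> Rep (a, b)" using XR dims by (auto simp: Z_def mem_Rep intro!: carrier_matI)
    ultimately show ?thesis unfolding pattern_def cw by blast
  qed
  moreover have "X = (?Q * fst Z * P', ?Q * snd Z * P')"
    using XR dims inverse_pairD(3)[OF P] XR[THEN carrier_matD(1)] XR[THEN carrier_matD(2)]
    by (simp add: Z_def prod_eq_iff mult_assoc_dim inverse_pair_cancel_dim[OF Q])
  moreover have "inverse_pair a P' ?P" using P by (simp add: inverse_pair_def)
  ultimately show ?thesis unfolding variety_def cw using Q by blast
qed

lemma profile_antimono: "sorted_wrt (\<ge>) (profile w)"
  by (induction w rule: profile.induct) (auto dest: profile_le)

text \<open>The last columns of \<open>P'\<close> are sent into the span of the last columns of
  \<open>Q\<close>. As the profile decreases, the bound for the column \<open>s\<close> also serves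
  all later columns.\<close>

lemma subspace_of_variety:
  fixes X :: "'k::field krep"
  assumes X: "X \<in> variety w" and s: "s < count_list w vi"
  obtains B G where "fv.independent B" "B \<subseteq> funs_below (count_list w vi)" "card B = count_list w vi - s"
    "finite G" "G \<subseteq> funs_below (count_list w vj)" "card G \<le> profile w ! s"
    "mat_fun (fst X) ` B \<union> mat_fun (snd X) ` B \<subseteq> fv.span G"
proof -
  let ?a = "count_list w vi" and ?b = "count_list w vj"
  obtain P P' Q Q' Z where Z: "X = (Q * fst Z * P, Q * snd Z * P)" "inverse_pair ?a P P'" "inverse_pair ?b Q Q'" "Z \<in> pattern w"
    using X unfolding variety_def by blast
  have ZR: "fst Z \<in> carrier_mat ?b ?a" "snd Z \<in> carrier_mat ?b ?a" using pattern_Rep[OF Z(4)] by (auto simp: mem_Rep)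
  note PQ = inverse_pairD(1,2)[OF Z(2)] inverse_pairD(1,2)[OF Z(3)] ZR
  note dims = PQ[THEN carrier_matD(1)] PQ[THEN carrier_matD(2)]
  have zero: "c s = 0" if c: "(\<Sum>s<?a. fscale (c s) (col_fun P' s)) = 0" and s: "s < ?a" for c s
  proof -
    let ?C = "mat ?a 1 (\<lambda>(t, _). c t)"
    have "(\<Sum>s<?a. fscale (col_fun ?C 0 s) (col_fun P' s)) = (\<Sum>s<?a. fscale (c s) (col_fun P' s))"
      by (rule sum.cong) (simp_all add: col_fun_def)
    then have "mat_fun P' (col_fun ?C 0) = 0"
      using c dims unfolding mat_fun_expand by simp
    then have "col_fun (P' * ?C) 0 = 0" using mat_fun_col_fun[of P' ?C 0] dims by simp
    then have "mat_fun P (col_fun (P' * ?C) 0) = 0"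
      by (simp add: Vector_Spaces.linear.axioms(3)[OF linear_mat_fun, THEN module_hom.zero])
    then have "col_fun (P * (P' * ?C)) 0 = 0" using mat_fun_col_fun[of P "P' * ?C" 0] dims by simp
    then have "col_fun ?C 0 s = 0" by (simp add: inverse_pair_cancel_dim[OF Z(2)])
    then show ?thesis using s by (simp add: col_fun_def)
  qed
  have inj: "inj_on (col_fun P') {..<?a}"
  proof (rule inj_onI)
    have unit: "mat_fun P (col_fun P' k) = unit_fun k" if "k < ?a" for k
      using that dims inverse_pairD(3)[OF Z(2)] by (subst mat_fun_col_fun) (auto simp: col_fun_def unit_fun_def)
    fix k l assume "k \<in> {..<?a}" "l \<in> {..<?a}" "col_fun P' k = col_fun P' l"
    then have "unit_fun k = (unit_fun l :: nat \<Rightarrow> 'k)" using unit[of k] unit[of l] by simp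
    then show "k = l" by (rule injD[OF inj_unit_fun])
  qed
  have "fv.independent (col_fun P' ` {..<?a})"
  proof (rule fv.independent_if_scalars_zero)
    fix f x assume f: "(\<Sum>x\<in>col_fun P' ` {..<?a}. fscale (f x) x) = 0" and x: "x \<in> col_fun P' ` {..<?a}"
    have "(\<Sum>s<?a. fscale (f (col_fun P' s)) (col_fun P' s)) = 0" using f by (simp add: sum.reindex[OF inj])
    note z = zero[OF this]
    from x show "f x = 0" by (elim imageE) (use z in blast)
  qed auto
  then have indep: "fv.independent (col_fun P' ` {s..<?a})" by (rule fv.independent_mono) auto
  show thesis
  proof (rule that[OF indep])
    show "col_fun P' ` {s..<?a} \<subseteq> funs_below ?a" using col_fun_below[of P'] dims by auto
    show "card (col_fun P' ` {s..<?a}) = ?a - s"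
      using inj_on_subset[OF inj, of "{s..<?a}"] by (simp add: card_image subset_iff)
    let ?G = "col_fun Q ` {?b - profile w ! s..<?b}"
    show "finite ?G" by simp
    show "?G \<subseteq> funs_below ?b" using col_fun_below[of Q] dims by auto
    show "card ?G \<le> profile w ! s" by (rule order_trans[OF card_image_le]) auto
    have "mat_fun (Q * z * P) (col_fun P' t) \<in> fv.span ?G"
      if z: "z \<in> carrier_mat ?b ?a" "\<And>r. r < ?b - profile w ! t \<Longrightarrow> z $$ (r, t) = 0" and t: "t \<in> {s..<?a}" for z t
    proof -
      have pt: "profile w ! t \<le> profile w ! s"
        using t sorted_wrt_nth_less[OF profile_antimono, of s t w] by (cases "t = s") (simp_all add: length_profile)
      have "mat_fun (Q * z * P) (col_fun P' t) = col_fun (Q * z * P * P') t"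
        using dims t by (intro mat_fun_col_fun) auto
      also have "Q * z * P * P' = Q * z" using dims z(1) inverse_pairD(3)[OF Z(2)] by (simp add: mult_assoc_dim)
      also have "col_fun (Q * z) t = mat_fun Q (col_fun z t)"
        using dims z t by (intro mat_fun_col_fun[symmetric]) auto
      also have "\<dots> = (\<Sum>r<?b. fscale (col_fun z t r) (col_fun Q r))" using dims by (simp add: mat_fun_expand)
      also have "\<dots> = (\<Sum>r\<in>{?b - profile w ! s..<?b}. fscale (col_fun z t r) (col_fun Q r))"
        using z pt by (intro sum.mono_neutral_right) (auto simp: col_fun_def fscale_def zero_fun_def)
      also have "\<dots> \<in> fv.span ?G" by (intro fv.span_sum fv.span_scale fv.span_base) auto
      finally show ?thesis .
    qed
    moreover have "fst Z $$ (r, t) = 0 \<and> snd Z $$ (r, t) = 0" if "r < ?b - profile w ! t" "t \<in> {s..<?a}" for r t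
      using Z(4) that by (auto simp: pattern_def)
    ultimately show "mat_fun (fst X) ` col_fun P' ` {s..<?a} \<union> mat_fun (snd X) ` col_fun P' ` {s..<?a} \<subseteq> fv.span ?G"
      using ZR unfolding Z(1) image_image by (simp add: image_subset_iff)
  qed
qed

section \<open>Relations between varieties\<close>

text \<open>Either \<open>x\<close> has a kernel, or the inverse of \<open>x\<close> times
  \<open>y\<close> has an eigenvector; the latter uses that the field is algebraically
  closed.\<close>

lemma pencil_eigenvector:
  fixes x y :: "'k::alg_closed_field mat"
  assumes x: "x \<in> carrier_mat n n" and y: "y \<in> carrier_mat n n" and n: "n > 0"
  obtains v w where "v \<in> carrier_vec n" "v \<noteq> 0\<^sub>v n" "w \<in> carrier_vec n"
    "\<exists>c. x *\<^sub>v v = c \<cdot>\<^sub>v w" "\<exists>c. y *\<^sub>v v = c \<cdot>\<^sub>v w"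
proof (cases "det x = 0")
  case True
  then obtain v where v: "v \<in> carrier_vec n" "v \<noteq> 0\<^sub>v n" "x *\<^sub>v v = 0\<^sub>v n"
    using det_0_iff_vec_prod_zero_field[OF x] by auto
  show thesis
  proof (rule that[OF v(1,2), of "y *\<^sub>v v"])
    show "y *\<^sub>v v \<in> carrier_vec n" using y v by simp
    show "\<exists>c. x *\<^sub>v v = c \<cdot>\<^sub>v (y *\<^sub>v v)"
      unfolding v(3) by (rule exI[of _ 0], rule eq_vecI) (use y v in auto)
    show "\<exists>c. y *\<^sub>v v = c \<cdot>\<^sub>v (y *\<^sub>v v)" by (rule exI[of _ 1]) simp
  qed
next
  case False
  then obtain x' where x': "x' \<in> carrier_mat n n" "x' * x = 1\<^sub>m n" "x * x' = 1\<^sub>m n"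
    using det_non_zero_imp_unit[OF x False, of undefined] by (auto simp: Units_def ring_mat_def)
  have "degree (char_poly (x' * y)) > 0"
    using degree_monic_char_poly[of "x' * y" n] x' y n by simp
  then obtain k where "poly (char_poly (x' * y)) k = 0" using alg_closed_imp_poly_has_root by blast
  then have "eigenvalue (x' * y) k" using eigenvalue_root_char_poly[of "x' * y" n] x' y by simp
  then obtain v where v: "v \<in> carrier_vec n" "v \<noteq> 0\<^sub>v n" "x' * y *\<^sub>v v = k \<cdot>\<^sub>v v"
    using x' by (auto simp: eigenvalue_def eigenvector_def)
  have "y *\<^sub>v v = x * x' *\<^sub>v (y *\<^sub>v v)" using x'(3) y v by simp
  also have "\<dots> = x *\<^sub>v (x' *\<^sub>v (y *\<^sub>v v))" by (rule assoc_mult_mat_vec) (use x x' y v in auto)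
  also have "x' *\<^sub>v (y *\<^sub>v v) = k \<cdot>\<^sub>v v" using v(1,3) x' y by simp
  also have "x *\<^sub>v (k \<cdot>\<^sub>v v) = k \<cdot>\<^sub>v (x *\<^sub>v v)" using x v by (simp add: mult_mat_vec[of _ n n])
  finally have e: "y *\<^sub>v v = k \<cdot>\<^sub>v (x *\<^sub>v v)" .
  show thesis
    by (rule that[OF v(1,2), of "x *\<^sub>v v"]) (use x v e in \<open>auto intro: exI[of _ 1]\<close>)
qed

definition vec_fun :: "'k::field vec \<Rightarrow> nat \<Rightarrow> 'k" where
  "vec_fun v = (\<lambda>r. if r < dim_vec v then v $ r else 0)"

lemma vec_fun_below: "v \<in> carrier_vec n \<Longrightarrow> vec_fun v \<in> funs_below n"
  by (auto simp: vec_fun_def funs_below_def)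

lemma vec_fun_nonzero: "v \<in> carrier_vec n \<Longrightarrow> v \<noteq> 0\<^sub>v n \<Longrightarrow> vec_fun v \<noteq> 0"
  by (auto simp: vec_fun_def fun_eq_iff vec_eq_iff)

lemma mat_fun_vec_fun: "dim_col M = dim_vec v \<Longrightarrow> mat_fun M (vec_fun v) = vec_fun (M *\<^sub>v v)"
  by (rule ext) (auto simp: mat_fun_def vec_fun_def scalar_prod_def lessThan_atLeast0)

lemma vec_fun_smult: "vec_fun (c \<cdot>\<^sub>v v) = fscale c (vec_fun v)"
  by (rule ext) (auto simp: vec_fun_def fscale_def)

definition two_step :: "nat \<Rightarrow> nat \<Rightarrow> nat \<Rightarrow> nat \<Rightarrow> vertex list" where
  "two_step p r p' r' = (replicate p vi @ replicate r vj) @ (replicate p' vi @ replicate r' vj)"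

lemma count_two_step: "count_list (two_step p r p' r') vi = p + p'" "count_list (two_step p r p' r') vj = r + r'"
  by (simp_all add: two_step_def count_list_replicate)

lemma variety_append_mono:
  assumes "(variety u :: 'k::field krep set) \<subseteq> variety u'" "(variety v :: 'k krep set) \<subseteq> variety v'"
  shows "(variety (u @ v) :: 'k krep set) \<subseteq> variety (u' @ v')"
  unfolding variety_append using assms by (auto simp: ext_monoid_def)

lemma variety_subset_Rep: "variety w \<subseteq> Rep (count_list w vi, count_list w vj)"
  using variety_Rep by blast

text \<open>Every representation of dimension \<open>(m + 1, m + 1)\<close> has a subrepresentation
  of dimension \<open>(1, 1)\<close>, by \<open>pencil_eigenvector\<close>, and the quotient is
  covered by induction.\<close>

lemma variety_reg_word:
  "variety (reg_word m) = (Rep (m, m) :: 'k::alg_closed_field krep set)"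
proof (induction m)
  case 0
  show ?case using variety_Rep_word[of 0 0] by simp
next
  case (Suc m)
  have sub: "(Rep (Suc m, Suc m) :: 'k krep set) \<subseteq> variety ((replicate m vi @ replicate m vj) @ [vi, vj])"
  proof
    fix X :: "'k krep" assume X: "X \<in> Rep (Suc m, Suc m)"
    then have R: "fst X \<in> carrier_mat (Suc m) (Suc m)" "snd X \<in> carrier_mat (Suc m) (Suc m)" by (auto simp: mem_Rep)
    obtain v w where v: "v \<in> carrier_vec (Suc m)" "v \<noteq> 0\<^sub>v (Suc m)" "w \<in> carrier_vec (Suc m)"
      "\<exists>c. fst X *\<^sub>v v = c \<cdot>\<^sub>v w" "\<exists>c. snd X *\<^sub>v v = c \<cdot>\<^sub>v w"
      using pencil_eigenvector[OF R] by auto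
    have "fv.independent {vec_fun v}"
      using vec_fun_nonzero[OF v(1,2)] by (simp add: fv.independent_insert fv.independent_empty)
    moreover have "mat_fun (fst X) ` {vec_fun v} \<union> mat_fun (snd X) ` {vec_fun v} \<subseteq> fv.span {vec_fun w}"
      using v R by (auto simp: mat_fun_vec_fun vec_fun_smult intro!: fv.span_scale[OF fv.span_base])
    ultimately have "X \<in> variety ((replicate (Suc m - card {vec_fun v}) vi @ replicate (Suc m - 1) vj)
        @ (replicate (card {vec_fun v}) vi @ replicate 1 vj))"
      by (intro variety_of_subspace[OF X, where G = "{vec_fun w}"]) (use v vec_fun_below in auto)
    then show "X \<in> variety ((replicate m vi @ replicate m vj) @ [vi, vj])" by simp
  qed
  have r: "reg_word (Suc m) = reg_word m @ [vi, vj]"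
    by (simp add: reg_word_def replicate_append_same flip: replicate_Suc concat_append) (metis append_Nil2 concat.simps concat_append replicate_Suc replicate_append_same)
  have "(variety ((replicate m vi @ replicate m vj) @ [vi, vj]) :: 'k krep set) \<subseteq> variety (reg_word (Suc m))"
    unfolding r by (rule variety_append_mono) (simp_all add: Suc.IH variety_Rep_word)
  moreover have "(variety (reg_word (Suc m)) :: 'k krep set) \<subseteq> Rep (Suc m, Suc m)"
    using variety_subset_Rep[of "reg_word (Suc m)"] by (simp only: count_words)
  ultimately show ?case using sub by (meson equalityI order_trans)
qed

text \<open>A chain with \<open>n = d - 1\<close> exists since \<open>n (a + 2) < (n + 1) a\<close>
  means \<open>2 d <= a + 1\<close>. If it spans \<open>d\<close> dimensions, it generates the
  required subrepresentation. Otherwise it gives one of dimension \<open>(p, p)\<close> with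
  \<open>0 < p < d\<close>, and induction applies to the quotient, of dimension
  \<open>(a - p, a - p + 2)\<close>.\<close>

lemma variety_small_subspace:
  fixes X :: "'k::field krep"
  assumes "X \<in> Rep (a, a + 2)" "2 * d \<le> a + 1"
  shows "X \<in> variety (two_step (a - d) (a + 1 - d) d (d + 1))"
  using assms
proof (induction d arbitrary: a X rule: less_induct)
  case (less d)
  have R: "fst X \<in> carrier_mat (a + 2) a" "snd X \<in> carrier_mat (a + 2) a" using less.prems by (auto simp: mem_Rep)
  show ?case
  proof (cases d)
    case 0
    have "X \<in> variety ((replicate (a - card ({} :: (nat \<Rightarrow> 'k) set)) vi @ replicate (a + 2 - 1) vj)
        @ (replicate (card ({} :: (nat \<Rightarrow> 'k) set)) vi @ replicate 1 vj))"
      by (rule variety_of_subspace[OF less.prems(1), where G = "{}"]) (auto simp: fv.independent_empty)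
    then show ?thesis using 0 by (simp add: two_step_def)
  next
    case (Suc n)
    have mf: "mat_fun (fst X) f \<in> funs_below (a + 2)" "mat_fun (snd X) f \<in> funs_below (a + 2)" for f
      using mat_fun_below[of "fst X" f] mat_fun_below[of "snd X" f] R by auto
    have "n * (a + 2) < Suc n * a" using less.prems(2) Suc by simp
    then obtain u where u: "\<And>k. u k \<in> funs_below a" "\<exists>k\<le>n. u k \<noteq> 0"
      "\<And>k. k < n \<Longrightarrow> mat_fun (snd X) (u k) = mat_fun (fst X) (u (Suc k))"
      using chain_exists[OF linear_mat_fun linear_mat_fun mf] by metis
    obtain B G where B: "B \<subseteq> u ` {..n}" "u ` {..n} \<subseteq> fv.span B" "fv.independent B" and G: "finite G"
      "G \<subseteq> fv.span (mat_fun (fst X) ` B \<union> mat_fun (snd X) ` u ` {..n})"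
      "mat_fun (fst X) ` B \<union> mat_fun (snd X) ` B \<subseteq> fv.span G" "card G \<le> Suc (card B)"
      "card B \<le> n \<Longrightarrow> card G \<le> card B"
      using chain_span[OF linear_mat_fun[of "fst X"] linear_mat_fun[of "snd X"], of n u] u(3) by metis
    have Ba: "B \<subseteq> funs_below a" using B(1) u(1) by auto
    have "fv.span (mat_fun (fst X) ` B \<union> mat_fun (snd X) ` u ` {..n}) \<subseteq> funs_below (a + 2)"
      by (rule fv.span_minimal[OF _ subspace_funs_below]) (use mf in auto)
    with G(2) have Gb: "G \<subseteq> funs_below (a + 2)" by blast
    have cB: "card B \<le> d" using card_mono[OF _ B(1)] card_image_le[of "{..n}" u] Suc by simp
    note sub = variety_of_subspace[OF less.prems(1) B(3) Ba G(1) Gb _ _ G(3)]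
    show ?thesis
    proof (cases "card B = d")
      case True
      then show ?thesis using sub[of "d + 1"] G(4) less.prems(2) by (simp add: two_step_def)
    next
      case False
      let ?p = "card B"
      have p: "?p \<le> n" "?p < d" using False cB Suc by auto
      have "?p \<noteq> 0"
        using u(2) B(2) finite_subset[OF B(1)] by (auto simp: image_subset_iff)
      then have dp: "d - ?p < d" using p by simp
      have "X \<in> variety ((replicate (a - ?p) vi @ replicate (a + 2 - ?p) vj) @ (replicate ?p vi @ replicate ?p vj))"
        using sub[of ?p] G(5) p less.prems(2) by simp
      moreover have "(variety (replicate (a - ?p) vi @ replicate (a + 2 - ?p) vj) :: 'k krep set)
          \<subseteq> variety (two_step (a - d) (a + 1 - d) (d - ?p) (d - ?p + 1))"
      proof
        fix Y :: "'k krep" assume "Y \<in> variety (replicate (a - ?p) vi @ replicate (a + 2 - ?p) vj)"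
        moreover have "a + 2 - ?p = a - ?p + 2" using p less.prems(2) by simp
        ultimately have "Y \<in> Rep (a - ?p, a - ?p + 2)" by (simp only: variety_Rep_word)
        from less.IH[OF dp this] show "Y \<in> variety (two_step (a - d) (a + 1 - d) (d - ?p) (d - ?p + 1))"
          using p less.prems(2) by simp
      qed
      ultimately have "X \<in> variety (two_step (a - d) (a + 1 - d) (d - ?p) (d - ?p + 1) @ (replicate ?p vi @ replicate ?p vj))"
        using variety_append_mono[OF _ subset_refl] by blast
      then have X: "X \<in> variety ((replicate (a - d) vi @ replicate (a + 1 - d) vj) @ two_step (d - ?p) (d - ?p + 1) ?p ?p)"
        by (simp add: two_step_def)
      \<comment> \<open>The preimage of the subrepresentation of the quotient has dimension
        \<open>(d, d + 1)\<close>. Only this dimension is kept, so the variety of the inner word is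
        enlarged to the whole space.\<close>
      have "(variety (two_step (d - ?p) (d - ?p + 1) ?p ?p) :: 'k krep set) \<subseteq> variety (replicate d vi @ replicate (d + 1) vj)"
        using variety_subset_Rep[of "two_step (d - ?p) (d - ?p + 1) ?p ?p"] p
        unfolding variety_Rep_word by (simp add: count_two_step)
      from variety_append_mono[OF subset_refl this] X show ?thesis unfolding two_step_def by blast
    qed
  qed
qed

section \<open>Duality\<close>

text \<open>Dualizing reverses flags. Reflection in the antidiagonal also reverses the coordinates,
  so that patterns go to patterns without permutation matrices.\<close>

definition antitranspose :: "'k mat \<Rightarrow> 'k mat" where
  "antitranspose M = mat (dim_col M) (dim_row M) (\<lambda>(i, j). M $$ (dim_row M - Suc j, dim_col M - Suc i))"

lemma dim_antitranspose [simp]: "dim_row (antitranspose M) = dim_col M" "dim_col (antitranspose M) = dim_row M"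
  by (simp_all add: antitranspose_def)

lemma antitranspose_twice: "antitranspose (antitranspose M) = M"
  by (rule eq_matI) (auto simp: antitranspose_def)

lemma antitranspose_mult:
  assumes "dim_col A = dim_row B"
  shows "antitranspose (A * B) = antitranspose B * antitranspose (A :: 'k::field mat)"
proof (rule eq_matI)
  fix i j assume "i < dim_row (antitranspose B * antitranspose A)" "j < dim_col (antitranspose B * antitranspose A)"
  then have ij: "i < dim_col B" "j < dim_row A" by simp_all
  have "antitranspose (A * B) $$ (i, j) = (\<Sum>k<dim_row B. A $$ (dim_row A - Suc j, k) * B $$ (k, dim_col B - Suc i))"
    using ij assms by (simp add: antitranspose_def index_mult_sum del: index_mult_mat(1))
  also have "\<dots> = (\<Sum>k<dim_row B. A $$ (dim_row A - Suc j, dim_row B - Suc k) * B $$ (dim_row B - Suc k, dim_col B - Suc i))"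
    by (rule sum.nat_diff_reindex[symmetric])
  also have "\<dots> = (antitranspose B * antitranspose A) $$ (i, j)"
    using ij assms by (simp add: antitranspose_def index_mult_sum mult.commute del: index_mult_mat(1))
  finally show "antitranspose (A * B) $$ (i, j) = (antitranspose B * antitranspose A) $$ (i, j)" .
qed (simp_all)

lemma antitranspose_one: "antitranspose (1\<^sub>m n) = 1\<^sub>m n"
  by (rule eq_matI) (auto simp: antitranspose_def)

lemma inverse_pair_antitranspose:
  assumes "inverse_pair n P P'"
  shows "inverse_pair n (antitranspose P) (antitranspose P')"
proof -
  note c = inverse_pairD[OF assms]
  have "antitranspose P * antitranspose P' = antitranspose (P' * P)"
    by (rule antitranspose_mult[symmetric]) (use c in auto)
  moreover have "antitranspose P' * antitranspose P = antitranspose (P * P')"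
    by (rule antitranspose_mult[symmetric]) (use c in auto)
  ultimately show ?thesis using c by (auto simp: inverse_pair_def antitranspose_one intro!: carrier_matI)
qed

lemma pattern_two_step:
  "pattern (two_step p r p' r') = {Z \<in> Rep (p + p', r + r'). \<forall>s q. p \<le> s \<longrightarrow> s < p + p' \<longrightarrow> q < r \<longrightarrow>
     fst Z $$ (q, s) = 0 \<and> snd Z $$ (q, s) = 0}"
proof -
  have "profile (two_step p r p' r') ! s = (if s < p then r + r' else r')" if "s < p + p'" for s
    using that by (simp add: two_step_def profile_append profile_replicate count_list_replicate nth_append)
  then have "(\<forall>s < p + p'. \<forall>q < r + r' - profile (two_step p r p' r') ! s. Q q s) \<longleftrightarrow>
      (\<forall>s q. p \<le> s \<longrightarrow> s < p + p' \<longrightarrow> q < r \<longrightarrow> Q q s)" for Q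
    by (auto simp: not_less)
  then show ?thesis by (simp add: pattern_def count_two_step)
qed

lemma variety_two_step_dual:
  fixes X :: "'k::field krep"
  assumes "X \<in> variety (two_step p r p' r')"
  shows "(antitranspose (fst X), antitranspose (snd X)) \<in> variety (two_step r' p' r p)"
proof -
  obtain P P' Q Q' Z where Z: "X = (Q * fst Z * P, Q * snd Z * P)" "inverse_pair (p + p') P P'"
    "inverse_pair (r + r') Q Q'" "Z \<in> pattern (two_step p r p' r')"
    using assms unfolding variety_def count_two_step by blast
  let ?Z = "(antitranspose (fst Z), antitranspose (snd Z))"
  have R: "fst Z \<in> carrier_mat (r + r') (p + p')" "snd Z \<in> carrier_mat (r + r') (p + p')"
    using Z(4) by (auto simp: pattern_two_step mem_Rep)
  have "?Z \<in> pattern (two_step r' p' r p)"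
    using Z(4) R by (auto simp: pattern_two_step mem_Rep antitranspose_def)
  moreover have "(antitranspose (fst X), antitranspose (snd X)) =
      (antitranspose P * fst ?Z * antitranspose Q, antitranspose P * snd ?Z * antitranspose Q)"
    using R inverse_pairD[OF Z(2)] inverse_pairD[OF Z(3)]
    by (simp add: Z(1) antitranspose_mult mult_assoc_dim)
  moreover have "inverse_pair (p + p') (antitranspose P) (antitranspose P')" "inverse_pair (r + r') (antitranspose Q) (antitranspose Q')"
    using Z by (auto intro: inverse_pair_antitranspose)
  ultimately show ?thesis unfolding variety_def count_two_step add.commute[of r' r] add.commute[of p' p] by blast
qed

lemma variety_two_step_proj:
  assumes "2 * d \<le> a + 1"
  shows "variety (two_step (a - d) (a + 1 - d) d (d + 1)) = (Rep (a, a + 2) :: 'k::field krep set)"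
  using variety_small_subspace[OF _ assms] variety_subset_Rep[of "two_step (a - d) (a + 1 - d) d (d + 1)"] assms
  by (auto simp: count_two_step)

lemma variety_two_step_inj:
  assumes "2 * d \<le> a + 1"
  shows "variety (two_step (d + 1) d (a + 1 - d) (a - d)) = (Rep (a + 2, a) :: 'k::field krep set)"
proof
  show "variety (two_step (d + 1) d (a + 1 - d) (a - d)) \<subseteq> (Rep (a + 2, a) :: 'k krep set)"
    using variety_subset_Rep[of "two_step (d + 1) d (a + 1 - d) (a - d)"] assms by (simp add: count_two_step)
  show "Rep (a + 2, a) \<subseteq> (variety (two_step (d + 1) d (a + 1 - d) (a - d)) :: 'k krep set)"
  proof
    fix X :: "'k krep" assume "X \<in> Rep (a + 2, a)"
    then have "(antitranspose (fst X), antitranspose (snd X)) \<in> Rep (a, a + 2)"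
      by (auto simp: mem_Rep intro!: carrier_matI)
    from variety_two_step_dual[OF variety_small_subspace[OF this assms]]
    show "X \<in> variety (two_step (d + 1) d (a + 1 - d) (a - d))" by (simp add: antitranspose_twice)
  qed
qed

lemma variety_proj_word: "variety (proj_word a) = (Rep (a, a + 1) :: 'k::alg_closed_field krep set)"
proof -
  have "(variety (proj_word a) :: 'k krep set) = variety ((replicate a vi @ replicate a vj) @ [vj])"
    unfolding proj_word_def variety_append[of "reg_word a"] variety_append[of "replicate a vi @ replicate a vj" "[vj]"]
    by (simp only: variety_reg_word variety_Rep_word)
  also have "(replicate a vi @ replicate a vj) @ [vj] = replicate a vi @ replicate (a + 1) vj"
    by (simp add: replicate_append_same)
  finally show ?thesis by (simp only: variety_Rep_word)
qed

lemma variety_inj_word: "variety (inj_word a) = (Rep (a + 1, a) :: 'k::alg_closed_field krep set)"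
proof -
  have "(variety (inj_word a) :: 'k krep set) = variety ([vi] @ (replicate a vi @ replicate a vj))"
    unfolding inj_word_def variety_append[of "[vi]" "replicate a vi @ replicate a vj"]
    using variety_append[of "[vi]" "reg_word a", where 'k = 'k]
    by (simp only: variety_reg_word variety_Rep_word append_Cons append_Nil)
  also have "[vi] @ (replicate a vi @ replicate a vj) = replicate (a + 1) vi @ replicate a vj" by simp
  finally show ?thesis by (simp only: variety_Rep_word)
qed

text \<open>Both products are the whole of \<open>Rep (2 d + 1, 2 d + 3)\<close>: for
  \<open>a = 2 d + 1\<close> the bound on small subrepresentations admits \<open>d\<close> and, with
  equality, \<open>d + 1\<close>.\<close>

lemma variety_proj_commute:
  "variety (proj_word (Suc d) @ proj_word d) = (variety (proj_word d @ proj_word (Suc d)) :: 'k::alg_closed_field krep set)"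
proof -
  have "variety (proj_word a @ proj_word b) = (variety (two_step a (a + 1) b (b + 1)) :: 'k krep set)" for a b
    unfolding two_step_def variety_append[of "proj_word a"] variety_append[of "replicate a vi @ _"] variety_proj_word variety_Rep_word ..
  then show ?thesis
    using variety_two_step_proj[of d "2 * d + 1", where 'k = 'k] variety_two_step_proj[of "Suc d" "2 * d + 1", where 'k = 'k]
    by (simp add: mult_2)
qed

lemma variety_inj_commute:
  "variety (inj_word d @ inj_word (Suc d)) = (variety (inj_word (Suc d) @ inj_word d) :: 'k::alg_closed_field krep set)"
proof -
  have "variety (inj_word a @ inj_word b) = (variety (two_step (a + 1) a (b + 1) b) :: 'k krep set)" for a b
    unfolding two_step_def variety_append[of "inj_word a"] variety_append[of "replicate (a + 1) vi @ _"] variety_inj_word variety_Rep_word ..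
  then show ?thesis
    using variety_two_step_inj[of d "2 * d + 1", where 'k = 'k] variety_two_step_inj[of "Suc d" "2 * d + 1", where 'k = 'k]
    by (simp add: mult_2)
qed

section \<open>Varieties of normal words are distinct\<close>

text \<open>Basis vectors go to basis vectors or to 0, strictly increasing in the index.
  Monotonicity makes the leading position of an image the image of the leading position.\<close>

definition monomial :: "nat \<Rightarrow> nat \<Rightarrow> 'k::field mat \<Rightarrow> (nat \<Rightarrow> nat option) \<Rightarrow> bool" where
  "monomial a b M \<xi> \<longleftrightarrow> M = mat b a (\<lambda>(r, s). of_bool (\<xi> s = Some r)) \<and>
     (\<forall>s<a. \<forall>r. \<xi> s = Some r \<longrightarrow> r < b) \<and>
     (\<forall>s<a. \<forall>t<s. \<forall>q r. \<xi> t = Some q \<longrightarrow> \<xi> s = Some r \<longrightarrow> q < r)"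

lemma monomialD:
  assumes "monomial a b M \<xi>"
  shows "M = mat b a (\<lambda>(r, s). of_bool (\<xi> s = Some r))"
    and "s < a \<Longrightarrow> \<xi> s = Some r \<Longrightarrow> r < b"
    and "s < a \<Longrightarrow> t < s \<Longrightarrow> \<xi> t = Some q \<Longrightarrow> \<xi> s = Some r \<Longrightarrow> q < r"
  using assms unfolding monomial_def by blast+

definition targets :: "(nat \<Rightarrow> nat option) \<Rightarrow> (nat \<Rightarrow> nat option) \<Rightarrow> nat set \<Rightarrow> nat set" where
  "targets \<xi> \<eta> L = {r. \<exists>s\<in>L. \<xi> s = Some r \<or> \<eta> s = Some r}"

text \<open>All other terms of \<open>u\<close> have smaller indices, so their images lie strictly
  below \<open>r\<close> and cannot cancel the leading one.\<close>

lemma lead_monomial: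
  fixes u :: "nat \<Rightarrow> 'k::field"
  assumes m: "monomial a b M \<xi>" and u: "u \<in> funs_below a" "u \<noteq> 0" and r: "\<xi> (lead u) = Some r"
  shows "lead (mat_fun M u) = r" "mat_fun M u \<noteq> 0"
proof -
  have l: "lead u < a" "u (lead u) \<noteq> 0" "\<And>k. k > lead u \<Longrightarrow> u k = 0" using lead[OF u] by auto
  have rb: "r < b" using monomialD(2)[OF m l(1) r] .
  note M = monomialD(1)[OF m] and mono = monomialD(3)[OF m]
  have ev: "mat_fun M u q = (\<Sum>s<a. of_bool (\<xi> s = Some q) * u s)" if "q < b" for q
    using that by (simp add: M mat_fun_def)
  have "(\<Sum>s<a. of_bool (\<xi> s = Some r) * u s) = (\<Sum>s<a. if s = lead u then u s else 0)"
  proof (rule sum.cong)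
    fix s assume "s \<in> {..<a}"
    then show "of_bool (\<xi> s = Some r) * u s = (if s = lead u then u s else 0)"
      using mono[of s "lead u" r r] mono[of "lead u" s r r] r l by (cases s "lead u" rule: linorder_cases) auto
  qed simp
  then have 1: "mat_fun M u r = u (lead u)" using ev[OF rb] l(1) by simp
  have "mat_fun M u q = 0" if "q > r" for q
  proof (cases "q < b")
    case True
    have "of_bool (\<xi> s = Some q) * u s = 0" if "s < a" for s
      using that mono[of "lead u" s q r] \<open>q > r\<close> r l by (cases s "lead u" rule: linorder_cases) auto
    then show ?thesis unfolding ev[OF True] by (intro sum.neutral) auto
  qed (simp add: mat_fun_def M)
  with 1 l(2) show "lead (mat_fun M u) = r" by (intro leadI) auto
  show "mat_fun M u \<noteq> 0" using 1 l(2) by auto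
qed

text \<open>The leading positions of the vectors of a subspace turn a flag into sets of basis vectors.\<close>

lemma monomial_variety_bound:
  fixes X :: "'k::field krep"
  assumes X: "X \<in> variety w" and x: "monomial (count_list w vi) (count_list w vj) (fst X) \<xi>"
    and y: "monomial (count_list w vi) (count_list w vj) (snd X) \<eta>" and s: "s < count_list w vi"
  shows "\<exists>L\<subseteq>{..<count_list w vi}. card L = count_list w vi - s \<and> card (targets \<xi> \<eta> L) \<le> profile w ! s"
proof -
  let ?a = "count_list w vi" and ?b = "count_list w vj"
  obtain B G where B: "fv.independent B" "B \<subseteq> funs_below ?a" "card B = ?a - s"
    and G: "finite G" "G \<subseteq> funs_below ?b" "card G \<le> profile w ! s"
    "mat_fun (fst X) ` B \<union> mat_fun (snd X) ` B \<subseteq> fv.span G"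
    using subspace_of_variety[OF X s] .
  have spB: "fv.span B \<subseteq> funs_below ?a" and spG: "fv.span G \<subseteq> funs_below ?b"
    by (rule fv.span_minimal[OF _ subspace_funs_below], fact)+
  have im: "mat_fun (fst X) u \<in> fv.span G" "mat_fun (snd X) u \<in> fv.span G" if "u \<in> fv.span B" for u
  proof -
    have "mat_fun M u \<in> fv.span (mat_fun M ` B)" for M
      using fvp.linear_span_image[OF linear_mat_fun, of M B] that by auto
    moreover have "fv.span (mat_fun (fst X) ` B) \<subseteq> fv.span G" "fv.span (mat_fun (snd X) ` B) \<subseteq> fv.span G"
      using G(4) by (simp_all add: fv.span_minimal)
    ultimately show "mat_fun (fst X) u \<in> fv.span G" "mat_fun (snd X) u \<in> fv.span G" by blast+
  qed
  let ?L = "lead ` (fv.span B - {0})" and ?R = "lead ` (fv.span G - {0})"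
  obtain L where L: "L \<subseteq> ?L" "card L = card B" using card_leads_ge[OF B(1,2)] by (meson obtain_subset_with_card_n)
  have "L \<subseteq> {..<?a}" using L(1) spB lead(3) by blast
  moreover have "targets \<xi> \<eta> L \<subseteq> ?R"
  proof
    fix r assume "r \<in> targets \<xi> \<eta> L"
    then obtain u where u: "u \<in> fv.span B" "u \<noteq> 0" "\<xi> (lead u) = Some r \<or> \<eta> (lead u) = Some r"
      using L(1) unfolding targets_def by blast
    then have ub: "u \<in> funs_below ?a" using spB by blast
    from u(3) show "r \<in> ?R"
      using lead_monomial[OF x ub u(2)] lead_monomial[OF y ub u(2)] im[OF u(1)] by blast
  qed
  moreover have "finite ?R" using spG lead(3) by (intro finite_subset[of ?R "{..<?b}"]) auto
  then have "card (targets \<xi> \<eta> L) \<le> card ?R" using calculation(2) by (intro card_mono)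
  then have "card (targets \<xi> \<eta> L) \<le> profile w ! s" using card_leads_le[OF G(1,2)] G(3) by linarith
  ultimately show ?thesis using L(2) B(3) by (intro exI[of _ L]) simp
qed

section \<open>Monomial representations with many targets\<close>

text \<open>\<open>R\<close> bounds the number of basis vectors reached from a set of columns in
  terms of the number of columns. As a relation it can be composed along direct sums.\<close>

definition realizes :: "'k::field itself \<Rightarrow> vertex list \<Rightarrow> (nat \<Rightarrow> nat \<Rightarrow> bool) \<Rightarrow> bool" where
  "realizes _ w R \<longleftrightarrow> (\<exists>(X :: 'k krep) \<xi> \<eta>. X \<in> variety w \<and>
     monomial (count_list w vi) (count_list w vj) (fst X) \<xi> \<and> monomial (count_list w vi) (count_list w vj) (snd X) \<eta> \<and>
     (\<forall>L\<subseteq>{..<count_list w vi}. R (card L) (card (targets \<xi> \<eta> L))))"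

definition shift_sum :: "nat \<Rightarrow> nat \<Rightarrow> (nat \<Rightarrow> nat option) \<Rightarrow> (nat \<Rightarrow> nat option) \<Rightarrow> nat \<Rightarrow> nat option" where
  "shift_sum a b \<xi> \<zeta> s = (if s < a then \<xi> s else map_option ((+) b) (\<zeta> (s - a)))"

lemma monomial_shift_sum:
  assumes M: "monomial a b (M :: 'k::field mat) \<xi>" and N: "monomial c d N \<zeta>"
  shows "monomial (a + c) (b + d) (four_block_mat M (0\<^sub>m b c) (0\<^sub>m d a) N) (shift_sum a b \<xi> \<zeta>)"
proof -
  note e = monomialD(1)[OF M] monomialD(1)[OF N] and bd = monomialD(2)[OF M] monomialD(2)[OF N]
    and mono = monomialD(3)[OF M] monomialD(3)[OF N]
  show ?thesis unfolding monomial_def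
  proof (intro conjI allI impI)
    show "four_block_mat M (0\<^sub>m b c) (0\<^sub>m d a) N = mat (b + d) (a + c) (\<lambda>(r, s). of_bool (shift_sum a b \<xi> \<zeta> s = Some r))"
      (is "?F = ?M")
    proof (rule eq_matI)
      fix r s assume "r < dim_row ?M" "s < dim_col ?M"
      then have rs: "r < b + d" "s < a + c" by simp_all
      have "(\<exists>z. \<zeta> (s - a) = Some z \<and> b + z = r) \<longleftrightarrow> b \<le> r \<and> \<zeta> (s - a) = Some (r - b)" by auto
      then have "?F $$ (r, s) = of_bool (shift_sum a b \<xi> \<zeta> s = Some r)"
        using rs bd(1)[of s r] by (cases "s < a"; cases "r < b") (auto simp: e shift_sum_def not_less)
      then show "?F $$ (r, s) = ?M $$ (r, s)" using rs by simp
    qed (simp_all add: e)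
    show "r < b + d" if sr: "s < a + c" "shift_sum a b \<xi> \<zeta> s = Some r" for s r
    proof (cases "s < a")
      case True
      then show ?thesis using that bd(1)[of s r] by (simp add: shift_sum_def)
    next
      case False
      then obtain r' where "\<zeta> (s - a) = Some r'" "r = b + r'" using sr by (auto simp: shift_sum_def)
      then show ?thesis using sr False bd(2)[of "s - a" r'] by simp
    qed
    show "q < r" if st: "s < a + c" "t < s" "shift_sum a b \<xi> \<zeta> t = Some q" "shift_sum a b \<xi> \<zeta> s = Some r" for s t q r
    proof (cases "s < a")
      case True
      then show ?thesis using st mono(1)[of s t q r] by (simp add: shift_sum_def)
    next
      case False
      then obtain r' where r': "\<zeta> (s - a) = Some r'" "r = b + r'" using st by (auto simp: shift_sum_def)
      show ?thesis
      proof (cases "t < a")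
        case True
        then show ?thesis using st r' bd(1)[of t q] by (simp add: shift_sum_def)
      next
        case F: False
        then obtain q' where "\<zeta> (t - a) = Some q'" "q = b + q'" using st by (auto simp: shift_sum_def)
        then show ?thesis using st r' F False mono(2)[of "s - a" "t - a" q' r'] by simp
      qed
    qed
  qed
qed

lemma block_rep_variety:
  fixes A :: "'k::field krep"
  assumes A: "A \<in> variety u" and B: "B \<in> variety v"
  shows "block_rep A (0\<^sub>m (count_list v vj) (count_list u vi), 0\<^sub>m (count_list v vj) (count_list u vi)) B \<in> variety (u @ v)"
proof -
  let ?a = "count_list u vi" and ?b = "count_list u vj" and ?c = "count_list v vi" and ?d = "count_list v vj"
  let ?Y = "(0\<^sub>m ?d ?a, 0\<^sub>m ?d ?a) :: 'k krep"
  obtain PA PA' QA QA' ZA where ZA: "A = (QA * fst ZA * PA, QA * snd ZA * PA)" "inverse_pair ?a PA PA'"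
      "inverse_pair ?b QA QA'" "ZA \<in> pattern u" using A unfolding variety_def by blast
  obtain PB PB' QB QB' ZB where ZB: "B = (QB * fst ZB * PB, QB * snd ZB * PB)" "inverse_pair ?c PB PB'"
      "inverse_pair ?d QB QB'" "ZB \<in> pattern v" using B unfolding variety_def by blast
  have R: "fst ZA \<in> carrier_mat ?b ?a" "snd ZA \<in> carrier_mat ?b ?a" "fst ZB \<in> carrier_mat ?d ?c" "snd ZB \<in> carrier_mat ?d ?c"
    using pattern_Rep[OF ZA(4)] pattern_Rep[OF ZB(4)] by (auto simp: mem_Rep)
  have z: "QB' * 0\<^sub>m ?d ?a * PA' = 0\<^sub>m ?d ?a" using inverse_pairD[OF ZB(3)] inverse_pairD[OF ZA(2)] by simp
  let ?Q = "four_block_mat QA (0\<^sub>m ?b ?d) (0\<^sub>m ?d ?b) QB" and ?P = "four_block_mat PA (0\<^sub>m ?a ?c) (0\<^sub>m ?c ?a) PB"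
  let ?Z = "block_rep ZA ?Y ZB" and ?X = "block_rep A ?Y B"
  have "?X = (?Q * fst ?Z * ?P, ?Q * snd ?Z * ?P)"
    using block_conjugate[OF R(1,3) zero_carrier_mat ZA(3) ZB(3) ZA(2) ZB(2)] block_conjugate[OF R(2,4) zero_carrier_mat ZA(3) ZB(3) ZA(2) ZB(2)]
      inverse_pairD[OF ZA(3)] inverse_pairD[OF ZB(2)] R
    by (simp add: block_rep_def ZA(1) ZB(1) z)
  moreover have "?Z \<in> pattern (u @ v)" by (rule block_rep_pattern[OF ZA(4) ZB(4)]) (simp add: mem_Rep)
  ultimately show ?thesis
    using inverse_pair_block[OF ZA(2) ZB(2)] inverse_pair_block[OF ZA(3) ZB(3)] unfolding variety_def count_list_append by blast
qed

text \<open>In a direct sum a set of columns splits into columns of the two summands, with disjoint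
  targets. The third hypothesis composes the two bounds.\<close>

lemma realizes_append:
  assumes u: "realizes TYPE('k::field) u R1" and v: "realizes TYPE('k) v R2"
    and R: "\<And>k c l d e. R1 k c \<Longrightarrow> R2 l d \<Longrightarrow> k \<le> count_list u vi \<Longrightarrow> l \<le> count_list v vi \<Longrightarrow> c + d \<le> e \<Longrightarrow> R (k + l) e"
  shows "realizes TYPE('k) (u @ v) R"
proof -
  let ?a = "count_list u vi" and ?b = "count_list u vj" and ?c = "count_list v vi" and ?d = "count_list v vj"
  obtain A \<xi> \<eta> where A: "(A :: 'k krep) \<in> variety u" "monomial ?a ?b (fst A) \<xi>" "monomial ?a ?b (snd A) \<eta>"
    "\<And>L. L \<subseteq> {..<?a} \<Longrightarrow> R1 (card L) (card (targets \<xi> \<eta> L))" using u unfolding realizes_def by blast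
  obtain B \<xi>' \<eta>' where B: "(B :: 'k krep) \<in> variety v" "monomial ?c ?d (fst B) \<xi>'" "monomial ?c ?d (snd B) \<eta>'"
    "\<And>L. L \<subseteq> {..<?c} \<Longrightarrow> R2 (card L) (card (targets \<xi>' \<eta>' L))" using v unfolding realizes_def by blast
  let ?Y = "(0\<^sub>m ?d ?a, 0\<^sub>m ?d ?a) :: 'k krep"
  have dims: "fst A \<in> carrier_mat ?b ?a" "snd A \<in> carrier_mat ?b ?a" "fst B \<in> carrier_mat ?d ?c" "snd B \<in> carrier_mat ?d ?c"
    using variety_Rep[OF A(1)] variety_Rep[OF B(1)] by (auto simp: mem_Rep)
  let ?X = "block_rep A ?Y B"
  have X: "?X \<in> variety (u @ v)" by (rule block_rep_variety[OF A(1) B(1)])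
  have fX: "fst ?X = four_block_mat (fst A) (0\<^sub>m ?b ?c) (0\<^sub>m ?d ?a) (fst B)" "snd ?X = four_block_mat (snd A) (0\<^sub>m ?b ?c) (0\<^sub>m ?d ?a) (snd B)"
    using dims by (simp_all add: block_rep_def)
  have "R (card L) (card (targets (shift_sum ?a ?b \<xi> \<xi>') (shift_sum ?a ?b \<eta> \<eta>') L))" if L: "L \<subseteq> {..<?a + ?c}" for L
  proof -
    define L1 where "L1 = L \<inter> {..<?a}"
    define L2 where "L2 = {t. ?a + t \<in> L}"
    have L2: "L2 \<subseteq> {..<?c}" using L by (auto simp: L2_def)
    have fin: "finite L1" "finite L2" using L2 by (auto simp: L1_def finite_subset)
    have "L = L1 \<union> (+) ?a ` L2"
    proof -
      have "x \<in> (+) ?a ` L2" if "x \<in> L" "\<not> x < ?a" for x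
        using that by (intro image_eqI[of _ _ "x - ?a"]) (auto simp: L2_def)
      then show ?thesis by (auto simp: L1_def L2_def)
    qed
    moreover have "L1 \<inter> (+) ?a ` L2 = {}" by (auto simp: L1_def)
    ultimately have "card L = card L1 + card L2" using fin by (simp add: card_Un_disjoint card_image)
    moreover have "card (targets \<xi> \<eta> L1) + card (targets \<xi>' \<eta>' L2) \<le> card (targets (shift_sum ?a ?b \<xi> \<xi>') (shift_sum ?a ?b \<eta> \<eta>') L)"
    proof -
      let ?T = "targets (shift_sum ?a ?b \<xi> \<xi>') (shift_sum ?a ?b \<eta> \<eta>') L"
      have sub: "targets \<xi> \<eta> L1 \<subseteq> {..<?b}" "targets \<xi>' \<eta>' L2 \<subseteq> {..<?d}"
        using monomialD(2)[OF A(2)] monomialD(2)[OF A(3)] monomialD(2)[OF B(2)] monomialD(2)[OF B(3)] L2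
        unfolding targets_def L1_def by blast+
      have "targets \<xi> \<eta> L1 \<union> (+) ?b ` targets \<xi>' \<eta>' L2 \<subseteq> ?T"
      proof -
        have "targets \<xi> \<eta> L1 \<subseteq> ?T" by (auto simp: targets_def L1_def shift_sum_def)
        moreover have "?b + r \<in> ?T" if "r \<in> targets \<xi>' \<eta>' L2" for r
          using that unfolding targets_def L2_def by (auto simp: shift_sum_def intro!: bexI[of _ "?a + _"])
        ultimately show ?thesis by auto
      qed
      moreover have "finite ?T"
      proof (rule finite_subset[of _ "{..<?b + ?d}"])
        show "?T \<subseteq> {..<?b + ?d}"
          using monomialD(2)[OF monomial_shift_sum[OF A(2) B(2)]] monomialD(2)[OF monomial_shift_sum[OF A(3) B(3)]] L
          unfolding targets_def by blast
      qed simp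
      moreover have "card (targets \<xi> \<eta> L1 \<union> (+) ?b ` targets \<xi>' \<eta>' L2) = card (targets \<xi> \<eta> L1) + card (targets \<xi>' \<eta>' L2)"
        using sub by (subst card_Un_disjoint) (auto simp: card_image finite_subset)
      ultimately show ?thesis using card_mono[of ?T "targets \<xi> \<eta> L1 \<union> (+) ?b ` targets \<xi>' \<eta>' L2"] by simp
    qed
    moreover have "card L1 \<le> ?a" "card L2 \<le> ?c"
      using card_mono[of "{..<?a}" L1] card_mono[of "{..<?c}" L2] L2 by (auto simp: L1_def)
    ultimately show ?thesis
      using assms(3)[OF A(4)[of L1] B(4)[of L2]] L2 by (simp add: L1_def)
  qed
  then show ?thesis unfolding realizes_def count_list_append
    using X monomial_shift_sum[OF A(2) B(2)] monomial_shift_sum[OF A(3) B(3)]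
    unfolding fX[symmetric] by blast
qed


lemma realizes_mono:
  "realizes T w R \<Longrightarrow> (\<And>k c. R k c \<Longrightarrow> R' k c) \<Longrightarrow> realizes T w R'"
  unfolding realizes_def by blast

lemma realizesI:
  fixes X :: "'k::field krep"
  assumes "variety w = (Rep (count_list w vi, count_list w vj) :: 'k krep set)"
    and \<xi>: "\<And>s r. s < count_list w vi \<Longrightarrow> \<xi> s = Some r \<Longrightarrow> r < count_list w vj"
      "\<And>s t q r. s < count_list w vi \<Longrightarrow> t < s \<Longrightarrow> \<xi> t = Some q \<Longrightarrow> \<xi> s = Some r \<Longrightarrow> q < r"
    and \<eta>: "\<And>s r. s < count_list w vi \<Longrightarrow> \<eta> s = Some r \<Longrightarrow> r < count_list w vj"
      "\<And>s t q r. s < count_list w vi \<Longrightarrow> t < s \<Longrightarrow> \<eta> t = Some q \<Longrightarrow> \<eta> s = Some r \<Longrightarrow> q < r"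
    and R: "\<And>L. L \<subseteq> {..<count_list w vi} \<Longrightarrow> R (card L) (card (targets \<xi> \<eta> L))"
  shows "realizes TYPE('k) w R"
proof -
  let ?a = "count_list w vi" and ?b = "count_list w vj"
  let ?X = "(mat ?b ?a (\<lambda>(r, s). of_bool (\<xi> s = Some r)), mat ?b ?a (\<lambda>(r, s). of_bool (\<eta> s = Some r))) :: 'k krep"
  have "?X \<in> variety w" by (simp add: assms(1) mem_Rep)
  moreover have "monomial ?a ?b (fst ?X) \<xi>" "monomial ?a ?b (snd ?X) \<eta>"
    unfolding monomial_def fst_conv snd_conv using \<xi> \<eta> by blast+
  ultimately show ?thesis unfolding realizes_def using R by blast
qed

lemma finite_targets: "finite L \<Longrightarrow> finite (targets \<xi> \<eta> L)"
proof -
  assume "finite L"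
  have "targets \<xi> \<eta> L \<subseteq> (\<lambda>s. the (\<xi> s)) ` L \<union> (\<lambda>s. the (\<eta> s)) ` L" by (force simp: targets_def)
  with \<open>finite L\<close> show ?thesis by (meson finite_UnI finite_imageI finite_subset)
qed

lemma realizes_reg_word: "realizes TYPE('k::alg_closed_field) (reg_word s) (\<lambda>k c. k \<le> c)"
proof (rule realizesI[where \<xi> = Some and \<eta> = Some])
  show "card L \<le> card (targets Some Some L)" for L
    by (simp add: targets_def)
qed (auto simp: variety_reg_word)

lemma realizes_proj_word: "realizes TYPE('k::alg_closed_field) (proj_word a) (\<lambda>k c. k + of_bool (0 < k) \<le> c)"
proof (rule realizesI[where \<xi> = Some and \<eta> = "\<lambda>s. Some (Suc s)"])
  fix L :: "nat set" assume "L \<subseteq> {..<count_list (proj_word a) vi}"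
  then have fin: "finite L" by (rule finite_subset) simp
  show "card L + of_bool (0 < card L) \<le> card (targets Some (\<lambda>s. Some (Suc s)) L)"
  proof (cases "L = {}")
    case False
    have "insert (Suc (Max L)) L \<subseteq> targets Some (\<lambda>s. Some (Suc s)) L"
      using Max_in[OF fin False] by (auto simp: targets_def)
    moreover have "Suc (Max L) \<notin> L" using Max_ge[OF fin, of "Suc (Max L)"] by auto
    ultimately show ?thesis
      using card_mono[OF finite_targets[OF fin], of "insert (Suc (Max L)) L" Some "\<lambda>s. Some (Suc s)"] fin
      by simp
  qed simp
qed (auto simp: variety_proj_word)

text \<open>If an index \<open>t\<close> is missing from the set, the columns below \<open>t\<close>
  follow the first matrix and those above it the second, with distinct targets. Only the full set
  loses one.\<close>

lemma realizes_inj_word: "realizes TYPE('k::alg_closed_field) (inj_word b) (\<lambda>k c. k \<le> c + of_bool (k = Suc b))"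
proof (rule realizesI[where \<xi> = "\<lambda>s. if s < b then Some s else None" and \<eta> = "\<lambda>s. if s = 0 then None else Some (s - 1)"])
  fix L :: "nat set" assume L: "L \<subseteq> {..<count_list (inj_word b) vi}"
  let ?T = "targets (\<lambda>s. if s < b then Some s else None) (\<lambda>s. if s = 0 then None else Some (s - 1)) L"
  have fin: "finite L" using L by (rule finite_subset) simp
  show "card L \<le> card ?T + of_bool (card L = Suc b)"
  proof (cases "L = {..<Suc b}")
    case True
    then have "r \<in> ?T" if "r < b" for r
      unfolding targets_def using that by (intro CollectI bexI[of _ r] disjI1) simp_all
    then have "{..<b} \<subseteq> ?T" by blast
    from card_mono[OF finite_targets[OF fin] this] have "b \<le> card ?T" by simp
    then show ?thesis using True by simp
  next
    case False
    with L obtain t where t: "t < Suc b" "t \<notin> L" by (metis count_words(6) lessThan_iff psubsetI psubset_imp_ex_mem DiffD1 DiffD2)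
    define L1 where "L1 = {s \<in> L. s < t}"
    define L2 where "L2 = {s \<in> L. t < s}"
    have f: "finite L1" "finite L2" using fin by (auto simp: L1_def L2_def)
    have "s < t \<or> t < s" if "s \<in> L" for s using that t(2) by (cases s t rule: linorder_cases) auto
    then have "L = L1 \<union> L2" unfolding L1_def L2_def by blast
    moreover have "L1 \<inter> L2 = {}" unfolding L1_def L2_def using less_asym by blast
    ultimately have "card L = card L1 + card L2" using f by (simp add: card_Un_disjoint)
    also have "card L2 = card ((\<lambda>s. s - 1) ` L2)"
      by (rule card_image[symmetric]) (auto simp: inj_on_def L2_def)
    also have "card L1 + card ((\<lambda>s. s - 1) ` L2) = card (L1 \<union> (\<lambda>s. s - 1) ` L2)"
      using f by (subst card_Un_disjoint) (auto simp: L1_def L2_def)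
    also have "\<dots> \<le> card ?T"
    proof (rule card_mono[OF finite_targets[OF fin]])
      have "r \<in> ?T" if "r \<in> L1" for r
        unfolding targets_def using that t(1) by (intro CollectI bexI[of _ r] disjI1) (simp_all add: L1_def)
      moreover have "r - 1 \<in> ?T" if "r \<in> L2" for r
        unfolding targets_def using that by (intro CollectI bexI[of _ r] disjI2) (simp_all add: L2_def)
      ultimately show "L1 \<union> (\<lambda>s. s - 1) ` L2 \<subseteq> ?T" by blast
    qed
    finally show ?thesis by simp
  qed
qed (auto simp: variety_inj_word split: if_splits)

text \<open>The last \<open>n\<close> entries are the smallest ones of the decreasing list
  \<open>bs\<close>, but the largest ones of the increasing list \<open>as\<close>.\<close>

definition weight_of_smallest :: "(nat \<Rightarrow> nat) \<Rightarrow> nat list \<Rightarrow> nat \<Rightarrow> nat" where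
  "weight_of_smallest f l n = sum_list (map f (take n (rev l)))"

lemma weight_of_smallest_Cons:
  "n \<le> length l \<Longrightarrow> weight_of_smallest f (x # l) n = weight_of_smallest f l n"
  "n \<ge> length l \<Longrightarrow> weight_of_smallest f l n = sum_list (map f l)"
  by (simp_all add: weight_of_smallest_def rev_map[symmetric])

lemma weight_of_smallest_Suc_le:
  assumes "sorted (rev (x # l))" "n \<le> length l" "mono f"
  shows "weight_of_smallest f (x # l) (Suc n) \<le> weight_of_smallest f l n + f x"
proof (cases "n = length l")
  case False
  then have n: "n < length l" using assms(2) by simp
  then have "rev l ! n \<le> x" using assms(1) nth_mem[of n "rev l"] by (auto simp: sorted_append)
  then show ?thesis using n monoD[OF assms(3)]
    by (simp add: weight_of_smallest_def take_Suc_conv_app_nth)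
qed (simp add: weight_of_smallest_def)

lemma weight_of_smallest_Suc_ge:
  assumes "sorted (x # l)" "n \<le> length l"
  shows "weight_of_smallest id l n + x \<le> weight_of_smallest id (x # l) (Suc n)"
proof (cases "n = length l")
  case False
  then have n: "n < length l" using assms(2) by simp
  then have "x \<le> rev l ! n" using assms(1) nth_mem[of n "rev l"] by (auto simp del: nth_mem)
  then show ?thesis using n
    by (simp add: weight_of_smallest_def take_Suc_conv_app_nth)
qed (simp add: weight_of_smallest_def)

lemma count_concat_words:
  "count_list (concat (map inj_word bs)) vi = sum_list (map Suc bs)"
  "count_list (concat (map inj_word bs)) vj = sum_list bs"
  "count_list (concat (map proj_word as) @ w) vi = sum_list as + count_list w vi"
  "count_list (concat (map proj_word as) @ w) vj = sum_list (map Suc as) + count_list w vj"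
proof -
  show "count_list (concat (map inj_word bs)) vi = sum_list (map Suc bs)"
    "count_list (concat (map inj_word bs)) vj = sum_list bs" by (induction bs) auto
  show "count_list (concat (map proj_word as) @ w) vi = sum_list as + count_list w vi"
    "count_list (concat (map proj_word as) @ w) vj = sum_list (map Suc as) + count_list w vj" by (induction as) auto
qed

lemma realizes_inj_words:
  assumes "sorted (rev bs)"
  shows "realizes TYPE('k::alg_closed_field) (concat (map inj_word bs))
    (\<lambda>k c. \<exists>F\<le>length bs. weight_of_smallest Suc bs F \<le> k \<and> k \<le> c + F)"
  using assms
proof (induction bs)
  case Nil
  show ?case using realizes_mono[OF realizes_reg_word[of 0]] by (simp add: weight_of_smallest_def)
next
  case (Cons b bs)
  have sorted: "sorted (rev bs)" using Cons.prems by (simp add: sorted_append)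
  show ?case unfolding list.map concat.simps
  proof (rule realizes_append[OF realizes_inj_word Cons.IH[OF sorted]])
    fix k c l d e
    assume k: "k \<le> c + of_bool (k = Suc b)" and l: "\<exists>F\<le>length bs. weight_of_smallest Suc bs F \<le> l \<and> l \<le> d + F" and e: "c + d \<le> e"
    from l obtain F where F: "F \<le> length bs" "weight_of_smallest Suc bs F \<le> l" "l \<le> d + F" by blast
    show "\<exists>F\<le>length (b # bs). weight_of_smallest Suc (b # bs) F \<le> k + l \<and> k + l \<le> e + F"
    proof (cases "k = Suc b")
      case True
      then show ?thesis using F k e weight_of_smallest_Suc_le[OF Cons.prems F(1), of Suc]
        by (intro exI[of _ "Suc F"]) (auto simp: mono_Suc)
    next
      case False
      then show ?thesis using F k e by (intro exI[of _ F]) (auto simp: weight_of_smallest_Cons(1))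
    qed
  qed
qed

text \<open>\<open>F\<close> counts the factors \<open>I_b\<close> taken completely, each losing one
  target, and \<open>T\<close> the factors \<open>P_a\<close> that are touched, each gaining one.
  Complete factors use at least the \<open>F\<close> smallest sizes and touched ones offer at most
  the \<open>T\<close> largest, which bounds \<open>k\<close> on both sides.\<close>

lemma realizes_normal_form:
  assumes "sorted as" "sorted (rev bs)"
  shows "realizes TYPE('k::alg_closed_field) (normal_form as s bs)
    (\<lambda>k c. \<exists>F\<le>length bs. \<exists>T\<le>length as. weight_of_smallest Suc bs F \<le> k \<and>
       k \<le> s + sum_list (map Suc bs) + weight_of_smallest id as T \<and> k + T \<le> c + F)"
  using assms(1)
proof (induction as)
  case Nil
  show ?case unfolding normal_form_def list.map concat.simps append_Nil
  proof (rule realizes_append[OF realizes_reg_word realizes_inj_words[OF assms(2)]])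
    fix k c l d e :: nat
    assume "k \<le> c" "\<exists>F\<le>length bs. weight_of_smallest Suc bs F \<le> l \<and> l \<le> d + F" "k \<le> count_list (reg_word s) vi"
      "l \<le> count_list (concat (map inj_word bs)) vi" "c + d \<le> e"
    then show "\<exists>F\<le>length bs. \<exists>T\<le>length ([] :: nat list). weight_of_smallest Suc bs F \<le> k + l \<and>
       k + l \<le> s + sum_list (map Suc bs) + weight_of_smallest id [] T \<and> k + l + T \<le> e + F"
      by (auto simp: count_concat_words)
  qed
next
  case (Cons a as)
  have n: "normal_form (a # as) s bs = proj_word a @ normal_form as s bs" by (simp add: normal_form_def)
  have "sorted as" using Cons.prems by simp
  show ?case unfolding n
  proof (rule realizes_append[OF realizes_proj_word Cons.IH[OF \<open>sorted as\<close>]])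
    fix k c l d e :: nat
    assume k: "k + of_bool (0 < k) \<le> c" "k \<le> count_list (proj_word a) vi"
      and l: "\<exists>F\<le>length bs. \<exists>T\<le>length as. weight_of_smallest Suc bs F \<le> l \<and>
       l \<le> s + sum_list (map Suc bs) + weight_of_smallest id as T \<and> l + T \<le> d + F" and e: "c + d \<le> e"
    from l obtain F T where FT: "F \<le> length bs" "T \<le> length as" "weight_of_smallest Suc bs F \<le> l"
       "l \<le> s + sum_list (map Suc bs) + weight_of_smallest id as T" "l + T \<le> d + F" by blast
    show "\<exists>F\<le>length bs. \<exists>T\<le>length (a # as). weight_of_smallest Suc bs F \<le> k + l \<and>
       k + l \<le> s + sum_list (map Suc bs) + weight_of_smallest id (a # as) T \<and> k + l + T \<le> e + F"
    proof (cases "k = 0")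
      case True
      then show ?thesis using FT k e by (intro exI[of _ F] conjI exI[of _ T]) (auto simp: weight_of_smallest_Cons(1))
    next
      case False
      then show ?thesis using FT k e weight_of_smallest_Suc_ge[OF Cons.prems FT(2)]
        by (intro exI[of _ F] conjI exI[of _ "Suc T"]) auto
    qed
  qed
qed


lemma profile_inj_words_le:
  assumes "1 \<le> k" "k \<le> sum_list (map Suc bs)" "weight_of_smallest Suc bs F \<le> k" "F \<le> length bs"
  shows "profile (concat (map inj_word bs)) ! (sum_list (map Suc bs) - k) + F \<le> k"
  using assms
proof (induction bs)
  case (Cons b bs)
  let ?w = "concat (map inj_word bs)" and ?N = "sum_list (map Suc bs)"
  have N: "?N = sum_list bs + length bs" by (induction bs) auto
  have p: "profile (concat (map inj_word (b # bs))) = map ((+) (sum_list bs)) (b # rev [1..<Suc b]) @ profile ?w"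
    by (simp add: profile_append profile_inj_word count_concat_words)
  show ?case
  proof (cases "k \<le> ?N")
    case True
    have "F \<le> length bs"
    proof (rule ccontr)
      assume "\<not> ?thesis"
      then have "weight_of_smallest Suc (b # bs) F = Suc b + ?N"
        using Cons.prems(4) by (subst weight_of_smallest_Cons(2)) auto
      then show False using Cons.prems(3) True by simp
    qed
    then have "profile ?w ! (?N - k) + F \<le> k"
      using Cons.IH[OF Cons.prems(1) True] Cons.prems(3) by (simp add: weight_of_smallest_Cons(1))
    moreover have e: "sum_list (map Suc (b # bs)) - k = Suc b + (?N - k)" using True by simp
    moreover have "profile (concat (map inj_word (b # bs))) ! (Suc b + (?N - k)) = profile ?w ! (?N - k)"
      using profile_nth_append(2)[of "inj_word b" ?w "?N - k"] by simp
    ultimately show ?thesis by (simp only:)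
  next
    case False
    define t where "t = k - ?N"
    have t: "k = ?N + t" "1 \<le> t" "t \<le> Suc b" using False Cons.prems(2) by (auto simp: t_def)
    have i: "sum_list (map Suc (b # bs)) - k = Suc b - t" using t by simp
    have "profile (concat (map inj_word (b # bs))) ! (Suc b - t) = sum_list bs + min t b"
    proof (cases "t = Suc b")
      case True
      then show ?thesis unfolding p by simp
    next
      case False
      then have "Suc b - t = Suc (b - t)" "b - t < b" "b - Suc (b - t) = t - 1" using t by auto
      then show ?thesis unfolding p using t(2) False t(3) by (simp add: nth_append rev_nth del: upt_Suc)
    qed
    moreover note i
    moreover have "F \<le> length bs \<or> F = Suc (length bs) \<and> t = Suc b"
    proof (cases "F \<le> length bs")
      case False
      then have "weight_of_smallest Suc (b # bs) F = Suc b + ?N"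
        using Cons.prems(4) by (subst weight_of_smallest_Cons(2)) auto
      then show ?thesis using Cons.prems(3,4) False t by simp
    qed simp
    ultimately show ?thesis using t N by auto
  qed
qed simp

text \<open>The suffix of a normal word with \<open>k\<close> letters i attains the least value of
  \<open>k + T - F\<close>, since from the right it completes the smallest \<open>I_b\<close> first
  and touches the largest \<open>P_a\<close> first.\<close>

lemma profile_normal_form_le:
  assumes "1 \<le> k" "k \<le> sum_list as + s + sum_list (map Suc bs)"
    and F: "weight_of_smallest Suc bs F \<le> k" "F \<le> length bs"
    and T: "k \<le> s + sum_list (map Suc bs) + weight_of_smallest id as T" "T \<le> length as"
  shows "profile (normal_form as s bs) ! (sum_list as + s + sum_list (map Suc bs) - k) + F \<le> k + T"
  using assms(1,2) T
proof (induction as arbitrary: T)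
  case Nil
  let ?w = "concat (map inj_word bs)" and ?N = "sum_list (map Suc bs)"
  have N: "?N = sum_list bs + length bs" by (induction bs) auto
  have p: "profile (normal_form [] s bs) = map ((+) (sum_list bs)) (rev [1..<Suc s]) @ profile ?w"
    by (simp add: normal_form_def profile_append profile_reg_word count_concat_words)
  show ?case
  proof (cases "k \<le> ?N")
    case True
    then have e: "sum_list [] + s + ?N - k = s + (?N - k)" by simp
    have "profile (normal_form [] s bs) ! (s + (?N - k)) = profile ?w ! (?N - k)"
      using profile_nth_append(2)[of "reg_word s" ?w "?N - k"] by (simp add: normal_form_def)
    then show ?thesis unfolding e using profile_inj_words_le[OF Nil(1) True F] by linarith
  next
    case False
    then have "s + ?N - k < s" "s - Suc (s + ?N - k) = k - ?N - 1" using Nil by auto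
    then have "profile (normal_form [] s bs) ! (s + ?N - k) = sum_list bs + (k - ?N)"
      using False by (simp add: p nth_append rev_nth del: upt_Suc)
    then show ?thesis using False N F(2) by simp
  qed
next
  case (Cons a as)
  let ?N = "sum_list as + s + sum_list (map Suc bs)"
  have N: "sum_list (map Suc bs) = sum_list bs + length bs" for bs by (induction bs) auto
  let ?c = "sum_list (map Suc as) + s + sum_list bs"
  have p: "profile (normal_form (a # as) s bs) = map ((+) ?c) (rev [Suc (Suc 0)..<Suc (Suc a)]) @ profile (normal_form as s bs)"
  proof -
    have c: "count_list (normal_form as s bs) vj = ?c"
      unfolding normal_form_def count_concat_words by (simp add: count_concat_words)
    have "normal_form (a # as) s bs = proj_word a @ normal_form as s bs" by (simp add: normal_form_def)
    then show ?thesis by (simp only: profile_append profile_proj_word c)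
  qed
  show ?case
  proof (cases "k \<le> ?N")
    case True
    then have e: "sum_list (a # as) + s + sum_list (map Suc bs) - k = a + (?N - k)" by simp
    have q: "profile (normal_form (a # as) s bs) ! (a + (?N - k)) = profile (normal_form as s bs) ! (?N - k)"
      using profile_nth_append(2)[of "proj_word a" "normal_form as s bs" "?N - k"] by (simp add: normal_form_def)
    show ?thesis
    proof (cases "T \<le> length as")
      case T: True
      then show ?thesis unfolding e q using Cons.IH[OF Cons.prems(1) True, of T] Cons.prems(3)
        by (simp only: weight_of_smallest_Cons(1))
    next
      case T: False
      have "k \<le> s + sum_list (map Suc bs) + weight_of_smallest id as (length as)"
        using True by (simp add: weight_of_smallest_Cons(2))
      then show ?thesis unfolding e q using Cons.IH[OF Cons.prems(1) True, of "length as"] T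
        by linarith
    qed
  next
    case False
    define t where "t = k - ?N"
    have t: "k = ?N + t" "1 \<le> t" "t \<le> a" using False Cons.prems(2) by (auto simp: t_def)
    then have i: "sum_list (a # as) + s + sum_list (map Suc bs) - k = a - t" by simp
    have "profile (normal_form (a # as) s bs) ! (a - t) = ?c + Suc t"
      using t by (simp add: p nth_append rev_nth del: upt_Suc)
    moreover have "T = Suc (length as)"
    proof (rule ccontr)
      assume "T \<noteq> Suc (length as)"
      then have "T \<le> length as" using Cons.prems(4) by simp
      moreover have "weight_of_smallest id as T \<le> sum_list as"
      proof -
        have "sum_list (rev as) = sum_list (take T (rev as)) + sum_list (drop T (rev as))"
          by (metis append_take_drop_id sum_list_append)
        then show ?thesis by (simp add: weight_of_smallest_def)
      qed
      ultimately show False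
        using Cons.prems(3) False weight_of_smallest_Cons(1)[of T as id a] by linarith
    qed
    ultimately show ?thesis unfolding i using t N[of as] N[of bs] F(2) by simp
  qed
qed

theorem variety_injective:
  assumes n: "n \<in> normal_words" "n' \<in> normal_words"
    and eq: "variety n = (variety n' :: 'k::alg_closed_field krep set)"
  shows "n = n'"
proof -
  have le: "word_le n w" if n: "n \<in> normal_words" and eq: "variety n = (variety w :: 'k krep set)" for n w
  proof -
    obtain as s bs where nf: "n = normal_form as s bs" "sorted as" "sorted (rev bs)"
      using n by (auto simp: normal_words_def)
    let ?N = "sum_list as + s + sum_list (map Suc bs)"
    have N: "count_list n vi = ?N"
      unfolding nf normal_form_def count_concat_words by (simp add: count_concat_words)
    obtain X :: "'k krep" and \<xi> \<eta> where X: "X \<in> variety n"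
      "monomial ?N (count_list n vj) (fst X) \<xi>" "monomial ?N (count_list n vj) (snd X) \<eta>"
      and R: "\<And>L. L \<subseteq> {..<?N} \<Longrightarrow> \<exists>F\<le>length bs. \<exists>T\<le>length as. weight_of_smallest Suc bs F \<le> card L \<and>
       card L \<le> s + sum_list (map Suc bs) + weight_of_smallest id as T \<and> card L + T \<le> card (targets \<xi> \<eta> L) + F"
      using realizes_normal_form[OF nf(2,3), of s, where 'k = 'k] unfolding realizes_def nf(1)[symmetric] N by blast
    have Xw: "X \<in> variety w" using X(1) eq by simp
    have c: "?N = count_list w vi" "count_list n vj = count_list w vj"
      using dimension_vector_Rep[OF variety_Rep[OF X(1)]] dimension_vector_Rep[OF variety_Rep[OF Xw]] N by auto
    have "profile n ! t \<le> profile w ! t" if t: "t < ?N" for t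
    proof -
      have t': "t < count_list w vi" using t c by simp
      \<comment> \<open>The flag given by \<open>w\<close> supplies columns with few targets,
        whereas \<open>realizes\<close> demands many; this compares the two profiles.\<close>
      obtain L where L: "L \<subseteq> {..<?N}" "card L = ?N - t" "card (targets \<xi> \<eta> L) \<le> profile w ! t"
        using monomial_variety_bound[OF Xw X(2)[unfolded c] X(3)[unfolded c] t'] unfolding c by blast
      obtain F T where FT: "F \<le> length bs" "T \<le> length as" "weight_of_smallest Suc bs F \<le> card L"
         "card L \<le> s + sum_list (map Suc bs) + weight_of_smallest id as T" "card L + T \<le> card (targets \<xi> \<eta> L) + F"
        using R[OF L(1)] by blast
      have "profile n ! (?N - card L) + F \<le> card L + T"
        unfolding nf(1) by (rule profile_normal_form_le) (use FT L t in auto)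
      then show ?thesis using FT(5) L(2,3) t by simp
    qed
    then show "word_le n w"
      unfolding word_le_def list_all2_conv_all_nth length_profile using c N by simp
  qed
  show ?thesis by (rule word_le_antisym[OF le[OF n(1) eq] le[OF n(2) eq[symmetric]]])
qed

section \<open>Free algebras and their ideals\<close>

text \<open>With concatenation as addition of exponents, the convolution product of finitely
  supported functions is the product of the free algebra.\<close>

instantiation list :: (type) monoid_add
begin
definition zero_list :: "'a list" where "zero_list = []"
definition plus_list :: "'a list \<Rightarrow> 'a list \<Rightarrow> 'a list" where "plus_list = (@)"
instance by standard (auto simp: zero_list_def plus_list_def)
end

lemma poly_mapping_induct [case_names zero add]:
  fixes f :: "'m \<Rightarrow>\<^sub>0 'r::comm_ring_1"
  assumes "P 0" "\<And>x a f. P f \<Longrightarrow> P (Poly_Mapping.single x a + f)"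
  shows "P f"
  using monoid_ring_induct[of f UNIV P] assms by simp

lemma single_mult: "Poly_Mapping.single u a * Poly_Mapping.single v b = Poly_Mapping.single (u @ v) (a * b :: 'r::comm_ring_1)"
  by (simp add: Poly_Mapping.mult_single plus_list_def)

lemma single_one: "(1 :: 'a list \<Rightarrow>\<^sub>0 'r::comm_ring_1) = Poly_Mapping.single [] 1"
  by (simp add: zero_list_def flip: single_one)

lemma free_monoid_simps [simp]:
  "carrier free_monoid = UNIV" "u \<otimes>\<^bsub>free_monoid\<^esub> v = u @ v" "\<one>\<^bsub>free_monoid\<^esub> = []"
  by (simp_all add: free_monoid_def)

lemma free_alg_simps:
  "f \<otimes>\<^bsub>monoid_ring free_monoid\<^esub> g = f * (g :: 'a list \<Rightarrow>\<^sub>0 'r::comm_ring_1)"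
  "\<one>\<^bsub>monoid_ring free_monoid\<^esub> = (1 :: 'a list \<Rightarrow>\<^sub>0 'r)"
  "carrier (monoid_ring free_monoid) = (UNIV :: ('a list \<Rightarrow>\<^sub>0 'r) set)"
proof -
  have "Poly_Mapping.single x a \<otimes>\<^bsub>monoid_ring free_monoid\<^esub> g = Poly_Mapping.single x a * g" for x and a :: 'r and g
    by (induction g rule: poly_mapping_induct)
      (simp_all add: monoid_ring_add_right distrib_left single_mult)
  note single = this
  show "f \<otimes>\<^bsub>monoid_ring free_monoid\<^esub> g = f * g"
    by (induction f rule: poly_mapping_induct) (simp_all add: monoid_ring_add_left distrib_right single)
  show "\<one>\<^bsub>monoid_ring free_monoid\<^esub> = (1 :: 'a list \<Rightarrow>\<^sub>0 'r)" by (simp add: single_one free_monoid_def)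
  show "carrier (monoid_ring free_monoid) = (UNIV :: ('a list \<Rightarrow>\<^sub>0 'r) set)" by (simp add: free_monoid_def)
qed

lemma ring_free_alg: "ring (monoid_ring free_monoid :: ('a list \<Rightarrow>\<^sub>0 'r::comm_ring_1) ring)"
proof -
  interpret monoid "free_monoid :: 'a list monoid" by unfold_locales (auto simp: free_monoid_def)
  show ?thesis by (rule ring_monoid_ring)
qed

definition two_sided :: "'a::ring_1 set \<Rightarrow> bool" where
  "two_sided I \<longleftrightarrow> 0 \<in> I \<and> (\<forall>x\<in>I. \<forall>y\<in>I. x + y \<in> I) \<and> (\<forall>x\<in>I. \<forall>a b. a * x * b \<in> I)"

lemma two_sidedD:
  assumes "two_sided I"
  shows "0 \<in> I" "x \<in> I \<Longrightarrow> y \<in> I \<Longrightarrow> x + y \<in> I" "x \<in> I \<Longrightarrow> a * x * b \<in> I" "x \<in> I \<Longrightarrow> a * x \<in> I"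
    "x \<in> I \<Longrightarrow> x * b \<in> I" "x \<in> I \<Longrightarrow> - x \<in> I" "x \<in> I \<Longrightarrow> y \<in> I \<Longrightarrow> x - y \<in> I"
proof -
  note s = assms[unfolded two_sided_def]
  show m: "a * x * b \<in> I" if "x \<in> I" for a x b using s that by blast
  show "a * x \<in> I" "x * b \<in> I" and u: "- x \<in> I" if "x \<in> I" for a b x using m[OF that, of a 1] m[OF that, of 1 b] m[OF that, of "-1" 1] by simp_all
  show a: "x + y \<in> I" if "x \<in> I" "y \<in> I" for x y using s that by blast+
  show "0 \<in> I" using s by blast
  show "x - y \<in> I" if "x \<in> I" "y \<in> I" using a[OF that(1) u[OF that(2)]] by simp
qed

lemma ideal_free_alg_iff: "ideal I (monoid_ring free_monoid) \<longleftrightarrow> two_sided (I :: ('a list \<Rightarrow>\<^sub>0 'r::comm_ring_1) set)"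
proof
  let ?R = "monoid_ring free_monoid :: ('a list \<Rightarrow>\<^sub>0 'r) ring"
  assume "ideal I ?R"
  then interpret ideal I ?R .
  note sub = is_additive_subgroup
  show "two_sided I" unfolding two_sided_def
  proof (intro conjI ballI allI)
    show "0 \<in> I" using additive_subgroup.zero_closed[OF sub] by simp
    show "x + y \<in> I" if "x \<in> I" "y \<in> I" for x y using additive_subgroup.a_closed[OF sub that] by simp
    show "a * x * b \<in> I" if "x \<in> I" for a x b
      using I_r_closed[OF I_l_closed[OF that, of a], of b] by (simp only: free_alg_simps UNIV_I)
  qed
next
  let ?R = "monoid_ring free_monoid :: ('a list \<Rightarrow>\<^sub>0 'r) ring"
  assume I: "two_sided I"
  interpret ring ?R by (rule ring_free_alg)
  show "ideal I ?R"
  proof (rule idealI[OF ring_free_alg])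
    show "subgroup I (add_monoid ?R)"
    proof (rule add.subgroupI)
      show "I \<noteq> {}" using two_sidedD(1)[OF I] by blast
      fix x y assume x: "x \<in> I"
      have "\<ominus>\<^bsub>?R\<^esub> x = - x" by (rule minus_equality) simp_all
      then show "\<ominus>\<^bsub>?R\<^esub> x \<in> I" using two_sidedD(6)[OF I x] by simp
      show "x \<oplus>\<^bsub>?R\<^esub> y \<in> I" if "y \<in> I" using two_sidedD(2)[OF I x that] by simp
    qed simp
    show "x \<otimes>\<^bsub>?R\<^esub> a \<in> I" "a \<otimes>\<^bsub>?R\<^esub> x \<in> I" if "a \<in> I" for a x
      using two_sidedD(4,5)[OF I that] by (simp_all only: free_alg_simps)
  qed
qed

lemma two_sided_rel_ideal: "two_sided rel_ideal"
  unfolding rel_ideal_def ideal_free_alg_iff[symmetric]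
  by (rule ring.genideal_ideal[OF ring_free_alg]) simp

lemma rel_in_rel_ideal: "rel_i \<in> rel_ideal" "rel_j \<in> rel_ideal"
  using ring.genideal_self[OF ring_free_alg, of "{rel_i, rel_j}"] by (simp_all add: rel_ideal_def)

lemma rel_ideal_least: "two_sided I \<Longrightarrow> rel_i \<in> I \<Longrightarrow> rel_j \<in> I \<Longrightarrow> rel_ideal \<subseteq> I"
  unfolding rel_ideal_def by (rule ring.genideal_minimal[OF ring_free_alg]) (simp_all add: ideal_free_alg_iff)

section \<open>Additive functionals and the integral form of the free algebra\<close>

definition psum :: "('m \<Rightarrow> 'r::zero \<Rightarrow> 'b::comm_monoid_add) \<Rightarrow> ('m \<Rightarrow>\<^sub>0 'r) \<Rightarrow> 'b" where
  "psum F f = (\<Sum>w\<in>Poly_Mapping.keys f. F w (Poly_Mapping.lookup f w))"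

lemma psum_superset:
  assumes "finite A" "Poly_Mapping.keys f \<subseteq> A" "\<And>w. F w 0 = 0"
  shows "psum F f = (\<Sum>w\<in>A. F w (Poly_Mapping.lookup f w))"
  unfolding psum_def by (rule sum.mono_neutral_left) (use assms in \<open>auto simp: in_keys_iff\<close>)

lemma psum_zero [simp]: "psum F 0 = 0"
  by (simp add: psum_def)

lemma psum_single: "F w 0 = 0 \<Longrightarrow> psum F (Poly_Mapping.single w a) = F w a"
  by (simp add: psum_def)

lemma psum_add:
  fixes f g :: "'m \<Rightarrow>\<^sub>0 'r::comm_ring_1"
  assumes "\<And>w. F w 0 = 0" "\<And>w a b. F w (a + b) = F w a + F w b"
  shows "psum F (f + g) = psum F f + psum F g"
proof -
  let ?A = "Poly_Mapping.keys f \<union> Poly_Mapping.keys g"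
  have "psum F h = (\<Sum>w\<in>?A. F w (Poly_Mapping.lookup h w))" if "Poly_Mapping.keys h \<subseteq> ?A" for h
    by (rule psum_superset) (use that assms in auto)
  then show ?thesis using Poly_Mapping.keys_add[of f g] by (simp add: lookup_add assms(2) sum.distrib)
qed

definition emb :: "('m \<Rightarrow>\<^sub>0 rat poly) \<Rightarrow> ('m \<Rightarrow>\<^sub>0 rat poly fract)" where
  "emb f = psum (\<lambda>w p. Poly_Mapping.single w (Fraction_Field.Fract p 1)) f"

lemma Fract_hom:
  "Fraction_Field.Fract (0 :: rat poly) 1 = 0" "Fraction_Field.Fract (1 :: rat poly) 1 = 1"
  "Fraction_Field.Fract (p + q) 1 = Fraction_Field.Fract p 1 + Fraction_Field.Fract (q :: rat poly) 1"
  "Fraction_Field.Fract (p * q) 1 = Fraction_Field.Fract p 1 * Fraction_Field.Fract (q :: rat poly) 1"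
  by (simp_all add: Zero_fract_def One_fract_def)

lemma Fract_eq_0: "Fraction_Field.Fract p 1 = 0 \<longleftrightarrow> p = (0 :: rat poly)"
  by (simp add: Zero_fract_def eq_fract)

lemma emb_zero [simp]: "emb 0 = 0"
  by (simp add: emb_def)

lemma emb_single: "emb (Poly_Mapping.single w p) = Poly_Mapping.single w (Fraction_Field.Fract p 1)"
  by (simp add: emb_def psum_single Fract_hom)

lemma emb_add: "emb (f + g) = emb f + emb g"
  unfolding emb_def by (rule psum_add) (simp_all only: Fract_hom single_add single_zero)

lemma emb_mult: "emb (f * g) = emb f * (emb g :: 'a list \<Rightarrow>\<^sub>0 _)"
proof -
  have "emb (Poly_Mapping.single x a * g) = emb (Poly_Mapping.single x a) * emb g" for x :: "'a list" and a g
    by (induction g rule: poly_mapping_induct)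
      (simp_all add: distrib_left emb_add emb_single single_mult)
  then show ?thesis by (induction f rule: poly_mapping_induct) (simp_all add: emb_add distrib_right)
qed

lemma emb_one: "emb (1 :: 'a list \<Rightarrow>\<^sub>0 _) = 1"
  by (simp add: single_one emb_single Fract_hom)

lemma emb_minus: "emb (- f) = - emb f" "emb (f - g) = emb f - emb g"
proof -
  show "emb (- f) = - emb f" for f :: "'a \<Rightarrow>\<^sub>0 rat poly" using emb_add[of "- f" f] by (simp add: eq_neg_iff_add_eq_0)
  from emb_add[of f "- g"] this[of g] show "emb (f - g) = emb f - emb g" by simp
qed

lemma lookup_emb:
  fixes f :: "'m \<Rightarrow>\<^sub>0 rat poly"
  shows "Poly_Mapping.lookup (emb f) w = Fraction_Field.Fract (Poly_Mapping.lookup f w) 1"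
  by (induction f rule: poly_mapping_induct) (simp_all add: emb_add emb_single lookup_add Fract_hom(1) lookup_single when_def)

text \<open>Naturality in the coefficient ring serves twice: from Q[q] into Q(q), where the action
  satisfies the Serre relations, and from Q[q] to Q by \<open>q = 0\<close>, where the values
  compare words.\<close>

lemma word_value_hom:
  fixes \<kappa> :: "'a::comm_ring_1 \<Rightarrow> 'b::comm_ring_1"
  assumes "\<kappa> 0 = 0" "\<kappa> 1 = 1" "\<And>x y. \<kappa> (x + y) = \<kappa> x + \<kappa> y" "\<And>x y. \<kappa> (x * y) = \<kappa> x * \<kappa> y"
  shows "\<kappa> (word_value q w m) = word_value (\<kappa> q) w m"
proof -
  have sum: "\<kappa> (sum f A) = (\<Sum>x\<in>A. \<kappa> (f x))" for f and A :: "nat set"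
    by (induction A rule: infinite_finite_induct) (simp_all add: assms)
  have pow: "\<kappa> (x ^ n) = \<kappa> x ^ n" for x n by (induction n) (simp_all add: assms)
  have qn: "\<kappa> (qnum q n) = qnum (\<kappa> q) n" for n by (simp add: qnum_def sum pow)
  have bc: "\<kappa> (block_coeff q c g) = block_coeff (\<kappa> q) c g" for c g
    by (cases "(q, c, g)" rule: block_coeff.cases) (simp_all add: assms qn)
  show ?thesis by (induction w arbitrary: m) (simp_all add: assms sum pow bc)
qed

lemma psum_minus:
  fixes f g :: "'m \<Rightarrow>\<^sub>0 'r::comm_ring_1" and F :: "'m \<Rightarrow> 'r \<Rightarrow> 'b::ab_group_add"
  assumes "\<And>w. F w 0 = 0" "\<And>w a b. F w (a + b) = F w a + F w b"
  shows "psum F (f - g) = psum F f - psum F g"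
  using psum_add[of F "f - g" g, OF assms] by (simp add: algebra_simps)

lemma psum_sandwich:
  fixes r :: "'a list \<Rightarrow>\<^sub>0 'r::comm_ring_1"
  assumes F: "\<And>w. F w 0 = 0" "\<And>w a b. F w (a + b) = F w a + F w b"
    and s: "\<And>x a y b. psum F (Poly_Mapping.single x a * r * Poly_Mapping.single y b) = 0"
  shows "psum F (g * r * h) = 0"
proof -
  have "psum F (Poly_Mapping.single x a * r * h) = 0" for x a
    by (induction h rule: poly_mapping_induct) (simp_all add: distrib_left psum_add[OF F] s)
  then show ?thesis
    by (induction g rule: poly_mapping_induct) (simp_all add: distrib_right psum_add[OF F])
qed

lemma ordered_list_valid:
  assumes "ordered_list m"
  shows "valid_list m"
proof -
  have 1: "fst g \<longrightarrow> fst h" if "ordered g h" for g h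
    using that by (cases g; cases h; cases "fst g"; cases "fst h") simp_all
  have m: "\<forall>g\<in>set m. valid_block g" "sorted_wrt ordered m" using assms unfolding ordered_list_def by blast+
  have "sorted_wrt (\<lambda>g h. fst g \<longrightarrow> fst h) m"
    by (rule sorted_wrt_mono_rel[OF 1 m(2)])
  then show ?thesis unfolding valid_list_def using m(1) by (intro conjI)
qed

lemma qvar_nonzero: "qvar \<noteq> 0"
  by (simp add: Fract_eq_0)

text \<open>The elements annihilated in every two-sided context form an ideal, and it contains both
  generators because the action satisfies the Serre relations.\<close>

lemma rel_ideal_word_act:
  assumes "F \<in> rel_ideal"
  shows "psum (\<lambda>w c. c * word_act qvar w m) F = 0"
proof -
  let ?\<Phi> = "psum (\<lambda>w c. c * word_act qvar w m) :: (vertex list \<Rightarrow>\<^sub>0 rat poly fract) \<Rightarrow> _"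
  have A: "(0 :: rat poly fract) * x = 0" "(a + b) * x = a * x + b * x" for a b x :: "rat poly fract"
    by (simp_all add: distrib_right)
  let ?I = "{F. \<forall>g h. ?\<Phi> (g * F * h) = 0}"
  note simps = psum_add[of "\<lambda>w c. c * word_act qvar w m", OF A] psum_minus[of "\<lambda>w c. c * word_act qvar w m", OF A]
    psum_single[of "\<lambda>w c. c * word_act qvar w m", OF A(1)]
  have "two_sided ?I" unfolding two_sided_def
  proof (intro conjI ballI allI CollectI)
    show "?\<Phi> (g * 0 * h) = 0" for g h by simp
    show "?\<Phi> (g * (x + y) * h) = 0" if "x \<in> ?I" "y \<in> ?I" for x y g h
      using that by (simp add: distrib_left distrib_right simps)
    show "?\<Phi> (g * (a * x * b) * h) = 0" if "x \<in> ?I" for a x b g h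
    proof -
      have "?\<Phi> ((g * a) * x * (b * h)) = 0" using that by blast
      then show ?thesis by (simp only: mult.assoc)
    qed
  qed
  moreover have "rel_i \<in> ?I" "rel_j \<in> ?I"
  proof -
    note serre = word_act_serre[OF qvar_nonzero, of _ _ m]
    have "?\<Phi> (Poly_Mapping.single x a * rel_i * Poly_Mapping.single y b) = 0" for x a y b
    proof -
      have "?\<Phi> (Poly_Mapping.single x a * rel_i * Poly_Mapping.single y b) =
        a * b * (word_act qvar (x @ [vi,vi,vi,vj] @ y) m - (qvar^2 + qvar + 1) * word_act qvar (x @ [vi,vi,vj,vi] @ y) m
     + qvar * (qvar^2 + qvar + 1) * word_act qvar (x @ [vi,vj,vi,vi] @ y) m - qvar^3 * word_act qvar (x @ [vj,vi,vi,vi] @ y) m)"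
        unfolding rel_i_def left_diff_distrib right_diff_distrib distrib_left distrib_right single_mult simps
        by (simp add: algebra_simps)
      then show ?thesis unfolding serre(1) by simp
    qed
    then show "rel_i \<in> ?I" using psum_sandwich[of "\<lambda>w c. c * word_act qvar w m", OF A] by blast
    have "?\<Phi> (Poly_Mapping.single x a * rel_j * Poly_Mapping.single y b) = 0" for x a y b
    proof -
      have "?\<Phi> (Poly_Mapping.single x a * rel_j * Poly_Mapping.single y b) =
        a * b * (word_act qvar (x @ [vi,vj,vj,vj] @ y) m - (qvar^2 + qvar + 1) * word_act qvar (x @ [vj,vi,vj,vj] @ y) m
     + qvar * (qvar^2 + qvar + 1) * word_act qvar (x @ [vj,vj,vi,vj] @ y) m - qvar^3 * word_act qvar (x @ [vj,vj,vj,vi] @ y) m)"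
        unfolding rel_j_def left_diff_distrib right_diff_distrib distrib_left distrib_right single_mult simps
        by (simp add: algebra_simps)
      then show ?thesis unfolding serre(2) by simp
    qed
    then show "rel_j \<in> ?I" using psum_sandwich[of "\<lambda>w c. c * word_act qvar w m", OF A] by blast
  qed
  ultimately have "F \<in> ?I" using rel_ideal_least assms by blast
  then have "?\<Phi> (1 * F * 1) = 0" by blast
  then show ?thesis by simp
qed

definition word_count :: "vertex list \<Rightarrow> (vertex list \<Rightarrow>\<^sub>0 rat poly) \<Rightarrow> rat" where
  "word_count n = psum (\<lambda>w p. poly p 0 * of_bool (word_le n w))"

lemma word_count_simps:
  "word_count n 0 = 0" "word_count n (f + g) = word_count n f + word_count n g"
  "word_count n (f - g) = word_count n f - word_count n g"
  "word_count n (Poly_Mapping.single w p) = poly p 0 * of_bool (word_le n w)"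
  unfolding word_count_def by (simp_all add: psum_add psum_minus psum_single distrib_right)

text \<open>After multiplication by \<open>q ^ defect\<close>, the vanishing sum over Q(q) is an
  identity between polynomials, which can be evaluated at 0.\<close>

lemma rel_ideal_word_count:
  assumes f: "emb f \<in> rel_ideal" and n: "n \<in> normal_words"
  shows "word_count n f = 0"
proof -
  obtain as s bs where nf: "n = normal_form as s bs" "sorted as" "sorted (rev bs)"
    using n by (auto simp: normal_words_def)
  let ?m = "normal_blocks as s bs" and ?x = "[:0, 1:] :: rat poly"
  have m: "valid_list ?m" by (rule ordered_list_valid[OF ordered_normal_blocks[OF nf(2,3)]])
  let ?A = "Poly_Mapping.keys f" and ?l = "Poly_Mapping.lookup f"
  have keys: "Poly_Mapping.keys (emb f) \<subseteq> ?A"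
    by (auto simp: in_keys_iff lookup_emb Fract_hom(1))
  have Fract_sum: "(\<Sum>w\<in>A. Fraction_Field.Fract (g w) 1) = Fraction_Field.Fract (\<Sum>w\<in>A. g w) (1 :: rat poly)" for g and A :: "vertex list set"
    by (induction A rule: infinite_finite_induct) (simp_all add: Fract_hom(1,3) del: add_fract)
  have "0 = qvar ^ defect ?m * psum (\<lambda>w c. c * word_act qvar w ?m) (emb f)"
    using rel_ideal_word_act[OF f] by simp
  also have "\<dots> = qvar ^ defect ?m * (\<Sum>w\<in>?A. Fraction_Field.Fract (?l w) 1 * word_act qvar w ?m)"
    by (subst psum_superset[OF _ keys]) (simp_all add: lookup_emb)
  also have "\<dots> = (\<Sum>w\<in>?A. Fraction_Field.Fract (?l w) 1 * word_value qvar w ?m)"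
    unfolding word_value_act[OF qvar_nonzero m] by (simp only: sum_distrib_left mult.left_commute)
  also have "\<dots> = (\<Sum>w\<in>?A. Fraction_Field.Fract (?l w * word_value ?x w ?m) 1)"
    using word_value_hom[of "\<lambda>p. Fraction_Field.Fract p 1" ?x _ ?m] by (simp only: Fract_hom)
  finally have "(\<Sum>w\<in>?A. ?l w * word_value ?x w ?m) = 0" unfolding Fract_sum by (simp add: Fract_eq_0)
  then have "poly (\<Sum>w\<in>?A. ?l w * word_value ?x w ?m) 0 = 0" by simp
  then have "(\<Sum>w\<in>?A. poly (?l w) 0 * poly (word_value ?x w ?m) 0) = 0" by (simp add: poly_sum)
  moreover have "poly (word_value ?x w ?m) 0 = of_bool (word_le n w)" for w
    using word_value_hom[of "\<lambda>p. poly p 0" ?x w ?m] word_value_normal_blocks[OF nf(2,3), of w s] by (simp add: nf(1))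
  ultimately show ?thesis by (simp add: word_count_def psum_def)
qed

text \<open>What the functionals of the normal words do not detect in any context. It bounds from
  above all relations that can hold in the quotient of \<open>C0\<close>.\<close>

definition null_ideal :: "(vertex list \<Rightarrow>\<^sub>0 rat poly) set" where
  "null_ideal = {f. \<forall>n\<in>normal_words. \<forall>g h. word_count n (g * f * h) = 0}"

lemma two_sided_null_ideal: "two_sided null_ideal"
  unfolding two_sided_def
proof (intro conjI ballI allI)
  show "0 \<in> null_ideal" by (simp add: null_ideal_def word_count_simps)
  show "x + y \<in> null_ideal" if "x \<in> null_ideal" "y \<in> null_ideal" for x y
    using that by (simp add: null_ideal_def distrib_left distrib_right word_count_simps)
  show "a * x * b \<in> null_ideal" if "x \<in> null_ideal" for a x b unfolding null_ideal_def
  proof (intro CollectI ballI allI)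
    fix n g h assume "n \<in> normal_words"
    then have "word_count n ((g * a) * x * (b * h)) = 0" using that unfolding null_ideal_def by blast
    then show "word_count n (g * (a * x * b) * h) = 0" by (simp only: mult.assoc)
  qed
qed

lemma null_ideal_word_count: "f \<in> null_ideal \<Longrightarrow> n \<in> normal_words \<Longrightarrow> word_count n f = 0"
proof -
  assume "f \<in> null_ideal" "n \<in> normal_words"
  then have "word_count n (1 * f * 1) = 0" unfolding null_ideal_def by blast
  then show ?thesis by simp
qed

lemma rel_ideal_null: "emb f \<in> rel_ideal \<Longrightarrow> f \<in> null_ideal"
  unfolding null_ideal_def
  using rel_ideal_word_count two_sidedD(3)[OF two_sided_rel_ideal] by (simp add: emb_mult)

abbreviation qZ :: "vertex list \<Rightarrow>\<^sub>0 rat poly" where "qZ \<equiv> Poly_Mapping.single [] [:0, 1:]"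

lemma scalar_central:
  fixes f :: "'a list \<Rightarrow>\<^sub>0 'r::comm_ring_1"
  shows "Poly_Mapping.single [] c * f = f * Poly_Mapping.single [] c"
  by (induction f rule: poly_mapping_induct) (simp_all add: distrib_left distrib_right single_mult mult.commute)

lemma qZ_null: "qZ * f \<in> null_ideal"
proof -
  have "word_count n (qZ * g) = 0" for n g
    by (induction g rule: poly_mapping_induct) (simp_all add: distrib_left word_count_simps single_mult)
  moreover have "g * (qZ * f) * h = qZ * (g * f * h)" for g h
    using scalar_central[of "[:0, 1:]" g] by (simp add: mult.assoc) (simp flip: mult.assoc)
  ultimately show ?thesis by (simp add: null_ideal_def)
qed

lemma reg_word_null:
  "Poly_Mapping.single (reg_word m) 1 - Poly_Mapping.single (replicate m vi @ replicate m vj) 1 \<in> null_ideal"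
  unfolding null_ideal_def word_count_def
proof (intro CollectI ballI allI)
  fix n g h assume n: "n \<in> normal_words"
  let ?F = "\<lambda>w p. poly p 0 * of_bool (word_le n w) :: rat"
  have A: "?F w 0 = 0" "?F w (a + b) = ?F w a + ?F w b" for w a b by (simp_all add: distrib_right)
  show "psum ?F (g * (Poly_Mapping.single (reg_word m) 1 - Poly_Mapping.single (replicate m vi @ replicate m vj) 1) * h) = 0"
  proof (rule psum_sandwich[OF A])
    fix x a y b
    show "psum ?F (Poly_Mapping.single x a * (Poly_Mapping.single (reg_word m) 1 -
        Poly_Mapping.single (replicate m vi @ replicate m vj) 1) * Poly_Mapping.single y b) = 0"
      unfolding left_diff_distrib right_diff_distrib single_mult psum_minus[of ?F, OF A] psum_single[of ?F, OF A(1)]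
      using word_le_reg_word[OF n, of x m y] by simp
  qed
qed

lemma one_not_null: "1 \<notin> null_ideal"
proof
  assume "1 \<in> null_ideal"
  moreover have n: "[] \<in> normal_words" unfolding normal_words_def normal_form_def
    by (rule CollectI, rule exI[of _ "[]"], rule exI[of _ 0], rule exI[of _ "[]"]) simp
  ultimately have "word_count [] 1 = 0" by (rule null_ideal_word_count)
  then show False by (simp add: single_one word_count_simps word_le_refl)
qed

lemma one_not_rel_ideal: "1 \<notin> rel_ideal"
  using rel_ideal_null[of 1] one_not_null by (auto simp: emb_one)

lemma two_sided_equivp:
  assumes "two_sided I"
  shows "equivp (\<lambda>f g. f - g \<in> I)"
proof (rule equivpI)
  show "reflp (\<lambda>f g. f - g \<in> I)" using two_sidedD(1)[OF assms] by (simp add: reflp_def)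
  show "symp (\<lambda>f g. f - g \<in> I)"
  proof (rule sympI)
    fix x y assume "x - y \<in> I"
    from two_sidedD(6)[OF assms this] show "y - x \<in> I" by simp
  qed
  show "transp (\<lambda>f g. f - g \<in> I)"
  proof (rule transpI)
    fix x y z assume "x - y \<in> I" "y - z \<in> I"
    from two_sidedD(2)[OF assms this] show "x - z \<in> I" by simp
  qed
qed

lemma two_sided_respects:
  assumes "two_sided I" "f - f' \<in> I" "g - g' \<in> I"
  shows "(f + g) - (f' + g') \<in> I" "(f - g) - (f' - g') \<in> I" "- f - (- f') \<in> I" "f * g - f' * g' \<in> I"
proof -
  note D = two_sidedD[OF assms(1)]
  show "(f + g) - (f' + g') \<in> I" using D(2)[OF assms(2,3)] by (simp add: algebra_simps)
  show "(f - g) - (f' - g') \<in> I" using D(7)[OF assms(2,3)] by (simp add: algebra_simps)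
  show "- f - (- f') \<in> I" using D(6)[OF assms(2)] by simp
  have "f * (g - g') + (f - f') * g' \<in> I" using D(2)[OF D(4)[OF assms(3)] D(5)[OF assms(2)]] .
  then show "f * g - f' * g' \<in> I" by (simp add: algebra_simps)
qed

\<comment> \<open>A copy of \<open>C'q\<close> as a type, so that identities in arbitrary rings
  apply to it; \<open>reg_alg\<close> does the same for the quotient of \<open>C0\<close>. The class
  requires \<open>1\<close> to be nonzero, which the functional of the empty word
  guarantees.\<close>
quotient_type serre_alg = "vertex list \<Rightarrow>\<^sub>0 rat poly fract" / "\<lambda>f g. f - g \<in> rel_ideal"
  by (rule two_sided_equivp[OF two_sided_rel_ideal])

instantiation serre_alg :: ring_1
begin
lift_definition zero_serre_alg :: serre_alg is 0 .
lift_definition one_serre_alg :: serre_alg is 1 .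
lift_definition plus_serre_alg :: "serre_alg \<Rightarrow> serre_alg \<Rightarrow> serre_alg" is "(+)"
  by (rule two_sided_respects[OF two_sided_rel_ideal])
lift_definition minus_serre_alg :: "serre_alg \<Rightarrow> serre_alg \<Rightarrow> serre_alg" is "(-)"
  by (rule two_sided_respects[OF two_sided_rel_ideal])
lift_definition uminus_serre_alg :: "serre_alg \<Rightarrow> serre_alg" is uminus
  by (rule two_sided_respects[OF two_sided_rel_ideal, where g = 0 and g' = 0]) (use two_sidedD(1)[OF two_sided_rel_ideal] in auto)
lift_definition times_serre_alg :: "serre_alg \<Rightarrow> serre_alg \<Rightarrow> serre_alg" is "(*)"
  by (rule two_sided_respects[OF two_sided_rel_ideal])
instance
  by standard (transfer; use one_not_rel_ideal two_sidedD(1,6)[OF two_sided_rel_ideal] in \<open>force simp: algebra_simps\<close>)+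
end

section \<open>The algebra \<open>C\<^sub>0\<close> as a quotient of the integral free algebra\<close>

text \<open>The bridge from rings given by a type to rings with a carrier set.\<close>

definition typed_hom :: "('b, 'z) ring_scheme \<Rightarrow> ('a::ring_1 \<Rightarrow> 'b) \<Rightarrow> bool" where
  "typed_hom R \<kappa> \<longleftrightarrow> ring R \<and> (\<forall>f. \<kappa> f \<in> carrier R) \<and> \<kappa> 1 = \<one>\<^bsub>R\<^esub> \<and>
     (\<forall>f g. \<kappa> (f + g) = \<kappa> f \<oplus>\<^bsub>R\<^esub> \<kappa> g) \<and> (\<forall>f g. \<kappa> (f * g) = \<kappa> f \<otimes>\<^bsub>R\<^esub> \<kappa> g)"

lemma typed_homD:
  assumes "typed_hom R \<kappa>"
  shows "ring R" "\<kappa> f \<in> carrier R" "\<kappa> 1 = \<one>\<^bsub>R\<^esub>" "\<kappa> (f + g) = \<kappa> f \<oplus>\<^bsub>R\<^esub> \<kappa> g" "\<kappa> (f * g) = \<kappa> f \<otimes>\<^bsub>R\<^esub> \<kappa> g"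
    "\<kappa> 0 = \<zero>\<^bsub>R\<^esub>" "\<kappa> (- f) = \<ominus>\<^bsub>R\<^esub> \<kappa> f" "\<kappa> (f - g) = \<kappa> f \<ominus>\<^bsub>R\<^esub> \<kappa> g" "\<kappa> (f ^ n) = \<kappa> f [^]\<^bsub>R\<^esub> (n :: nat)"
proof -
  note t = assms[unfolded typed_hom_def]
  show R: "ring R" and c: "\<kappa> f \<in> carrier R" and 1: "\<kappa> 1 = \<one>\<^bsub>R\<^esub>" for f using t by blast+
  show a: "\<kappa> (f + g) = \<kappa> f \<oplus>\<^bsub>R\<^esub> \<kappa> g" and m: "\<kappa> (f * g) = \<kappa> f \<otimes>\<^bsub>R\<^esub> \<kappa> g" for f g using t by blast+
  interpret ring R by (rule R)
  have "\<kappa> 0 = \<kappa> 0 \<oplus>\<^bsub>R\<^esub> \<kappa> 0" using a[of 0 0] by simp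
  then show 0: "\<kappa> 0 = \<zero>\<^bsub>R\<^esub>" using c[of 0] add.l_cancel_one'[of "\<kappa> 0" "\<kappa> 0"] by simp
  show u: "\<kappa> (- f) = \<ominus>\<^bsub>R\<^esub> \<kappa> f" for f
  proof -
    have "\<kappa> (- f) \<oplus>\<^bsub>R\<^esub> \<kappa> f = \<zero>\<^bsub>R\<^esub>" using a[of "- f" f] 0 by simp
    then show ?thesis using c by (simp add: minus_equality)
  qed
  show "\<kappa> (f - g) = \<kappa> f \<ominus>\<^bsub>R\<^esub> \<kappa> g" using a[of f "- g"] u by (simp add: a_minus_def)
  show "\<kappa> (f ^ n) = \<kappa> f [^]\<^bsub>R\<^esub> n"
    by (induction n) (simp_all only: power_0 1 nat_pow_0 power_Suc2 m nat_pow_Suc)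
qed

lemma typed_hom_Quot:
  assumes \<kappa>: "typed_hom R \<kappa>" and I: "ideal I R"
  shows "typed_hom (R Quot I) (\<lambda>f. I +>\<^bsub>R\<^esub> \<kappa> f)"
    and "I +>\<^bsub>R\<^esub> \<kappa> f = I +>\<^bsub>R\<^esub> \<kappa> g \<longleftrightarrow> \<kappa> (f - g) \<in> I"
proof -
  interpret ideal I R by (rule I)
  interpret q: ring_hom_ring R "R Quot I" "(+>\<^bsub>R\<^esub>) I" by (rule rcos_ring_hom_ring)
  note t = typed_homD[OF \<kappa>]
  show "typed_hom (R Quot I) (\<lambda>f. I +>\<^bsub>R\<^esub> \<kappa> f)"
    unfolding typed_hom_def using quotient_is_ring t by (simp add: q.hom_add q.hom_mult q.hom_closed)
  show "I +>\<^bsub>R\<^esub> \<kappa> f = I +>\<^bsub>R\<^esub> \<kappa> g \<longleftrightarrow> \<kappa> (f - g) \<in> I"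
    using quotient_eq_iff_same_a_r_cos[OF I t(2) t(2)] by (simp add: t(8))
qed

lemma typed_hom_vimage_ideal:
  assumes \<kappa>: "typed_hom R \<kappa>" and I: "ideal I R"
  shows "two_sided {f. \<kappa> f \<in> I}"
proof -
  interpret ideal I R by (rule I)
  note t = typed_homD[OF \<kappa>] and sub = is_additive_subgroup
  show ?thesis unfolding two_sided_def
    using additive_subgroup.zero_closed[OF sub] additive_subgroup.a_closed[OF sub] I_l_closed I_r_closed
    by (simp add: t(2,4,5,6))
qed

lemma typed_hom_image_ideal:
  assumes \<kappa>: "typed_hom R \<kappa>" and car: "carrier R = range \<kappa>" and N: "two_sided N"
  shows "ideal (\<kappa> ` N) R"
proof -
  note t = typed_homD[OF \<kappa>] and n = two_sidedD[OF N]
  interpret ring R by (rule t(1))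
  show ?thesis
  proof (rule idealI[OF t(1)])
    show "subgroup (\<kappa> ` N) (add_monoid R)"
    proof (rule add.subgroupI)
      show "\<kappa> ` N \<subseteq> carrier R" "\<kappa> ` N \<noteq> {}" using n(1) t(2) by auto
      fix x y assume "x \<in> \<kappa> ` N"
      then show "\<ominus>\<^bsub>R\<^esub> x \<in> \<kappa> ` N" using n(6) by (auto simp flip: t(7))
      assume "x \<in> \<kappa> ` N" "y \<in> \<kappa> ` N"
      then show "x \<oplus>\<^bsub>R\<^esub> y \<in> \<kappa> ` N" using n(2) by (auto simp flip: t(4))
    qed
    fix a x assume "a \<in> \<kappa> ` N" "x \<in> carrier R"
    then show "x \<otimes>\<^bsub>R\<^esub> a \<in> \<kappa> ` N" "a \<otimes>\<^bsub>R\<^esub> x \<in> \<kappa> ` N"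
      using n(4,5) unfolding car by (auto simp flip: t(5))
  qed
qed

lemma typed_hom_emb: "typed_hom free_alg emb"
  using ring_free_alg unfolding typed_hom_def by (simp add: free_alg_simps single_one[symmetric] emb_one emb_add emb_mult)

definition kappa :: "(vertex list \<Rightarrow>\<^sub>0 rat poly) \<Rightarrow> (vertex list \<Rightarrow>\<^sub>0 rat poly fract) set" where
  "kappa f = rel_ideal +>\<^bsub>free_alg\<^esub> emb f"

lemma ideal_rel_ideal: "ideal rel_ideal free_alg"
  using two_sided_rel_ideal by (simp only: ideal_free_alg_iff)

lemma typed_hom_kappa: "typed_hom C'q kappa"
  using typed_hom_Quot(1)[OF typed_hom_emb ideal_rel_ideal] by (simp only: C'q_def kappa_def[abs_def])

lemma kappa_eq_iff: "kappa f = kappa g \<longleftrightarrow> emb (f - g) \<in> rel_ideal"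
  unfolding kappa_def by (rule typed_hom_Quot(2)[OF typed_hom_emb ideal_rel_ideal])

lemma kappa_gen: "C'q_gen v = kappa (Poly_Mapping.single [v] 1)"
  by (simp add: C'q_gen_def kappa_def emb_single Fract_hom(2))

lemma kappa_scalar: "C'q_scalar (Fraction_Field.Fract p 1) = kappa (Poly_Mapping.single [] p)"
  by (simp add: C'q_scalar_def kappa_def emb_single)

lemma Cq_simps:
  "x \<otimes>\<^bsub>Cq\<^esub> y = x \<otimes>\<^bsub>C'q\<^esub> y" "x \<oplus>\<^bsub>Cq\<^esub> y = x \<oplus>\<^bsub>C'q\<^esub> y" "\<one>\<^bsub>Cq\<^esub> = \<one>\<^bsub>C'q\<^esub>"
  by (simp_all add: Cq_def)

lemma carrier_Cq: "carrier Cq = range kappa"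
proof -
  let ?H = "range (\<lambda>p. C'q_scalar (Fraction_Field.Fract p 1)) \<union> range C'q_gen"
  note t = typed_homD[OF typed_hom_kappa]
  have "generate_ring C'q ?H \<subseteq> range kappa"
  proof
    fix x assume "x \<in> generate_ring C'q ?H"
    then show "x \<in> range kappa"
      by induction (auto simp: kappa_scalar kappa_gen t(3)[symmetric] t(4,5,7)[symmetric])
  qed
  moreover have "kappa f \<in> generate_ring C'q ?H" for f
  proof (induction f rule: poly_mapping_induct)
    case zero
    have "kappa (Poly_Mapping.single [] 0) \<in> generate_ring C'q ?H"
      unfolding kappa_scalar[symmetric] by (rule generate_ring.incl) blast
    then show ?case by simp
  next
    case (add x a f)
    have "kappa (Poly_Mapping.single x a) \<in> generate_ring C'q ?H"
    proof (induction x arbitrary: a)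
      case Nil
      show ?case unfolding kappa_scalar[symmetric] by (rule generate_ring.incl) blast
    next
      case (Cons c x)
      have "kappa (Poly_Mapping.single [c] 1) \<in> generate_ring C'q ?H"
        unfolding kappa_gen[symmetric] by (rule generate_ring.incl) blast
      from generate_ring.eng_mult[OF this Cons] show ?case
        by (simp add: t(5)[symmetric] single_mult)
    qed
    then show ?case using add by (simp add: t(4) generate_ring.eng_add)
  qed
  ultimately show ?thesis by (auto simp: Cq_def)
qed

lemma ring_Cq: "ring Cq"
proof -
  interpret ring C'q by (rule typed_homD(1)[OF typed_hom_kappa])
  show ?thesis unfolding Cq_def
    by (rule subring_is_ring, rule generate_ring_is_subring)
      (auto simp: kappa_scalar kappa_gen typed_homD(2)[OF typed_hom_kappa])
qed

lemma typed_hom_kappa_Cq: "typed_hom Cq kappa"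
  using typed_hom_kappa ring_Cq unfolding typed_hom_def by (auto simp: Cq_simps carrier_Cq)

lemma qCq_eq: "qCq = range (\<lambda>f. kappa (qZ * f))"
  unfolding qCq_def carrier_Cq kappa_scalar typed_homD(5)[OF typed_hom_kappa_Cq] by auto

lemma ideal_qCq: "ideal qCq Cq"
proof -
  have "two_sided (range ((*) qZ))" unfolding two_sided_def
  proof (intro conjI ballI allI)
    show "0 \<in> range ((*) qZ)" by (rule range_eqI[of _ _ 0]) simp
    show "x + y \<in> range ((*) qZ)" if "x \<in> range ((*) qZ)" "y \<in> range ((*) qZ)" for x y
      using that by (auto simp flip: distrib_left)
    show "a * x * b \<in> range ((*) qZ)" if x: "x \<in> range ((*) qZ)" for a x b
    proof -
      obtain f where "x = qZ * f" using x by blast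
      then have "a * x * b = qZ * (a * f * b)" using scalar_central[of "[:0, 1:]" a] by (simp flip: mult.assoc)
      then show ?thesis by blast
    qed
  qed
  then have "ideal (kappa ` range ((*) qZ)) Cq" by (rule typed_hom_image_ideal[OF typed_hom_kappa_Cq carrier_Cq])
  then show ?thesis by (simp only: qCq_eq image_image)
qed

definition pi0 :: "(vertex list \<Rightarrow>\<^sub>0 rat poly) \<Rightarrow> (vertex list \<Rightarrow>\<^sub>0 rat poly fract) set set" where
  "pi0 f = qCq +>\<^bsub>Cq\<^esub> kappa f"

lemma typed_hom_pi0: "typed_hom C0 pi0"
  using typed_hom_Quot(1)[OF typed_hom_kappa_Cq ideal_qCq] by (simp only: C0_def pi0_def[abs_def])

text \<open>\<open>rel_ideal\<close> is an ideal over Q(q): an integral element with a nonzero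
  polynomial multiple in it already vanishes in \<open>C0\<close>.\<close>

lemma pi0_eq_iff: "pi0 f = pi0 g \<longleftrightarrow> (\<exists>h. emb (f - g - qZ * h) \<in> rel_ideal)"
  unfolding pi0_def typed_hom_Quot(2)[OF typed_hom_kappa_Cq ideal_qCq]
  by (auto simp: qCq_eq kappa_eq_iff image_iff)

lemma pi0_eq_null: "pi0 f = pi0 g \<Longrightarrow> f - g \<in> null_ideal"
proof -
  assume "pi0 f = pi0 g"
  then obtain h where "emb (f - g - qZ * h) \<in> rel_ideal" by (auto simp: pi0_eq_iff)
  from two_sidedD(2)[OF two_sided_null_ideal rel_ideal_null[OF this] qZ_null[of h]]
  show ?thesis by simp
qed

lemma pi0_qZ: "pi0 (qZ * f) = \<zero>\<^bsub>C0\<^esub>"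
  unfolding typed_homD(6)[OF typed_hom_pi0, symmetric] pi0_eq_iff
  using two_sidedD(1)[OF two_sided_rel_ideal] by (intro exI[of _ f]) simp

lemma pi0_rel_ideal: "emb f \<in> rel_ideal \<Longrightarrow> pi0 f = \<zero>\<^bsub>C0\<^esub>"
  unfolding typed_homD(6)[OF typed_hom_pi0, symmetric] pi0_eq_iff
  by (intro exI[of _ 0]) simp

lemma carrier_C0: "carrier C0 = range pi0"
  by (auto simp: C0_def FactRing_def A_RCOSETS_def' carrier_Cq pi0_def)

lemma C0_gen_eq: "C0_gen v = pi0 (Poly_Mapping.single [v] 1)"
  by (simp add: C0_gen_def pi0_def kappa_gen)

lemma C0_scalar_eq: "C0_scalar c = pi0 (Poly_Mapping.single [] [:c:])"
  by (simp add: C0_scalar_def pi0_def kappa_scalar)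

section \<open>Relations in the quotient by \<open>(ij)\<^sup>m = i\<^sup>m j\<^sup>m\<close>\<close>

lemma root_vector_hom:
  fixes \<rho> :: "'a::ring_1 \<Rightarrow> 'b::ring_1"
  assumes "\<And>x y. \<rho> (x - y) = \<rho> x - \<rho> y" "\<And>x y. \<rho> (x * y) = \<rho> x * \<rho> y"
  shows "\<rho> (root_vector q h j m) = root_vector (\<rho> q) (\<rho> h) (\<rho> j) m"
  by (induction m) (simp_all add: assms)

lemma root_vector_0: "root_vector 0 h j m = h ^ m * j"
  by (induction m) (simp_all add: mult.assoc)

text \<open>The commutation of root vectors divides by polynomials in \<open>q\<close> and lives in
  the target of \<open>\<kappa>\<close>, whereas \<open>reg_power_proj_commute\<close> belongs to
  the target of \<open>\<rho>\<close>, where \<open>q = 0\<close>. Both are reached from the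
  integral free algebra, and \<open>ker\<close> carries the relation across, where it reads
  \<open>u_(m + 1) u_m = 0\<close>.\<close>

lemma proj_commute_transfer:
  fixes \<kappa> :: "'a::ring_1 \<Rightarrow> 'b::ring_1" and \<rho> :: "'a \<Rightarrow> 'c::ring_1" and i j q :: 'a
  defines "t \<equiv> q^2 + q + 1"
  assumes \<kappa>: "\<And>x y. \<kappa> (x + y) = \<kappa> x + \<kappa> y" "\<And>x y. \<kappa> (x - y) = \<kappa> x - \<kappa> y" "\<And>x y. \<kappa> (x * y) = \<kappa> x * \<kappa> y" "\<kappa> 1 = 1"
    and \<rho>: "\<And>x y. \<rho> (x - y) = \<rho> x - \<rho> y" "\<And>x y. \<rho> (x * y) = \<rho> x * \<rho> y"
    and ker: "\<And>x. \<kappa> x = 0 \<Longrightarrow> \<rho> x = 0" and q: "\<rho> q = 0"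
    and central: "\<And>x. x * \<kappa> q = \<kappa> q * x"
    and si: "\<kappa> (i * i * i * j - t * (i * i * j * i) + q * t * (i * j * i * i) - q ^ 3 * (j * i * i * i)) = 0"
    and sj: "\<kappa> (i * j * j * j - t * (j * i * j * j) + q * t * (j * j * i * j) - q ^ 3 * (j * j * j * i)) = 0"
    and cancel: "\<And>x. \<kappa> (q * t) * x = 0 \<Longrightarrow> x = 0" "\<And>x. \<kappa> (2 * q * (1 + q^2)) * x = 0 \<Longrightarrow> x = 0"
    and reg: "\<And>m. (\<rho> i * \<rho> j) ^ m = \<rho> i ^ m * \<rho> j ^ m"
  shows "(\<rho> i * \<rho> j) ^ Suc d * \<rho> j * ((\<rho> i * \<rho> j) ^ d * \<rho> j) = (\<rho> i * \<rho> j) ^ d * \<rho> j * ((\<rho> i * \<rho> j) ^ Suc d * \<rho> j)"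
proof (rule reg_power_proj_commute[OF reg])
  fix m
  let ?h = "i * j - j * i"
  let ?u = "root_vector q ?h j"
  have pow: "\<kappa> (x ^ n) = \<kappa> x ^ n" for x n by (induction n) (simp_all add: \<kappa>)
  have two: "\<kappa> 2 = 2" using \<kappa>(1)[of 1 1] \<kappa>(4) by simp
  note hom = \<kappa> pow two
  have \<kappa>u: "\<kappa> (?u n) = root_vector (\<kappa> q) (\<kappa> i * \<kappa> j - \<kappa> j * \<kappa> i) (\<kappa> j) n" for n
    using root_vector_hom[of \<kappa>, OF \<kappa>(2,3), of q ?h j n] by (simp add: \<kappa>)
  have "\<kappa> (?u (Suc m)) * \<kappa> (?u m) = \<kappa> q ^ 2 * (\<kappa> (?u m) * \<kappa> (?u (Suc m)))"
    unfolding \<kappa>u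
  proof (rule root_vector_commute[OF central])
    show "\<kappa> i * \<kappa> i * \<kappa> i * \<kappa> j - (\<kappa> q ^ 2 + \<kappa> q + 1) * (\<kappa> i * \<kappa> i * \<kappa> j * \<kappa> i) + \<kappa> q * (\<kappa> q ^ 2 + \<kappa> q + 1) * (\<kappa> i * \<kappa> j * \<kappa> i * \<kappa> i) - \<kappa> q ^ 3 * (\<kappa> j * \<kappa> i * \<kappa> i * \<kappa> i) = 0"
      using si unfolding t_def hom .
    show "\<kappa> i * \<kappa> j * \<kappa> j * \<kappa> j - (\<kappa> q ^ 2 + \<kappa> q + 1) * (\<kappa> j * \<kappa> i * \<kappa> j * \<kappa> j) + \<kappa> q * (\<kappa> q ^ 2 + \<kappa> q + 1) * (\<kappa> j * \<kappa> j * \<kappa> i * \<kappa> j) - \<kappa> q ^ 3 * (\<kappa> j * \<kappa> j * \<kappa> j * \<kappa> i) = 0"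
      using sj unfolding t_def hom .
    show "x = 0" if "\<kappa> q * (\<kappa> q ^ 2 + \<kappa> q + 1) * x = 0" for x
      using cancel(1)[of x] that unfolding t_def hom by blast
    show "x = 0" if "2 * \<kappa> q * (1 + \<kappa> q ^ 2) * x = 0" for x
      using cancel(2)[of x] that unfolding hom by blast
  qed
  then have "\<kappa> (?u (Suc m) * ?u m - q * (q * (?u m * ?u (Suc m)))) = 0"
    by (simp add: \<kappa> power2_eq_square mult.assoc)
  from ker[OF this] have "\<rho> (?u (Suc m)) * \<rho> (?u m) = 0" by (simp add: \<rho> q)
  moreover have "\<rho> (?u n) = (\<rho> i * \<rho> j - \<rho> j * \<rho> i) ^ n * \<rho> j" for n
    using root_vector_hom[of \<rho>, OF \<rho>, of q ?h j n] by (simp add: \<rho> q root_vector_0)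
  ultimately show "(\<rho> i * \<rho> j - \<rho> j * \<rho> i) ^ Suc m * \<rho> j * ((\<rho> i * \<rho> j - \<rho> j * \<rho> i) ^ m * \<rho> j) = 0"
    by (simp only:)
qed

text \<open>\<open>proj_commute_transfer\<close> is applied to the opposite rings with i and j
  exchanged. This interchanges the Serre relations and moves their coefficients to the right, from
  where \<open>qc\<close> brings them back.\<close>

lemma inj_commute_transfer:
  fixes \<kappa> :: "'a::ring_1 \<Rightarrow> 'b::ring_1" and \<rho> :: "'a \<Rightarrow> 'c::ring_1" and i j q :: 'a
  defines "t \<equiv> q^2 + q + 1"
  assumes \<kappa>: "\<And>x y. \<kappa> (x + y) = \<kappa> x + \<kappa> y" "\<And>x y. \<kappa> (x - y) = \<kappa> x - \<kappa> y" "\<And>x y. \<kappa> (x * y) = \<kappa> x * \<kappa> y" "\<kappa> 1 = 1"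
    and \<rho>: "\<And>x y. \<rho> (x - y) = \<rho> x - \<rho> y" "\<And>x y. \<rho> (x * y) = \<rho> x * \<rho> y"
    and ker: "\<And>x. \<kappa> x = 0 \<Longrightarrow> \<rho> x = 0" and q: "\<rho> q = 0" and qc: "\<And>x. x * q = q * x"
    and central: "\<And>x. x * \<kappa> q = \<kappa> q * x"
    and si: "\<kappa> (i * i * i * j - t * (i * i * j * i) + q * t * (i * j * i * i) - q ^ 3 * (j * i * i * i)) = 0"
    and sj: "\<kappa> (i * j * j * j - t * (j * i * j * j) + q * t * (j * j * i * j) - q ^ 3 * (j * j * j * i)) = 0"
    and cancel: "\<And>x. \<kappa> (q * t) * x = 0 \<Longrightarrow> x = 0" "\<And>x. \<kappa> (2 * q * (1 + q^2)) * x = 0 \<Longrightarrow> x = 0"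
    and reg: "\<And>m. (\<rho> i * \<rho> j) ^ m = \<rho> i ^ m * \<rho> j ^ m"
  shows "\<rho> i * (\<rho> i * \<rho> j) ^ d * (\<rho> i * (\<rho> i * \<rho> j) ^ Suc d) = \<rho> i * (\<rho> i * \<rho> j) ^ Suc d * (\<rho> i * (\<rho> i * \<rho> j) ^ d)"
proof -
  have one: "to_opposite (1 :: 'x::ring_1) = 1" by (simp add: one_opposite.abs_eq)
  have two: "2 = to_opposite (2 :: 'a)" using to_opposite(2)[of "1 :: 'a" 1] by (simp add: one)
  have swap: "x * q ^ n = q ^ n * x" for x n
  proof (induction n)
    case (Suc n)
    have "x * q ^ Suc n = (x * q) * q ^ n" by (simp add: mult.assoc)
    also have "\<dots> = q * (x * q ^ n)" by (simp only: qc[of x] mult.assoc)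
    finally show ?case by (simp add: Suc mult.assoc)
  qed simp
  have tc: "x * t = t * x" for x using swap[of x 2] qc[of x] by (simp add: t_def distrib_left distrib_right)
  have qt: "x * (q * t) = q * t * x" for x
  proof -
    have "x * (q * t) = (x * q) * t" by (simp only: mult.assoc)
    also have "\<dots> = q * (x * t)" by (simp only: qc[of x] mult.assoc)
    finally show ?thesis by (simp only: tc[of x] mult.assoc)
  qed
  let ?K = "\<lambda>x. to_opposite (\<kappa> (from_opposite x))" and ?R = "\<lambda>x. to_opposite (\<rho> (from_opposite x))"
  let ?i = "to_opposite j" and ?j = "to_opposite i" and ?q = "to_opposite q"
  have f: "from_opposite (to_opposite x) = x" for x :: 'a by (rule to_opposite_inverse) simp
  have cent_back: "x = 0" if "\<And>y. \<kappa> c * y = 0 \<Longrightarrow> y = 0" "\<And>y. y * \<kappa> c = \<kappa> c * y" "to_opposite (\<kappa> c) * x = 0" for c x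
  proof -
    have y: "x = to_opposite (from_opposite x)" by (simp add: from_opposite_inverse)
    let ?y = "from_opposite x"
    from that(3) have "to_opposite (\<kappa> c) * to_opposite ?y = 0" by (simp only: y[symmetric])
    then have "?y * \<kappa> c = 0" by (simp only: to_opposite(1,4))
    then have "\<kappa> c * ?y = 0" by (simp only: that(2)[of ?y])
    then have "?y = 0" by (rule that(1))
    then show ?thesis using y by (simp only: to_opposite(4))
  qed
  have central': "y * \<kappa> (q * t) = \<kappa> (q * t) * y" "y * \<kappa> (2 * q * (1 + q ^ 2)) = \<kappa> (2 * q * (1 + q ^ 2)) * y" for y
  proof -
    have c1: "x * (\<kappa> q * z) = \<kappa> q * (x * z)" for x z using central[of x] by (simp flip: mult.assoc)
    show "y * \<kappa> (q * t) = \<kappa> (q * t) * y"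
      by (simp only: t_def \<kappa> power2_eq_square distrib_left distrib_right mult.assoc c1[of y] central[of y] mult_1_left mult_1_right)
    have "\<kappa> 2 = 2" using \<kappa>(1)[of 1 1] \<kappa>(4) by simp
    then show "y * \<kappa> (2 * q * (1 + q ^ 2)) = \<kappa> (2 * q * (1 + q ^ 2)) * y"
      by (simp only: \<kappa> power2_eq_square distrib_left distrib_right mult.assoc c1[of y] central[of y] mult_2 mult_2_right mult_1_left mult_1_right)
  qed
  have "(?R ?i * ?R ?j) ^ Suc d * ?R ?j * ((?R ?i * ?R ?j) ^ d * ?R ?j) = (?R ?i * ?R ?j) ^ d * ?R ?j * ((?R ?i * ?R ?j) ^ Suc d * ?R ?j)"
  proof (rule proj_commute_transfer[where \<kappa> = ?K and q = ?q])
    show "?K (x + y) = ?K x + ?K y" "?K (x - y) = ?K x - ?K y" "?K (x * y) = ?K x * ?K y" "?R (x - y) = ?R x - ?R y" "?R (x * y) = ?R x * ?R y" for x y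
      by (simp_all add: plus_opposite.rep_eq minus_opposite.rep_eq times_opposite.rep_eq \<kappa> \<rho> to_opposite(1-3))
    show "?K 1 = 1" by (simp add: one_opposite.rep_eq \<kappa> one)
    show "?R x = 0" if "?K x = 0" for x using that ker by (simp add: to_opposite(4))
    show "?R ?q = 0" by (simp add: f q to_opposite(4))
    show "x * ?K ?q = ?K ?q * x" for x
    proof -
      obtain y where "x = to_opposite y" using from_opposite_inverse[of x, symmetric] by blast
      then show ?thesis using central[of y] by (simp add: f to_opposite(1))
    qed
    show "?K (?i * ?i * ?i * ?j - (?q^2 + ?q + 1) * (?i * ?i * ?j * ?i) + ?q * (?q^2 + ?q + 1) * (?i * ?j * ?i * ?i) - ?q ^ 3 * (?j * ?i * ?i * ?i)) = 0"
    proof -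
      have "?i * ?i * ?i * ?j - (?q^2 + ?q + 1) * (?i * ?i * ?j * ?i) + ?q * (?q^2 + ?q + 1) * (?i * ?j * ?i * ?i) - ?q ^ 3 * (?j * ?i * ?i * ?i) =
        to_opposite (i * (j * (j * j)) - j * (i * (j * j)) * t + j * (j * (i * j)) * (t * q) - j * (j * (j * i)) * q ^ 3)"
        by (simp only: t_def flip: one) (simp only: to_opposite(1-3) to_opposite_power)
      also have "i * (j * (j * j)) - j * (i * (j * j)) * t + j * (j * (i * j)) * (t * q) - j * (j * (j * i)) * q ^ 3 =
        i * j * j * j - t * (j * i * j * j) + q * t * (j * j * i * j) - q ^ 3 * (j * j * j * i)"
        by (simp only: tc[of "j * (i * (j * j))"] swap[of "j * (j * (j * i))" 3] qc[of t] qt[of "j * (j * (i * j))"])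
          (simp only: mult.assoc)
      finally show ?thesis using sj by (simp add: f to_opposite(4))
    qed
    show "?K (?i * ?j * ?j * ?j - (?q^2 + ?q + 1) * (?j * ?i * ?j * ?j) + ?q * (?q^2 + ?q + 1) * (?j * ?j * ?i * ?j) - ?q ^ 3 * (?j * ?j * ?j * ?i)) = 0"
    proof -
      have "?i * ?j * ?j * ?j - (?q^2 + ?q + 1) * (?j * ?i * ?j * ?j) + ?q * (?q^2 + ?q + 1) * (?j * ?j * ?i * ?j) - ?q ^ 3 * (?j * ?j * ?j * ?i) =
        to_opposite (i * (i * (i * j)) - i * (i * (j * i)) * t + i * (j * (i * i)) * (t * q) - j * (i * (i * i)) * q ^ 3)"
        by (simp only: t_def flip: one) (simp only: to_opposite(1-3) to_opposite_power)
      also have "i * (i * (i * j)) - i * (i * (j * i)) * t + i * (j * (i * i)) * (t * q) - j * (i * (i * i)) * q ^ 3 =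
        i * i * i * j - t * (i * i * j * i) + q * t * (i * j * i * i) - q ^ 3 * (j * i * i * i)"
        by (simp only: tc[of "i * (i * (j * i))"] swap[of "j * (i * (i * i))" 3] qc[of t] qt[of "i * (j * (i * i))"])
          (simp only: mult.assoc)
      finally show ?thesis using si by (simp add: f to_opposite(4))
    qed
    show "x = 0" if "?K (?q * (?q^2 + ?q + 1)) * x = 0" for x
    proof (rule cent_back[of "q * t", OF cancel(1) central'(1)])
      have "?q * (?q^2 + ?q + 1) = to_opposite (t * q)" unfolding t_def by (simp only: flip: one) (simp only: to_opposite(1-3) to_opposite_power)
      then show "to_opposite (\<kappa> (q * t)) * x = 0" using that by (simp add: f qc)
    qed
    show "x = 0" if "?K (2 * ?q * (1 + ?q^2)) * x = 0" for x
    proof (rule cent_back[of "2 * q * (1 + q^2)", OF cancel(2) central'(2)])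
      have "2 * ?q * (1 + ?q^2) = to_opposite ((1 + q^2) * (q * 2))" by (simp only: two flip: one) (simp only: to_opposite(1-3) to_opposite_power)
      also have "(1 + q^2) * (q * 2) = 2 * q * (1 + q^2)"
        by (simp add: distrib_left distrib_right mult_2 mult_2_right power2_eq_square mult.assoc)
      finally show "to_opposite (\<kappa> (2 * q * (1 + q^2))) * x = 0" using that by (simp add: f)
    qed
    show "(?R ?i * ?R ?j) ^ m = ?R ?i ^ m * ?R ?j ^ m" for m
      by (simp add: f to_opposite(1) to_opposite_power reg)
  qed
  then show ?thesis by (simp only: f to_opposite(1,5) to_opposite_power)
qed

abbreviation monom_word :: "vertex list \<Rightarrow> vertex list \<Rightarrow>\<^sub>0 rat poly" where
  "monom_word w \<equiv> Poly_Mapping.single w 1"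

lemma monom_word_power:
  "monom_word [v] ^ m = monom_word (replicate m v)"
  "(monom_word [vi] * monom_word [vj]) ^ m = monom_word (reg_word m)"
  by (induction m) (simp_all add: single_one single_mult)

definition reg_gens :: "(vertex list \<Rightarrow>\<^sub>0 rat poly fract) set set set" where
  "reg_gens = {(C0_gen vi \<otimes>\<^bsub>C0\<^esub> C0_gen vj) [^]\<^bsub>C0\<^esub> m
        \<ominus>\<^bsub>C0\<^esub> C0_gen vi [^]\<^bsub>C0\<^esub> m \<otimes>\<^bsub>C0\<^esub> C0_gen vj [^]\<^bsub>C0\<^esub> m | m :: nat. m \<ge> 1}"

lemma reg_gens_eq:
  "reg_gens = {pi0 (monom_word (reg_word m) - monom_word (replicate m vi @ replicate m vj)) | m. m \<ge> 1}"
proof -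
  have "(C0_gen vi \<otimes>\<^bsub>C0\<^esub> C0_gen vj) [^]\<^bsub>C0\<^esub> m \<ominus>\<^bsub>C0\<^esub> C0_gen vi [^]\<^bsub>C0\<^esub> m \<otimes>\<^bsub>C0\<^esub> C0_gen vj [^]\<^bsub>C0\<^esub> m =
    pi0 (monom_word (reg_word m) - monom_word (replicate m vi @ replicate m vj))" for m :: nat
    unfolding C0_gen_eq typed_homD(5,8,9)[OF typed_hom_pi0, symmetric] monom_word_power
    by (simp add: single_mult)
  then show ?thesis unfolding reg_gens_def by simp
qed

definition reg_null :: "(vertex list \<Rightarrow>\<^sub>0 rat poly) set" where
  "reg_null = {f. pi0 f \<in> Idl\<^bsub>C0\<^esub> reg_gens}"

lemma reg_gens_carrier: "reg_gens \<subseteq> carrier C0"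
  by (auto simp: reg_gens_eq carrier_C0)

lemma ideal_reg_gens: "ideal (Idl\<^bsub>C0\<^esub> reg_gens) C0"
  by (rule ring.genideal_ideal[OF typed_homD(1)[OF typed_hom_pi0] reg_gens_carrier])

lemma two_sided_reg_null: "two_sided reg_null"
  unfolding reg_null_def by (rule typed_hom_vimage_ideal[OF typed_hom_pi0 ideal_reg_gens])

text \<open>The image of \<open>null_ideal\<close> is an ideal of \<open>C0\<close> that contains
  the generators. The inclusion lifts to the free algebra because \<open>null_ideal\<close> contains
  the kernel of \<open>pi0\<close>.\<close>

lemma reg_null_subset: "reg_null \<subseteq> null_ideal"
proof
  fix f assume "f \<in> reg_null"
  moreover have "Idl\<^bsub>C0\<^esub> reg_gens \<subseteq> pi0 ` null_ideal"
  proof (rule ring.genideal_minimal[OF typed_homD(1)[OF typed_hom_pi0]])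
    show "ideal (pi0 ` null_ideal) C0"
      by (rule typed_hom_image_ideal[OF typed_hom_pi0 carrier_C0 two_sided_null_ideal])
    show "reg_gens \<subseteq> pi0 ` null_ideal" using reg_word_null by (auto simp: reg_gens_eq)
  qed
  ultimately obtain g where g: "g \<in> null_ideal" "pi0 f = pi0 g" unfolding reg_null_def by blast
  from two_sidedD(2)[OF two_sided_null_ideal pi0_eq_null[OF g(2)] g(1)] show "f \<in> null_ideal" by simp
qed

lemma pi0_zero_reg_null: "pi0 f = \<zero>\<^bsub>C0\<^esub> \<Longrightarrow> f \<in> reg_null"
  using two_sidedD(1)[OF two_sided_reg_null] unfolding reg_null_def
  by (simp add: typed_homD(6)[OF typed_hom_pi0])

lemma reg_word_reg_null: "monom_word (reg_word m) - monom_word (replicate m vi @ replicate m vj) \<in> reg_null"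
proof (cases "m = 0")
  case True
  then show ?thesis using two_sidedD(1)[OF two_sided_reg_null] by simp
next
  case False
  then have "pi0 (monom_word (reg_word m) - monom_word (replicate m vi @ replicate m vj)) \<in> reg_gens"
    unfolding reg_gens_eq by (intro CollectI exI[of _ m]) simp
  then show ?thesis
    using ring.genideal_self[OF typed_homD(1)[OF typed_hom_pi0] reg_gens_carrier] unfolding reg_null_def by blast
qed

quotient_type reg_alg = "vertex list \<Rightarrow>\<^sub>0 rat poly" / "\<lambda>f g. f - g \<in> reg_null"
  by (rule two_sided_equivp[OF two_sided_reg_null])

instantiation reg_alg :: ring_1
begin
lift_definition zero_reg_alg :: reg_alg is 0 .
lift_definition one_reg_alg :: reg_alg is 1 .
lift_definition plus_reg_alg :: "reg_alg \<Rightarrow> reg_alg \<Rightarrow> reg_alg" is "(+)"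
  by (rule two_sided_respects[OF two_sided_reg_null])
lift_definition minus_reg_alg :: "reg_alg \<Rightarrow> reg_alg \<Rightarrow> reg_alg" is "(-)"
  by (rule two_sided_respects[OF two_sided_reg_null])
lift_definition uminus_reg_alg :: "reg_alg \<Rightarrow> reg_alg" is uminus
  by (rule two_sided_respects[OF two_sided_reg_null, where g = 0 and g' = 0]) (use two_sidedD(1)[OF two_sided_reg_null] in auto)
lift_definition times_reg_alg :: "reg_alg \<Rightarrow> reg_alg \<Rightarrow> reg_alg" is "(*)"
  by (rule two_sided_respects[OF two_sided_reg_null])
instance
  by standard (transfer; use one_not_null reg_null_subset two_sidedD(1,6)[OF two_sided_reg_null] in \<open>force simp: algebra_simps\<close>)+
end

lemma abs_reg_alg:
  "abs_reg_alg (f - g) = abs_reg_alg f - abs_reg_alg g" "abs_reg_alg (f * g) = abs_reg_alg f * abs_reg_alg g"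
  "abs_reg_alg f = 0 \<longleftrightarrow> f \<in> reg_null" "abs_reg_alg f = abs_reg_alg g \<longleftrightarrow> f - g \<in> reg_null" "abs_reg_alg 1 = 1"
  by (simp_all add: minus_reg_alg.abs_eq times_reg_alg.abs_eq zero_reg_alg.abs_eq one_reg_alg.abs_eq reg_alg.abs_eq_iff)

lemma abs_reg_alg_power: "abs_reg_alg (f ^ n) = abs_reg_alg f ^ n"
  by (induction n) (simp_all add: abs_reg_alg)

definition serre_class :: "(vertex list \<Rightarrow>\<^sub>0 rat poly) \<Rightarrow> serre_alg" where
  "serre_class f = abs_serre_alg (emb f)"

lemma serre_class_hom:
  "serre_class (f + g) = serre_class f + serre_class g" "serre_class (f - g) = serre_class f - serre_class g"
  "serre_class (f * g) = serre_class f * serre_class g" "serre_class 1 = 1" "serre_class f = 0 \<longleftrightarrow> emb f \<in> rel_ideal"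
  by (simp_all add: serre_class_def emb_add emb_minus emb_mult emb_one plus_serre_alg.abs_eq minus_serre_alg.abs_eq
      times_serre_alg.abs_eq zero_serre_alg.abs_eq one_serre_alg.abs_eq serre_alg.abs_eq_iff)

lemma scalar_serre_class:
  "x * serre_class (Poly_Mapping.single [] c) = serre_class (Poly_Mapping.single [] c) * x"
  "c \<noteq> 0 \<Longrightarrow> serre_class (Poly_Mapping.single [] c) * x = 0 \<Longrightarrow> x = 0"
proof -
  obtain f where f: "x = abs_serre_alg f" using serre_alg.abs_induct[of "\<lambda>x. \<exists>f. x = abs_serre_alg f" x] by blast
  show "x * serre_class (Poly_Mapping.single [] c) = serre_class (Poly_Mapping.single [] c) * x"
    unfolding f serre_class_def times_serre_alg.abs_eq emb_single by (simp only: scalar_central)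
  assume c: "c \<noteq> 0" and 0: "serre_class (Poly_Mapping.single [] c) * x = 0"
  let ?c = "Fraction_Field.Fract c 1"
  have "Poly_Mapping.single [] ?c * f \<in> rel_ideal"
    using 0 by (simp add: f serre_class_def times_serre_alg.abs_eq emb_single zero_serre_alg.abs_eq serre_alg.abs_eq_iff)
  from two_sidedD(4)[OF two_sided_rel_ideal this, of "Poly_Mapping.single [] (inverse ?c)"]
  have "Poly_Mapping.single [] (inverse ?c) * Poly_Mapping.single [] ?c * f \<in> rel_ideal" by (simp only: mult.assoc)
  moreover have "?c \<noteq> 0" using c by (simp only: Fract_eq_0 not_False_eq_True)
  ultimately have "f \<in> rel_ideal"
    by (simp only: single_mult append_Nil left_inverse single_one[symmetric] mult_1_left not_False_eq_True)
  then show "x = 0" by (simp add: f zero_serre_alg.abs_eq serre_alg.abs_eq_iff)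
qed

lemma emb_rel:
  fixes i j :: "vertex list \<Rightarrow>\<^sub>0 rat poly"
  defines "i \<equiv> monom_word [vi]" and "j \<equiv> monom_word [vj]" and "t \<equiv> qZ^2 + qZ + 1"
  shows "emb (i * i * i * j - t * (i * i * j * i) + qZ * t * (i * j * i * i) - qZ ^ 3 * (j * i * i * i)) = rel_i"
    and "emb (i * j * j * j - t * (j * i * j * j) + qZ * t * (j * j * i * j) - qZ ^ 3 * (j * j * j * i)) = rel_j"
proof -
  let ?x = "[:0, 1:] :: rat poly"
  have t: "t = Poly_Mapping.single [] (?x^2 + ?x + 1)" "qZ ^ 3 = Poly_Mapping.single [] (?x ^ 3)"
    by (simp_all only: t_def power2_eq_square power3_eq_cube single_mult single_one single_add append_Nil)
  have pow: "Fraction_Field.Fract (p ^ n) 1 = Fraction_Field.Fract p 1 ^ n" for p :: "rat poly" and n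
    by (induction n) (simp_all only: power_0 power_Suc Fract_hom)
  note simps = i_def j_def t single_mult emb_add emb_minus emb_single Fract_hom pow append_Cons append_Nil mult_1_right mult_1_left
  show "emb (i * i * i * j - t * (i * i * j * i) + qZ * t * (i * j * i * i) - qZ ^ 3 * (j * i * i * i)) = rel_i"
    unfolding rel_i_def by (simp only: simps)
  show "emb (i * j * j * j - t * (j * i * j * j) + qZ * t * (j * j * i * j) - qZ ^ 3 * (j * j * j * i)) = rel_j"
    unfolding rel_j_def by (simp only: simps)
qed

lemma commute_reg_null:
  "monom_word (proj_word (Suc d) @ proj_word d) - monom_word (proj_word d @ proj_word (Suc d)) \<in> reg_null"
  "monom_word (inj_word d @ inj_word (Suc d)) - monom_word (inj_word (Suc d) @ inj_word d) \<in> reg_null"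
proof -
  let ?i = "monom_word [vi]" and ?j = "monom_word [vj]" and ?t = "qZ^2 + qZ + 1" and ?x = "[:0, 1:] :: rat poly"
  let ?\<rho> = abs_reg_alg
  have q: "?\<rho> qZ = 0" using pi0_zero_reg_null[OF pi0_qZ[of 1]] by (simp add: abs_reg_alg)
  have ker: "?\<rho> x = 0" if "serre_class x = 0" for x
    using that pi0_zero_reg_null[OF pi0_rel_ideal] by (simp add: abs_reg_alg serre_class_hom(5))
  have S: "serre_class (?i * ?i * ?i * ?j - ?t * (?i * ?i * ?j * ?i) + qZ * ?t * (?i * ?j * ?i * ?i) - qZ ^ 3 * (?j * ?i * ?i * ?i)) = 0"
    "serre_class (?i * ?j * ?j * ?j - ?t * (?j * ?i * ?j * ?j) + qZ * ?t * (?j * ?j * ?i * ?j) - qZ ^ 3 * (?j * ?j * ?j * ?i)) = 0"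
    unfolding serre_class_hom(5) emb_rel by (rule rel_in_rel_ideal)+
  have c: "qZ * ?t = Poly_Mapping.single [] (?x * (?x^2 + ?x + 1))" "2 * qZ * (1 + qZ^2) = Poly_Mapping.single [] (2 * ?x * (1 + ?x^2))"
    by (simp_all only: power2_eq_square single_mult single_one mult_2 append_Nil single_add[symmetric])
  \<comment> \<open>Their values at 1 show that the two divisors are nonzero polynomials, hence
    invertible over Q(q).\<close>
  have "poly (?x * (?x^2 + ?x + 1)) 1 \<noteq> 0" "poly (2 * ?x * (1 + ?x^2)) 1 \<noteq> 0" by simp_all
  then have "?x * (?x^2 + ?x + 1) \<noteq> 0" "2 * ?x * (1 + ?x^2) \<noteq> 0" by (metis poly_0)+
  then have cancel: "x = 0" if "serre_class (qZ * ?t) * x = 0 \<or> serre_class (2 * qZ * (1 + qZ^2)) * x = 0" for x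
    using scalar_serre_class(2) that unfolding c by blast
  have pw: "(?\<rho> ?i * ?\<rho> ?j) ^ m = ?\<rho> (monom_word (reg_word m))" for m
    by (simp only: abs_reg_alg(2)[symmetric] abs_reg_alg_power[symmetric] monom_word_power)
  have reg: "(?\<rho> ?i * ?\<rho> ?j) ^ m = ?\<rho> ?i ^ m * ?\<rho> ?j ^ m" for m
  proof -
    have "?\<rho> ?i ^ m * ?\<rho> ?j ^ m = ?\<rho> (monom_word (replicate m vi @ replicate m vj))"
      by (simp only: abs_reg_alg_power[symmetric] monom_word_power(1) abs_reg_alg(2)[symmetric] single_mult mult_1_left)
    then show ?thesis using reg_word_reg_null[of m] by (simp only: pw abs_reg_alg(4))
  qed
  have "(?\<rho> ?i * ?\<rho> ?j) ^ Suc d * ?\<rho> ?j * ((?\<rho> ?i * ?\<rho> ?j) ^ d * ?\<rho> ?j) = (?\<rho> ?i * ?\<rho> ?j) ^ d * ?\<rho> ?j * ((?\<rho> ?i * ?\<rho> ?j) ^ Suc d * ?\<rho> ?j)"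
    by (rule proj_commute_transfer[where \<kappa> = serre_class and q = qZ])
      (use serre_class_hom(1-4) abs_reg_alg(1,2) ker q scalar_serre_class(1) S cancel reg in blast)+
  then show "monom_word (proj_word (Suc d) @ proj_word d) - monom_word (proj_word d @ proj_word (Suc d)) \<in> reg_null"
    unfolding pw unfolding abs_reg_alg(2)[symmetric] abs_reg_alg(4) single_mult by (simp add: proj_word_def)
  have "?\<rho> ?i * (?\<rho> ?i * ?\<rho> ?j) ^ d * (?\<rho> ?i * (?\<rho> ?i * ?\<rho> ?j) ^ Suc d) = ?\<rho> ?i * (?\<rho> ?i * ?\<rho> ?j) ^ Suc d * (?\<rho> ?i * (?\<rho> ?i * ?\<rho> ?j) ^ d)"
    by (rule inj_commute_transfer[where \<kappa> = serre_class and q = qZ])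
      (use serre_class_hom(1-4) abs_reg_alg(1,2) ker q scalar_serre_class(1) S cancel reg scalar_central[symmetric] in blast)+
  then show "monom_word (inj_word d @ inj_word (Suc d)) - monom_word (inj_word (Suc d) @ inj_word d) \<in> reg_null"
    unfolding pw unfolding abs_reg_alg(2)[symmetric] abs_reg_alg(4) single_mult by (simp add: inj_word_def)
qed

text \<open>\<open>word_congruence\<close> is interpreted once, by the conjunction; separate
  interpretations could yield different normal words for \<open>w\<close>.\<close>

lemma normal_form_mod:
  "\<exists>v\<in>normal_words. monom_word w - monom_word v \<in> reg_null \<and> variety w = (variety v :: 'k::alg_closed_field krep set)"
proof -
  let ?R = "\<lambda>v w. monom_word v - monom_word w \<in> reg_null \<and> variety v = (variety w :: 'k krep set)"
  note D = two_sidedD[OF two_sided_reg_null]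
  interpret word_congruence ?R
  proof
    show "?R w w" for w using D(1) by simp
    show "?R w v" if "?R v w" for v w using D(6)[of "monom_word v - monom_word w"] that by simp
    show "?R u w" if "?R u v" "?R v w" for u v w
      using D(2)[of "monom_word u - monom_word v" "monom_word v - monom_word w"] that by simp
    show "?R (x @ v @ y) (x @ w @ y)" if "?R v w" for v w x y
      using D(3)[of "monom_word v - monom_word w" "monom_word x" "monom_word y"] that
      by (simp add: left_diff_distrib right_diff_distrib single_mult variety_append)
    show "?R (reg_word m) (replicate m vi @ replicate m vj)" for m
      using reg_word_reg_null by (simp add: variety_reg_word variety_Rep_word)
    show "?R (proj_word (Suc d) @ proj_word d) (proj_word d @ proj_word (Suc d))" for d
      using commute_reg_null(1) variety_proj_commute by blast
    show "?R (inj_word d @ inj_word (Suc d)) (inj_word (Suc d) @ inj_word d)" for d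
      using commute_reg_null(2) variety_inj_commute by blast
  qed
  show ?thesis using normal_form_exists[of w] by blast
qed

section \<open>The homomorphism to the monoid ring\<close>

text \<open>The lift of the homomorphism to the free algebra over Q[q].\<close>

definition specialize :: "(vertex list \<Rightarrow>\<^sub>0 rat poly) \<Rightarrow> ('k::field krep set \<Rightarrow>\<^sub>0 rat)" where
  "specialize = psum (\<lambda>w p. Poly_Mapping.single (variety w) (poly p 0))"

lemma specialize_simps:
  "specialize 0 = 0" "specialize (f + g) = specialize f + specialize g" "specialize (f - g) = specialize f - specialize g"
  "specialize (Poly_Mapping.single w p) = Poly_Mapping.single (variety w) (poly p 0)"
  unfolding specialize_def by (simp_all add: psum_add psum_minus psum_single single_add)

lemma ring_QCM: "ring (QCM :: ('k::field krep set \<Rightarrow>\<^sub>0 rat) ring)"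
  unfolding QCM_def by (rule monoid.ring_monoid_ring[OF monoid_comp_monoid])

lemma typed_hom_specialize: "typed_hom QCM (specialize :: _ \<Rightarrow> ('k::field krep set \<Rightarrow>\<^sub>0 rat))"
proof -
  let ?s = "specialize :: _ \<Rightarrow> ('k krep set \<Rightarrow>\<^sub>0 rat)"
  have car: "Poly_Mapping.keys (?s f) \<subseteq> range variety" for f
  proof (induction f rule: poly_mapping_induct)
    case (add x a f)
    have "Poly_Mapping.keys (?s (Poly_Mapping.single x a)) \<subseteq> range variety" by (simp add: specialize_simps)
    with add Poly_Mapping.keys_add[of "?s (Poly_Mapping.single x a)" "?s f"] show ?case
      unfolding specialize_simps(2) by blast
  qed (simp add: specialize_simps)
  have "?s (Poly_Mapping.single x a * g) = ?s (Poly_Mapping.single x a) \<otimes>\<^bsub>monoid_ring comp_monoid\<^esub> ?s g" for x a g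
    by (induction g rule: poly_mapping_induct)
      (simp_all add: distrib_left specialize_simps single_mult monoid_ring_add_right comp_monoid_simps)
  note single = this
  have "?s (f * g) = ?s f \<otimes>\<^bsub>monoid_ring comp_monoid\<^esub> ?s g" for f g
    by (induction f rule: poly_mapping_induct)
      (simp_all add: distrib_right specialize_simps(1,2) single monoid_ring_add_left)
  moreover have "?s 1 = Poly_Mapping.single (variety []) 1" unfolding single_one specialize_simps by simp
  ultimately show ?thesis
    using ring_QCM car unfolding typed_hom_def QCM_def by (simp add: specialize_simps comp_monoid_simps)
qed

lemma normal_representative:
  "\<exists>g. Poly_Mapping.keys g \<subseteq> normal_words \<and> f - g \<in> reg_null \<and> specialize f = (specialize g :: 'k::alg_closed_field krep set \<Rightarrow>\<^sub>0 rat)"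
proof (induction f rule: poly_mapping_induct)
  case zero
  then show ?case using two_sidedD(1)[OF two_sided_reg_null] by (intro exI[of _ 0]) simp
next
  case (add w p f)
  note D = two_sidedD[OF two_sided_reg_null]
  obtain g where g: "Poly_Mapping.keys g \<subseteq> normal_words" "f - g \<in> reg_null" "specialize f = (specialize g :: 'k krep set \<Rightarrow>\<^sub>0 rat)"
    using add by blast
  obtain v where v: "v \<in> normal_words" "monom_word w - monom_word v \<in> reg_null" "variety w = (variety v :: 'k krep set)"
    using normal_form_mod by blast
  have "Poly_Mapping.single [] p * (monom_word w - monom_word v) \<in> reg_null" by (rule D(4)[OF v(2)])
  then have "Poly_Mapping.single w p - Poly_Mapping.single v p \<in> reg_null"
    by (simp add: right_diff_distrib single_mult)
  from D(2)[OF this g(2)] have "(Poly_Mapping.single w p + f) - (Poly_Mapping.single v p + g) \<in> reg_null"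
    by (simp add: algebra_simps)
  moreover have "Poly_Mapping.keys (Poly_Mapping.single v p + g) \<subseteq> normal_words"
    using Poly_Mapping.keys_add[of "Poly_Mapping.single v p" g] g(1) v(1) by (auto split: if_splits)
  ultimately show ?case using g(3) v(3) by (intro exI[of _ "Poly_Mapping.single v p + g"]) (simp add: specialize_simps)
qed

text \<open>On normal words both conditions say that all coefficients vanish at
  \<open>q = 0\<close>: on the algebraic side by the functionals \<open>word_count\<close>, on the
  geometric side by injectivity of \<open>variety\<close>. Conversely such coefficients are
  multiples of \<open>q\<close>, which are zero in \<open>C0\<close>.\<close>

lemma specialize_eq_0_normal:
  assumes f: "Poly_Mapping.keys f \<subseteq> normal_words"
  shows "f \<in> reg_null \<longleftrightarrow> specialize f = (0 :: 'k::alg_closed_field krep set \<Rightarrow>\<^sub>0 rat)"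
proof
  let ?A = "Poly_Mapping.keys f" and ?l = "Poly_Mapping.lookup f"
  assume "f \<in> reg_null"
  then have "f \<in> null_ideal" using reg_null_subset by blast
  then have "(\<Sum>w\<in>?A. poly (?l w) 0 * of_bool (word_le n w)) = 0" if "n \<in> normal_words" for n
    using null_ideal_word_count[OF _ that] by (simp add: word_count_def psum_def)
  then have "poly (?l w) 0 = 0" if "w \<in> ?A" for w
    using normal_words_independent[of ?A "\<lambda>w. poly (?l w) 0", OF _ f _ that] by simp
  then show "specialize f = (0 :: 'k krep set \<Rightarrow>\<^sub>0 rat)" by (simp add: specialize_def psum_def)
next
  let ?A = "Poly_Mapping.keys f" and ?l = "Poly_Mapping.lookup f"
  assume 0: "specialize f = (0 :: 'k krep set \<Rightarrow>\<^sub>0 rat)"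
  have zero: "poly (?l w) 0 = 0" if w: "w \<in> ?A" for w
  proof -
    have "0 = Poly_Mapping.lookup (specialize f :: 'k krep set \<Rightarrow>\<^sub>0 rat) (variety w)" using 0 by simp
    also have "\<dots> = (\<Sum>v\<in>?A. poly (?l v) 0 when variety v = (variety w :: 'k krep set))"
      by (simp add: specialize_def psum_def lookup_sum lookup_single)
    also have "\<dots> = (\<Sum>v\<in>?A. if v = w then poly (?l v) 0 else 0)"
    proof (rule sum.cong)
      fix v assume "v \<in> ?A"
      then have "variety v = (variety w :: 'k krep set) \<longleftrightarrow> v = w"
        using variety_injective[of v w, where 'k = 'k] f w by blast
      then show "(poly (?l v) 0 when variety v = (variety w :: 'k krep set)) = (if v = w then poly (?l v) 0 else 0)"
        by (simp add: when_def)
    qed simp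
    finally show ?thesis using w by simp
  qed
  note D = two_sidedD[OF two_sided_reg_null]
  have single: "Poly_Mapping.single w (?l w) \<in> reg_null" if "w \<in> ?A" for w
  proof -
    have "[:- 0, 1:] dvd ?l w" using zero[OF that] by (simp only: poly_eq_0_iff_dvd)
    then obtain r where "?l w = [:0, 1:] * r" by auto
    then have "Poly_Mapping.single w (?l w) = qZ * Poly_Mapping.single w r" by (simp only: single_mult append_Nil)
    then show ?thesis by (simp only: pi0_zero_reg_null[OF pi0_qZ])
  qed
  have "(\<Sum>w\<in>B. Poly_Mapping.single w (?l w)) \<in> reg_null" if "finite B" "B \<subseteq> ?A" for B
    using that by (induction B rule: finite_induct) (simp_all add: D(1,2) single)
  moreover have "(\<Sum>w\<in>?A. Poly_Mapping.single w (?l w)) = f"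
    by (rule poly_mapping_eqI) (auto simp: lookup_sum lookup_single when_def in_keys_iff)
  ultimately show "f \<in> reg_null" by (metis finite_keys subset_refl)
qed

text \<open>Equality of the two kernels shows at once that the map is well defined on
  \<open>C0\<close> and what its kernel is.\<close>

lemma specialize_eq_0: "specialize f = (0 :: 'k::alg_closed_field krep set \<Rightarrow>\<^sub>0 rat) \<longleftrightarrow> f \<in> reg_null"
proof -
  obtain g where g: "Poly_Mapping.keys g \<subseteq> normal_words" "f - g \<in> reg_null" "specialize f = (specialize g :: 'k krep set \<Rightarrow>\<^sub>0 rat)"
    using normal_representative by blast
  have "f \<in> reg_null \<longleftrightarrow> g \<in> reg_null"
    using two_sidedD(2)[OF two_sided_reg_null g(2), of g] two_sidedD(7)[OF two_sided_reg_null _ g(2), of f] by auto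
  then show ?thesis using specialize_eq_0_normal[OF g(1), where 'k = 'k] g(3) by simp
qed

theorem corollary13:
  shows "\<exists>h :: _ \<Rightarrow> ('k::{alg_closed_field, field_char_0} krep set \<Rightarrow>\<^sub>0 rat).
    ring_hom_ring C0 QCM h \<and>
    (\<forall>c. h (C0_scalar c) = Poly_Mapping.single \<one>\<^bsub>comp_monoid\<^esub> c) \<and>
    h (C0_gen vi) = Poly_Mapping.single (Rep (1, 0)) 1 \<and>
    h (C0_gen vj) = Poly_Mapping.single (Rep (0, 1)) 1 \<and>
    h ` carrier C0 = carrier QCM \<and>
    (\<forall>\<alpha>\<in>positive_roots. h (C0_root \<alpha>) = Poly_Mapping.single (Rep \<alpha>) 1) \<and>
    a_kernel C0 QCM h =
      Idl\<^bsub>C0\<^esub> {(C0_gen vi \<otimes>\<^bsub>C0\<^esub> C0_gen vj) [^]\<^bsub>C0\<^esub> m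
        \<ominus>\<^bsub>C0\<^esub> C0_gen vi [^]\<^bsub>C0\<^esub> m \<otimes>\<^bsub>C0\<^esub> C0_gen vj [^]\<^bsub>C0\<^esub> m | m :: nat. m \<ge> 1}"
proof -
  let ?s = "specialize :: _ \<Rightarrow> ('k krep set \<Rightarrow>\<^sub>0 rat)"
  \<comment> \<open>The representative of \<open>X\<close> in the free algebra is arbitrary; two of
    them differ by an element of \<open>reg_null\<close>, on which \<open>specialize\<close>
    vanishes.\<close>
  define h where "h X = ?s (SOME f. pi0 f = X)" for X
  note t = typed_homD[OF typed_hom_pi0] and u = typed_homD[OF typed_hom_specialize[where 'k = 'k]]
  have h: "h (pi0 f) = ?s f" for f
  proof -
    let ?g = "SOME g. pi0 g = pi0 f"
    have "pi0 ?g = pi0 f" by (rule someI[where P = "\<lambda>g. pi0 g = pi0 f"]) simp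
    then have "pi0 (?g - f) = \<zero>\<^bsub>C0\<^esub>"
      using ring.r_right_minus_eq[OF t(1)] t(2) by (simp add: t(8))
    then have "?s (?g - f) = 0" using pi0_zero_reg_null by (simp only: specialize_eq_0)
    then show ?thesis by (simp add: h_def specialize_simps)
  qed
  have hom: "ring_hom_ring C0 QCM h"
    by (rule ring_hom_ringI2[OF t(1) u(1)], rule ring_hom_memI)
      (auto simp: carrier_C0 h u(2) t(3-5)[symmetric] u(3-5)[symmetric])
  have scalar: "h (C0_scalar c) = Poly_Mapping.single \<one>\<^bsub>comp_monoid\<^esub> c" for c
    by (simp add: C0_scalar_eq h specialize_simps comp_monoid_simps)
  have root: "h (C0_root (a, b)) = Poly_Mapping.single (Rep (a, b)) 1" for a b
  proof -
    have "C0_root (a, b) = pi0 (monom_word (replicate a vi @ replicate b vj))"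
      unfolding C0_root_def C0_gen_eq t(5,9)[symmetric] monom_word_power single_mult by simp
    then show ?thesis by (simp add: h specialize_simps variety_Rep_word)
  qed
  have gens: "h (C0_gen vi) = Poly_Mapping.single (Rep (1, 0)) 1" "h (C0_gen vj) = Poly_Mapping.single (Rep (0, 1)) 1"
    using variety_Rep_word[of 1 0, where 'a = 'k] variety_Rep_word[of 0 1, where 'a = 'k]
    by (simp_all add: C0_gen_eq h specialize_simps)
  have surj: "h ` carrier C0 = carrier QCM"
  proof
    show "h ` carrier C0 \<subseteq> carrier QCM" using u(2) by (auto simp: carrier_C0 h)
    show "carrier QCM \<subseteq> h ` carrier C0"
    proof
      fix Y :: "'k krep set \<Rightarrow>\<^sub>0 rat" assume "Y \<in> carrier QCM"
      then have "Poly_Mapping.keys Y \<subseteq> range variety" by (simp add: QCM_def comp_monoid_simps)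
      then have "Y \<in> range ?s"
      proof (induction Y rule: monoid_ring_induct)
        case zero
        show ?case using specialize_simps(1)[symmetric] by (rule range_eqI)
      next
        case (add x a f)
        then obtain w g where "x = variety w" "f = ?s g" by blast
        then have "Poly_Mapping.single x a + f = ?s (Poly_Mapping.single w [:a:] + g)" by (simp add: specialize_simps)
        then show ?case by (rule range_eqI)
      qed
      then show "Y \<in> h ` carrier C0" by (auto simp: carrier_C0 h[symmetric])
    qed
  qed
  have "a_kernel C0 QCM h = Idl\<^bsub>C0\<^esub> reg_gens"
  proof -
    have "Idl\<^bsub>C0\<^esub> reg_gens \<subseteq> carrier C0"
      by (rule subsetI, rule ideal.Icarr[OF ideal_reg_gens])
    then show ?thesis
      unfolding a_kernel_def' carrier_C0 using specialize_eq_0[where 'k = 'k] by (auto simp: h QCM_def reg_null_def)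
  qed
  moreover have "\<forall>\<alpha>\<in>positive_roots. h (C0_root \<alpha>) = Poly_Mapping.single (Rep \<alpha>) 1"
  proof
    fix \<alpha> :: "nat \<times> nat"
    show "h (C0_root \<alpha>) = Poly_Mapping.single (Rep \<alpha>) 1" using root[of "fst \<alpha>" "snd \<alpha>"] by simp
  qed
  ultimately show ?thesis
    using hom scalar gens surj unfolding reg_gens_def by (intro exI[of _ h] conjI allI)
qed

end
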